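(* Let $(A,\mathfrak m,k)$ be a commutative Noetherian local ring, and let $C$ be a totally acyclic minimal complex of finitely generated free $A$-modules. Let $M_C$ be the image of the differential $d_0\colon C_0\to C_{-1}$ and $(M_C)^*=\operatorname{Hom}_A(M_C,A)$. If $M_C\oplus(M_C)^*$ has complete intersection dimension zero over $A$, then $C$ has symmetric growth, that is, $\operatorname{cx}_A^{+}M_C=\operatorname{cx}_A^{-}M_C$.
   Context: All modules are finitely generated, and local rings are commutative Noetherian. Totally acyclic complexes. A complex $C\colon\cdots\to C_1\to C_0\xrightarrow{d_0}C_{-1}\to C_{-2}\to\cdots$ of finitely generated free $A$-modules is totally acyclic if both $C$ and $\operatorname{Hom}_A(C,A)$ are exact; it is minimal if the image of each differential $C_{n+1}\to C_n$ lies in $\mathfrak m C_n$. Complexity. For $C$ totally acyclic and minimal and $M=M_C$, put $\beta_n(M)=\operatorname{rank}C_n$ for $n\in\mathbb Z$ (the Betti numbers of the minimal complete resolution of $M$), and define $\operatorname{cx}_A^{+}M=\inf\{t\in\mathbb N\cup\{0\}\mid\exists a\in\mathbb R:\ \beta_n(M)\le an^{t-1}\text{ for }n\gg0\}$ and $\operatorname{cx}_A^{-}M=\inf\{t\in\mathbb N\cup\{0\}\mid\exists a\in\mathbb R:\ \beta_n(M)\le a(-n)^{t-1}\text{ for }n\ll0\}$. Complete intersection dimension. A quasi-deformation of local rings is a diagram of local homomorphisms $A\to A'\leftarrow B$ such that $A\to A'$ is flat and $B\to A'$ is onto with kernel generated by a $B$-regular sequence contained in the maximal ideal of $B$. A finitely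 generated $A$-module $N$ has finite complete intersection dimension, $\operatorname{CI-dim}_AN<\infty$, if there is a quasi-deformation $A\to A'\leftarrow B$ with $\operatorname{pd}_B(N\otimes_AA')<\infty$. In that case, for $N\neq0$, $\operatorname{CI-dim}_AN=\operatorname{depth}_AA-\operatorname{depth}_AN$; so $N\ne 0$ has CI-dimension zero exactly when its CI-dimension is finite and $\operatorname{depth}_AN=\operatorname{depth}_AA$. (The zero module is regarded as having CI-dimension zero.) *)

theory Defs
  imports
    "HOL-Algebra.Algebra"
    "HOL-Library.Poly_Mapping"
    "HOL-Library.Extended_Nat"
begin

section \<open>Modules\<close>

text \<open>
  Module records inherit the fields \<open>mult\<close> and \<open>one\<close> of ring records; they play no role for
  modules and are left unspecified.
\<close>

definition self_module :: "('a, 'm) ring_scheme \<Rightarrow> ('a, 'a) module" where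
  "self_module R =
     \<lparr>carrier = carrier R, monoid.mult = undefined, monoid.one = undefined,
      ring.zero = \<zero>\<^bsub>R\<^esub>, ring.add = ring.add R, smult = monoid.mult R\<rparr>"

definition free_module :: "('a, 'm) ring_scheme \<Rightarrow> nat \<Rightarrow> ('a, nat \<Rightarrow> 'a) module" where
  "free_module R n =
     \<lparr>carrier = {..<n} \<rightarrow>\<^sub>E carrier R, monoid.mult = undefined, monoid.one = undefined,
      ring.zero = (\<lambda>i\<in>{..<n}. \<zero>\<^bsub>R\<^esub>),
      ring.add = (\<lambda>x y. \<lambda>i\<in>{..<n}. x i \<oplus>\<^bsub>R\<^esub> y i),
      smult = (\<lambda>a x. \<lambda>i\<in>{..<n}. a \<otimes>\<^bsub>R\<^esub> x i)\<rparr>"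

definition direct_sum ::
    "('a, 'b, 'm) module_scheme \<Rightarrow> ('a, 'c, 'n) module_scheme \<Rightarrow> ('a, 'b \<times> 'c) module" where
  "direct_sum M N =
     \<lparr>carrier = carrier M \<times> carrier N, monoid.mult = undefined, monoid.one = undefined,
      ring.zero = (\<zero>\<^bsub>M\<^esub>, \<zero>\<^bsub>N\<^esub>),
      ring.add = (\<lambda>(x, y) (x', y'). (x \<oplus>\<^bsub>M\<^esub> x', y \<oplus>\<^bsub>N\<^esub> y')),
      smult = (\<lambda>a (x, y). (a \<odot>\<^bsub>M\<^esub> x, a \<odot>\<^bsub>N\<^esub> y))\<rparr>"

definition restrict_scalars ::
    "('a \<Rightarrow> 's) \<Rightarrow> ('s, 'b, 'm) module_scheme \<Rightarrow> ('a, 'b) module" where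
  "restrict_scalars h M =
     \<lparr>carrier = carrier M, monoid.mult = undefined, monoid.one = undefined,
      ring.zero = \<zero>\<^bsub>M\<^esub>, ring.add = ring.add M, smult = (\<lambda>a x. h a \<odot>\<^bsub>M\<^esub> x)\<rparr>"

definition module_hom ::
    "('a, 'r) ring_scheme \<Rightarrow> ('a, 'b, 'm) module_scheme \<Rightarrow> ('a, 'c, 'n) module_scheme
      \<Rightarrow> ('b \<Rightarrow> 'c) set" where
  "module_hom R M N =
     {f \<in> carrier M \<rightarrow> carrier N.
        (\<forall>x\<in>carrier M. \<forall>y\<in>carrier M. f (x \<oplus>\<^bsub>M\<^esub> y) = f x \<oplus>\<^bsub>N\<^esub> f y) \<and>
        (\<forall>a\<in>carrier R. \<forall>x\<in>carrier M. f (a \<odot>\<^bsub>M\<^esub> x) = a \<odot>\<^bsub>N\<^esub> f x)}"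

definition module_iso ::
    "('a, 'r) ring_scheme \<Rightarrow> ('a, 'b, 'm) module_scheme \<Rightarrow> ('a, 'c, 'n) module_scheme \<Rightarrow> bool" where
  "module_iso R M N \<longleftrightarrow> (\<exists>f\<in>module_hom R M N. bij_betw f (carrier M) (carrier N))"

text \<open>Functions on a carrier are made extensional, so that equality of homomorphisms is equality
  in HOL.\<close>

definition hom_module ::
    "('a, 'r) ring_scheme \<Rightarrow> ('a, 'b, 'm) module_scheme \<Rightarrow> ('a, 'c, 'n) module_scheme
      \<Rightarrow> ('a, 'b \<Rightarrow> 'c) module" where
  "hom_module R M N =
     \<lparr>carrier = module_hom R M N \<inter> extensional (carrier M), monoid.mult = undefined, monoid.one = undefined,
      ring.zero = (\<lambda>x\<in>carrier M. \<zero>\<^bsub>N\<^esub>),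
      ring.add = (\<lambda>f g. \<lambda>x\<in>carrier M. f x \<oplus>\<^bsub>N\<^esub> g x),
      smult = (\<lambda>a f. \<lambda>x\<in>carrier M. a \<odot>\<^bsub>N\<^esub> f x)\<rparr>"

definition dual_module ::
    "('a, 'r) ring_scheme \<Rightarrow> ('a, 'b, 'm) module_scheme \<Rightarrow> ('a, 'b \<Rightarrow> 'a) module" where
  "dual_module R M = hom_module R M (self_module R)"

definition fg_free :: "('a, 'r) ring_scheme \<Rightarrow> ('a, 'b, 'm) module_scheme \<Rightarrow> bool" where
  "fg_free R M \<longleftrightarrow> module R M \<and> (\<exists>n. module_iso R M (free_module R n))"

text \<open>Over a nonzero commutative ring the rank is unique.\<close>

definition free_rank :: "('a, 'r) ring_scheme \<Rightarrow> ('a, 'b, 'm) module_scheme \<Rightarrow> nat" where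
  "free_rank R M = (THE n. module_iso R M (free_module R n))"

definition ideal_smult ::
    "('a, 'r) ring_scheme \<Rightarrow> 'a set \<Rightarrow> ('a, 'b, 'm) module_scheme \<Rightarrow> 'b set" where
  "ideal_smult R I M =
     {(\<Oplus>\<^bsub>M\<^esub>i\<in>{..<n}. a i \<odot>\<^bsub>M\<^esub> x i) | (n::nat) a x. a \<in> {..<n} \<rightarrow> I \<and> x \<in> {..<n} \<rightarrow> carrier M}"


section \<open>Local rings\<close>

definition noetherian_local_ring :: "('a, 'r) ring_scheme \<Rightarrow> bool" where
  "noetherian_local_ring R \<longleftrightarrow> cring R \<and> noetherian_ring R \<and> (\<exists>!I. maximalideal I R)"

definition max_ideal :: "('a, 'r) ring_scheme \<Rightarrow> 'a set" where
  "max_ideal R = (THE I. maximalideal I R)"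

definition local_hom :: "('a, 'r) ring_scheme \<Rightarrow> ('b, 's) ring_scheme \<Rightarrow> ('a \<Rightarrow> 'b) \<Rightarrow> bool" where
  "local_hom R S h \<longleftrightarrow> h \<in> ring_hom R S \<and> h ` max_ideal R \<subseteq> max_ideal S"


section \<open>Regular sequences and depth\<close>

text \<open>The divisor condition says that \<open>xs ! i\<close> is a nonzerodivisor on
  \<open>M / (xs ! 0, \<dots>, xs ! (i - 1)) M\<close>.\<close>

definition regular_sequence ::
    "('a, 'r) ring_scheme \<Rightarrow> ('a, 'b, 'm) module_scheme \<Rightarrow> 'a list \<Rightarrow> bool" where
  "regular_sequence R M xs \<longleftrightarrow>
     set xs \<subseteq> carrier R \<and>
     (\<forall>i<length xs. \<forall>x\<in>carrier M.
        xs ! i \<odot>\<^bsub>M\<^esub> x \<in> ideal_smult R (Idl\<^bsub>R\<^esub> (set (take i xs))) M \<longrightarrow>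
        x \<in> ideal_smult R (Idl\<^bsub>R\<^esub> (set (take i xs))) M) \<and>
     ideal_smult R (Idl\<^bsub>R\<^esub> (set xs)) M \<noteq> carrier M"

definition depth :: "('a, 'r) ring_scheme \<Rightarrow> ('a, 'b, 'm) module_scheme \<Rightarrow> enat" where
  "depth R M =
     Sup {enat (length xs) | xs. set xs \<subseteq> max_ideal R \<and> regular_sequence R M xs}"


section \<open>Tensor products, base change and flatness\<close>

text \<open>
  \<open>M \<otimes>\<^sub>R N\<close> is the free abelian group on \<open>carrier M \<times> carrier N\<close> modulo the subgroup generated by
  the bilinearity relations. Its elements are cosets of that subgroup.
\<close>

definition tensor_relations ::
    "('a, 'r) ring_scheme \<Rightarrow> ('a, 'b, 'm) module_scheme \<Rightarrow> ('a, 'c, 'n) module_scheme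
      \<Rightarrow> (('b \<times> 'c) \<Rightarrow>\<^sub>0 int) set" where
  "tensor_relations R M N =
     generate (free_Abelian_group (carrier M \<times> carrier N))
       ({frag_of (x \<oplus>\<^bsub>M\<^esub> x', y) - frag_of (x, y) - frag_of (x', y) | x x' y.
           x \<in> carrier M \<and> x' \<in> carrier M \<and> y \<in> carrier N} \<union>
        {frag_of (x, y \<oplus>\<^bsub>N\<^esub> y') - frag_of (x, y) - frag_of (x, y') | x y y'.
           x \<in> carrier M \<and> y \<in> carrier N \<and> y' \<in> carrier N} \<union>
        {frag_of (a \<odot>\<^bsub>M\<^esub> x, y) - frag_of (x, a \<odot>\<^bsub>N\<^esub> y) | a x y.
           a \<in> carrier R \<and> x \<in> carrier M \<and> y \<in> carrier N})"

definition tensor_group ::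
    "('a, 'r) ring_scheme \<Rightarrow> ('a, 'b, 'm) module_scheme \<Rightarrow> ('a, 'c, 'n) module_scheme
      \<Rightarrow> (('b \<times> 'c) \<Rightarrow>\<^sub>0 int) set monoid" where
  "tensor_group R M N =
     free_Abelian_group (carrier M \<times> carrier N) Mod tensor_relations R M N"

text \<open>
  The map \<open>f \<otimes> g : M \<otimes> N \<rightarrow> M' \<otimes> N'\<close> for linear \<open>f\<close> and \<open>g\<close>. All cosets in the union coincide.
\<close>

definition tensor_map ::
    "('a, 'r) ring_scheme \<Rightarrow> ('a, 'd, 'm) module_scheme \<Rightarrow> ('a, 'e, 'n) module_scheme
      \<Rightarrow> ('b \<Rightarrow> 'd) \<Rightarrow> ('c \<Rightarrow> 'e)
      \<Rightarrow> (('b \<times> 'c) \<Rightarrow>\<^sub>0 int) set \<Rightarrow> (('d \<times> 'e) \<Rightarrow>\<^sub>0 int) set" where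
  "tensor_map R M' N' f g U =
     (\<Union>c\<in>U. tensor_relations R M' N' #>\<^bsub>free_Abelian_group (carrier M' \<times> carrier N')\<^esub>
               frag_extend (\<lambda>(x, y). frag_of (f x, g y)) c)"

definition algebra_module ::
    "('a \<Rightarrow> 's) \<Rightarrow> ('s, 't) ring_scheme \<Rightarrow> ('a, 's) module" where
  "algebra_module h S = restrict_scalars h (self_module S)"

text \<open>\<open>N \<otimes>\<^sub>R S\<close> as an \<open>S\<close>-module, where \<open>S\<close> is an \<open>R\<close>-algebra via \<open>h\<close>.\<close>

definition base_change ::
    "('a, 'r) ring_scheme \<Rightarrow> ('s, 't) ring_scheme \<Rightarrow> ('a \<Rightarrow> 's) \<Rightarrow> ('a, 'b, 'm) module_scheme
      \<Rightarrow> ('s, (('b \<times> 's) \<Rightarrow>\<^sub>0 int) set) module" where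
  "base_change R S h N =
     \<lparr>carrier = carrier (tensor_group R N (algebra_module h S)),
      monoid.mult = undefined, monoid.one = undefined,
      ring.zero = \<one>\<^bsub>tensor_group R N (algebra_module h S)\<^esub>,
      ring.add = monoid.mult (tensor_group R N (algebra_module h S)),
      smult = (\<lambda>s. tensor_map R N (algebra_module h S) id (\<lambda>t. s \<otimes>\<^bsub>S\<^esub> t))\<rparr>"

text \<open>
  A definition cannot quantify over all types, so the test modules are those with carrier in
  \<open>(nat \<Rightarrow> 'a) set\<close>. Every quotient of \<open>R\<^sup>n\<close>, hence up to isomorphism every finitely generated
  \<open>R\<close>-module, occurs there, and tensor products commute with direct limits; so this is flatness
  with respect to all \<open>R\<close>-modules.
\<close>

definition flat_module :: "('a, 'r) ring_scheme \<Rightarrow> ('a, 'c, 'n) module_scheme \<Rightarrow> bool" where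
  "flat_module R T \<longleftrightarrow> module R T \<and>
     (\<forall>(M :: ('a, (nat \<Rightarrow> 'a) set) module) (N :: ('a, (nat \<Rightarrow> 'a) set) module) f.
        module R M \<and> module R N \<and> f \<in> module_hom R M N \<and> inj_on f (carrier M) \<longrightarrow>
        inj_on (tensor_map R N T f id) (carrier (tensor_group R M T)))"


section \<open>Projective dimension\<close>

text \<open>
  Finitely generated projective modules are the direct summands of the \<open>R\<^sup>n\<close>. Both such a module
  and its complement embed in \<open>R\<^sup>n\<close>, so up to isomorphism the type \<open>nat \<Rightarrow> 'a\<close> holds
  all of them; it is used for complements here and for the terms of resolutions below.
\<close>

definition fg_projective :: "('a, 'r) ring_scheme \<Rightarrow> ('a, 'b, 'm) module_scheme \<Rightarrow> bool" where
  "fg_projective R P \<longleftrightarrow> module R P \<and>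
     (\<exists>n (Q :: ('a, nat \<Rightarrow> 'a) module).
        module R Q \<and> module_iso R (direct_sum P Q) (free_module R n))"

definition projective_resolution ::
    "('a, 'r) ring_scheme \<Rightarrow> ('a, 'b, 'm) module_scheme \<Rightarrow> (nat \<Rightarrow> ('a, 'c) module)
      \<Rightarrow> (nat \<Rightarrow> 'c \<Rightarrow> 'c) \<Rightarrow> ('c \<Rightarrow> 'b) \<Rightarrow> bool" where
  "projective_resolution R M P \<delta> \<epsilon> \<longleftrightarrow>
     (\<forall>i. fg_projective R (P i)) \<and>
     (\<forall>i. \<delta> i \<in> module_hom R (P (Suc i)) (P i)) \<and>
     \<epsilon> \<in> module_hom R (P 0) M \<and>
     \<epsilon> ` carrier (P 0) = carrier M \<and>
     \<delta> 0 ` carrier (P 1) = {x \<in> carrier (P 0). \<epsilon> x = \<zero>\<^bsub>M\<^esub>} \<and>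
     (\<forall>i. \<delta> (Suc i) ` carrier (P (Suc (Suc i))) =
            {x \<in> carrier (P (Suc i)). \<delta> i x = \<zero>\<^bsub>P i\<^esub>})"

text \<open>Meant for finitely generated modules over a Noetherian ring, where finitely generated
  resolutions suffice.\<close>

definition projective_dimension ::
    "('a, 'r) ring_scheme \<Rightarrow> ('a, 'b, 'm) module_scheme \<Rightarrow> enat" where
  "projective_dimension R M =
     Inf {enat n | n. \<exists>(P :: nat \<Rightarrow> ('a, nat \<Rightarrow> 'a) module) \<delta> \<epsilon>.
            projective_resolution R M P \<delta> \<epsilon> \<and> (\<forall>i>n. carrier (P i) = {\<zero>\<^bsub>P i\<^esub>})}"


section \<open>Complete intersection dimension\<close>

text \<open>The diagram \<open>A \<rightarrow> A' \<leftarrow> B\<close> with maps \<open>\<phi>\<close> and \<open>\<psi>\<close>.\<close>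

definition quasi_deformation ::
    "('a, 'r) ring_scheme \<Rightarrow> ('b, 's) ring_scheme \<Rightarrow> ('c, 't) ring_scheme
      \<Rightarrow> ('a \<Rightarrow> 'b) \<Rightarrow> ('c \<Rightarrow> 'b) \<Rightarrow> bool" where
  "quasi_deformation A A' B \<phi> \<psi> \<longleftrightarrow>
     noetherian_local_ring A \<and> noetherian_local_ring A' \<and> noetherian_local_ring B \<and>
     local_hom A A' \<phi> \<and> local_hom B A' \<psi> \<and>
     flat_module A (algebra_module \<phi> A') \<and>
     \<psi> ` carrier B = carrier A' \<and>
     (\<exists>xs. set xs \<subseteq> max_ideal B \<and> regular_sequence B (self_module B) xs \<and>
           a_kernel B A' \<psi> = Idl\<^bsub>B\<^esub> (set xs))"

text \<open>
  The type arguments are the types in which the elements of \<open>A'\<close> and \<open>B\<close> live. With type variables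
  for them, a theorem having \<open>finite_CI_dim\<close> as a hypothesis covers all quasi-deformations.
\<close>

definition finite_CI_dim ::
    "'b itself \<Rightarrow> 'c itself \<Rightarrow> ('a, 'r) ring_scheme \<Rightarrow> ('a, 'n, 'm) module_scheme \<Rightarrow> bool" where
  "finite_CI_dim _ _ A N \<longleftrightarrow>
     (\<exists>(A' :: 'b ring) (B :: 'c ring) \<phi> \<psi>.
        quasi_deformation A A' B \<phi> \<psi> \<and>
        projective_dimension B (restrict_scalars \<psi> (base_change A A' \<phi> N)) < \<infinity>)"

text \<open>
  For \<open>N \<noteq> 0\<close> of finite CI-dimension one has \<open>CI-dim N = depth A - depth N\<close>; the zero module has
  CI-dimension zero by convention.
\<close>

definition CI_dim_zero ::
    "'b itself \<Rightarrow> 'c itself \<Rightarrow> ('a, 'r) ring_scheme \<Rightarrow> ('a, 'n, 'm) module_scheme \<Rightarrow> bool" where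
  "CI_dim_zero tb tc A N \<longleftrightarrow>
     carrier N = {\<zero>\<^bsub>N\<^esub>} \<or>
     finite_CI_dim tb tc A N \<and> depth A N = depth A (self_module A)"


section \<open>Totally acyclic complexes and complexity\<close>

text \<open>A complex is a family of modules \<open>C n\<close> with differentials \<open>d n : C n \<rightarrow> C (n - 1)\<close>.\<close>

definition free_complex ::
    "('a, 'r) ring_scheme \<Rightarrow> (int \<Rightarrow> ('a, 'b, 'm) module_scheme) \<Rightarrow> (int \<Rightarrow> 'b \<Rightarrow> 'b) \<Rightarrow> bool" where
  "free_complex A C d \<longleftrightarrow>
     (\<forall>n. fg_free A (C n)) \<and>
     (\<forall>n. d n \<in> module_hom A (C n) (C (n - 1))) \<and>
     (\<forall>n. \<forall>x\<in>carrier (C (n + 1)). d n (d (n + 1) x) = \<zero>\<^bsub>C (n - 1)\<^esub>)"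

definition exact_complex ::
    "(int \<Rightarrow> ('a, 'b, 'm) module_scheme) \<Rightarrow> (int \<Rightarrow> 'b \<Rightarrow> 'b) \<Rightarrow> bool" where
  "exact_complex C d \<longleftrightarrow>
     (\<forall>n. d (n + 1) ` carrier (C (n + 1)) = {x \<in> carrier (C n). d n x = \<zero>\<^bsub>C (n - 1)\<^esub>})"

text \<open>\<open>Hom(C, A)\<close> with its terms and differentials reindexed homologically: in degree \<open>n\<close> it is
  \<open>Hom(C (-n), A)\<close>, and its differential is composition with \<open>d (1 - n)\<close>.\<close>

definition dual_complex ::
    "('a, 'r) ring_scheme \<Rightarrow> (int \<Rightarrow> ('a, 'b, 'm) module_scheme) \<Rightarrow> int \<Rightarrow> ('a, 'b \<Rightarrow> 'a) module" where
  "dual_complex A C n = dual_module A (C (- n))"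

definition dual_diff ::
    "(int \<Rightarrow> ('a, 'b, 'm) module_scheme) \<Rightarrow> (int \<Rightarrow> 'b \<Rightarrow> 'b) \<Rightarrow> int \<Rightarrow> ('b \<Rightarrow> 'a) \<Rightarrow> ('b \<Rightarrow> 'a)" where
  "dual_diff C d n f = compose (carrier (C (1 - n))) f (d (1 - n))"

definition totally_acyclic ::
    "('a, 'r) ring_scheme \<Rightarrow> (int \<Rightarrow> ('a, 'b, 'm) module_scheme) \<Rightarrow> (int \<Rightarrow> 'b \<Rightarrow> 'b) \<Rightarrow> bool" where
  "totally_acyclic A C d \<longleftrightarrow>
     free_complex A C d \<and> exact_complex C d \<and>
     exact_complex (dual_complex A C) (dual_diff C d)"

definition minimal_complex ::
    "('a, 'r) ring_scheme \<Rightarrow> (int \<Rightarrow> ('a, 'b, 'm) module_scheme) \<Rightarrow> (int \<Rightarrow> 'b \<Rightarrow> 'b) \<Rightarrow> bool" where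
  "minimal_complex A C d \<longleftrightarrow>
     (\<forall>n. d (n + 1) ` carrier (C (n + 1)) \<subseteq> ideal_smult A (max_ideal A) (C n))"

definition complex_image ::
    "(int \<Rightarrow> ('a, 'b, 'm) module_scheme) \<Rightarrow> (int \<Rightarrow> 'b \<Rightarrow> 'b) \<Rightarrow> ('a, 'b, 'm) module_scheme" where
  "complex_image C d = (C (- 1))\<lparr>carrier := d 0 ` carrier (C 0)\<rparr>"

definition betti ::
    "('a, 'r) ring_scheme \<Rightarrow> (int \<Rightarrow> ('a, 'b, 'm) module_scheme) \<Rightarrow> int \<Rightarrow> nat" where
  "betti A C n = free_rank A (C n)"

text \<open>The complexities of \<open>complex_image C d\<close>, computed from its minimal complete resolution \<open>C\<close>;
  they are \<open>\<infinity>\<close> if no polynomial bound exists.\<close>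

definition cx_plus ::
    "('a, 'r) ring_scheme \<Rightarrow> (int \<Rightarrow> ('a, 'b, 'm) module_scheme) \<Rightarrow> enat" where
  "cx_plus A C =
     Inf {enat t | t. \<exists>a::real. \<forall>\<^sub>F n::int in at_top.
            real (betti A C n) \<le> a * real_of_int n powi (int t - 1)}"

definition cx_minus ::
    "('a, 'r) ring_scheme \<Rightarrow> (int \<Rightarrow> ('a, 'b, 'm) module_scheme) \<Rightarrow> enat" where
  "cx_minus A C =
     Inf {enat t | t. \<exists>a::real. \<forall>\<^sub>F n::int in at_bot.
            real (betti A C n) \<le> a * real_of_int (- n) powi (int t - 1)}"

definition symmetric_growth ::
    "('a, 'r) ring_scheme \<Rightarrow> (int \<Rightarrow> ('a, 'b, 'm) module_scheme) \<Rightarrow> bool" where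
  "symmetric_growth A C \<longleftrightarrow> cx_plus A C = cx_minus A C"

end

theory Submission
  imports Defs
begin

text \<open>
  Over a quasi-deformation \<open>A \<rightarrow> A' \<leftarrow> B\<close> the complex \<open>C\<close> becomes a complex of free modules over
  \<open>B/(x\<^sub>1, \<dots>, x\<^sub>c)\<close>. Lifted to \<open>B\<close>, the square of its differential is \<open>\<Sum> x\<^sub>j T\<^sub>j\<close>, and the operators \<open>T\<^sub>j\<close>
  of degree two act on the cohomology \<open>E\<close> of \<open>Hom(C, k)\<close>, whose dimensions are the Betti numbers. Finite
  projective dimension over \<open>B\<close> makes the part of \<open>E\<close> in high degrees finitely generated over the \<open>T\<^sub>j\<close>:
  the regular sequence is removed one element at a time, and without it a comparison with the finite
  resolution shows that \<open>E\<close> vanishes in high degrees.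

  A homogeneous polynomial \<open>p\<close> of degree \<open>q\<close> in the \<open>T\<^sub>j\<close> that acts injectively on \<open>E\<close> in high degrees exists by prime
  avoidance. The Betti numbers of its cone have smaller order of growth in positive degrees, hence by induction
  in negative degrees, and there they bound the differences \<open>h(n) - h(n + 2 q)\<close>
  of the Betti numbers; summation gives the bound for \<open>C\<close> in negative degrees. If the cohomology vanishes in
  a single degree, then exactness splits the complex and it vanishes in all lower degrees, which starts the
  induction. Finiteness for \<open>M\<^sub>C\<close> gives one inequality of complexities and finiteness for its dual the other.

  The linear algebra takes place over polynomial rings that cover the given rings, in congruences modulo
  ideals.
\<close>

section \<open>Linear algebra modulo ideals\<close>

text \<open>Quotients of record modules change the type of their elements, while the argument runs
  through cones of cones and through all the rings \<open>B / (x 0, ..., x (i - 1))\<close>. Hence a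
  subquotient is a pair of sets of vectors over one ring \<open>'r\<close>, a quotient ring is an
  ideal of \<open>'r\<close>, and equality is a congruence. \<open>A'\<close> is covered through
  \<open>B\<close>, so that the kernel of its cover is the ideal generated by the sequence over the
  kernel of the cover of \<open>B\<close>.

  The residue field may be finite, so no linear form in the operators need be injective in high
  degrees; this is why \<open>p\<close> has a degree \<open>q\<close> and all comparisons run in
  steps of \<open>2 q\<close>. No Hilbert polynomial is formed: only upper bounds are moved, by
  taking differences in positive degrees and by summation in negative ones. \<open>E\<close> is
  unbounded below, so finiteness is used for truncations only, whereas the exact sequence of the
  cone holds in every degree and carries the bounds to the negative side.

  The module and its dual are treated as retracts of their sum; one finite resolution of the base
  change of the sum serves both directions.\<close>

datatype ('p, 'r) vec = Vec (ix: "'p => 'r")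

lemma vec_eqI: "(\<And>p. ix u p = ix v p) ==> u = v"
  by (simp add: vec.expand ext)

lemma vec_eq_iff: "u = v \<longleftrightarrow> (\<forall>p. ix u p = ix v p)"
  using vec_eqI by blast

instantiation vec :: (type, ab_group_add) ab_group_add
begin

definition "0 = Vec (\<lambda>_. 0)"
definition "u + v = Vec (\<lambda>p. ix u p + ix v p)"
definition "u - v = Vec (\<lambda>p. ix u p - ix v p)"
definition "- v = Vec (\<lambda>p. - ix v p)"

instance
  by standard
    (auto simp: vec_eq_iff zero_vec_def plus_vec_def minus_vec_def uminus_vec_def algebra_simps)

end

lemma ix_simps [simp]:
  "ix 0 p = 0" "ix (u + v) p = ix u p + ix v p" "ix (u - v) p = ix u p - ix v p" "ix (- v) p = - ix v p"
  by (simp_all add: zero_vec_def plus_vec_def minus_vec_def uminus_vec_def)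

lemma ix_sum: "ix (\<Sum>i\<in>S. f i) p = (\<Sum>i\<in>S. ix (f i) p)"
  by (induction S rule: infinite_finite_induct) auto

definition scl :: "'r::comm_ring_1 => ('p, 'r) vec => ('p, 'r) vec" where
  "scl a v = Vec (\<lambda>p. a * ix v p)"

lemma ix_scl [simp]: "ix (scl a v) p = a * ix v p"
  by (simp add: scl_def)

definition lin :: "(('p, 'r::comm_ring_1) vec => ('q, 'r) vec) => bool" where
  "lin f \<longleftrightarrow> (\<forall>u v. f (u + v) = f u + f v) \<and> (\<forall>a v. f (scl a v) = scl a (f v))"

definition smod :: "('p, 'r::comm_ring_1) vec set => bool" where
  "smod W \<longleftrightarrow> 0 \<in> W \<and> (\<forall>u\<in>W. \<forall>v\<in>W. u + v \<in> W) \<and> (\<forall>a. \<forall>u\<in>W. scl a u \<in> W)"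

definition idl :: "'r::comm_ring_1 set => bool" where
  "idl I \<longleftrightarrow> 0 \<in> I \<and> (\<forall>u\<in>I. \<forall>v\<in>I. u + v \<in> I) \<and> (\<forall>a. \<forall>u\<in>I. a * u \<in> I)"

text \<open>Congruence of vectors modulo \<open>I\<close> is membership of the difference in
  \<open>pt I\<close>. The index type may be infinite, so \<open>pt I\<close> can be larger than
  \<open>I\<close> times the module; the two agree on finitely supported vectors.\<close>

definition pt :: "'r set => ('p, 'r) vec set" where
  "pt I = {v. \<forall>p. ix v p \<in> I}"

lemma scl_simps:
  "scl a (u + v) = scl a u + scl a v" "scl (a + b) u = scl a u + scl b u"
  "scl a (u - v) = scl a u - scl a v" "scl (a - b) u = scl a u - scl b u"
  "scl a (scl b u) = scl (a * b) u" "scl 1 u = u" "scl 0 u = 0" "scl a 0 = 0"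
  "scl (- a) u = - scl a u" "scl a (- u) = - scl a u"
  by (auto simp: vec_eq_iff algebra_simps)

lemma scl_sum: "scl a (\<Sum>i\<in>S. f i) = (\<Sum>i\<in>S. scl a (f i))"
  by (auto simp: vec_eq_iff ix_sum sum_distrib_left)

lemma scl_sum_left: "scl (\<Sum>i\<in>S. c i) u = (\<Sum>i\<in>S. scl (c i) u)"
  by (auto simp: vec_eq_iff ix_sum sum_distrib_right)

lemma
  assumes "lin f"
  shows lin_add: "f (u + v) = f u + f v" and lin_scl: "f (scl a v) = scl a (f v)"
    and lin_zero: "f 0 = 0" and lin_minus: "f (- v) = - f v" and lin_diff: "f (u - v) = f u - f v"
    and lin_sum: "f (\<Sum>i\<in>S. g i) = (\<Sum>i\<in>S. f (g i))"
proof -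
  show add: "f (u + v) = f u + f v" for u v using assms by (simp add: lin_def)
  show sc: "f (scl a v) = scl a (f v)" for a v using assms by (simp add: lin_def)
  show z: "f 0 = 0" using sc[of 0 0] by (simp add: scl_simps)
  show m: "f (- v) = - f v" for v using sc[of "-1" v] by (simp add: scl_simps)
  show "f (u - v) = f u - f v" using add[of u "-v"] m by simp
  show "f (\<Sum>i\<in>S. g i) = (\<Sum>i\<in>S. f (g i))"
    by (induction S rule: infinite_finite_induct) (auto simp: z add)
qed

lemmas lin_simps = lin_add lin_scl lin_zero lin_minus lin_diff lin_sum

lemma linI:
  assumes "\<And>u v. f (u + v) = f u + f v" "\<And>a v. f (scl a v) = scl a (f v)"
  shows "lin f"
  using assms by (simp add: lin_def)

lemma lin_id: "lin (\<lambda>v. v)" and lin_0: "lin (\<lambda>v. 0)"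
  by (auto simp: lin_def scl_simps)

lemma lin_comp: "lin f ==> lin g ==> lin (\<lambda>v. f (g v))"
  by (simp add: lin_def)

lemma lin_plus: "lin f ==> lin g ==> lin (\<lambda>v. f v + g v)"
  by (simp add: lin_def scl_simps algebra_simps)

lemma lin_sub: "lin f ==> lin g ==> lin (\<lambda>v. f v - g v)"
  by (simp add: lin_def scl_simps algebra_simps)

lemma lin_scl_map: "lin f ==> lin (\<lambda>v. scl a (f v))"
  by (simp add: lin_def scl_simps mult.commute)

lemma lin_neg: "lin f ==> lin (\<lambda>v. - f v)"
  by (simp add: lin_def scl_simps)

lemma lin_sum_map: "(\<And>i. i \<in> S ==> lin (f i)) ==> lin (\<lambda>v. \<Sum>i\<in>S. f i v)"
  by (induction S rule: infinite_finite_induct) (auto intro: lin_plus lin_0)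

lemmas lin_intros = lin_id lin_0 lin_plus lin_sub lin_scl_map lin_neg lin_sum_map

lemma
  assumes "smod W"
  shows smod_0: "0 \<in> W" and smod_add: "u \<in> W ==> v \<in> W ==> u + v \<in> W"
    and smod_scl: "u \<in> W ==> scl a u \<in> W" and smod_minus: "u \<in> W ==> - u \<in> W"
    and smod_diff: "u \<in> W ==> v \<in> W ==> u - v \<in> W"
    and smod_sum: "(\<And>i. i \<in> S ==> g i \<in> W) ==> (\<Sum>i\<in>S. g i) \<in> W"
proof -
  show z: "0 \<in> W" using assms by (simp add: smod_def)
  show add: "u \<in> W ==> v \<in> W ==> u + v \<in> W" for u v using assms by (simp add: smod_def)
  show sc: "u \<in> W ==> scl a u \<in> W" for u a using assms by (simp add: smod_def)
  show m: "u \<in> W ==> - u \<in> W" for u using sc[of u "-1"] by (simp add: scl_simps)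
  show "u \<in> W ==> v \<in> W ==> u - v \<in> W" using add[of u "-v"] m by simp
  show "(\<And>i. i \<in> S ==> g i \<in> W) ==> (\<Sum>i\<in>S. g i) \<in> W"
    by (induction S rule: infinite_finite_induct) (auto simp: z add)
qed

lemma
  assumes "idl I"
  shows idl_0: "0 \<in> I" and idl_add: "u \<in> I ==> v \<in> I ==> u + v \<in> I"
    and idl_mult: "u \<in> I ==> a * u \<in> I" and idl_mult_right: "u \<in> I ==> u * a \<in> I"
    and idl_minus: "u \<in> I ==> - u \<in> I"
    and idl_diff: "u \<in> I ==> v \<in> I ==> u - v \<in> I"
    and idl_sum: "(\<And>i. i \<in> S ==> g i \<in> I) ==> (\<Sum>i\<in>S. g i) \<in> I"
proof -
  show z: "0 \<in> I" using assms by (simp add: idl_def)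
  show add: "u \<in> I ==> v \<in> I ==> u + v \<in> I" for u v using assms by (simp add: idl_def)
  show sc: "u \<in> I ==> a * u \<in> I" for u a using assms by (simp add: idl_def)
  show "u \<in> I ==> u * a \<in> I" for u a using sc[of u a] by (simp add: mult.commute)
  show m: "u \<in> I ==> - u \<in> I" for u using sc[of u "-1"] by simp
  show "u \<in> I ==> v \<in> I ==> u - v \<in> I" using add[of u "-v"] m by simp
  show "(\<And>i. i \<in> S ==> g i \<in> I) ==> (\<Sum>i\<in>S. g i) \<in> I"
    by (induction S rule: infinite_finite_induct) (auto simp: z add)
qed

lemma smod_pt: "idl I ==> smod (pt I)"
  by (auto simp: smod_def pt_def idl_def)

lemma pt_mono: "I \<subseteq> J ==> v \<in> pt I ==> v \<in> pt J"
  by (auto simp: pt_def)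

lemma scl_pt: "idl I ==> a \<in> I ==> scl a v \<in> pt I"
  by (auto simp: pt_def idl_mult_right)

lemma smod_diff_trans:
  "smod W ==> u - v \<in> W ==> v - w \<in> W ==> u - w \<in> W"
  using smod_add[of W "u - v" "v - w"] by simp

lemma smod_diff_sym: "smod W ==> u - v \<in> W ==> v - u \<in> W"
  using smod_minus[of W "u - v"] by simp

lemma smod_diff_cancel: "smod W ==> u - v \<in> W ==> v \<in> W ==> u \<in> W"
  using smod_add[of W "u - v" v] by simp

lemma smod_diff_cancel': "smod W ==> u - v \<in> W ==> u \<in> W ==> v \<in> W"
  using smod_diff[of W u "u - v"] by simp

section \<open>Subquotients and their dimension over the residue field\<close>

definition spans :: "('p, 'r::comm_ring_1) vec set => ('p, 'r) vec set => ('p, 'r) vec set => bool" where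
  "spans S W' W \<longleftrightarrow> finite S \<and> S \<subseteq> W \<and> (\<forall>w\<in>W. \<exists>f. w - (\<Sum>s\<in>S. scl (f s) s) \<in> W')"

text \<open>The minimal number of generators of the subquotient \<open>W / W'\<close>. It is a
  dimension over the residue field once multiplication by \<open>M\<close> sends \<open>W\<close>
  into \<open>W'\<close>.\<close>

definition rdim :: "('p, 'r::comm_ring_1) vec set => ('p, 'r) vec set => nat" where
  "rdim W' W = (LEAST m. \<exists>S. spans S W' W \<and> card S = m)"

definition fdim :: "('p, 'r::comm_ring_1) vec set => ('p, 'r) vec set => bool" where
  "fdim W' W \<longleftrightarrow> (\<exists>S. spans S W' W)"

lemma sum_delta_scl: "finite S ==> t \<in> S ==> (\<Sum>s\<in>S. scl (if s = t then 1 else 0) s) = t"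
proof -
  assume S: "finite S" "t \<in> S"
  have "(\<Sum>s\<in>S. scl (if s = t then 1 else 0) s) = (\<Sum>s\<in>S. if s = t then s else 0)"
    by (rule sum.cong) (auto simp: scl_simps)
  then show ?thesis using S by simp
qed

lemma rdim_le: "spans S W' W ==> rdim W' W \<le> card S"
  unfolding rdim_def by (rule Least_le) auto

lemma rdim_ex:
  assumes "fdim W' W"
  obtains S where "spans S W' W" "card S = rdim W' W"
proof -
  have "\<exists>m. \<exists>S. spans S W' W \<and> card S = m" using assms by (auto simp: fdim_def)
  from LeastI_ex[OF this] show ?thesis using that unfolding rdim_def by blast
qed

lemma rdim_self: "smod W' ==> W \<subseteq> W' ==> rdim W' W = 0"
  using rdim_le[of "{}" W' W] by (auto simp: spans_def)

lemma fdim_mono: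
  assumes "fdim W' W" "W' \<subseteq> U"
  shows "fdim U W"
proof -
  obtain S where S: "spans S W' W" using assms(1) by (auto simp: fdim_def)
  have "\<exists>f. w - (\<Sum>s\<in>S. scl (f s) s) \<in> U" if "w \<in> W" for w
  proof -
    have "\<exists>f. w - (\<Sum>s\<in>S. scl (f s) s) \<in> W'" using S that by (auto simp: spans_def)
    then show ?thesis using assms(2) by blast
  qed
  then have "spans S U W" using S by (simp add: spans_def)
  then show ?thesis by (auto simp: fdim_def)
qed

lemma rdim_surj:
  assumes "fdim W' W" "lin \<phi>" "smod U'" "\<And>w. w \<in> W ==> \<phi> w \<in> U"
    and "\<And>w. w \<in> W' ==> \<phi> w \<in> U'"
    and surj: "\<And>u. u \<in> U ==> \<exists>w\<in>W. u - \<phi> w \<in> U'"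
  shows "rdim U' U \<le> rdim W' W" "fdim U' U"
proof -
  obtain S where S: "spans S W' W" "card S = rdim W' W" using rdim_ex assms(1) by blast
  have fin: "finite S" using S by (simp add: spans_def)
  have "spans (\<phi> ` S) U' U"
    unfolding spans_def
  proof (intro conjI ballI)
    show "finite (\<phi> ` S)" "\<phi> ` S \<subseteq> U" using S assms(4) by (auto simp: spans_def)
    fix u assume "u \<in> U"
    then obtain w where w: "w \<in> W" "u - \<phi> w \<in> U'" using surj by blast
    obtain f where f: "w - (\<Sum>s\<in>S. scl (f s) s) \<in> W'" using S(1) w(1) by (auto simp: spans_def)
    have "\<phi> w - (\<Sum>s\<in>S. scl (f s) (\<phi> s)) \<in> U'"
      using assms(5)[OF f] by (simp add: lin_simps[OF assms(2)])
    then have 1: "u - (\<Sum>s\<in>S. scl (f s) (\<phi> s)) \<in> U'" using smod_diff_trans assms(3) w(2) by blast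
    \<comment> \<open>\<open>\<phi>\<close> may identify elements of \<open>S\<close>, so the
      coefficients are collected over its fibres.\<close>
    have "(\<Sum>s\<in>S. scl (f s) (\<phi> s)) = (\<Sum>t\<in>\<phi> ` S. \<Sum>s\<in>{s\<in>S. \<phi> s = t}. scl (f s) (\<phi> s))"
      using sum.image_gen[OF fin] by blast
    also have "\<dots> = (\<Sum>t\<in>\<phi> ` S. scl (\<Sum>s\<in>{s\<in>S. \<phi> s = t}. f s) t)"
      by (intro sum.cong refl) (auto simp: scl_sum_left intro!: sum.cong)
    finally show "\<exists>g. u - (\<Sum>t\<in>\<phi> ` S. scl (g t) t) \<in> U'"
      using 1 by (intro exI[of _ "\<lambda>t. \<Sum>s\<in>{s\<in>S. \<phi> s = t}. f s"]) simp
  qed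
  then show "fdim U' U" and "rdim U' U \<le> rdim W' W"
    using rdim_le[of "\<phi> ` S" U' U] card_image_le[OF fin, of \<phi>] S(2) by (auto simp: fdim_def)
qed

lemma rdim_subadd:
  assumes "fdim W' U" "fdim U W" "smod W'" "smod U" "U \<subseteq> W"
  shows "rdim W' W \<le> rdim W' U + rdim U W" "fdim W' W"
proof -
  obtain S where S: "spans S W' U" "card S = rdim W' U" using rdim_ex assms(1) by blast
  obtain T where T: "spans T U W" "card T = rdim U W" using rdim_ex assms(2) by blast
  have fin: "finite S" "finite T" using S T by (auto simp: spans_def)
  have "spans (S \<union> T) W' W" unfolding spans_def
  proof (intro conjI ballI)
    show "finite (S \<union> T)" "S \<union> T \<subseteq> W" using S T assms(5) by (auto simp: spans_def)
    fix w assume "w \<in> W"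
    then obtain f where f: "w - (\<Sum>s\<in>T. scl (f s) s) \<in> U" using T by (auto simp: spans_def)
    then obtain g where g: "w - (\<Sum>s\<in>T. scl (f s) s) - (\<Sum>s\<in>S. scl (g s) s) \<in> W'"
      using S by (auto simp: spans_def)
    \<comment> \<open>\<open>S\<close> and \<open>T\<close> may overlap; on the overlap the two
      coefficients are added.\<close>
    let ?h = "\<lambda>s. (if s \<in> T then f s else 0) + (if s \<in> S then g s else 0)"
    have "(\<Sum>s\<in>S \<union> T. scl (?h s) s)
        = (\<Sum>s\<in>S \<union> T. scl (if s \<in> T then f s else 0) s) + (\<Sum>s\<in>S \<union> T. scl (if s \<in> S then g s else 0) s)"
      by (simp add: scl_simps(2) sum.distrib)
    also have "(\<Sum>s\<in>S \<union> T. scl (if s \<in> T then f s else 0) s) = (\<Sum>s\<in>T. scl (f s) s)"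
      using fin by (intro sum.mono_neutral_cong_right) (auto simp: scl_simps)
    also have "(\<Sum>s\<in>S \<union> T. scl (if s \<in> S then g s else 0) s) = (\<Sum>s\<in>S. scl (g s) s)"
      using fin by (intro sum.mono_neutral_cong_right) (auto simp: scl_simps)
    finally show "\<exists>h. w - (\<Sum>s\<in>S \<union> T. scl (h s) s) \<in> W'"
      using g by (intro exI[of _ ?h]) (simp add: algebra_simps)
  qed
  then show "fdim W' W" and "rdim W' W \<le> rdim W' U + rdim U W"
    using rdim_le[of "S \<union> T" W' W] card_Un_le[of S T] S(2) T(2) by (auto simp: fdim_def)
qed

text \<open>\<open>'r\<close> will be a polynomial ring and far from local, so elements outside
  \<open>M\<close> are invertible only modulo \<open>M\<close>.\<close>

locale max_idl =
  fixes M :: "'r::comm_ring_1 set"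
  assumes idl_M: "idl M" and one_M: "1 \<notin> M"
    and inv_M: "\<And>a. a \<notin> M ==> \<exists>b. a * b - 1 \<in> M"
begin

definition indep :: "('p, 'r) vec set => ('p, 'r) vec set => bool" where
  "indep S W' \<longleftrightarrow> finite S \<and> (\<forall>f. (\<Sum>s\<in>S. scl (f s) s) \<in> W' --> (\<forall>s\<in>S. f s \<in> M))"

lemma inv_M': "a \<notin> M ==> \<exists>b. 1 - b * a \<in> M"
  using inv_M[of a] idl_minus[OF idl_M] by (force simp: mult.commute)

text \<open>Gaussian elimination over the residue field: an equation with a coefficient outside
  \<open>M\<close> is used to eliminate one unknown, and an equation without such a coefficient
  holds for every choice of \<open>c\<close>.\<close>

lemma homogeneous_system:
  assumes "finite B" "finite S" "card B < card S"
  shows "\<exists>c. (\<exists>s\<in>S. c s \<notin> M) \<and> (\<forall>b\<in>B. (\<Sum>s\<in>S. c s * a s b) \<in> M)"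
  using assms
proof (induction B arbitrary: S a rule: finite_induct)
  case empty
  then have "S \<noteq> {}" by auto
  then show ?case using one_M by (intro exI[of _ "\<lambda>_. 1"]) auto
next
  case (insert b B)
  show ?case
  proof (cases "\<forall>s\<in>S. a s b \<in> M")
    case True
    have "card B < card S" using insert by simp
    then obtain c where c: "\<exists>s\<in>S. c s \<notin> M" "\<forall>b\<in>B. (\<Sum>s\<in>S. c s * a s b) \<in> M"
      using insert.IH[OF insert.prems(1), of a] by blast
    then show ?thesis using True by (intro exI[of _ c]) (auto intro!: idl_sum idl_mult idl_M)
  next
    case False
    then obtain s0 where s0: "s0 \<in> S" "a s0 b \<notin> M" by blast
    then obtain u where u: "1 - u * a s0 b \<in> M" using inv_M' by blast
    let ?S = "S - {s0}"
    let ?a = "\<lambda>s b'. a s b' - a s b * u * a s0 b'"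
    have "card B < card ?S" using insert s0 by simp
    then obtain c where c: "\<exists>s\<in>?S. c s \<notin> M" "\<forall>b\<in>B. (\<Sum>s\<in>?S. c s * ?a s b) \<in> M"
      using insert.IH[of ?S ?a] insert.prems(1) by blast
    let ?c = "\<lambda>s. if s = s0 then - (\<Sum>s\<in>?S. c s * a s b * u) else c s"
    have eq: "(\<Sum>s\<in>S. ?c s * a s b') = (\<Sum>s\<in>?S. c s * ?a s b')" for b'
    proof -
      have "(\<Sum>s\<in>S. ?c s * a s b') = ?c s0 * a s0 b' + (\<Sum>s\<in>?S. ?c s * a s b')"
        using s0 insert.prems(1) by (simp add: sum.remove)
      also have "(\<Sum>s\<in>?S. ?c s * a s b') = (\<Sum>s\<in>?S. c s * a s b')" by (rule sum.cong) auto
      finally show ?thesis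
        by (simp add: sum_distrib_left sum_distrib_right sum_subtractf algebra_simps)
    qed
    \<comment> \<open>The pivot equation holds up to the factor \<open>1 - u * a s0 b\<close>, which
      lies in \<open>M\<close>; the other equations are the reduced ones by
      \<open>eq\<close>.\<close>
    have "(\<Sum>s\<in>?S. c s * ?a s b) = (\<Sum>s\<in>?S. c s * a s b) * (1 - u * a s0 b)"
      by (simp add: sum_distrib_right sum_distrib_left sum_subtractf algebra_simps)
    then have "(\<Sum>s\<in>?S. c s * ?a s b) \<in> M" using u idl_mult[OF idl_M] by simp
    then show ?thesis using c eq by (intro exI[of _ ?c]) auto
  qed
qed

text \<open>Expressing \<open>S\<close> through \<open>B\<close> turns a dependence of
  \<open>S\<close> into a homogeneous system with \<open>card B\<close> equations and
  \<open>card S\<close> unknowns.\<close>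

lemma steinitz:
  assumes "indep S W'" "S \<subseteq> W" "spans B W' W" "smod W'" "\<And>a w. a \<in> M ==> w \<in> W ==> scl a w \<in> W'"
  shows "card S \<le> card B"
proof (rule ccontr)
  assume "\<not> card S \<le> card B"
  then have lt: "card B < card S" by simp
  have fin: "finite B" "finite S" using assms by (auto simp: spans_def indep_def)
  have "\<forall>s\<in>S. \<exists>f. s - (\<Sum>b\<in>B. scl (f b) b) \<in> W'" using assms by (auto simp: spans_def)
  then obtain a where a: "\<And>s. s \<in> S ==> s - (\<Sum>b\<in>B. scl (a s b) b) \<in> W'"
    using bchoice by metis
  obtain c where c: "\<exists>s\<in>S. c s \<notin> M" "\<forall>b\<in>B. (\<Sum>s\<in>S. c s * a s b) \<in> M"
    using homogeneous_system[OF fin lt] by blast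
  have 1: "(\<Sum>s\<in>S. scl (c s) (s - (\<Sum>b\<in>B. scl (a s b) b))) \<in> W'"
    using a by (intro smod_sum smod_scl assms(4)) auto
  have 2: "(\<Sum>s\<in>S. scl (c s) (s - (\<Sum>b\<in>B. scl (a s b) b)))
      = (\<Sum>s\<in>S. scl (c s) s) - (\<Sum>b\<in>B. scl (\<Sum>s\<in>S. c s * a s b) b)"
    by (simp add: scl_simps scl_sum sum_subtractf scl_sum_left sum.swap[of _ S B])
  have 3: "(\<Sum>b\<in>B. scl (\<Sum>s\<in>S. c s * a s b) b) \<in> W'"
    using c(2) assms(3,5) by (intro smod_sum assms(4)) (auto simp: spans_def)
  have "(\<Sum>s\<in>S. scl (c s) s) \<in> W'"
    by (rule smod_diff_cancel[OF assms(4) 1[unfolded 2] 3])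
  then show False using assms(1) c(1) by (auto simp: indep_def)
qed

text \<open>A minimal spanning set is independent, since a coefficient outside \<open>M\<close> can be inverted.\<close>

lemma minimal_spanning_indep:
  assumes "spans S W' W" "card S = rdim W' W" "smod W'" "smod W" "\<And>a w. a \<in> M ==> w \<in> W ==> scl a w \<in> W'"
  shows "indep S W'"
  unfolding indep_def
proof (intro conjI allI impI ballI, rule_tac [2] ccontr)
  show fin: "finite S" using assms by (simp add: spans_def)
  fix f s assume f: "(\<Sum>s\<in>S. scl (f s) s) \<in> W'" and s: "s \<in> S" "f s \<notin> M"
  obtain u where u: "1 - u * f s \<in> M" using inv_M' s by blast
  let ?S = "S - {s}"
  have sW: "s \<in> W" using assms s by (auto simp: spans_def)
  have 1: "scl u (\<Sum>s\<in>S. scl (f s) s) \<in> W'" using f smod_scl assms(3) by blast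
  have 2: "scl u (\<Sum>s\<in>S. scl (f s) s) = scl (u * f s) s + (\<Sum>t\<in>?S. scl (u * f t) t)"
    using fin s by (simp add: sum.remove[of S s] scl_simps scl_sum)
  have 3: "scl (1 - u * f s) s \<in> W'" using assms(5) u sW by blast
  have "scl (1 - u * f s) s + (scl (u * f s) s + (\<Sum>t\<in>?S. scl (u * f t) t)) \<in> W'"
    by (rule smod_add[OF assms(3) 3 1[unfolded 2]])
  then have *: "s + (\<Sum>t\<in>?S. scl (u * f t) t) \<in> W'" by (simp add: scl_simps)
  have "spans ?S W' W" unfolding spans_def
  proof (intro conjI ballI)
    show "finite ?S" "?S \<subseteq> W" using assms fin by (auto simp: spans_def)
    fix w assume "w \<in> W"
    then obtain g where g: "w - (\<Sum>t\<in>S. scl (g t) t) \<in> W'" using assms by (auto simp: spans_def)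
    have "w - (\<Sum>t\<in>S. scl (g t) t) + scl (g s) (s + (\<Sum>t\<in>?S. scl (u * f t) t)) \<in> W'"
      using smod_add smod_scl * g assms(3) by blast
    moreover have "(\<Sum>t\<in>S. scl (g t) t) = scl (g s) s + (\<Sum>t\<in>?S. scl (g t) t)"
      using fin s by (simp add: sum.remove[of S s])
    ultimately have "w - (\<Sum>t\<in>?S. scl (g t - g s * (u * f t)) t) \<in> W'"
      by (simp add: scl_simps scl_sum sum_subtractf algebra_simps)
    then show "\<exists>h. w - (\<Sum>t\<in>?S. scl (h t) t) \<in> W'"
      by (intro exI[of _ "\<lambda>t. g t - g s * (u * f t)"])
  qed
  from rdim_le[OF this] show False using assms(2) s fin
    by (simp add: card_Diff_singleton) (metis Suc_pred card_gt_0_iff empty_iff lessI not_less)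
qed

lemma rdim_basis:
  assumes "fdim W' W" "smod W'" "smod W" "\<And>a w. a \<in> M ==> w \<in> W ==> scl a w \<in> W'"
  obtains S where "spans S W' W" "card S = rdim W' W" "indep S W'" "S \<subseteq> W" "finite S"
proof -
  obtain S where S: "spans S W' W" "card S = rdim W' W" using rdim_ex assms(1) by blast
  with minimal_spanning_indep[OF S assms(2-4)] show ?thesis using that by (auto simp: spans_def)
qed

lemma indep_le_rdim:
  assumes "indep S W'" "S \<subseteq> W" "fdim W' W" "smod W'" "\<And>a w. a \<in> M ==> w \<in> W ==> scl a w \<in> W'"
  shows "card S \<le> rdim W' W"
proof -
  obtain B where "spans B W' W" "card B = rdim W' W" using rdim_ex assms(3) by blast
  then show ?thesis using steinitz[OF assms(1,2) _ assms(4,5)] by metis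
qed

lemma rdim_inj:
  assumes "fdim W' W" "smod W'" "smod W" "\<And>a w. a \<in> M ==> w \<in> W ==> scl a w \<in> W'"
    and "fdim U' U" "smod U'" "\<And>a w. a \<in> M ==> w \<in> U ==> scl a w \<in> U'"
    and "lin \<phi>" "\<And>w. w \<in> W ==> \<phi> w \<in> U" "\<And>w. w \<in> W ==> \<phi> w \<in> U' ==> w \<in> W'"
  shows "rdim W' W \<le> rdim U' U"
proof -
  obtain S where S: "spans S W' W" "card S = rdim W' W" "indep S W'" "S \<subseteq> W" "finite S"
    using rdim_basis assms(1-4) by blast
  have key: "\<forall>s\<in>S. f s \<in> M" if "(\<Sum>s\<in>S. scl (f s) (\<phi> s)) \<in> U'" for f
  proof -
    have "\<phi> (\<Sum>s\<in>S. scl (f s) s) \<in> U'" using that by (simp add: lin_simps[OF assms(8)])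
    moreover have "(\<Sum>s\<in>S. scl (f s) s) \<in> W"
      using S by (intro smod_sum smod_scl assms(3)) auto
    ultimately show ?thesis using assms(10) S(3) by (auto simp: indep_def)
  qed
  have inj: "inj_on \<phi> S"
  proof (rule inj_onI, rule ccontr)
    fix s t assume st: "s \<in> S" "t \<in> S" "\<phi> s = \<phi> t" "s \<noteq> t"
    let ?f = "\<lambda>r. if r = s then 1 else if r = t then -1 else 0 :: 'r"
    have "(\<Sum>r\<in>S. scl (?f r) (\<phi> r)) = (\<Sum>r\<in>{s,t}. scl (?f r) (\<phi> r))"
      using S(5) st by (intro sum.mono_neutral_right) (auto simp: scl_simps)
    also have "\<dots> = 0" using st by (simp add: scl_simps)
    finally have "(\<Sum>r\<in>S. scl (?f r) (\<phi> r)) \<in> U'" using smod_0 assms(6) by metis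
    from key[OF this] st have "?f s \<in> M" by blast
    then show False using one_M by simp
  qed
  have "indep (\<phi> ` S) U'"
    unfolding indep_def
  proof (intro conjI allI impI ballI)
    fix f t assume "(\<Sum>s\<in>\<phi> ` S. scl (f s) s) \<in> U'" "t \<in> \<phi> ` S"
    then show "f t \<in> M" using key[of "\<lambda>s. f (\<phi> s)"] by (auto simp: sum.reindex[OF inj] o_def)
  qed (use S in auto)
  then have "card (\<phi> ` S) \<le> rdim U' U"
    using S(4) assms(5-7,9) by (intro indep_le_rdim) auto
  then show ?thesis using S card_image[OF inj] by simp
qed

text \<open>A basis of \<open>U / W'\<close> and a basis of \<open>W / U\<close> are disjoint, and
  their union is independent modulo \<open>W'\<close>.\<close>

lemma rdim_superadd:
  assumes "fdim W' W" "fdim W' U" "smod W'" "smod U" "smod W" "W' \<subseteq> U" "U \<subseteq> W"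
    "\<And>a w. a \<in> M ==> w \<in> W ==> scl a w \<in> W'"
  shows "rdim W' U + rdim U W \<le> rdim W' W"
proof -
  obtain S where S: "spans S W' U" "card S = rdim W' U" "indep S W'" "S \<subseteq> U" "finite S"
    using rdim_basis[of W' U] assms by blast
  have "fdim U W" using assms fdim_mono by blast
  then obtain T where T: "spans T U W" "card T = rdim U W" "indep T U" "T \<subseteq> W" "finite T"
    using rdim_basis[of U W] assms by blast
  have "T \<inter> U = {}"
  proof (rule ccontr)
    assume "T \<inter> U \<noteq> {}"
    then obtain t where t: "t \<in> T" "t \<in> U" by blast
    have "(\<Sum>s\<in>T. scl (if s = t then 1 else 0) s) = t" by (rule sum_delta_scl) (use T(5) t in auto)
    moreover have "\<forall>s\<in>T. f s \<in> M" if "(\<Sum>s\<in>T. scl (f s) s) \<in> U" for f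
      using T(3) that by (simp add: indep_def)
    ultimately have "\<forall>s\<in>T. (if s = t then 1 else 0 :: 'r) \<in> M" using t(2) by presburger
    then show False using one_M t(1) by auto
  qed
  then have disj: "S \<inter> T = {}" using S by blast
  have "indep (S \<union> T) W'"
    unfolding indep_def
  proof (intro conjI allI impI)
    fix f assume f: "(\<Sum>s\<in>S \<union> T. scl (f s) s) \<in> W'"
    have eq: "(\<Sum>s\<in>S \<union> T. scl (f s) s) = (\<Sum>s\<in>S. scl (f s) s) + (\<Sum>s\<in>T. scl (f s) s)"
      using S T disj by (simp add: sum.union_disjoint)
    have "(\<Sum>s\<in>S. scl (f s) s) \<in> U" using S(4) by (intro smod_sum smod_scl assms(4)) auto
    then have "(\<Sum>s\<in>T. scl (f s) s) \<in> U"
      using smod_diff[OF assms(4), of "(\<Sum>s\<in>S \<union> T. scl (f s) s)" "(\<Sum>s\<in>S. scl (f s) s)"] f eq assms(6)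
      by auto
    then have fT: "\<forall>t\<in>T. f t \<in> M" using T(3) by (auto simp: indep_def)
    then have "(\<Sum>s\<in>T. scl (f s) s) \<in> W'" using T(4) by (intro smod_sum assms) auto
    then have "(\<Sum>s\<in>S. scl (f s) s) \<in> W'"
      using smod_diff[OF assms(3), of "(\<Sum>s\<in>S \<union> T. scl (f s) s)" "(\<Sum>s\<in>T. scl (f s) s)"] f eq by auto
    then show "\<forall>s\<in>S \<union> T. f s \<in> M" using S(3) fT by (auto simp: indep_def)
  qed (use S T in auto)
  from indep_le_rdim[OF this] have "card (S \<union> T) \<le> rdim W' W"
    using S T assms by auto
  then show ?thesis using S T disj by (simp add: card_Un_disjoint)
qed

text \<open>Independent subsets of \<open>U\<close> have at most \<open>rdim W' W\<close> elements,
  so there is a largest one; it spans because a new element can be solved for in any dependence that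
  it creates.\<close>

lemma fdim_sub:
  assumes "fdim W' W" "smod W'" "smod U" "U \<subseteq> W" "\<And>a w. a \<in> M ==> w \<in> W ==> scl a w \<in> W'"
  shows "fdim W' U"
proof -
  let ?P = "\<lambda>S. indep S W' \<and> S \<subseteq> U"
  have b: "card S \<le> rdim W' W" if "?P S" for S
    using that assms by (intro indep_le_rdim) auto
  have "?P {}" by (simp add: indep_def)
  then obtain S where S: "?P S" "\<And>T. ?P T ==> card T \<le> card S"
    using ex_has_greatest_nat[of ?P "{}" card "Suc (rdim W' W)"] b by (metis (mono_tags, lifting) less_Suc_eq_le)
  have "spans S W' U"
    unfolding spans_def
  proof (intro conjI ballI)
    show fin: "finite S" and "S \<subseteq> U" using S by (auto simp: indep_def)
    fix w assume w: "w \<in> U"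
    show "\<exists>f. w - (\<Sum>s\<in>S. scl (f s) s) \<in> W'"
    proof (cases "w \<in> S")
      case True
      have "(\<Sum>s\<in>S. scl (if s = w then 1 else 0) s) = w"
        by (rule sum_delta_scl) (use fin True in auto)
      then show ?thesis using smod_0[OF assms(2)]
        by (intro exI[of _ "\<lambda>s. if s = w then 1 else 0"]) simp
    next
      case False
      have "\<not> ?P (insert w S)" using S(2)[of "insert w S"] fin False by auto
      then obtain f where f: "(\<Sum>s\<in>insert w S. scl (f s) s) \<in> W'" "\<exists>s\<in>insert w S. f s \<notin> M"
        using S(1) w fin by (auto simp: indep_def)
      have eq: "(\<Sum>s\<in>insert w S. scl (f s) s) = scl (f w) w + (\<Sum>s\<in>S. scl (f s) s)"
        using fin False by simp
      have wn: "f w \<notin> M"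
      proof
        assume fw: "f w \<in> M"
        then have "scl (f w) w \<in> W'" using assms w by blast
        then have "(\<Sum>s\<in>S. scl (f s) s) \<in> W'"
          using smod_diff[OF assms(2) f(1), of "scl (f w) w"] eq by simp
        then show False using S(1) fw f(2) by (auto simp: indep_def)
      qed
      obtain u where u: "1 - u * f w \<in> M" using inv_M' wn by blast
      have "scl (1 - u * f w) w \<in> W'" using u w assms by blast
      moreover have "scl u (\<Sum>s\<in>insert w S. scl (f s) s) \<in> W'" using f assms smod_scl by blast
      ultimately have "scl (1 - u * f w) w + scl u (\<Sum>s\<in>insert w S. scl (f s) s) \<in> W'"
        using smod_add[OF assms(2)] by blast
      then have "w - (\<Sum>s\<in>S. scl (- u * f s) s) \<in> W'"
        unfolding eq by (simp add: scl_simps scl_sum sum_negf algebra_simps)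
      then show ?thesis by (intro exI[of _ "\<lambda>s. - u * f s"])
    qed
  qed
  then show ?thesis by (auto simp: fdim_def)
qed

lemma rdim_zero_imp:
  assumes "fdim W' W" "rdim W' W = 0" "w \<in> W"
  shows "w \<in> W'"
proof -
  obtain S where "spans S W' W" "card S = rdim W' W" using rdim_ex assms(1) by blast
  then show ?thesis using assms by (auto simp: spans_def)
qed

end

section \<open>Graded modules over commuting operators of degree two\<close>

context max_idl
begin

text \<open>The dimensions \<open>rdim N (G i)\<close> increase and are bounded; where they agree,
  the quotient of the two members has dimension zero.\<close>

lemma chain_stabilizes:
  fixes G :: "nat => ('p, 'r) vec set"
  assumes "fdim N Z" "smod N" "smod Z" "\<And>a z. a \<in> M ==> z \<in> Z ==> scl a z \<in> N"
    and G: "\<And>i. smod (G i)" "\<And>i. N \<subseteq> G i" "\<And>i. G i \<subseteq> Z" "\<And>i. G i \<subseteq> G (Suc i)"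
  shows "\<exists>i0. \<forall>i\<ge>i0. G i = G i0"
proof -
  have mono: "G i \<subseteq> G j" if "i \<le> j" for i j using lift_Suc_mono_le[of G i j] G(4) that by blast
  have fdG: "fdim N (G i)" for i using fdim_sub[OF assms(1,2) G(1) G(3) assms(4)] by blast
  have MG: "a \<in> M ==> z \<in> G i ==> scl a z \<in> N" for a z i using assms(4) G(3) by blast
  have add: "rdim N (G i) + rdim (G i) (G j) \<le> rdim N (G j)" if "i \<le> j" for i j
    using rdim_superadd[OF fdG fdG assms(2) G(1) G(1) G(2) mono[OF that] MG] .
  have "rdim N (G i) \<le> rdim N Z" for i
    using rdim_superadd[OF assms(1) fdG assms(2) G(1) assms(3) G(2) G(3) assms(4), of i] by simp
  then obtain i0 where i0: "\<And>i. rdim N (G i) \<le> rdim N (G i0)"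
    using ex_has_greatest_nat[of "\<lambda>_. True" 0 "\<lambda>i. rdim N (G i)" "Suc (rdim N Z)"]
    by (auto simp: less_Suc_eq_le)
  have "G i = G i0" if "i0 \<le> i" for i
  proof
    have "rdim (G i0) (G i) = 0" using add[OF that] i0[of i] by simp
    then show "G i \<subseteq> G i0" using rdim_zero_imp[of "G i0" "G i"] fdim_mono[OF fdG G(2)] by blast
  qed (use mono that in blast)
  then show ?thesis by blast
qed

text \<open>The family \<open>Z n / N n\<close> as a graded module over a polynomial ring in
  \<open>c\<close> variables of degree two, with residue field coefficients and finite dimension in
  each degree. The \<open>T j\<close> commute only modulo \<open>N\<close>, as cohomology operators
  on cocycles do.\<close>

definition gm ::
  "nat => (int => ('p, 'r) vec set) => (int => ('p, 'r) vec set) => (nat => ('p, 'r) vec => ('p, 'r) vec) => bool"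
  where "gm c Z N T \<longleftrightarrow>
    (\<forall>n. smod (Z n) \<and> smod (N n) \<and> N n \<subseteq> Z n \<and> fdim (N n) (Z n) \<and> (\<forall>a\<in>M. \<forall>z\<in>Z n. scl a z \<in> N n)) \<and>
    (\<forall>j<c. lin (T j) \<and> (\<forall>n. (\<forall>z\<in>Z n. T j z \<in> Z (n + 2)) \<and> (\<forall>z\<in>N n. T j z \<in> N (n + 2)))) \<and>
    (\<forall>i<c. \<forall>j<c. \<forall>n. \<forall>z\<in>Z n. T i (T j z) - T j (T i z) \<in> N (n + 4))"

lemma
  assumes "gm c Z N T"
  shows gm_Z: "smod (Z n)" and gm_N: "smod (N n)" and gm_NZ: "z \<in> N n ==> z \<in> Z n"
    and gm_NZ': "N n \<subseteq> Z n"
    and gm_fd: "fdim (N n) (Z n)" and gm_M: "a \<in> M ==> z \<in> Z n ==> scl a z \<in> N n"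
    and gm_lin: "j < c ==> lin (T j)" and gm_TZ: "j < c ==> z \<in> Z n ==> T j z \<in> Z (n + 2)"
    and gm_TN: "j < c ==> z \<in> N n ==> T j z \<in> N (n + 2)"
    and gm_comm: "i < c ==> j < c ==> z \<in> Z n ==> T i (T j z) - T j (T i z) \<in> N (n + 4)"
  using assms unfolding gm_def by blast+

definition gsub where
  "gsub c Z N T G \<longleftrightarrow> (\<forall>n. smod (G n) \<and> N n \<subseteq> G n \<and> G n \<subseteq> Z n \<and> (\<forall>j<c. \<forall>z\<in>G n. T j z \<in> G (n + (2::int))))"

text \<open>Finite generation degree by degree: from \<open>n1\<close> on, everything comes from
  degree \<open>n - 2\<close>. Together with finite dimensions and vanishing in low degrees this is
  finite generation over the operators.\<close>

definition gens where
  "gens c Z N T n1 \<longleftrightarrow> (\<forall>n\<ge>n1. \<forall>z\<in>Z n. \<exists>f. (\<forall>j<c. f j \<in> Z (n - 2)) \<and> z - (\<Sum>j<c. T j (f j)) \<in> N (n::int))"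

lemma gm_pow:
  assumes "gm c Z N T" "j < c"
  shows "lin ((T j) ^^ k)" "z \<in> Z n ==> (T j ^^ k) z \<in> Z (n + 2 * int k)"
    "z \<in> N n ==> (T j ^^ k) z \<in> N (n + 2 * int k)"
proof -
  show "lin ((T j) ^^ k)"
  proof (induction k)
    case 0 then show ?case by (simp add: lin_def)
  next
    case (Suc k) then show ?case using gm_lin[OF assms] lin_comp[of "T j" "T j ^^ k"] by (simp add: o_def)
  qed
  show "z \<in> Z n ==> (T j ^^ k) z \<in> Z (n + 2 * int k)"
  proof (induction k)
    case (Suc k)
    then show ?case using gm_TZ[OF assms, of "(T j ^^ k) z" "n + 2 * int k"] by (simp add: algebra_simps)
  qed simp
  show "z \<in> N n ==> (T j ^^ k) z \<in> N (n + 2 * int k)"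
  proof (induction k)
    case (Suc k)
    then show ?case using gm_TN[OF assms, of "(T j ^^ k) z" "n + 2 * int k"] by (simp add: algebra_simps)
  qed simp
qed

lemma gm_pow_comm:
  assumes "gm c Z N T" "j < c" "i < c" "z \<in> Z n"
  shows "T i ((T j ^^ k) z) - (T j ^^ k) (T i z) \<in> N (n + 2 * int k + 2)"
proof (induction k)
  case 0 then show ?case using smod_0[OF gm_N[OF assms(1)]] by simp
next
  case (Suc k)
  have "T i (T j ((T j ^^ k) z)) - T j (T i ((T j ^^ k) z)) \<in> N (n + 2 * int k + 4)"
    using gm_comm[OF assms(1,3,2) gm_pow(2)[OF assms(1,2,4)]] .
  moreover have "T j (T i ((T j ^^ k) z)) - T j ((T j ^^ k) (T i z)) \<in> N (n + 2 * int k + 4)"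
    using gm_TN[OF assms(1,2) Suc] by (simp add: lin_simps[OF gm_lin[OF assms(1,2)]] algebra_simps)
  ultimately have "T i (T j ((T j ^^ k) z)) - T j ((T j ^^ k) (T i z)) \<in> N (n + 2 * int k + 4)"
    by (rule smod_diff_trans[OF gm_N[OF assms(1)]])
  then show ?case by (simp add: algebra_simps)
qed

text \<open>A homogeneous polynomial is kept as the map that it induces on representatives, together
  with its degree. The \<open>T j\<close> commute only modulo \<open>N\<close>, so a polynomial ring
  would not act on the vectors themselves.\<close>

inductive pol for c :: nat and T :: "nat => ('p, 'r) vec => ('p, 'r) vec" where
  pol_id: "pol c T 0 (\<lambda>v. v)"
| pol_zero: "pol c T q (\<lambda>v. 0)"
| pol_add: "pol c T q f ==> pol c T q g ==> pol c T q (\<lambda>v. f v + g v)"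
| pol_scl: "pol c T q f ==> pol c T q (\<lambda>v. scl a (f v))"
| pol_op: "j < c ==> pol c T q f ==> pol c T (Suc q) (\<lambda>v. T j (f v))"

lemma pol_comp: "pol c T q f ==> pol c T r g ==> pol c T (q + r) (\<lambda>v. f (g v))"
  by (induction rule: pol.induct) (auto intro: pol.intros)

lemma pol_T: "j < c ==> pol c T 1 (T j)"
  using pol_op[OF _ pol_id, of j c T] by simp

lemma pol_pow: "pol c T q f ==> pol c T (k * q) (f ^^ k)"
proof (induction k)
  case (Suc k)
  then show ?case using pol_comp[of c T q f "k * q" "f ^^ k"] by (simp add: o_def)
qed (simp add: id_def pol_id)

context
  fixes c Z N T
  assumes gm: "gm c Z N T"
begin

lemma pol_lin: "pol c T q f ==> lin f"
  by (induction rule: pol.induct) (auto intro: lin_intros lin_comp[OF gm_lin[OF gm]])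

lemma pol_gsub:
  assumes "pol c T q f" "gsub c Z N T G" "z \<in> G n"
  shows "f z \<in> G (n + 2 * int q)"
  using assms(1)
proof (induction rule: pol.induct)
  case (pol_op j q f)
  then have "T j (f z) \<in> G (n + 2 * int q + 2)" using assms(2) by (auto simp: gsub_def)
  then show ?case by (simp add: algebra_simps)
qed (use assms(2,3) in \<open>auto simp: gsub_def intro: smod_0 smod_add smod_scl\<close>)

lemma gsub_Z: "gsub c Z N T Z" and gsub_N: "gsub c Z N T N"
  using gm unfolding gm_def gsub_def by auto

lemmas pol_Z = pol_gsub[OF _ gsub_Z] and pol_N = pol_gsub[OF _ gsub_N]

lemma pol_comm_op:
  assumes "pol c T q f" "j < c" "z \<in> Z n"
  shows "f (T j z) - T j (f z) \<in> N (n + 2 * int q + 2)"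
  using assms(1)
proof (induction rule: pol.induct)
  case (pol_add q f g)
  from smod_add[OF gm_N[OF gm] pol_add.IH] show ?case
    by (simp add: lin_add[OF gm_lin[OF gm assms(2)]] algebra_simps)
next
  case (pol_scl q f a)
  from smod_scl[OF gm_N[OF gm] pol_scl.IH, of a] show ?case
    by (simp add: lin_scl[OF gm_lin[OF gm assms(2)]] scl_simps)
next
  case (pol_op i q f)
  have 1: "T i (f (T j z)) - T i (T j (f z)) \<in> N (n + 2 * int q + 4)"
    using gm_TN[OF gm pol_op(1) pol_op.IH] by (simp add: lin_diff[OF gm_lin[OF gm pol_op(1)]] algebra_simps)
  have 2: "T i (T j (f z)) - T j (T i (f z)) \<in> N (n + 2 * int q + 4)"
    using gm_comm[OF gm pol_op(1) assms(2) pol_Z[OF pol_op(2) assms(3)]] .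
  show ?case using smod_diff_trans[OF gm_N[OF gm] 1 2] by (simp add: algebra_simps)
qed (simp_all add: smod_0[OF gm_N[OF gm]] lin_zero[OF gm_lin[OF gm assms(2)]])

lemma pol_comm:
  assumes "pol c T q f" "pol c T r g" "z \<in> Z n"
  shows "f (g z) - g (f z) \<in> N (n + 2 * int q + 2 * int r)"
  using assms(2)
proof (induction rule: pol.induct)
  case (pol_add r g h)
  from smod_add[OF gm_N[OF gm] pol_add.IH] show ?case
    by (simp add: lin_add[OF pol_lin[OF assms(1)]] algebra_simps)
next
  case (pol_scl r g a)
  from smod_scl[OF gm_N[OF gm] pol_scl.IH, of a] show ?case
    by (simp add: lin_scl[OF pol_lin[OF assms(1)]] scl_simps)
next
  case (pol_op i r g)
  have 1: "f (T i (g z)) - T i (f (g z)) \<in> N (n + 2 * int q + 2 * int (Suc r))"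
    using pol_comm_op[OF assms(1) pol_op(1) pol_Z[OF pol_op(2) assms(3)]] by (simp add: algebra_simps)
  have 2: "T i (f (g z)) - T i (g (f z)) \<in> N (n + 2 * int q + 2 * int (Suc r))"
    using gm_TN[OF gm pol_op(1) pol_op.IH] by (simp add: lin_diff[OF gm_lin[OF gm pol_op(1)]] algebra_simps)
  show ?case using smod_diff_trans[OF gm_N[OF gm] 1 2] .
qed (simp_all add: smod_0[OF gm_N[OF gm]] lin_zero[OF pol_lin[OF assms(1)]])

end

text \<open>\<open>N'\<close> is \<open>N + p Z\<close>, so the new module is the cokernel of
  \<open>p\<close>. It is stable under the operators because \<open>p\<close> commutes with them
  modulo \<open>N\<close>.\<close>

lemma gm_quot:
  assumes gm: "gm c Z N T" and p: "pol c T q p"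
  defines "N' \<equiv> \<lambda>n. {z. \<exists>y\<in>Z (n - 2 * int q). z - p y \<in> N n}"
  shows "gm c Z N' T" and "N n \<subseteq> N' n"
proof -
  have linp: "lin p" using pol_lin[OF gm p] .
  have N'I: "z - p y \<in> N n ==> y \<in> Z (n - 2 * int q) ==> z \<in> N' n" for z y n by (auto simp: N'_def)
  have NN': "z \<in> N n ==> z \<in> N' n" for z n
    using N'I[of z 0 n] smod_0[OF gm_Z[OF gm]] by (simp add: lin_simps[OF linp])
  have smN': "smod (N' n)" for n
    unfolding smod_def
  proof (intro conjI ballI allI)
    show "0 \<in> N' n" using NN' smod_0[OF gm_N[OF gm]] by blast
    fix u v assume "u \<in> N' n" "v \<in> N' n"
    then obtain y y' where y: "y \<in> Z (n - 2 * int q)" "u - p y \<in> N n"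
        "y' \<in> Z (n - 2 * int q)" "v - p y' \<in> N n"
      by (auto simp: N'_def)
    then have "u - p y + (v - p y') \<in> N n" using smod_add[OF gm_N[OF gm]] by blast
    then have "u + v - p (y + y') \<in> N n" by (simp add: lin_simps[OF linp] algebra_simps)
    then show "u + v \<in> N' n" using N'I y smod_add[OF gm_Z[OF gm]] by blast
  next
    fix a u assume "u \<in> N' n"
    then obtain y where y: "y \<in> Z (n - 2 * int q)" "u - p y \<in> N n" by (auto simp: N'_def)
    then have "scl a (u - p y) \<in> N n" using smod_scl[OF gm_N[OF gm]] by blast
    then have "scl a u - p (scl a y) \<in> N n" by (simp add: lin_simps[OF linp] scl_simps)
    then show "scl a u \<in> N' n" using N'I y smod_scl[OF gm_Z[OF gm]] by blast
  qed
  have N'Z: "N' n \<subseteq> Z n" for n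
  proof
    fix z assume "z \<in> N' n"
    then obtain y where y: "y \<in> Z (n - 2 * int q)" "z - p y \<in> N n" by (auto simp: N'_def)
    then have "p y \<in> Z n" using pol_Z[OF gm p, of y "n - 2 * int q"] by simp
    then show "z \<in> Z n" using smod_diff_cancel[OF gm_Z[OF gm] gm_NZ[OF gm y(2)]] by blast
  qed
  have TN': "T j z \<in> N' (n + 2)" if "j < c" and z: "z \<in> N' n" for j z n
  proof -
    obtain y where y: "y \<in> Z (n - 2 * int q)" "z - p y \<in> N n" using z by (auto simp: N'_def)
    have lj: "lin (T j)" using gm_lin[OF gm] that by simp
    have 1: "T j z - T j (p y) \<in> N (n + 2)"
      using gm_TN[OF gm _ y(2), of j] that by (simp add: lin_simps[OF lj])
    have "p (T j y) - T j (p y) \<in> N (n + 2)"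
      using pol_comm_op[OF gm p that(1) y(1)] by simp
    then have "T j z - p (T j y) \<in> N (n + 2)"
      using smod_diff_trans[OF gm_N[OF gm] 1] smod_diff_sym[OF gm_N[OF gm]] by blast
    moreover have "T j y \<in> Z (n + 2 - 2 * int q)"
      using gm_TZ[OF gm, of j y "n - 2 * int q"] y that by (simp add: algebra_simps)
    ultimately show ?thesis by (rule N'I)
  qed
  show "gm c Z N' T"
    unfolding gm_def
    using smN' N'Z TN' gm_Z[OF gm] fdim_mono[OF gm_fd[OF gm]] gm_M[OF gm] NN' gm_lin[OF gm]
      gm_TZ[OF gm] gm_comm[OF gm] by (auto simp: subset_iff)
  show "N n \<subseteq> N' n" using NN' by blast
qed

lemma gm_less: "gm (Suc c) Z N T ==> gm c Z N T"
  unfolding gm_def by simp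

text \<open>Hilbert's basis theorem. The inductive step compares the leading-term modules
  \<open>L i k = {e. T\<^sup>k e \<in> G i + T\<^sup>k\<^sup>+\<^sup>1 Z}\<close> of the members of the chain.\<close>

theorem gm_acc:
  fixes G :: "nat => int => ('p, 'r) vec set"
  assumes "gm c Z N T" "gens c Z N T n1" "\<And>n. n < l ==> Z n \<subseteq> N n"
    and "\<And>i. gsub c Z N T (G i)" "\<And>i n. G i n \<subseteq> G (Suc i) n"
  shows "\<exists>i0. \<forall>i\<ge>i0. \<forall>n. G i n = G i0 n"
  using assms
proof (induction c arbitrary: N G)
  case 0
  \<comment> \<open>Without operators, \<open>gens\<close> says that the module vanishes from degree
    \<open>n1\<close> on, so only the finitely many degrees from \<open>l\<close> up to
    \<open>n1\<close> are left.\<close>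
  have eq: "G i n = N n" if "n < l \<or> n \<ge> n1" for i n
  proof -
    have "Z n \<subseteq> N n" using that 0(2,3) by (auto simp: gens_def)
    then show ?thesis using 0(4)[of i] by (auto simp: gsub_def)
  qed
  have "\<exists>i0. \<forall>i\<ge>i0. G i n = G i0 n" for n
    using chain_stabilizes[of "N n" "Z n" "\<lambda>i. G i n"] gm_fd[OF 0(1)] gm_N[OF 0(1)] gm_Z[OF 0(1)]
      gm_M[OF 0(1)] 0(4,5) by (auto simp: gsub_def)
  then obtain s where s: "\<And>n i. i \<ge> s n ==> G i n = G (s n) n" by metis
  define i0 where "i0 = Max (insert 0 (s ` {l..<n1}))"
  have "G i n = G i0 n" if "i \<ge> i0" for i n
  proof (cases "n < l \<or> n \<ge> n1")
    case False
    then have "s n \<le> i0" unfolding i0_def by (intro Max_ge) auto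
    then show ?thesis using s[of n i] s[of n i0] that by simp
  qed (use eq in simp)
  then show ?case by blast
next
  case (Suc c)
  note gm = Suc.prems(1)
  let ?T = "T c"
  have linT: "lin ?T" using gm_lin[OF gm] by simp
  \<comment> \<open>The quotient by the image of \<open>T c\<close> is generated by the remaining
    \<open>c\<close> operators, so the induction hypothesis applies to it.\<close>
  define N' where "N' n = {z. \<exists>y\<in>Z (n - 2). z - ?T y \<in> N n}" for n
  have N'I: "z - ?T y \<in> N n ==> y \<in> Z (n - 2) ==> z \<in> N' n" for z y n by (auto simp: N'_def)
  have gm1: "gm (Suc c) Z N' T" and NN: "N n \<subseteq> N' n" for n
    using gm_quot[OF gm pol_T[of c "Suc c" T]] by (simp_all add: N'_def[abs_def])
  note gm' = gm_less[OF gm1]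
  have NN': "z \<in> N n ==> z \<in> N' n" and N'Z: "N' n \<subseteq> Z n" for z n
    using NN gm_NZ'[OF gm'] by blast+
  have gens': "gens c Z N' T n1"
    unfolding gens_def
  proof (intro allI impI ballI)
    fix n z assume "n1 \<le> n" "z \<in> Z n"
    then obtain f where f: "\<forall>j<Suc c. f j \<in> Z (n - 2)" "z - (\<Sum>j<Suc c. T j (f j)) \<in> N n"
      using Suc.prems(2) unfolding gens_def by blast
    have "(z - (\<Sum>j<c. T j (f j))) - ?T (f c) \<in> N n" using f(2) by (simp add: algebra_simps)
    then have "z - (\<Sum>j<c. T j (f j)) \<in> N' n" using N'I f(1) by simp
    then show "\<exists>f. (\<forall>j<c. f j \<in> Z (n - 2)) \<and> z - (\<Sum>j<c. T j (f j)) \<in> N' n"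
      using f(1) by (intro exI[of _ f]) simp
  qed
  have van': "\<And>n. n < l ==> Z n \<subseteq> N' n" using Suc.prems(3) NN' by blast
  have smG: "smod (G i n)" and NG: "z \<in> N n ==> z \<in> G i n" and GZ: "z \<in> G i n ==> z \<in> Z n"
    and TG: "j < Suc c ==> z \<in> G i n ==> T j z \<in> G i (n + 2)" for i j n z
    using Suc.prems(4)[of i] unfolding gsub_def by blast+
  have Gmono: "i \<le> i' ==> G i n \<subseteq> G i' n" for i i' n
    using lift_Suc_mono_le[of "\<lambda>i. G i n"] Suc.prems(5) by blast
  define L where "L i k n = {e \<in> Z n. \<exists>y\<in>Z (n - 2). (?T ^^ k) e - (?T ^^ Suc k) y \<in> G i (n + 2 * int k)}"
    for i k n
  have LI: "e \<in> Z n ==> y \<in> Z (n - 2) ==> (?T ^^ k) e - (?T ^^ Suc k) y \<in> G i (n + 2 * int k) ==> e \<in> L i k n"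
    for e y i k n by (auto simp: L_def)
  have linp: "lin (?T ^^ k)" for k using gm_pow(1)[OF gm, of c] by simp
  have gsL: "gsub c Z N' T (L i k)" for i k
    unfolding gsub_def
  proof (intro allI conjI impI ballI)
    fix n
    show "smod (L i k n)" unfolding smod_def
    proof (intro conjI ballI allI)
      show "0 \<in> L i k n"
        by (rule LI[of _ _ 0]) (use smod_0[OF gm_Z[OF gm]] smod_0[OF smG] in
            \<open>auto simp: lin_simps[OF linp] lin_simps[OF linT]\<close>)
      fix u v assume "u \<in> L i k n" "v \<in> L i k n"
      then obtain y y' where y: "u \<in> Z n" "v \<in> Z n" "y \<in> Z (n-2)" "y' \<in> Z (n-2)"
          "(?T ^^ k) u - (?T ^^ Suc k) y \<in> G i (n + 2 * int k)"
          "(?T ^^ k) v - (?T ^^ Suc k) y' \<in> G i (n + 2 * int k)" by (auto simp: L_def)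
      show "u + v \<in> L i k n"
        by (rule LI[of _ _ "y + y'"]) (use y smod_add[OF gm_Z[OF gm]] smod_add[OF smG y(5,6)] in
            \<open>auto simp: lin_simps[OF linp] lin_simps[OF linT] algebra_simps\<close>)
    next
      fix a u assume "u \<in> L i k n"
      then obtain y where y: "u \<in> Z n" "y \<in> Z (n-2)"
          "(?T ^^ k) u - (?T ^^ Suc k) y \<in> G i (n + 2 * int k)" by (auto simp: L_def)
      show "scl a u \<in> L i k n"
        by (rule LI[of _ _ "scl a y"]) (use y smod_scl[OF gm_Z[OF gm]] smod_scl[OF smG y(3), of a] in
            \<open>auto simp: lin_simps[OF linp] lin_simps[OF linT] scl_simps\<close>)
    qed
    show "L i k n \<subseteq> Z n" by (auto simp: L_def)
    show "N' n \<subseteq> L i k n"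
    proof
      fix z assume z: "z \<in> N' n"
      then obtain y where y: "y \<in> Z (n-2)" "z - ?T y \<in> N n" by (auto simp: N'_def)
      have "(?T ^^ k) (z - ?T y) \<in> N (n + 2 * int k)" using gm_pow(3)[OF gm _ y(2)] by simp
      then have "(?T ^^ k) z - (?T ^^ Suc k) y \<in> N (n + 2 * int k)"
        by (simp add: lin_simps[OF linp] funpow_swap1)
      then show "z \<in> L i k n" using LI y(1) z N'Z NG by blast
    qed
    fix j z assume j: "j < c" and "z \<in> L i k n"
    then obtain y where y: "z \<in> Z n" "y \<in> Z (n-2)"
        "(?T ^^ k) z - (?T ^^ Suc k) y \<in> G i (n + 2 * int k)" by (auto simp: L_def)
    have lj: "lin (T j)" using gm_lin[OF gm] j by simp
    let ?m = "n + 2 + 2 * int k"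
    have 1: "T j ((?T ^^ k) z) - T j ((?T ^^ Suc k) y) \<in> G i ?m"
      using TG[OF _ y(3), of j] j by (simp add: lin_diff[OF lj] algebra_simps)
    have 2: "T j ((?T ^^ k) z) - (?T ^^ k) (T j z) \<in> G i ?m"
      using NG gm_pow_comm[OF gm _ _ y(1), of c j k] j by (simp add: algebra_simps)
    have 3: "T j ((?T ^^ Suc k) y) - (?T ^^ Suc k) (T j y) \<in> G i ?m"
      using NG gm_pow_comm[OF gm _ _ y(2), of c j "Suc k"] j by (simp add: algebra_simps)
    have "(T j ((?T ^^ k) z) - T j ((?T ^^ Suc k) y)) - (T j ((?T ^^ k) z) - (?T ^^ k) (T j z))
        + (T j ((?T ^^ Suc k) y) - (?T ^^ Suc k) (T j y)) \<in> G i ?m"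
      using smod_add[OF smG smod_diff[OF smG 1 2] 3] .
    then have "(?T ^^ k) (T j z) - (?T ^^ Suc k) (T j y) \<in> G i ?m" by (simp add: algebra_simps)
    moreover have "T j y \<in> Z (n + 2 - 2)" using gm_TZ[OF gm, of j y "n - 2"] y j by simp
    moreover have "T j z \<in> Z (n + 2)" using gm_TZ[OF gm, of j z n] y j by simp
    ultimately show "T j z \<in> L i k (n + 2)" using LI by blast
  qed
  have Lmono1: "L i k n \<subseteq> L i' k n" if "i \<le> i'" for i i' k n
    using Gmono[OF that] unfolding L_def by blast
  have LmonoS: "L i k n \<subseteq> L i (Suc k) n" for i k n
  proof
    fix z assume "z \<in> L i k n"
    then obtain y where y: "z \<in> Z n" "y \<in> Z (n-2)"
      "(?T ^^ k) z - (?T ^^ Suc k) y \<in> G i (n + 2 * int k)" by (auto simp: L_def)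
    have "?T ((?T ^^ k) z - (?T ^^ Suc k) y) \<in> G i (n + 2 * int k + 2)" using TG[OF _ y(3)] by simp
    then have "(?T ^^ Suc k) z - (?T ^^ Suc (Suc k)) y \<in> G i (n + 2 * int (Suc k))"
      by (simp add: lin_simps[OF linT] algebra_simps)
    then show "z \<in> L i (Suc k) n" using LI y by blast
  qed
  have Lmono2: "L i k n \<subseteq> L i k' n" if "k \<le> k'" for i k k' n
    using lift_Suc_mono_le[of "\<lambda>k. L i k n"] LmonoS that by blast
  \<comment> \<open>\<open>L i k\<close> increases in both indices. Once the diagonal is stationary
    from \<open>d\<close> on, all rows \<open>k \<ge> d\<close> are stationary, and the finitely
    many rows below \<open>d\<close> are treated one by one.\<close>
  have "\<exists>i0. \<forall>i\<ge>i0. \<forall>n. L i i n = L i0 i0 n"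
    using Suc.IH[OF gm' gens' van', of "\<lambda>i. L i i"] gsL Lmono1 Lmono2
    by (meson lessI less_imp_le_nat order_trans)
  then obtain d where d: "\<And>i n. i \<ge> d ==> L i i n = L d d n" by blast
  have "\<exists>i0. \<forall>i\<ge>i0. \<forall>n. L i k n = L i0 k n" for k
    using Suc.IH[OF gm' gens' van', of "\<lambda>i. L i k"] gsL Lmono1 by (meson lessI less_imp_le_nat)
  then obtain s where s: "\<And>k i n. i \<ge> s k ==> L i k n = L (s k) k n" by metis
  define I where "I = Max (insert d (s ` {..<d}))"
  have Id: "d \<le> I" and Is: "k < d ==> s k \<le> I" for k unfolding I_def by auto
  have LI_eq: "L i k n = L I k n" if "i \<ge> I" for i k n
  proof (cases "k < d")
    case True
    then show ?thesis using s[of k i n] s[of k I n] Is[OF True] that by simp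
  next
    case False
    have "L i' k n = L d d n" if "i' \<ge> d" for i'
    proof
      have "L i' k n \<subseteq> L (max i' k) (max i' k) n" using Lmono1 Lmono2 by (meson max.cobounded1 max.cobounded2 order_trans)
      then show "L i' k n \<subseteq> L d d n" using d[of "max i' k" n] that by auto
      show "L d d n \<subseteq> L i' k n" using Lmono1 Lmono2 False that by (meson not_le_imp_less less_imp_le_nat order_trans)
    qed
    then show ?thesis using Id that by (metis order_trans)
  qed
  have "G i n = G I n" if "i \<ge> I" for i n
  proof
    show "G I n \<subseteq> G i n" using Gmono that by blast
    show "G i n \<subseteq> G I n"
    proof
      fix g assume g: "g \<in> G i n"
      \<comment> \<open>Leading terms of \<open>G i\<close> are leading terms of \<open>G I\<close>,
        so modulo \<open>G I\<close> the element can be pushed into the image of ever higher powers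
        of \<open>T c\<close>.\<close>
      have "\<exists>e\<in>Z (n - 2 * int k). g - (?T ^^ k) e \<in> G I n" for k
      proof (induction k)
        case 0 then show ?case using GZ[OF g] smod_0[OF smG] by (intro bexI[of _ g]) auto
      next
        case (Suc k)
        then obtain e where e: "e \<in> Z (n - 2 * int k)" "g - (?T ^^ k) e \<in> G I n" by blast
        have "(?T ^^ k) e \<in> G i n"
          using smod_diff_cancel'[OF smG _ g] e(2) Gmono[OF that] by blast
        then have "e \<in> L i k (n - 2 * int k)"
          using LI[OF e(1) smod_0[OF gm_Z[OF gm]]] by (simp add: lin_simps[OF linp] lin_simps[OF linT])
        then have "e \<in> L I k (n - 2 * int k)" using LI_eq[OF that] by blast
        then obtain y where y: "y \<in> Z (n - 2 * int k - 2)" "(?T ^^ k) e - (?T ^^ Suc k) y \<in> G I n"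
          by (auto simp: L_def)
        have "g - (?T ^^ Suc k) y \<in> G I n" using smod_diff_trans[OF smG e(2) y(2)] .
        then show ?case using y(1) by (intro bexI[of _ y]) (simp_all add: algebra_simps)
      qed
      \<comment> \<open>With this exponent \<open>e\<close> has degree below \<open>l\<close>, where
        the module vanishes.\<close>
      from this[of "nat (n - l) + 1"]
      obtain e where e: "e \<in> Z (n - 2 * int (nat (n - l) + 1))" "g - (?T ^^ (nat (n - l) + 1)) e \<in> G I n"
        by blast
      have "n - 2 * int (nat (n - l) + 1) < l" by simp
      then have "e \<in> N (n - 2 * int (nat (n - l) + 1))" using e(1) Suc.prems(3) by blast
      then have "(?T ^^ (nat (n - l) + 1)) e \<in> N n"
        using gm_pow(3)[OF gm, of c e "n - 2 * int (nat (n - l) + 1)" "nat (n - l) + 1"] by simp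
      then show "g \<in> G I n" using smod_diff_cancel[OF smG e(2)] NG by blast
    qed
  qed
  then show ?case by blast
qed

section \<open>Consequences of the chain condition: maximal submodules and generation of
  submodules\<close>

definition fg where
  "fg c Z N T \<longleftrightarrow> gm c Z N T \<and> (\<exists>n1. gens c Z N T n1) \<and> (\<exists>l. \<forall>n<l. Z n \<subseteq> N n)"

lemma fg_gm: "fg c Z N T ==> gm c Z N T"
  by (simp add: fg_def)

lemma fg_acc:
  fixes G :: "nat => int => ('p, 'r) vec set"
  assumes "fg c Z N T" "\<And>i. gsub c Z N T (G i)" "\<And>i n. G i n \<subseteq> G (Suc i) n"
  shows "\<exists>i0. \<forall>i\<ge>i0. \<forall>n. G i n = G i0 n"
proof -
  obtain n1 l where "gens c Z N T n1" "\<And>n. n < l ==> Z n \<subseteq> N n" using assms(1) by (auto simp: fg_def)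
  then show ?thesis using gm_acc[of c Z N T n1 l G] fg_gm[OF assms(1)] assms(2,3) by simp
qed

text \<open>A family of submodules without a maximal member would, by choice of ever larger members,
  contradict \<open>fg_acc\<close>.\<close>

lemma fg_maximal:
  assumes "fg c Z N T" "Q G0" "\<And>G. Q G ==> gsub c Z N T G"
  shows "\<exists>G. Q G \<and> (\<forall>G'. Q G' --> (\<forall>n. G n \<subseteq> G' n) --> G' = G)"
proof (rule ccontr)
  assume *: "\<not> ?thesis"
  have "\<exists>G'. Q G' \<and> (\<forall>n. G n \<subseteq> G' n) \<and> G' \<noteq> G" if "Q G" for G
  proof (rule ccontr)
    assume "\<not> ?thesis"
    then have "\<forall>G'. Q G' --> (\<forall>n. G n \<subseteq> G' n) --> G' = G" by blast
    then show False using * that by blast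
  qed
  then have "\<forall>G. \<exists>G'. Q G --> Q G' \<and> (\<forall>n. G n \<subseteq> G' n) \<and> G' \<noteq> G" by simp
  from choice[OF this] obtain nx where "\<forall>G. Q G --> Q (nx G) \<and> (\<forall>n. G n \<subseteq> nx G n) \<and> nx G \<noteq> G" ..
  then have nx: "Q G ==> Q (nx G)" "Q G ==> G n \<subseteq> nx G n" "Q G ==> nx G \<noteq> G" for G n by simp_all
  define f where "f = rec_nat G0 (\<lambda>_. nx)"
  have f: "Q (f i)" for i by (induction i) (simp_all add: f_def assms(2) nx(1))
  have f': "f (Suc i) = nx (f i)" for i by (simp add: f_def)
  have "\<exists>i0. \<forall>i\<ge>i0. \<forall>n. f i n = f i0 n"
  proof (rule fg_acc[where G = f, OF assms(1)])
    show "gsub c Z N T (f i)" for i by (rule assms(3)[OF f])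
    show "f i n \<subseteq> f (Suc i) n" for i n unfolding f' by (rule nx(2)[OF f])
  qed
  then obtain i0 where i0: "\<forall>i\<ge>i0. \<forall>n. f i n = f i0 n" ..
  have "f (Suc i0) n = f i0 n" for n using i0[rule_format, of "Suc i0"] by simp
  then have "f (Suc i0) = f i0" ..
  then show False using nx(3)[OF f[of i0]] by (simp add: f')
qed

inductive gspan for c :: nat and N :: "int => ('p, 'r) vec set" and T :: "nat => ('p, 'r) vec => ('p, 'r) vec"
    and H :: "int => ('p, 'r) vec set" where
  gspan_base: "z \<in> H n ==> gspan c N T H n z"
| gspan_null: "z \<in> N n ==> gspan c N T H n z"
| gspan_add: "gspan c N T H n u ==> gspan c N T H n v ==> gspan c N T H n (u + v)"
| gspan_scl: "gspan c N T H n u ==> gspan c N T H n (scl a u)"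
| gspan_op: "j < c ==> gspan c N T H n u ==> gspan c N T H (n + 2) (T j u)"

lemma gspan_mono: "gspan c N T H n z ==> (\<And>n. H n \<subseteq> H' n) ==> gspan c N T H' n z"
  by (induction rule: gspan.induct) (blast intro: gspan.intros)+

text \<open>The submodules generated by the parts of \<open>G\<close> in degrees below
  \<open>l + i\<close> form an ascending chain. Where it becomes stationary, all higher degrees of
  \<open>G\<close> are generated by lower ones.\<close>

lemma submodule_fg:
  assumes fg: "fg c Z N T" and G: "gsub c Z N T G"
  shows "\<exists>n2. gens c G N T n2"
proof -
  obtain l where l: "\<And>n. n < l ==> Z n \<subseteq> N n" using fg by (auto simp: fg_def)
  note gm = fg_gm[OF fg]
  have smG: "smod (G n)" and NG: "z \<in> N n ==> z \<in> G n" and GZ: "z \<in> G n ==> z \<in> Z n"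
    and TG: "j < c ==> z \<in> G n ==> T j z \<in> G (n + 2)" for j n z
    using G unfolding gsub_def by blast+
  define H where "H i n = (if n < l + int i then G n else {})" for i n
  define S where "S i n = {z. gspan c N T (H i) n z}" for i n
  have SG: "z \<in> G n" if "gspan c N T (H i) n z" for i n z
    using that by (induction rule: gspan.induct)
      (auto simp: H_def NG TG smod_add[OF smG] smod_scl[OF smG] split: if_splits)
  have "gsub c Z N T (S i)" for i
    unfolding gsub_def
    by (auto simp: S_def smod_def intro: gspan.intros gspan_null smod_0[OF gm_N[OF gm]] GZ SG)
  moreover have "S i n \<subseteq> S (Suc i) n" for i n
    unfolding S_def using gspan_mono[of c N T "H i" n _ "H (Suc i)"] by (auto simp: H_def)
  ultimately obtain i0 where i0: "\<And>i n. i \<ge> i0 ==> S i n = S i0 n" using fg_acc[OF fg, of S] by blast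
  have main: "\<exists>f. (\<forall>j<c. f j \<in> G (n - 2)) \<and> z - (\<Sum>j<c. T j (f j)) \<in> N n"
    if "gspan c N T (H i0) n z" "n \<ge> l + int i0" for n z
    using that
  proof (induction rule: gspan.induct)
    case (gspan_base z n) then show ?case by (auto simp: H_def)
  next
    case (gspan_null z n)
    have "(\<Sum>j<c. T j 0) = 0" by (rule sum.neutral) (simp add: lin_zero[OF gm_lin[OF gm]])
    then show ?case using gspan_null smod_0[OF smG] by (intro exI[of _ "\<lambda>_. 0"]) simp
  next
    case (gspan_add n u v)
    then obtain f g where f: "\<forall>j<c. f j \<in> G (n - 2)" "u - (\<Sum>j<c. T j (f j)) \<in> N n"
      and g: "\<forall>j<c. g j \<in> G (n - 2)" "v - (\<Sum>j<c. T j (g j)) \<in> N n" by blast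
    have "(\<Sum>j<c. T j (f j + g j)) = (\<Sum>j<c. T j (f j)) + (\<Sum>j<c. T j (g j))"
      by (simp add: sum.distrib lin_add[OF gm_lin[OF gm]])
    then show ?case using f(1) g(1) smod_add[OF gm_N[OF gm] f(2) g(2)] smod_add[OF smG]
      by (intro exI[of _ "\<lambda>j. f j + g j"]) (simp add: algebra_simps)
  next
    case (gspan_scl n u a)
    then obtain f where f: "\<forall>j<c. f j \<in> G (n - 2)" "u - (\<Sum>j<c. T j (f j)) \<in> N n" by blast
    have "(\<Sum>j<c. T j (scl a (f j))) = scl a (\<Sum>j<c. T j (f j))"
      by (simp add: scl_sum lin_scl[OF gm_lin[OF gm]])
    then show ?case using f(1) smod_scl[OF gm_N[OF gm] f(2), of a] smod_scl[OF smG]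
      by (intro exI[of _ "\<lambda>j. scl a (f j)"]) (simp add: scl_simps)
  next
    case (gspan_op j n u)
    let ?f = "\<lambda>i. if i = j then u else 0"
    have "(\<Sum>i<c. T i (?f i)) = (\<Sum>i<c. if i = j then T j u else 0)"
      by (rule sum.cong) (auto simp: lin_zero[OF gm_lin[OF gm]])
    also have "\<dots> = T j u" using gspan_op by simp
    finally show ?case using SG[OF gspan_op(2)] smod_0[OF smG] smod_0[OF gm_N[OF gm]]
      by (intro exI[of _ ?f]) auto
  qed
  have "gens c G N T (l + int i0)"
    unfolding gens_def
  proof (intro allI impI ballI)
    fix n z assume n: "l + int i0 \<le> n" and z: "z \<in> G n"
    have "z \<in> S (nat (n - l) + 1) n" unfolding S_def using z by (auto simp: H_def intro!: gspan_base)
    moreover have "i0 \<le> nat (n - l) + 1" using n by linarith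
    ultimately have "z \<in> S i0 n" using i0 by blast
    then have "gspan c N T (H i0) n z" by (simp add: S_def)
    then show "\<exists>f. (\<forall>j<c. f j \<in> G (n - 2)) \<and> z - (\<Sum>j<c. T j (f j)) \<in> N n" using main n by blast
  qed
  then show ?thesis by blast
qed

text \<open>A homogeneous prime ideal that does not contain all the \<open>T j\<close>. Its elements
  are pairs because the zero map has every degree, and it is closed under composition on both sides
  because the maps commute only modulo \<open>N\<close>.\<close>

definition relevant_prime where
  "relevant_prime c T Q \<longleftrightarrow>
     (\<forall>q f g. (q, f) \<in> Q --> (q, g) \<in> Q --> (q, \<lambda>v. f v + g v) \<in> Q) \<and>
     (\<forall>q f a. (q, f) \<in> Q --> (q, \<lambda>v. scl a (f v)) \<in> Q) \<and>
     (\<forall>q f r g. (q, f) \<in> Q --> pol c T r g --> (r + q, \<lambda>v. g (f v)) \<in> Q \<and> (q + r, \<lambda>v. f (g v)) \<in> Q) \<and>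
     (\<forall>q f r g. pol c T q f --> pol c T r g --> (q + r, \<lambda>v. f (g v)) \<in> Q --> (q, f) \<in> Q \<or> (r, g) \<in> Q) \<and>
     (\<exists>j<c. (1, T j) \<notin> Q)"

lemma
  assumes "relevant_prime c T Q"
  shows rp_add: "(q, f) \<in> Q ==> (q, g) \<in> Q ==> (q, \<lambda>v. f v + g v) \<in> Q"
    and rp_scl: "(q, f) \<in> Q ==> (q, \<lambda>v. scl a (f v)) \<in> Q"
    and rp_left: "(q, f) \<in> Q ==> pol c T r g ==> (r + q, \<lambda>v. g (f v)) \<in> Q"
    and rp_right: "(q, f) \<in> Q ==> pol c T r g ==> (q + r, \<lambda>v. f (g v)) \<in> Q"
    and rp_prime: "pol c T q f ==> pol c T r g ==> (q + r, \<lambda>v. f (g v)) \<in> Q ==> (q, f) \<in> Q \<or> (r, g) \<in> Q"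
    and rp_rel: "\<exists>j<c. (1, T j) \<notin> Q"
  using assms unfolding relevant_prime_def by blast+

lemma rp_pow:
  assumes "relevant_prime c T Q" "pol c T q f" "k \<ge> 1"
  shows "(k * q, f ^^ k) \<in> Q \<longleftrightarrow> (q, f) \<in> Q"
  using assms(3)
proof (induction k rule: dec_induct)
  case (step k)
  show ?case
  proof
    assume "(Suc k * q, f ^^ Suc k) \<in> Q"
    then have "(q + k * q, \<lambda>v. f ((f ^^ k) v)) \<in> Q" by (simp add: o_def)
    then show "(q, f) \<in> Q" using rp_prime[OF assms(1,2) pol_pow[OF assms(2)]] step.IH by blast
  next
    assume "(q, f) \<in> Q"
    from rp_right[OF assms(1) this pol_pow[OF assms(2)], of k]
    show "(Suc k * q, f ^^ Suc k) \<in> Q" by (simp add: o_def)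
  qed
qed simp

text \<open>Over a finite residue field a linear combination of the \<open>T j\<close> may fail to
  avoid the primes, so powers are used to reach a common degree, and the degree of \<open>p\<close>
  cannot be prescribed.\<close>

lemma prime_avoidance:
  assumes "finite \<Q>" "\<And>Q. Q \<in> \<Q> ==> relevant_prime c T Q"
  shows "\<exists>q p. q \<ge> 1 \<and> pol c T q p \<and> (\<forall>Q\<in>\<Q>. (q, p) \<notin> Q)"
  using assms
proof (induction "card \<Q>" arbitrary: \<Q> rule: less_induct)
  case less
  show ?case
  proof (cases "\<Q> = {}")
    case True
    then show ?thesis using pol_zero[of c T 1] by (metis empty_iff order_refl)
  next
    case False
    then obtain Q0 where Q0: "Q0 \<in> \<Q>" by blast
    have "\<exists>q p. q \<ge> 1 \<and> pol c T q p \<and> (\<forall>R\<in>\<Q> - {Q}. (q, p) \<notin> R)" if "Q \<in> \<Q>" for Q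
      using less(1)[OF card_Diff1_less[OF less(2) that]] less(2,3) by simp
    then obtain d a where a: "\<And>Q. Q \<in> \<Q> ==> d Q \<ge> 1" "\<And>Q. Q \<in> \<Q> ==> pol c T (d Q) (a Q)"
      "\<And>Q R. Q \<in> \<Q> ==> R \<in> \<Q> ==> R \<noteq> Q ==> (d Q, a Q) \<notin> R"
      by (metis (no_types, lifting) Diff_iff singletonD)
    show ?thesis
    proof (cases "\<exists>Q\<in>\<Q>. (d Q, a Q) \<notin> Q")
      case True
      then show ?thesis using a by metis
    next
      case False
      \<comment> \<open>Now each \<open>a Q\<close> lies in \<open>Q\<close> and in no other member.
        The product of the \<open>a Q\<close> with \<open>Q \<noteq> Q0\<close> and of some
        \<open>T j\<close> outside \<open>Q0\<close> lies in every member except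
        \<open>Q0\<close>.\<close>
      have "\<exists>r b. r \<ge> 1 \<and> pol c T r b \<and> (r, b) \<notin> Q0 \<and> (\<forall>Q\<in>\<R>. (r, b) \<in> Q)"
        if "finite \<R>" "\<R> \<subseteq> \<Q> - {Q0}" for \<R>
        using that
      proof (induction \<R> rule: finite_induct)
        case empty
        then show ?case using rp_rel[OF less(3)[OF Q0]] pol_T by (metis empty_iff order_refl)
      next
        case (insert Q \<R>)
        then obtain r b where b: "r \<ge> 1" "pol c T r b" "(r, b) \<notin> Q0" "\<forall>Q\<in>\<R>. (r, b) \<in> Q" by auto
        have Q: "Q \<in> \<Q>" "Q \<noteq> Q0" using insert by auto
        have "(d Q + r, \<lambda>v. a Q (b v)) \<notin> Q0"
          using rp_prime[OF less(3)[OF Q0] a(2)[OF Q(1)] b(2)] a(3)[OF Q(1) Q0] Q b(3) by blast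
        moreover have "(d Q + r, \<lambda>v. a Q (b v)) \<in> Q"
          using rp_right[OF less(3)[OF Q(1)] _ b(2)] False Q(1) by blast
        moreover have "\<forall>R\<in>\<R>. (d Q + r, \<lambda>v. a Q (b v)) \<in> R"
          using rp_left[OF less(3) _ a(2)[OF Q(1)]] b(4) insert by blast
        ultimately show ?case using pol_comp[OF a(2)[OF Q(1)] b(2)] b(1)
          by (intro exI[of _ "d Q + r"] exI[of _ "\<lambda>v. a Q (b v)"]) auto
      qed
      from this[of "\<Q> - {Q0}"] less(2)
      obtain r b where b: "r \<ge> 1" "pol c T r b" "(r, b) \<notin> Q0" "\<forall>Q\<in>\<Q> - {Q0}. (r, b) \<in> Q" by auto
      \<comment> \<open>The powers have the common degree \<open>r * d Q0\<close>. Each member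
        contains exactly one of \<open>A\<close> and \<open>B\<close>, so none contains the
        sum.\<close>
      define A where "A = a Q0 ^^ r"
      define B where "B = b ^^ d Q0"
      define D where "D = r * d Q0"
      have pA: "pol c T D A" using pol_pow[OF a(2)[OF Q0]] by (simp add: A_def D_def)
      have pB: "pol c T D B" using pol_pow[OF b(2), of "d Q0"] by (simp add: B_def D_def mult.commute)
      have A: "(D, A) \<in> Q \<longleftrightarrow> (d Q0, a Q0) \<in> Q" if "Q \<in> \<Q>" for Q
        using rp_pow[OF less(3)[OF that] a(2)[OF Q0] b(1)] by (simp add: A_def D_def)
      have B: "(D, B) \<in> Q \<longleftrightarrow> (r, b) \<in> Q" if "Q \<in> \<Q>" for Q
        using rp_pow[OF less(3)[OF that] b(2) a(1)[OF Q0]] by (simp add: B_def D_def mult.commute)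
      have sub1: "(D, B) \<in> Q" if "Q \<in> \<Q>" "(D, \<lambda>v. A v + B v) \<in> Q" "(D, A) \<in> Q" for Q
        using rp_add[OF less(3)[OF that(1)] that(2) rp_scl[OF less(3)[OF that(1)] that(3), of "-1"]]
        by (simp add: scl_simps)
      have sub2: "(D, A) \<in> Q" if "Q \<in> \<Q>" "(D, \<lambda>v. A v + B v) \<in> Q" "(D, B) \<in> Q" for Q
        using rp_add[OF less(3)[OF that(1)] that(2) rp_scl[OF less(3)[OF that(1)] that(3), of "-1"]]
        by (simp add: scl_simps)
      have "(D, \<lambda>v. A v + B v) \<notin> Q" if Q: "Q \<in> \<Q>" for Q
      proof (cases "Q = Q0")
        case True
        then show ?thesis using sub1[OF Q] A[OF Q] B[OF Q] b(3) False Q by blast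
      next
        case False
        then show ?thesis using sub2[OF Q] A[OF Q] B[OF Q] b(4) a(3)[OF Q0 Q] Q by blast
      qed
      moreover have "D \<ge> 1" using b(1) a(1)[OF Q0] by (simp add: D_def)
      ultimately show ?thesis using pol_add[OF pA pB] by blast
    qed
  qed
qed

text \<open>Noetherian induction with associated primes. A maximal submodule \<open>G\<close>
  without the property \<open>good\<close> is enlarged by a cyclic submodule whose annihilator is
  prime; adding this prime to those of the larger submodule makes \<open>G\<close> good after
  all.\<close>

lemma filter_regular:
  assumes fg: "fg c Z N T"
  shows "\<exists>q p n0. q \<ge> 1 \<and> pol c T q p \<and> (\<forall>n\<ge>n0. \<forall>v\<in>Z n. p v \<in> N (n + 2 * int q) --> v \<in> N n)"
proof -
  note gm = fg_gm[OF fg]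
  note smN = gm_N[OF gm] and smZ = gm_Z[OF gm]
  define good where "good G \<longleftrightarrow> (\<exists>\<Q>. finite \<Q> \<and> (\<forall>Q\<in>\<Q>. relevant_prime c T Q) \<and>
      (\<forall>q p. pol c T q p --> (\<forall>Q\<in>\<Q>. (q, p) \<notin> Q) -->
        (\<exists>n0. \<forall>n\<ge>n0. \<forall>v\<in>Z n. p v \<in> G (n + 2 * int q) --> v \<in> G n)))" for G
  have "good N"
  proof (rule ccontr)
    assume "\<not> good N"
    then have "\<exists>G. (\<not> good G \<and> gsub c Z N T G) \<and>
        (\<forall>G'. \<not> good G' \<and> gsub c Z N T G' --> (\<forall>n. G n \<subseteq> G' n) --> G' = G)"
      using gsub_N[OF gm] by (intro fg_maximal[OF fg, of _ N]) simp_all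
    then obtain G where G: "\<not> good G" "gsub c Z N T G"
      and max: "\<And>G'. \<not> good G' ==> gsub c Z N T G' ==> (\<And>n. G n \<subseteq> G' n) ==> G' = G"
      by blast
    have smG: "smod (G n)" and NG: "z \<in> N n ==> z \<in> G n" and GZ: "z \<in> G n ==> z \<in> Z n"
      and TG: "j < c ==> z \<in> G n ==> T j z \<in> G (n + 2)" for j n z
      using G(2) unfolding gsub_def by blast+
    have "good Z" unfolding good_def by (intro exI[of _ "{}"]) auto
    then have "G \<noteq> Z" using G by blast
    then obtain n e where e: "e \<in> Z n" "e \<notin> G n" using GZ by blast
    \<comment> \<open>The kernel of \<open>s\<close> modulo \<open>G\<close>. The chain condition is
      at hand for submodules of \<open>Z\<close> rather than for ideals of polynomials, so the
      multiple \<open>s e\<close> is selected by a maximal kernel in place of a maximal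
      annihilator.\<close>
    define K where "K a s m = {v \<in> Z m. s v \<in> G (m + 2 * int a)}" for a :: nat and s m
    have gsK: "gsub c Z N T (K a s)" if s: "pol c T a s" for a s
      unfolding gsub_def
    proof (intro allI conjI impI ballI)
      fix m
      show "smod (K a s m)" unfolding smod_def K_def
        by (auto simp: lin_add[OF pol_lin[OF gm s]] lin_scl[OF pol_lin[OF gm s]] lin_zero[OF pol_lin[OF gm s]]
            smod_0[OF smG] smod_add[OF smG] smod_scl[OF smG] smod_0[OF smZ] smod_add[OF smZ] smod_scl[OF smZ])
      show "N m \<subseteq> K a s m" using pol_N[OF gm s] NG gm_NZ[OF gm] by (auto simp: K_def)
      show "K a s m \<subseteq> Z m" by (auto simp: K_def)
      fix j z assume j: "j < c" "z \<in> K a s m"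
      have "s (T j z) - T j (s z) \<in> G (m + 2 * int a + 2)"
        using pol_comm_op[OF gm s j(1)] j(2) NG by (auto simp: K_def)
      moreover have "T j (s z) \<in> G (m + 2 * int a + 2)" using TG j by (auto simp: K_def)
      ultimately have "s (T j z) \<in> G (m + 2 * int a + 2)" by (rule smod_diff_cancel[OF smG])
      then show "T j z \<in> K a s (m + 2)" using gm_TZ[OF gm j(1)] j(2) by (auto simp: K_def algebra_simps)
    qed
    define F where "F H \<longleftrightarrow> (\<exists>a s. pol c T a s \<and> s e \<notin> G (n + 2 * int a) \<and> H = K a s)" for H
    have "F (K 0 (\<lambda>v. v))" unfolding F_def
      by (intro exI[of _ 0] exI[of _ "\<lambda>v. v"]) (simp add: pol_id e)
    moreover have "\<And>H. F H ==> gsub c Z N T H" using gsK unfolding F_def by blast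
    ultimately have "\<exists>H. F H \<and> (\<forall>H'. F H' --> (\<forall>n. H n \<subseteq> H' n) --> H' = H)" by (rule fg_maximal[OF fg])
    then obtain H where H: "F H" "\<And>H'. F H' ==> (\<And>n. H n \<subseteq> H' n) ==> H' = H" by blast
    then obtain a s where s: "pol c T a s" "s e \<notin> G (n + 2 * int a)" "H = K a s" by (auto simp: F_def)
    define n' where "n' = n + 2 * int a"
    define e' where "e' = s e"
    have e': "e' \<in> Z n'" "e' \<notin> G n'" using pol_Z[OF gm s(1) e(1)] s(2) by (auto simp: e'_def n'_def)
    define Q where "Q = {(q, p). pol c T q p \<and> p e' \<in> G (n' + 2 * int q)}"
    \<comment> \<open>By maximality \<open>r s\<close> has the same kernel modulo \<open>G\<close>
      as \<open>s\<close>. Commuting \<open>p\<close> past \<open>r s\<close> puts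
      \<open>p e\<close> into it, and commuting back gives \<open>p e' \<in> G\<close>.\<close>
    have prime: "(q, p) \<in> Q" if p: "pol c T q p" and r: "pol c T d r" "r e' \<notin> G (n' + 2 * int d)"
      and pr: "p (r e') \<in> G (n' + 2 * int q + 2 * int d)" for q p d r
    proof -
      have "F (K (d + a) (\<lambda>v. r (s v)))" unfolding F_def using pol_comp[OF r(1) s(1)] r(2)
        by (intro exI[of _ "d + a"] exI[of _ "\<lambda>v. r (s v)"]) (simp add: e'_def n'_def algebra_simps)
      moreover have "H m \<subseteq> K (d + a) (\<lambda>v. r (s v)) m" for m
        using pol_gsub[OF gm r(1) G(2), of "s _" "m + 2 * int a"] by (auto simp: s(3) K_def algebra_simps)
      ultimately have eq: "K (d + a) (\<lambda>v. r (s v)) = H" by (rule H(2))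
      have "r (s (p e)) \<in> G (n + 2 * int q + 2 * int a + 2 * int d)"
      proof -
        have 1: "r (s (p e)) - r (p (s e)) \<in> G (n + 2 * int q + 2 * int a + 2 * int d)"
          using NG[OF pol_N[OF gm r(1) pol_comm[OF gm s(1) p e(1)]]]
          by (simp add: lin_diff[OF pol_lin[OF gm r(1)]] algebra_simps)
        have 2: "r (p (s e)) - p (r (s e)) \<in> G (n + 2 * int q + 2 * int a + 2 * int d)"
          using NG[OF pol_comm[OF gm r(1) p e'(1)]] by (simp add: e'_def n'_def algebra_simps)
        show ?thesis using smod_diff_cancel[OF smG smod_diff_trans[OF smG 1 2]] pr
          by (simp add: e'_def n'_def algebra_simps)
      qed
      then have "p e \<in> K (d + a) (\<lambda>v. r (s v)) (n + 2 * int q)"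
        using pol_Z[OF gm p e(1)] by (simp add: K_def algebra_simps)
      then have "s (p e) \<in> G (n + 2 * int q + 2 * int a)" unfolding eq s(3) by (simp add: K_def)
      moreover have "s (p e) - p (s e) \<in> G (n + 2 * int q + 2 * int a)"
        using NG[OF pol_comm[OF gm s(1) p e(1)]] by (simp add: algebra_simps)
      ultimately have "p e' \<in> G (n' + 2 * int q)"
        using smod_diff_cancel'[OF smG] by (simp add: e'_def n'_def algebra_simps)
      then show ?thesis using p by (simp add: Q_def)
    qed
    have Qrp: "relevant_prime c T Q" if rel: "\<exists>j<c. T j e' \<notin> G (n' + 2)"
      unfolding relevant_prime_def
    proof (intro conjI allI impI)
      fix q f g assume "(q, f) \<in> Q" "(q, g) \<in> Q"
      then show "(q, \<lambda>v. f v + g v) \<in> Q" using smod_add[OF smG] by (auto simp: Q_def intro: pol_add)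
    next
      fix q f a assume "(q, f) \<in> Q"
      then show "(q, \<lambda>v. scl a (f v)) \<in> Q" using smod_scl[OF smG] by (auto simp: Q_def intro: pol_scl)
    next
      fix q f r g assume f: "(q, f) \<in> Q" and g: "pol c T r g"
      have 1: "g (f e') \<in> G (n' + 2 * int (r + q))"
        using pol_gsub[OF gm g G(2), of "f e'" "n' + 2 * int q"] f by (simp add: Q_def algebra_simps)
      then show "(r + q, \<lambda>v. g (f v)) \<in> Q" using f g by (simp add: Q_def pol_comp)
      have "f (g e') - g (f e') \<in> G (n' + 2 * int (r + q))"
        using NG[OF pol_comm[OF gm _ g e'(1), of q f]] f by (simp add: Q_def algebra_simps)
      then have "f (g e') \<in> G (n' + 2 * int (r + q))" using 1 by (rule smod_diff_cancel[OF smG])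
      then show "(q + r, \<lambda>v. f (g v)) \<in> Q" using f g by (simp add: Q_def pol_comp algebra_simps)
    next
      fix q f r g assume f: "pol c T q f" and g: "pol c T r g" and fg: "(q + r, \<lambda>v. f (g v)) \<in> Q"
      then have "f (g e') \<in> G (n' + 2 * int q + 2 * int r)" by (simp add: Q_def algebra_simps)
      then show "(q, f) \<in> Q \<or> (r, g) \<in> Q" using prime[OF f g] g by (auto simp: Q_def)
    next
      show "\<exists>j<c. (1, T j) \<notin> Q" using rel by (auto simp: Q_def)
    qed
    \<comment> \<open>The cyclic submodule generated by \<open>e'\<close>; the explicit zero serves
      the degrees that are not of the form \<open>n' + 2 r\<close>.\<close>
    define S where "S m = {w. w = 0 \<or> (\<exists>r f. pol c T r f \<and> m = n' + 2 * int r \<and> w = f e')}" for m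
    have smS: "smod (S m)" for m
      unfolding smod_def
    proof (intro conjI ballI allI)
      show "0 \<in> S m" by (simp add: S_def)
      fix u v assume "u \<in> S m" "v \<in> S m"
      then show "u + v \<in> S m"
        unfolding S_def using pol_add by (auto, blast)
    next
      fix b u assume "u \<in> S m"
      then show "scl b u \<in> S m" by (auto simp: S_def scl_simps dest: pol_scl)
    qed
    have SZ: "w \<in> Z m" if "w \<in> S m" for w m
      using that pol_Z[OF gm _ e'(1)] smod_0[OF smZ] by (auto simp: S_def)
    define G' where "G' m = {v. \<exists>w\<in>S m. v - w \<in> G m}" for m
    have GG': "G m \<subseteq> G' m" for m using smod_0[OF smS] by (force simp: G'_def)
    have gsG': "gsub c Z N T G'"
      unfolding gsub_def
    proof (intro allI conjI impI ballI)
      fix m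
      show "smod (G' m)" unfolding smod_def
      proof (intro conjI ballI allI)
        show "0 \<in> G' m" using GG' smod_0[OF smG] by blast
        fix u v assume "u \<in> G' m" "v \<in> G' m"
        then obtain w w' where "w \<in> S m" "w' \<in> S m" "u - w \<in> G m" "v - w' \<in> G m" by (auto simp: G'_def)
        then show "u + v \<in> G' m" using smod_add[OF smG, of "u - w" m "v - w'"] smod_add[OF smS]
          by (auto simp: G'_def algebra_simps intro!: bexI[of _ "w + w'"])
      next
        fix b u assume "u \<in> G' m"
        then obtain w where "w \<in> S m" "u - w \<in> G m" by (auto simp: G'_def)
        then show "scl b u \<in> G' m" using smod_scl[OF smG, of "u - w" m b] smod_scl[OF smS]
          by (auto simp: G'_def scl_simps intro!: bexI[of _ "scl b w"])
      qed
      show "N m \<subseteq> G' m" using GG' NG by blast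
      show "G' m \<subseteq> Z m"
      proof
        fix z assume "z \<in> G' m"
        then obtain w where "w \<in> S m" "z - w \<in> G m" by (auto simp: G'_def)
        then show "z \<in> Z m" using smod_diff_cancel[OF smZ GZ SZ] by blast
      qed
      fix j z assume j: "j < c" and "z \<in> G' m"
      then obtain w where w: "w \<in> S m" "z - w \<in> G m" by (auto simp: G'_def)
      have "T j w \<in> S (m + 2)"
      proof (cases "w = 0")
        case False
        then obtain r f where f: "pol c T r f" "m = n' + 2 * int r" "w = f e'" using w(1) by (auto simp: S_def)
        show ?thesis unfolding S_def
          using pol_op[OF j f(1)] f(2,3) by (auto intro!: exI[of _ "Suc r"] exI[of _ "\<lambda>v. T j (f v)"])
      qed (simp add: lin_zero[OF gm_lin[OF gm j]] smod_0[OF smS])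
      moreover have "T j z - T j w \<in> G (m + 2)" using TG[OF j w(2)] by (simp add: lin_diff[OF gm_lin[OF gm j]])
      ultimately show "T j z \<in> G' (m + 2)" by (auto simp: G'_def)
    qed
    have "e' \<in> S n'" unfolding S_def using pol_id[of c T] by (auto intro!: exI[of _ 0] exI[of _ "\<lambda>v. v"])
    then have "e' \<in> G' n'" using smod_0[OF smG] by (auto simp: G'_def intro!: bexI[of _ e'])
    then have "G' \<noteq> G" using e'(2) by blast
    then have "good G'" using max[OF _ gsG' GG'] by blast
    then obtain \<Q> where \<Q>: "finite \<Q>" "\<forall>Q\<in>\<Q>. relevant_prime c T Q"
      "\<And>q p. pol c T q p ==> \<forall>Q\<in>\<Q>. (q, p) \<notin> Q ==>
        \<exists>n0. \<forall>n\<ge>n0. \<forall>v\<in>Z n. p v \<in> G' (n + 2 * int q) --> v \<in> G' n"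
      unfolding good_def by blast
    \<comment> \<open>If every \<open>T j\<close> sends \<open>e'\<close> into \<open>G\<close>,
      then \<open>S\<close> lies in \<open>G\<close> above degree \<open>n'\<close>, and no prime
      has to be added.\<close>
    define \<Q>' where "\<Q>' = \<Q> \<union> (if \<exists>j<c. T j e' \<notin> G (n' + 2) then {Q} else {})"
    have "\<exists>n0. \<forall>n\<ge>n0. \<forall>v\<in>Z n. p v \<in> G (n + 2 * int q) --> v \<in> G n"
      if p: "pol c T q p" "\<forall>Q\<in>\<Q>'. (q, p) \<notin> Q" for q p
    proof -
      obtain n0 where n0: "\<And>n v. n \<ge> n0 ==> v \<in> Z n ==> p v \<in> G' (n + 2 * int q) ==> v \<in> G' n"
        using \<Q>(3)[OF p(1)] p(2) by (auto simp: \<Q>'_def)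
      have "v \<in> G m" if m: "m \<ge> max n0 (n' + 1)" and v: "v \<in> Z m" and pv: "p v \<in> G (m + 2 * int q)" for m v
      proof -
        have "v \<in> G' m" using n0 m v pv GG' by auto
        then obtain w where w: "w \<in> S m" "v - w \<in> G m" by (auto simp: G'_def)
        have "w \<in> G m"
        proof (cases "w = 0")
          case False
          then obtain r f where f: "pol c T r f" "m = n' + 2 * int r" "w = f e'" using w(1) by (auto simp: S_def)
          show ?thesis
          proof (cases "\<exists>j<c. T j e' \<notin> G (n' + 2)")
            case True
            then have "(q, p) \<notin> Q" using p(2) by (simp add: \<Q>'_def)
            moreover have "p v - p w \<in> G (m + 2 * int q)"
              using pol_gsub[OF gm p(1) G(2) w(2)] by (simp add: lin_diff[OF pol_lin[OF gm p(1)]])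
            then have "p w \<in> G (m + 2 * int q)" using smod_diff_cancel'[OF smG] pv by blast
            ultimately show ?thesis using prime[OF p(1) f(1)] f(2,3) by (auto simp: algebra_simps)
          next
            case irr: False
            have "r > 0 --> f e' \<in> G (n' + 2 * int r)"
              using f(1)
            proof (induction rule: pol.induct)
              case (pol_op j r f)
              have "f (T j e') \<in> G (n' + 2 + 2 * int r)" using pol_gsub[OF gm pol_op(2) G(2)] irr pol_op(1) by blast
              moreover have "f (T j e') - T j (f e') \<in> G (n' + 2 + 2 * int r)"
                using NG[OF pol_comm_op[OF gm pol_op(2,1) e'(1)]] by (simp add: algebra_simps)
              ultimately have "T j (f e') \<in> G (n' + 2 + 2 * int r)" using smod_diff_cancel'[OF smG] by blast
              then show ?case by (simp add: algebra_simps)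
            qed (auto simp: smod_0[OF smG] smod_add[OF smG] smod_scl[OF smG])
            then show ?thesis using f(2,3) m by auto
          qed
        qed (simp add: smod_0[OF smG])
        then show ?thesis using smod_diff_cancel[OF smG w(2)] by blast
      qed
      then show ?thesis by blast
    qed
    moreover have "finite \<Q>'" "\<forall>Q\<in>\<Q>'. relevant_prime c T Q" using \<Q>(1,2) Qrp by (auto simp: \<Q>'_def)
    ultimately have "good G" unfolding good_def by blast
    then show False using G by blast
  qed
  then obtain \<Q> where \<Q>: "finite \<Q>" "\<forall>Q\<in>\<Q>. relevant_prime c T Q"
      "\<And>q p. pol c T q p ==> \<forall>Q\<in>\<Q>. (q, p) \<notin> Q ==>
        \<exists>n0. \<forall>n\<ge>n0. \<forall>v\<in>Z n. p v \<in> N (n + 2 * int q) --> v \<in> N n"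
    unfolding good_def by blast
  obtain q p where qp: "q \<ge> 1" "pol c T q p" "\<forall>Q\<in>\<Q>. (q, p) \<notin> Q"
    using prime_avoidance[OF \<Q>(1)] \<Q>(2) by blast
  from \<Q>(3)[OF qp(2,3)] qp(1,2) show ?thesis by blast
qed

lemma fg_quot:
  assumes fg: "fg c Z N T" and p: "pol c T q p"
  shows "fg c Z (\<lambda>n. {z. \<exists>y\<in>Z (n - 2 * int q). z - p y \<in> N n}) T"
proof -
  note q = gm_quot[OF fg_gm[OF fg] p]
  show ?thesis using q fg unfolding fg_def gens_def by (meson subsetD subset_trans)
qed

end

section \<open>Polynomial growth\<close>

text \<open>The integer form of the bounds that define the complexities: for \<open>t = 0\<close>
  the bound \<open>a / n\<close> on natural numbers means that they vanish eventually.\<close>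

definition growth_le :: "nat => (int => nat) => bool" where
  "growth_le t e \<longleftrightarrow> (\<exists>(a::int) n0. \<forall>n\<ge>n0. int (e n) \<le> (if t = 0 then 0 else a * n ^ (t - 1)))"

lemma growth_le_0: "growth_le 0 e \<longleftrightarrow> (\<exists>n0. \<forall>n\<ge>n0. e n = 0)"
  by (simp add: growth_le_def)

lemma growth_le_Suc: "growth_le (Suc t) e \<longleftrightarrow> (\<exists>(a::int) n0. a \<ge> 0 \<and> n0 \<ge> 1 \<and> (\<forall>n\<ge>n0. int (e n) \<le> a * n ^ t))"
proof
  assume "growth_le (Suc t) e"
  then obtain a n0 where a: "\<And>n. n \<ge> n0 ==> int (e n) \<le> a * n ^ t" by (auto simp: growth_le_def)
  have "int (e n) \<le> \<bar>a\<bar> * n ^ t" if "n \<ge> max n0 1" for n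
  proof -
    have "a * n ^ t \<le> \<bar>a\<bar> * n ^ t" using that by (intro mult_right_mono) auto
    then show ?thesis using a[of n] that by linarith
  qed
  then show "\<exists>(a::int) n0. a \<ge> 0 \<and> n0 \<ge> 1 \<and> (\<forall>n\<ge>n0. int (e n) \<le> a * n ^ t)"
    by (intro exI[of _ "\<bar>a\<bar>"] exI[of _ "max n0 1"]) auto
qed (auto simp: growth_le_def)

lemma growth_le_shift:
  assumes "growth_le t e"
  shows "growth_le t (\<lambda>n. e (n + s))"
proof (cases t)
  case 0
  then obtain n0 where "\<And>n. n \<ge> n0 ==> e n = 0" using assms by (auto simp: growth_le_0)
  then show ?thesis unfolding 0 growth_le_0 by (intro exI[of _ "n0 - s"]) auto
next
  case (Suc u)
  then obtain a n0 where a: "a \<ge> 0" "n0 \<ge> 1" "\<And>n. n \<ge> n0 ==> int (e n) \<le> a * n ^ u"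
    using assms by (auto simp: growth_le_Suc)
  have "int (e (n + s)) \<le> (a * 2 ^ u) * n ^ u" if "n \<ge> max 1 (max (n0 - s) \<bar>s\<bar>)" for n
  proof -
    have "int (e (n + s)) \<le> a * (n + s) ^ u" using a(3)[of "n + s"] that by simp
    also have "\<dots> \<le> a * (2 * n) ^ u" using that a by (intro mult_left_mono power_mono) auto
    finally show ?thesis by (simp add: power_mult_distrib)
  qed
  then show ?thesis using a(1) unfolding Suc growth_le_Suc
    by (intro exI[of _ "a * 2 ^ u"] exI[of _ "max 1 (max (n0 - s) \<bar>s\<bar>)"]) auto
qed

lemma growth_le_mono:
  assumes "growth_le t e" "\<And>n. n \<ge> n1 ==> f n \<le> e n"
  shows "growth_le t f"
proof -
  obtain a n0 where a: "\<And>n. n \<ge> n0 ==> int (e n) \<le> (if t = 0 then 0 else a * n ^ (t - 1))"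
    using assms(1) by (auto simp: growth_le_def)
  have "int (f n) \<le> (if t = 0 then 0 else a * n ^ (t - 1))" if "n \<ge> max n0 n1" for n
    using a[of n] assms(2)[of n] that by linarith
  then show ?thesis unfolding growth_le_def by blast
qed

text \<open>Adding up \<open>s\<close> differences, with \<open>e'\<close> nondecreasing along the
  steps, gives \<open>s * e' m \<le> e (m + L * s)\<close>; the choice \<open>s = m\<close> then
  costs \<open>e'\<close> one power of \<open>m\<close>.\<close>

lemma growth_le_quotient:
  assumes "growth_le (Suc t) e" "L \<ge> 1"
    and step: "\<And>n. n \<ge> n4 ==> e n + e' (n + L) \<le> e (n + L)" "\<And>n. n \<ge> n4 ==> e' n \<le> e' (n + L)"
  shows "growth_le t e'"
proof -
  obtain a n0 where a: "a \<ge> 0" "n0 \<ge> 1" "\<And>n. n \<ge> n0 ==> int (e n) \<le> a * n ^ t"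
    using assms(1) by (auto simp: growth_le_Suc)
  have low: "s * e' m \<le> e (m + L * int s) \<and> e' m \<le> e' (m + L * int s)" if "m \<ge> n4" for m s
  proof (induction s)
    case (Suc s)
    have ge: "m + L * int s \<ge> n4" using that assms(2) by (simp add: add_increasing2)
    have eq: "m + L * int (Suc s) = m + L * int s + L" by (simp add: algebra_simps)
    show ?case using Suc step[OF ge] unfolding eq by simp
  qed simp
  define b where "b = a * (1 + L) ^ t"
  have up: "m * int (e' m) \<le> b * m ^ t" if "m \<ge> max n4 n0" for m
  proof -
    have m: "m \<ge> 1" using that a by simp
    have "m * int (e' m) = int (nat m * e' m)" using m by simp
    also have "\<dots> \<le> int (e (m + L * m))"
      using conjunct1[OF low[of m "nat m"]] that m by (simp add: of_nat_le_iff del: of_nat_mult)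
    also have "\<dots> \<le> a * (m + L * m) ^ t"
    proof (rule a(3))
      have "m \<le> m + L * m" using m assms(2) by simp
      then show "n0 \<le> m + L * m" using that by linarith
    qed
    also have "m + L * m = (1 + L) * m" by (simp add: algebra_simps)
    finally show ?thesis by (simp add: power_mult_distrib b_def mult.assoc)
  qed
  have b: "b \<ge> 0" using a assms(2) by (simp add: b_def)
  show ?thesis
  proof (cases t)
    case 0
    have "e' m = 0" if "m \<ge> max (max n4 n0) (b + 1)" for m
    proof (rule ccontr)
      assume "e' m \<noteq> 0"
      then have "m * 1 \<le> m * int (e' m)" using that a by (intro mult_left_mono) auto
      then show False using up[of m] that 0 by simp
    qed
    then show ?thesis unfolding 0 growth_le_0 by blast
  next
    case (Suc u)
    have "int (e' m) \<le> b * m ^ u" if "m \<ge> max 1 (max n4 n0)" for m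
    proof -
      have "m * int (e' m) \<le> m * (b * m ^ u)" using up[of m] that Suc by (simp add: algebra_simps)
      then show ?thesis using that by (simp add: mult_le_cancel_left)
    qed
    then show ?thesis unfolding Suc growth_le_Suc using b by (intro exI[of _ b] exI[of _ "max 1 (max n4 n0)"]) auto
  qed
qed

text \<open>Descending in steps of \<open>L \<ge> 1\<close> from \<open>n\<close> to a starting
  window collects at most \<open>n\<close> values of \<open>k\<close>, each bounded by
  \<open>w n\<close>.\<close>

lemma growth_le_sum:
  assumes "growth_le t k" "L \<ge> 1" and step: "\<And>n. e n \<le> e (n - L) + k n"
  shows "growth_le (Suc t) e"
proof -
  obtain a n0 where a: "a \<ge> 0" "n0 \<ge> 1" "\<And>n. n \<ge> n0 ==> int (k n) \<le> (if t = 0 then 0 else a * n ^ (t - 1))"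
  proof (cases t)
    case 0
    then obtain n0 where "\<And>n. n \<ge> n0 ==> k n = 0" using assms(1) by (auto simp: growth_le_0)
    then show ?thesis using that[of 0 "max 1 n0"] 0 by auto
  next
    case (Suc u)
    then show ?thesis using assms(1) that by (auto simp: growth_le_Suc)
  qed
  define w where "w n = (if t = 0 then 0 else a * n ^ (t - 1))" for n :: int
  have w: "int (k n) \<le> w n" if "n \<ge> n0" for n using a(3)[OF that] by (simp add: w_def)
  have wmono: "w m \<le> w n" if "1 \<le> m" "m \<le> n" for m n
    using that a(1) by (auto simp: w_def intro!: mult_left_mono power_mono)
  have w0: "w n \<ge> 0" if "1 \<le> n" for n using that a(1) by (auto simp: w_def)
  \<comment> \<open>A whole window of length \<open>L\<close> is needed as the start, since the
    descent preserves residues modulo \<open>L\<close>.\<close>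
  define B where "B = Max ((\<lambda>n. int (e n)) ` {n0..n0 + L})"
  have B: "int (e n) \<le> B" if "n0 \<le> n" "n \<le> n0 + L" for n
    unfolding B_def using that by (intro Max_ge) auto
  have B0: "B \<ge> 0" using B[of n0] assms(2) by simp
  have main: "n \<ge> n0 ==> int (e n) \<le> B + n * w n" for n
  proof (induction "nat n" arbitrary: n rule: less_induct)
    case less
    show ?case
    proof (cases "n \<le> n0 + L")
      case True
      have "0 \<le> n * w n" using less(2) a(2) w0[of n] by simp
      then show ?thesis using B[of n] less(2) True by simp
    next
      case False
      have n: "n - L \<ge> n0" "nat (n - L) < nat n" "n \<ge> 1" using False assms(2) a(2) by auto
      have "int (e n) \<le> int (e (n - L)) + int (k n)" using step[of n] by linarith
      also have "\<dots> \<le> B + (n - L) * w (n - L) + w n" using less(1)[OF n(2,1)] w[of n] less(2) by simp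
      also have "\<dots> \<le> B + (n - L) * w n + w n"
        using n a(2) wmono[of "n - L" n] assms(2) by (intro add_mono mult_left_mono) auto
      also have "\<dots> = B + n * w n + (1 - L) * w n" by (simp add: algebra_simps)
      also have "\<dots> \<le> B + n * w n" using w0[OF n(3)] assms(2) by (simp add: mult_nonpos_nonneg)
      finally show ?thesis by simp
    qed
  qed
  have "int (e n) \<le> (B + a) * n ^ t" if "n \<ge> n0" for n
  proof -
    have "n * w n \<le> a * n ^ t" using a(1) that a(2)
      by (cases t) (auto simp: w_def algebra_simps)
    moreover have "B * 1 \<le> B * n ^ t" using B0 that a(2) by (intro mult_left_mono one_le_power) auto
    ultimately show ?thesis using main[OF that] by (simp add: distrib_right)
  qed
  then show ?thesis unfolding growth_le_Suc using a B0 by (intro exI[of _ "B + a"] exI[of _ n0]) auto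
qed

context max_idl
begin

text \<open>Injectivity of \<open>p\<close> gives the difference inequality of
  \<open>growth_le_quotient\<close>. Monotonicity of the dimensions of the quotient comes from a
  second element \<open>p'\<close>, injective on the quotient in high degrees.\<close>

lemma growth_le_regular_quotient:
  assumes fg: "fg c Z N T" and p: "pol c T q p" "q \<ge> 1"
    and reg: "\<And>n v. n \<ge> n0 ==> v \<in> Z n ==> p v \<in> N (n + 2 * int q) ==> v \<in> N n"
    and gr: "growth_le (Suc t) (\<lambda>n. rdim (N n) (Z n))"
  defines "N' \<equiv> \<lambda>n. {z. \<exists>y\<in>Z (n - 2 * int q). z - p y \<in> N n}"
  shows "growth_le t (\<lambda>n. rdim (N' n) (Z n))"
proof -
  note gm = fg_gm[OF fg]
  have fg': "fg c Z N' T" and NN': "N n \<subseteq> N' n" for n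
    using fg_quot[OF fg p(1)] gm_quot(2)[OF gm p(1)] by (simp_all add: N'_def)
  note gm' = fg_gm[OF fg']
  obtain q' p' n3 where p': "q' \<ge> 1" "pol c T q' p'"
    "\<And>n v. n \<ge> n3 ==> v \<in> Z n ==> p' v \<in> N' (n + 2 * int q') ==> v \<in> N' n"
    using filter_regular[OF fg'] by blast
  let ?e = "\<lambda>n. rdim (N n) (Z n)" and ?e' = "\<lambda>n. rdim (N' n) (Z n)"
  have fdNN': "fdim (N n) (N' n)" for n
    using fdim_sub[OF gm_fd[OF gm] gm_N[OF gm] gm_N[OF gm'] gm_NZ'[OF gm'] gm_M[OF gm]] .
  have MN': "a \<in> M ==> z \<in> N' n ==> scl a z \<in> N n" for a z n using gm_M[OF gm] gm_NZ[OF gm'] by blast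
  have 1: "?e n + ?e' (n + 2 * int q) \<le> ?e (n + 2 * int q)" if "n \<ge> n0" for n
  proof -
    have "?e n \<le> rdim (N (n + 2 * int q)) (N' (n + 2 * int q))"
    proof (rule rdim_inj[where \<phi> = p])
      show "p w \<in> N' (n + 2 * int q)" if "w \<in> Z n" for w
        unfolding N'_def using that smod_0[OF gm_N[OF gm]] by (auto intro!: bexI[of _ w])
    qed (use gm_fd[OF gm] gm_N[OF gm] gm_Z[OF gm] gm_M[OF gm] fdNN' MN' pol_lin[OF gm p(1)] reg that in auto)
    moreover have "rdim (N m) (N' m) + rdim (N' m) (Z m) \<le> rdim (N m) (Z m)" for m
      by (rule rdim_superadd[OF gm_fd[OF gm] fdNN' gm_N[OF gm] gm_N[OF gm'] gm_Z[OF gm] NN' gm_NZ'[OF gm']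
            gm_M[OF gm]])
    ultimately show ?thesis by (meson add_le_mono1 order_trans)
  qed
  have 2: "?e' n \<le> ?e' (n + 2 * int q')" if "n \<ge> n3" for n
  proof (rule rdim_inj[where \<phi> = p'])
    show "p' w \<in> Z (n + 2 * int q')" if "w \<in> Z n" for w using pol_Z[OF gm p'(2) that] .
  qed (use gm_fd[OF gm'] gm_N[OF gm'] gm_Z[OF gm'] gm_M[OF gm'] pol_lin[OF gm p'(2)] p'(3) that in auto)
  have 3: "?e n \<le> ?e (n + 2 * int q * int k)" if "n \<ge> n0" for n k
  proof (induction k)
    case (Suc k)
    have ge: "n0 \<le> n + 2 * int q * int k" using that by (simp add: add_increasing2)
    have eq: "n + 2 * int q * int (Suc k) = n + 2 * int q * int k + 2 * int q" by (simp add: algebra_simps)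
    show ?case using Suc 1[OF ge] unfolding eq by linarith
  qed simp
  have 4: "?e' n \<le> ?e' (n + 2 * int q' * int k)" if "n \<ge> n3" for n k
  proof (induction k)
    case (Suc k)
    have ge: "n3 \<le> n + 2 * int q' * int k" using that by (simp add: add_increasing2)
    have eq: "n + 2 * int q' * int (Suc k) = n + 2 * int q' * int k + 2 * int q'" by (simp add: algebra_simps)
    show ?case using Suc 2[OF ge] unfolding eq by linarith
  qed simp
  \<comment> \<open>The first inequality runs in steps of \<open>2 q\<close>, the second in steps of
    \<open>2 q'\<close>; the step \<open>2 q q'\<close> is a common multiple.\<close>
  show ?thesis
  proof (rule growth_le_quotient[where L = "2 * int q * int q'" and ?n4.0 = "max n0 n3", OF gr])
    show "1 \<le> 2 * int q * int q'" using p(2) p'(1)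
      by (simp add: order_less_imp_le int_one_le_iff_zero_less)
    fix n assume n: "max n0 n3 \<le> n"
    have eq: "n + 2 * int q * int (q' - 1) + 2 * int q = n + 2 * int q * int q'"
      using p'(1) by (simp add: algebra_simps of_nat_diff)
    have "?e n \<le> ?e (n + 2 * int q * int (q' - 1))" using 3 n by simp
    moreover have "n + 2 * int q * int (q' - 1) \<ge> n0" using n by (simp add: add_increasing2)
    note 1[OF this, unfolded eq]
    ultimately show "?e n + ?e' (n + 2 * int q * int q') \<le> ?e (n + 2 * int q * int q')" by linarith
    show "?e' n \<le> ?e' (n + 2 * int q * int q')" using 4[of n q] n by (simp add: algebra_simps)
  qed
qed

end

section \<open>Complexes of free modules over a quotient by a regular sequence\<close>

text \<open>The two tagged copies of an index are used for direct sums of two complexes.\<close>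

datatype idx = Base nat | InL idx | InR idx

text \<open>All degrees live in one type of vectors, so that a differential or an operator is a
  single linear map and not a family; \<open>VV I n\<close> is the part of degree
  \<open>n\<close>.\<close>

definition VV :: "(int => idx set) => int => (int \<times> idx, 'r::comm_ring_1) vec set" where
  "VV I n = {v. \<forall>m i. \<not> (m = n \<and> i \<in> I n) --> ix v (m, i) = 0}"

definition ev :: "int => idx => (int \<times> idx, 'r::comm_ring_1) vec" where
  "ev n i = Vec (\<lambda>p. if p = (n, i) then 1 else 0)"

lemma ix_ev: "ix (ev n i) p = (if p = (n, i) then 1 else 0)"
  by (simp add: ev_def)

lemma smod_VV: "smod (VV I n)"
  unfolding smod_def VV_def by auto

lemma ev_VV: "i \<in> I n ==> ev n i \<in> VV I n"
  by (auto simp: VV_def ix_ev)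

lemma VV_expand:
  assumes "finite (I n)" "v \<in> VV I n"
  shows "v = (\<Sum>i\<in>I n. scl (ix v (n, i)) (ev n i))"
proof (rule vec_eqI)
  fix p :: "int \<times> idx"
  obtain m k where p: "p = (m, k)" by fastforce
  have "ix (\<Sum>i\<in>I n. scl (ix v (n, i)) (ev n i)) p = (\<Sum>i\<in>I n. if i = k \<and> m = n then ix v (n, i) else 0)"
    unfolding ix_sum by (rule sum.cong) (auto simp: ix_ev p)
  also have "\<dots> = (if m = n \<and> k \<in> I n then ix v p else 0)"
    using assms(1) by (auto simp: p intro: sum.neutral)
  also have "\<dots> = ix v p" using assms(2) by (auto simp: VV_def p)
  finally show "ix v p = ix (\<Sum>i\<in>I n. scl (ix v (n, i)) (ev n i)) p" ..
qed

lemma lin_on_basis: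
  assumes "lin G" "smod W" "finite (I n)" "\<And>i. i \<in> I n ==> G (ev n i) \<in> W" "v \<in> VV I n"
  shows "G v \<in> W"
proof -
  have "G v = (\<Sum>i\<in>I n. scl (ix v (n, i)) (G (ev n i)))"
    by (subst VV_expand[OF assms(3,5)]) (simp add: lin_simps[OF assms(1)])
  then show ?thesis using assms by (auto intro!: smod_sum[OF assms(2)] smod_scl[OF assms(2)])
qed

text \<open>The expansion of \<open>v\<close> in basis vectors has coefficients in \<open>L\<close>.
  An infinitely supported vector of \<open>pt L\<close> has no such expansion, hence the hypothesis
  on \<open>v\<close>.\<close>

lemma lin_pt:
  fixes G :: "(int \<times> idx, 'r::comm_ring_1) vec => ('q, 'r) vec"
  assumes "lin G" "idl L" "finite (I n)" "v \<in> VV I n" "v \<in> pt L"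
  shows "G v \<in> pt L"
proof -
  have "G v = (\<Sum>i\<in>I n. scl (ix v (n, i)) (G (ev n i)))"
    by (subst VV_expand[OF assms(3,4)]) (simp add: lin_simps[OF assms(1)])
  moreover have "scl (ix v (n, i)) u \<in> pt L" for i and u :: "('q, 'r) vec"
    using assms(5) by (intro scl_pt[OF assms(2)]) (auto simp: pt_def)
  ultimately show ?thesis by (auto intro!: smod_sum[OF smod_pt[OF assms(2)]])
qed

lemma lin_extend:
  fixes f :: "int => idx => (int \<times> idx, 'r::comm_ring_1) vec"
  assumes "\<And>n. finite (I n)" "\<And>n i. i \<in> I n ==> f n i \<in> VV I' (n + s)"
  shows "\<exists>F. lin F \<and> (\<forall>n. \<forall>v\<in>VV I n. F v \<in> VV I' (n + s)) \<and> (\<forall>n. \<forall>i\<in>I n. F (ev n i) = f n i)"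
proof -
  define F where "F v = Vec (\<lambda>(m, k). \<Sum>i\<in>I (m - s). ix v (m - s, i) * ix (f (m - s) i) (m, k))" for v
  have ixF: "ix (F v) (m, k) = (\<Sum>i\<in>I (m - s). ix v (m - s, i) * ix (f (m - s) i) (m, k))" for v m k
    by (simp add: F_def)
  have lin: "lin F"
    by (rule linI; rule vec_eqI) (auto simp: ixF sum.distrib sum_distrib_left algebra_simps)
  have ev: "F (ev n i) = f n i" if i: "i \<in> I n" for n i
  proof (rule vec_eqI)
    fix p :: "int \<times> idx"
    obtain m k where p: "p = (m, k)" by fastforce
    show "ix (F (ev n i)) p = ix (f n i) p"
    proof (cases "m = n + s")
      case True
      have "ix (F (ev n i)) p = (\<Sum>i'\<in>I n. if i' = i then ix (f n i) (m, k) else 0)"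
        unfolding p ixF using True by (intro sum.cong) (auto simp: ix_ev)
      then show ?thesis using assms(1) i by (simp add: p)
    next
      case False
      then have "ix (f n i) p = 0" using assms(2)[OF i] by (auto simp: VV_def p)
      moreover have "ix (F (ev n i)) p = 0"
        unfolding p ixF using False by (intro sum.neutral) (auto simp: ix_ev)
      ultimately show ?thesis by simp
    qed
  qed
  have "F v \<in> VV I' (n + s)" if "v \<in> VV I n" for n v
    using lin_on_basis[OF lin smod_VV assms(1) _ that] ev assms(2) by simp
  with lin ev show ?thesis by blast
qed

lemma lin_choice:
  fixes Q :: "int => idx => (int \<times> idx, 'r::comm_ring_1) vec => bool"
  assumes "\<And>n. finite (I n)" "\<And>n i. i \<in> I n ==> \<exists>w\<in>VV I' (n + s). Q n i w"
  shows "\<exists>F. lin F \<and> (\<forall>n. \<forall>v\<in>VV I n. F v \<in> VV I' (n + s)) \<and> (\<forall>n. \<forall>i\<in>I n. Q n i (F (ev n i)))"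
proof -
  have "\<forall>n i. \<exists>w. i \<in> I n --> w \<in> VV I' (n + s) \<and> Q n i w" using assms(2) by blast
  then obtain f where f: "\<And>n i. i \<in> I n ==> f n i \<in> VV I' (n + s) \<and> Q n i (f n i)" by metis
  then show ?thesis using lin_extend[where I = I and f = f and I' = I' and s = s, OF assms(1)] by metis
qed

text \<open>The ideal \<open>K + (x 0, ..., x (i - 1))\<close>. With \<open>K\<close> the kernel of
  the cover of \<open>B\<close>, it is the preimage of the ideal generated by the first
  \<open>i\<close> elements of the sequence.\<close>

definition Jx :: "'r set => (nat => 'r::comm_ring_1) => nat => 'r set" where
  "Jx K x i = {a. \<exists>b. a - (\<Sum>j<i. x j * b j) \<in> K}"

lemma JxI: "a - (\<Sum>j<i. x j * b j) \<in> K ==> a \<in> Jx K x i"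
  by (auto simp: Jx_def)

lemma Jx_0: "Jx K x 0 = K"
  by (simp add: Jx_def)

lemma idl_Jx:
  assumes "idl K"
  shows "idl (Jx K x i)"
  unfolding idl_def
proof (intro conjI ballI allI)
  show "0 \<in> Jx K x i" using idl_0[OF assms] by (auto simp: Jx_def intro: exI[of _ "\<lambda>_. 0"])
  fix u v assume "u \<in> Jx K x i" "v \<in> Jx K x i"
  then obtain b b' where "u - (\<Sum>j<i. x j * b j) \<in> K" "v - (\<Sum>j<i. x j * b' j) \<in> K" by (auto simp: Jx_def)
  from idl_add[OF assms this] show "u + v \<in> Jx K x i" unfolding Jx_def
    by (auto simp: sum.distrib algebra_simps intro!: exI[of _ "\<lambda>j. b j + b' j"])
next
  fix a u assume "u \<in> Jx K x i"
  then obtain b where "u - (\<Sum>j<i. x j * b j) \<in> K" by (auto simp: Jx_def)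
  from idl_mult[OF assms this, of a] show "a * u \<in> Jx K x i" unfolding Jx_def
    by (auto simp: sum_distrib_left algebra_simps intro!: exI[of _ "\<lambda>j. a * b j"])
qed

lemma K_Jx: "K \<subseteq> Jx K x i"
  by (auto simp: Jx_def intro: exI[of _ "\<lambda>_. 0"])

lemma Jx_Suc: "a \<in> Jx K x (Suc i) \<longleftrightarrow> (\<exists>b. a - x i * b \<in> Jx K x i)"
proof
  assume "a \<in> Jx K x (Suc i)"
  then obtain b where "a - (\<Sum>j<Suc i. x j * b j) \<in> K" by (auto simp: Jx_def)
  then have "a - x i * b i \<in> Jx K x i" by (auto simp: Jx_def algebra_simps)
  then show "\<exists>b. a - x i * b \<in> Jx K x i" ..
next
  assume "\<exists>b. a - x i * b \<in> Jx K x i"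
  then obtain b b' where "a - x i * b - (\<Sum>j<i. x j * b' j) \<in> K" by (auto simp: Jx_def)
  then show "a \<in> Jx K x (Suc i)"
    unfolding Jx_def by (auto simp: algebra_simps intro!: exI[of _ "b'(i := b)"])
qed

lemma Jx_mono:
  assumes "idl K" "i \<le> i'"
  shows "Jx K x i \<subseteq> Jx K x i'"
  using assms(2)
proof (induction i' rule: dec_induct)
  case (step k)
  have "a \<in> Jx K x (Suc k)" if "a \<in> Jx K x k" for a
    using that Jx_Suc by (metis diff_zero mult_zero_right)
  then show ?case using step by blast
qed simp

lemma x_Jx: "idl K ==> j < i ==> x j * a \<in> Jx K x i"
proof -
  assume "idl K" "j < i"
  then have "x j * a \<in> Jx K x (Suc j)" unfolding Jx_Suc using idl_0[OF idl_Jx] by (metis diff_self)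
  then show ?thesis using Jx_mono[OF \<open>idl K\<close>, of "Suc j" i] \<open>j < i\<close> by auto
qed

lemma pt_Jx_decompose:
  assumes "v \<in> VV I n" "v \<in> pt (Jx K x i)" "idl K"
  shows "\<exists>w. (\<forall>j. w j \<in> VV I n) \<and> v - (\<Sum>j<i. scl (x j) (w j)) \<in> pt K"
proof -
  \<comment> \<open>Zero entries receive zero coefficients, which keeps the vectors
    \<open>w j\<close> in \<open>VV I n\<close>.\<close>
  have "\<forall>p. \<exists>b. (ix v p = 0 --> (\<forall>j. b j = 0)) \<and> ix v p - (\<Sum>j<i. x j * b j) \<in> K"
  proof
    fix p show "\<exists>b. (ix v p = 0 --> (\<forall>j. b j = 0)) \<and> ix v p - (\<Sum>j<i. x j * b j) \<in> K"
    proof (cases "ix v p = 0")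
      case True
      then show ?thesis using idl_0[OF assms(3)] by (intro exI[of _ "\<lambda>_. 0"]) simp
    next
      case False
      have "ix v p \<in> Jx K x i" using assms(2) unfolding pt_def by blast
      then show ?thesis using False unfolding Jx_def by blast
    qed
  qed
  then obtain b where b: "\<And>p j. ix v p = 0 ==> b p j = 0" "\<And>p. ix v p - (\<Sum>j<i. x j * b p j) \<in> K" by metis
  have "Vec (\<lambda>p. b p j) \<in> VV I n" for j using assms(1) b(1) unfolding VV_def by fastforce
  moreover have "v - (\<Sum>j<i. scl (x j) (Vec (\<lambda>p. b p j))) \<in> pt K" using b(2) by (simp add: pt_def ix_sum)
  ultimately show ?thesis by (intro exI[of _ "\<lambda>j. Vec (\<lambda>p. b p j)"]) auto
qed

lemma lin_decompose:
  fixes G :: "(int \<times> idx, 'r::comm_ring_1) vec => (int \<times> idx, 'r) vec"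
  assumes "lin G" "idl K" "\<And>n. finite (I n)" "\<And>n v. v \<in> VV I n ==> G v \<in> VV I' (n + s)"
    and "\<And>n v. v \<in> VV I n ==> G v \<in> pt (Jx K x i)"
  shows "\<exists>W. \<forall>j. lin (W j) \<and> (\<forall>n. \<forall>v\<in>VV I n. W j v \<in> VV I' (n + s)) \<and>
    (\<forall>n. \<forall>v\<in>VV I n. G v - (\<Sum>j<i. scl (x j) (W j v)) \<in> pt K)"
proof -
  have "\<forall>n k. \<exists>w. k \<in> I n --> (\<forall>j. w j \<in> VV I' (n + s)) \<and> G (ev n k) - (\<Sum>j<i. scl (x j) (w j)) \<in> pt K"
    using pt_Jx_decompose[OF assms(4)[OF ev_VV] assms(5)[OF ev_VV] assms(2)] by blast
  then obtain w where w: "\<And>n k j. k \<in> I n ==> w n k j \<in> VV I' (n + s)"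
    "\<And>n k. k \<in> I n ==> G (ev n k) - (\<Sum>j<i. scl (x j) (w n k j)) \<in> pt K" by metis
  have "\<forall>j. \<exists>F. lin F \<and> (\<forall>n. \<forall>v\<in>VV I n. F v \<in> VV I' (n + s)) \<and> (\<forall>n. \<forall>k\<in>I n. F (ev n k) = w n k j)"
    by (intro allI lin_extend assms(3) w(1))
  from choice[OF this] obtain W where W: "\<forall>j. lin (W j) \<and> (\<forall>n. \<forall>v\<in>VV I n. W j v \<in> VV I' (n + s)) \<and>
    (\<forall>n. \<forall>k\<in>I n. W j (ev n k) = w n k j)" ..
  then have Wev: "k \<in> I n ==> W j (ev n k) = w n k j" for n k j by blast
  have "G v - (\<Sum>j<i. scl (x j) (W j v)) \<in> pt K" if "v \<in> VV I n" for n v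
  proof (rule lin_on_basis[of "\<lambda>v. G v - (\<Sum>j<i. scl (x j) (W j v))", OF _ smod_pt[OF assms(2)] assms(3) _ that])
    show "lin (\<lambda>v. G v - (\<Sum>j<i. scl (x j) (W j v)))" using assms(1) W by (intro lin_intros) auto
    show "G (ev n k) - (\<Sum>j<i. scl (x j) (W j (ev n k))) \<in> pt K" if "k \<in> I n" for k
      using w(2)[OF that] Wev[OF that] by simp
  qed
  then show ?thesis using W by blast
qed

text \<open>Representatives of the cocycles, and in \<open>cob\<close> of the coboundaries, of the
  complex reduced modulo \<open>M\<close>; vectors in \<open>pt M\<close> count as zero.\<close>

definition coc :: "'r set => (int => idx set) => ((int \<times> idx, 'r::comm_ring_1) vec => (int \<times> idx, 'r) vec)
    => int => (int \<times> idx, 'r) vec set" where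
  "coc M I D n = {v \<in> VV I n. D v \<in> pt M}"

definition cob :: "'r set => (int => idx set) => ((int \<times> idx, 'r::comm_ring_1) vec => (int \<times> idx, 'r) vec)
    => int => (int \<times> idx, 'r) vec set" where
  "cob M I D n = {v \<in> VV I n. \<exists>w\<in>VV I (n - 1). v - D w \<in> pt M}"

text \<open>A local ring \<open>'r / K\<close> with maximal ideal \<open>M / K\<close> and a regular
  sequence \<open>x 0, ..., x (c - 1)\<close> in it; the given complex will live over the quotient
  by \<open>J c\<close>.\<close>

locale local_quotient = max_idl M for M :: "'r::comm_ring_1 set" +
  fixes K :: "'r set" and x :: "nat => 'r" and c :: nat
  assumes idl_K: "idl K" and K_M: "K \<subseteq> M" and x_M: "\<And>j. j < c ==> x j \<in> M"
    and unit_K: "\<And>a. a \<notin> M ==> \<exists>b. a * b - 1 \<in> K"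
    and reg: "\<And>i a. i < c ==> x i * a \<in> Jx K x i ==> a \<in> Jx K x i"
begin

abbreviation "J \<equiv> Jx K x"

lemmas idl_J = idl_Jx[OF idl_K] and smod_J = smod_pt[OF idl_Jx[OF idl_K]]
  and smod_ptK = smod_pt[OF idl_K] and smod_ptM = smod_pt[OF idl_M]

lemma J_M: "i \<le> c ==> J i \<subseteq> M"
proof
  fix a assume i: "i \<le> c" and "a \<in> J i"
  then obtain b where b: "a - (\<Sum>j<i. x j * b j) \<in> K" by (auto simp: Jx_def)
  have "(\<Sum>j<i. x j * b j) \<in> M" using x_M i by (intro idl_sum[OF idl_M] idl_mult_right[OF idl_M]) auto
  then have "a - (\<Sum>j<i. x j * b j) + (\<Sum>j<i. x j * b j) \<in> M" using b K_M idl_add[OF idl_M] by blast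
  then show "a \<in> M" by simp
qed

lemma regular_syzygy_last:
  assumes "i < c" "(\<Sum>j<Suc i. x j * a j) \<in> K"
  shows "a i \<in> J i"
proof -
  have "x i * a i - (\<Sum>j<i. x j * - a j) \<in> K" using assms(2) by (simp add: sum_negf algebra_simps)
  then have "x i * a i \<in> J i" by (rule JxI)
  then show ?thesis using reg[of i] assms by simp
qed

text \<open>The first syzygies of a regular sequence have their entries in the ideal it generates.\<close>

lemma regular_syzygy:
  assumes "i \<le> c" "(\<Sum>j<i. x j * a j) \<in> K" "j < i"
  shows "a j \<in> J i"
  using assms
proof (induction i arbitrary: a j)
  case (Suc i)
  have ai: "a i \<in> J i" using regular_syzygy_last[OF _ Suc.prems(2)] Suc.prems(1) by simp
  then obtain w where w: "a i - (\<Sum>j<i. x j * w j) \<in> K" by (auto simp: Jx_def)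
  have "(\<Sum>j<Suc i. x j * a j) - x i * (a i - (\<Sum>j<i. x j * w j)) \<in> K"
    using idl_diff[OF idl_K Suc.prems(2) idl_mult[OF idl_K w]] .
  then have "(\<Sum>j<i. x j * (a j + x i * w j)) \<in> K"
    by (simp add: sum.distrib sum_distrib_left algebra_simps)
  then have IH: "j < i ==> a j + x i * w j \<in> J i" for j using Suc.IH[of "\<lambda>j. a j + x i * w j"] Suc.prems by simp
  show ?case
  proof (cases "j = i")
    case True
    then show ?thesis using ai Jx_mono[OF idl_K, of i "Suc i"] by auto
  next
    case False
    then have "a j + x i * w j \<in> J i" using IH Suc.prems by simp
    then show ?thesis unfolding Jx_Suc by (intro exI[of _ "- w j"]) simp
  qed
qed simp

lemma regular_syzygy_pt:
  assumes "i \<le> c" "(\<Sum>j<i. scl (x j) (v j)) \<in> pt K" "j < i"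
  shows "v j \<in> pt (J i)"
  using regular_syzygy[OF assms(1) _ assms(3), of "\<lambda>j. ix (v j) _"] assms(2) by (simp add: pt_def ix_sum)

text \<open>\<open>D\<close> is a differential only modulo \<open>J i\<close>, and the
  \<open>T j\<close> are the Eisenbud operators read off from the square of the lift. They depend on
  choices and are therefore carried as data.\<close>

definition cpx where
  "cpx i I D T \<longleftrightarrow> (\<forall>n. finite (I n)) \<and> lin D \<and> (\<forall>n. \<forall>v\<in>VV I n. D v \<in> VV I (n + 1)) \<and>
     (\<forall>j<i. lin (T j) \<and> (\<forall>n. \<forall>v\<in>VV I n. T j v \<in> VV I (n + 2))) \<and>
     (\<forall>n. \<forall>v\<in>VV I n. D (D v) - (\<Sum>j<i. scl (x j) (T j v)) \<in> pt K)"

lemma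
  assumes "cpx i I D T"
  shows cpx_fin: "finite (I n)" and cpx_linD: "lin D" and cpx_D: "v \<in> VV I n ==> D v \<in> VV I (n + 1)"
    and cpx_linT: "j < i ==> lin (T j)" and cpx_T: "j < i ==> v \<in> VV I n ==> T j v \<in> VV I (n + 2)"
    and cpx_DD: "v \<in> VV I n ==> D (D v) - (\<Sum>j<i. scl (x j) (T j v)) \<in> pt K"
  using assms unfolding cpx_def by blast+

lemma cpx_exists:
  assumes "\<And>n. finite (I n)" "lin D" "\<And>n v. v \<in> VV I n ==> D v \<in> VV I (n + 1)"
    and "\<And>n v. v \<in> VV I n ==> D (D v) \<in> pt (J i)"
  shows "\<exists>T. cpx i I D T"
proof -
  have d2: "D (D v) \<in> VV I (n + 2)" if "v \<in> VV I n" for n v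
    using assms(3)[OF assms(3)[OF that]] by (simp add: add.commute)
  have "\<exists>W. \<forall>j. lin (W j) \<and> (\<forall>n. \<forall>v\<in>VV I n. W j v \<in> VV I (n + 2)) \<and>
      (\<forall>n. \<forall>v\<in>VV I n. D (D v) - (\<Sum>j<i. scl (x j) (W j v)) \<in> pt K)"
    by (rule lin_decompose[where I = I and I' = I and G = "\<lambda>v. D (D v)"])
      (use lin_comp[OF assms(2,2)] idl_K assms(1) d2 assms(4) in auto)
  then show ?thesis using assms(1-3) unfolding cpx_def by blast
qed

lemma cpx_DD_J: "cpx i I D T ==> v \<in> VV I n ==> D (D v) \<in> pt (J i)"
proof -
  assume a: "cpx i I D T" "v \<in> VV I n"
  have "D (D v) - (\<Sum>j<i. scl (x j) (T j v)) \<in> pt (J i)" using pt_mono[OF K_Jx cpx_DD[OF a]] .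
  moreover have "(\<Sum>j<i. scl (x j) (T j v)) \<in> pt (J i)"
    using x_Jx[OF idl_K] by (intro smod_sum[OF smod_J]) (auto simp: pt_def)
  ultimately show ?thesis by (rule smod_diff_cancel[OF smod_J])
qed

lemma cpx_ptK: "cpx i I D T ==> lin G ==> idl L ==> v \<in> VV I n ==> v \<in> pt L ==> G v \<in> pt L"
  using lin_pt cpx_fin by blast

text \<open>The cube of \<open>D\<close> can be expanded by applying \<open>D\<close> after or
  before its square; the difference of the two expansions is this syzygy.\<close>

lemma cpx_comm_sum:
  assumes "cpx i I D T" "v \<in> VV I n"
  shows "(\<Sum>j<i. scl (x j) (D (T j v) - T j (D v))) \<in> pt K"
proof -

  have 1: "D (D (D v)) - (\<Sum>j<i. scl (x j) (D (T j v))) \<in> pt K"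
  proof -
    have "D (D (D v) - (\<Sum>j<i. scl (x j) (T j v))) \<in> pt K"
    proof (rule cpx_ptK[OF assms(1) cpx_linD[OF assms(1)] idl_K _ cpx_DD[OF assms]])
      show "D (D v) - (\<Sum>j<i. scl (x j) (T j v)) \<in> VV I (n + 2)"
        using cpx_D[OF assms(1) cpx_D[OF assms]] cpx_T[OF assms(1) _ assms(2)]
        by (intro smod_diff[OF smod_VV] smod_sum[OF smod_VV] smod_scl[OF smod_VV]) (auto simp: add.commute)
    qed
    then show ?thesis by (simp add: lin_simps[OF cpx_linD[OF assms(1)]])
  qed
  have 2: "D (D (D v)) - (\<Sum>j<i. scl (x j) (T j (D v))) \<in> pt K" using cpx_DD[OF assms(1) cpx_D[OF assms]] .
  show ?thesis using smod_diff[OF smod_ptK 2 1] by (simp add: scl_simps sum_subtractf)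
qed

lemma cpx_comm_D:
  assumes "i \<le> c" "cpx i I D T" "j < i" "v \<in> VV I n"
  shows "D (T j v) - T j (D v) \<in> pt (J i)"
  using regular_syzygy_pt[OF assms(1) cpx_comm_sum[OF assms(2,4)] assms(3)] .

text \<open>The last operator commutes with \<open>D\<close> modulo the smaller ideal
  \<open>J i\<close>. This lets it become part of a differential over the ring modulo
  \<open>J i\<close>.\<close>

lemma cpx_comm_D_last:
  assumes "i < c" "cpx (Suc i) I D T" "v \<in> VV I n"
  shows "D (T i v) - T i (D v) \<in> pt (J i)"
  using regular_syzygy_last[OF assms(1), of "\<lambda>j. ix (D (T j v) - T j (D v)) _"] cpx_comm_sum[OF assms(2,3)]
  by (simp add: pt_def ix_sum)

text \<open>The operators commute up to homotopy: comparing the two ways of commuting \<open>T j\<close> past \<open>D\<^sup>2\<close>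
  gives a homotopy from any decomposition of \<open>D T j - T j D\<close> along the regular sequence.\<close>

lemma cpx_comm_T:
  assumes i: "i \<le> c" and X: "cpx i I D T" and jl: "j < i" "l < i"
  shows "\<exists>U. lin U \<and> (\<forall>n. \<forall>v\<in>VV I n. U v \<in> VV I (n + 3)) \<and>
    (\<forall>n. \<forall>v\<in>VV I n. T l (T j v) - T j (T l v) - (D (U v) + U (D v)) \<in> pt (J i))"
proof -
  note linD = cpx_linD[OF X] and linT = cpx_linT[OF X jl(1)]
  have G: "D (T j v) - T j (D v) \<in> VV I (n + 3)" if "v \<in> VV I n" for n v
    using cpx_D[OF X cpx_T[OF X jl(1) that]] cpx_T[OF X jl(1) cpx_D[OF X that]]
    by (intro smod_diff[OF smod_VV]) (auto simp: add.commute)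
  have "\<exists>W. \<forall>j'. lin (W j') \<and> (\<forall>n. \<forall>v\<in>VV I n. W j' v \<in> VV I (n + 3)) \<and>
    (\<forall>n. \<forall>v\<in>VV I n. D (T j v) - T j (D v) - (\<Sum>j'<i. scl (x j') (W j' v)) \<in> pt K)"
  proof (rule lin_decompose)
    show "lin (\<lambda>v. D (T j v) - T j (D v))" by (intro lin_sub lin_comp[OF linD linT] lin_comp[OF linT linD])
  qed (use idl_K cpx_fin[OF X] G cpx_comm_D[OF i X jl(1)] in auto)
  then obtain W where W: "\<And>j'. lin (W j')" "\<And>j' n v. v \<in> VV I n ==> W j' v \<in> VV I (n + 3)"
    "\<And>n v. v \<in> VV I n ==> D (T j v) - T j (D v) - (\<Sum>j'<i. scl (x j') (W j' v)) \<in> pt K" by blast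
  have "T l (T j v) - T j (T l v) - (D (W l v) + W l (D v)) \<in> pt (J i)" if v: "v \<in> VV I n" for n v
  proof -
    have 1: "D (D (T j v)) - (\<Sum>l<i. scl (x l) (T l (T j v))) \<in> pt K" using cpx_DD[OF X cpx_T[OF X jl(1) v]] .
    have 2: "T j (D (D v)) - (\<Sum>l<i. scl (x l) (T j (T l v))) \<in> pt K"
    proof -
      have "T j (D (D v) - (\<Sum>j<i. scl (x j) (T j v))) \<in> pt K"
      proof (rule cpx_ptK[OF X linT idl_K _ cpx_DD[OF X v]])
        show "D (D v) - (\<Sum>j<i. scl (x j) (T j v)) \<in> VV I (n + 2)"
          using cpx_D[OF X cpx_D[OF X v]] cpx_T[OF X _ v]
          by (intro smod_diff[OF smod_VV] smod_sum[OF smod_VV] smod_scl[OF smod_VV]) (auto simp: add.commute)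
      qed
      then show ?thesis by (simp add: lin_simps[OF linT])
    qed
    have 3: "D (D (T j v)) - D (T j (D v)) - (\<Sum>l<i. scl (x l) (D (W l v))) \<in> pt K"
    proof -
      have "D (D (T j v) - T j (D v) - (\<Sum>j'<i. scl (x j') (W j' v))) \<in> pt K"
        by (rule cpx_ptK[OF X linD idl_K _ W(3)[OF v], of "n + 3"])
          (use G[OF v] W(2)[OF v] in \<open>auto intro!: smod_diff[OF smod_VV] smod_sum[OF smod_VV] smod_scl[OF smod_VV]\<close>)
      then show ?thesis by (simp add: lin_simps[OF linD])
    qed
    have 4: "D (T j (D v)) - T j (D (D v)) - (\<Sum>l<i. scl (x l) (W l (D v))) \<in> pt K" using W(3)[OF cpx_D[OF X v]] .
    have "(\<Sum>l<i. scl (x l) (T l (T j v) - T j (T l v) - (D (W l v) + W l (D v)))) \<in> pt K"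
      using smod_diff[OF smod_ptK smod_add[OF smod_ptK smod_add[OF smod_ptK 3 4] 2] 1]
      by (simp add: scl_simps sum_subtractf sum.distrib algebra_simps)
    then show ?thesis by (rule regular_syzygy_pt[OF i _ jl(2)])
  qed
  then show ?thesis using W(1,2) by blast
qed

lemma fdim_VV:
  assumes "finite (I n)"
  shows "fdim (VV I n \<inter> pt M) (VV I n)"
proof -
  have inj: "inj_on (ev n :: idx => (int \<times> idx, 'r) vec) (I n)"
    by (rule inj_onI) (metis Pair_inject ix_ev zero_neq_one)
  have "spans (ev n ` I n) (VV I n \<inter> pt M) (VV I n :: (int \<times> idx, 'r) vec set)"
    unfolding spans_def
  proof (intro conjI ballI)
    fix w :: "(int \<times> idx, 'r) vec" assume "w \<in> VV I n"
    have "w = (\<Sum>i\<in>I n. scl (ix w (n, i)) (ev n i))" using VV_expand[OF assms \<open>w \<in> VV I n\<close>] .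
    also have "\<dots> = (\<Sum>s\<in>ev n ` I n. scl (ix w (n, inv_into (I n) (ev n) s)) s)"
      by (simp add: sum.reindex[OF inj] inv_into_f_f[OF inj])
    finally have "w - (\<Sum>s\<in>ev n ` I n. scl (ix w (n, inv_into (I n) (ev n) s)) s) = 0" by simp
    moreover have "0 \<in> VV I n \<inter> pt M" using smod_0[OF smod_VV] smod_0[OF smod_ptM] by blast
    ultimately show "\<exists>f. w - (\<Sum>s\<in>ev n ` I n. scl (f s) s) \<in> VV I n \<inter> pt M"
      by (intro exI[of _ "\<lambda>s. ix w (n, inv_into (I n) (ev n) s)"]) (simp only:)
  qed (use assms ev_VV in auto)
  then show ?thesis by (auto simp: fdim_def)
qed

text \<open>Since \<open>J i \<subseteq> M\<close>, the operators are chain maps modulo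
  \<open>M\<close>, and they commute on cohomology because \<open>cpx_comm_T\<close> provides
  homotopies.\<close>

lemma cpx_gm:
  assumes i: "i \<le> c" and X: "cpx i I D T"
  shows "gm i (coc M I D) (cob M I D) T"
proof -
  note linD = cpx_linD[OF X]
  have ptM: "v \<in> VV I n ==> v \<in> pt M ==> lin G ==> G v \<in> pt M"
    for v n and G :: "(int \<times> idx, 'r) vec => (int \<times> idx, 'r) vec"
    using cpx_ptK[OF X _ idl_M] by blast
  have JM: "v \<in> pt (J i) ==> v \<in> pt M" for v :: "(int \<times> idx, 'r) vec" using pt_mono[OF J_M[OF i]] .
  have smZ: "smod (coc M I D n)" for n
    unfolding smod_def coc_def
    by (auto simp: lin_simps[OF linD] smod_0[OF smod_VV] smod_0[OF smod_ptM] smod_add[OF smod_VV]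
        smod_add[OF smod_ptM] smod_scl[OF smod_VV] smod_scl[OF smod_ptM])
  have smN: "smod (cob M I D n)" for n
    unfolding smod_def
  proof (intro conjI ballI allI)
    show "0 \<in> cob M I D n" unfolding cob_def using smod_0[OF smod_VV] smod_0[OF smod_ptM]
      by (auto intro!: bexI[of _ 0] simp: lin_zero[OF linD])
    fix u v assume "u \<in> cob M I D n" "v \<in> cob M I D n"
    then obtain w w' where w: "u \<in> VV I n" "v \<in> VV I n" "w \<in> VV I (n-1)" "w' \<in> VV I (n-1)"
      "u - D w \<in> pt M" "v - D w' \<in> pt M" by (auto simp: cob_def)
    then show "u + v \<in> cob M I D n"
      using smod_add[OF smod_ptM w(5,6)] smod_add[OF smod_VV]
      by (auto simp: cob_def lin_simps[OF linD] algebra_simps intro!: bexI[of _ "w + w'"])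
  next
    fix a u assume "u \<in> cob M I D n"
    then obtain w where w: "u \<in> VV I n" "w \<in> VV I (n-1)" "u - D w \<in> pt M" by (auto simp: cob_def)
    then show "scl a u \<in> cob M I D n"
      using smod_scl[OF smod_ptM w(3), of a] smod_scl[OF smod_VV]
      by (auto simp: cob_def lin_simps[OF linD] scl_simps intro!: bexI[of _ "scl a w"])
  qed
  have NZ: "v \<in> coc M I D n" if v: "v \<in> cob M I D n" for v n
  proof -
    obtain w where w: "v \<in> VV I n" "w \<in> VV I (n-1)" "v - D w \<in> pt M" using v by (auto simp: cob_def)
    have Dw: "D w \<in> VV I n" using cpx_D[OF X w(2)] by simp
    have "D v - D (D w) \<in> pt M"
      using ptM[OF smod_diff[OF smod_VV w(1) Dw] w(3) linD] by (simp add: lin_simps[OF linD])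
    moreover have "D (D w) \<in> pt M" using JM[OF cpx_DD_J[OF X w(2)]] .
    ultimately have "D v \<in> pt M" by (rule smod_diff_cancel[OF smod_ptM])
    then show ?thesis using w by (simp add: coc_def)
  qed
  have VM: "VV I n \<inter> pt M \<subseteq> cob M I D n" for n
    unfolding cob_def using smod_0[OF smod_VV] by (auto intro!: bexI[of _ 0] simp: lin_zero[OF linD])
  have fd: "fdim (cob M I D n) (coc M I D n)" for n
  proof (rule fdim_mono[OF _ VM])
    have "smod (VV I n \<inter> pt M)" using smod_VV smod_ptM unfolding smod_def by blast
    then show "fdim (VV I n \<inter> pt M) (coc M I D n)"
      using smZ scl_pt[OF idl_M] smod_scl[OF smod_VV] by (intro fdim_sub[OF fdim_VV[OF cpx_fin[OF X]]]) (auto simp: coc_def)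
  qed
  have M: "scl a z \<in> cob M I D n" if "a \<in> M" "z \<in> coc M I D n" for a z n
    using VM[of n] scl_pt[OF idl_M that(1), of z] smod_scl[OF smod_VV, of z I n a] that(2)
    unfolding coc_def by blast
  have TD: "D (T j v) - T j (D v) \<in> pt M" if "j < i" "v \<in> VV I n" for j v n
    using JM[OF cpx_comm_D[OF i X that]] .
  have TZ: "T j z \<in> coc M I D (n + 2)" if "j < i" "z \<in> coc M I D n" for j z n
  proof -
    have z: "z \<in> VV I n" "D z \<in> pt M" using that by (auto simp: coc_def)
    have "T j (D z) \<in> pt M" using ptM[OF cpx_D[OF X z(1)] z(2) cpx_linT[OF X that(1)]] .
    then have "D (T j z) \<in> pt M" using smod_diff_cancel[OF smod_ptM TD[OF that(1) z(1)]] by blast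
    then show ?thesis using cpx_T[OF X that(1) z(1)] by (simp add: coc_def)
  qed
  have TN: "T j z \<in> cob M I D (n + 2)" if j: "j < i" and z: "z \<in> cob M I D n" for j z n
  proof -
    note that = j z
    obtain w where w: "z \<in> VV I n" "w \<in> VV I (n-1)" "z - D w \<in> pt M" using z by (auto simp: cob_def)
    have Dw: "D w \<in> VV I n" using cpx_D[OF X w(2)] by simp
    have 1: "T j z - T j (D w) \<in> pt M"
      using ptM[OF smod_diff[OF smod_VV w(1) Dw] w(3) cpx_linT[OF X that(1)]]
      by (simp add: lin_simps[OF cpx_linT[OF X that(1)]])
    have "T j z - D (T j w) \<in> pt M"
      using smod_diff_trans[OF smod_ptM 1 smod_diff_sym[OF smod_ptM TD[OF that(1) w(2)]]] .
    moreover have "T j w \<in> VV I (n + 2 - 1)" using cpx_T[OF X that(1) w(2)] by (simp add: algebra_simps)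
    ultimately show ?thesis using cpx_T[OF X that(1) w(1)] unfolding cob_def by blast
  qed
  have comm: "T l (T j z) - T j (T l z) \<in> cob M I D (n + 4)" if lj: "l < i" "j < i" and zc: "z \<in> coc M I D n" for l j z n
  proof -
    note that = lj zc
    obtain U where U: "lin U" "\<And>n v. v \<in> VV I n ==> U v \<in> VV I (n + 3)"
      "\<And>n v. v \<in> VV I n ==> T l (T j v) - T j (T l v) - (D (U v) + U (D v)) \<in> pt (J i)"
      using cpx_comm_T[OF i X lj(2,1)] by blast
    have z: "z \<in> VV I n" "D z \<in> pt M" using that by (auto simp: coc_def)
    have "T l (T j z) - T j (T l z) - (D (U z) + U (D z)) \<in> pt M" using JM[OF U(3)[OF z(1)]] .
    moreover have "U (D z) \<in> pt M" using ptM[OF cpx_D[OF X z(1)] z(2) U(1)] .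
    ultimately have "T l (T j z) - T j (T l z) - (D (U z) + U (D z)) + U (D z) \<in> pt M"
      by (rule smod_add[OF smod_ptM])
    then have "T l (T j z) - T j (T l z) - D (U z) \<in> pt M" by (simp add: algebra_simps)
    moreover have "U z \<in> VV I (n + 4 - 1)" using U(2)[OF z(1)] by (simp add: add.commute)
    moreover have "T l (T j z) - T j (T l z) \<in> VV I (n + 4)"
      using cpx_T[OF X that(1) cpx_T[OF X that(2) z(1)]] cpx_T[OF X that(2) cpx_T[OF X that(1) z(1)]]
      by (intro smod_diff[OF smod_VV]) (auto simp: add.commute add.left_commute)
    ultimately show ?thesis unfolding cob_def by blast
  qed
  show ?thesis unfolding gm_def using smZ smN NZ fd M cpx_linT[OF X] TZ TN comm by blast
qed

end

section \<open>Direct sums of two shifted copies of a complex\<close>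

lemma ptD: "v \<in> pt L ==> ix v p \<in> L"
  unfolding pt_def by blast

text \<open>The shifts \<open>1\<close> and \<open>2 * int q\<close> will give the cone of an
  operator of degree \<open>2 * int q\<close>, the shifts \<open>0\<close> and \<open>-1\<close> the
  doubled complex that removes one element of the regular sequence.\<close>

definition sumI :: "int => int => (int => idx set) => int => idx set" where
  "sumI s t I n = InL ` I (n + s) \<union> InR ` I (n + t)"

definition prL :: "int => (int \<times> idx, 'r::comm_ring_1) vec => (int \<times> idx, 'r) vec" where
  "prL s v = Vec (\<lambda>(m, i). ix v (m - s, InL i))"

definition prR :: "int => (int \<times> idx, 'r::comm_ring_1) vec => (int \<times> idx, 'r) vec" where
  "prR t v = Vec (\<lambda>(m, i). ix v (m - t, InR i))"

definition mk :: "int => int => (int \<times> idx, 'r::comm_ring_1) vec => (int \<times> idx, 'r) vec => (int \<times> idx, 'r) vec" where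
  "mk s t a b = Vec (\<lambda>(m, k). case k of InL i => ix a (m + s, i) | InR i => ix b (m + t, i) | Base _ => 0)"

lemma ix_prL [simp]: "ix (prL s v) (m, i) = ix v (m - s, InL i)"
  and ix_prR [simp]: "ix (prR t v) (m, i) = ix v (m - t, InR i)"
  and ix_mk [simp]: "ix (mk s t a b) (m, InL i) = ix a (m + s, i)" "ix (mk s t a b) (m, InR i) = ix b (m + t, i)"
    "ix (mk s t a b) (m, Base j) = 0"
  by (simp_all add: prL_def prR_def mk_def)

lemma lin_prL: "lin (prL s)" and lin_prR: "lin (prR t)"
  by (rule linI; rule vec_eqI; auto)+

lemma mk_eqI:
  assumes "\<And>m i. ix v (m, InL i) = ix w (m, InL i)" "\<And>m i. ix v (m, InR i) = ix w (m, InR i)"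
    "\<And>m j. ix v (m, Base j) = ix w (m, Base j)"
  shows "v = w"
proof (rule vec_eqI)
  fix p show "ix v p = ix w p" using assms by (cases p; cases "snd p") auto
qed

lemma mk_add: "mk s t (a + a') (b + b') = mk s t a b + mk s t a' b'"
  and mk_scl: "mk s t (scl r a) (scl r b) = scl r (mk s t a b)"
  and mk_diff: "mk s t (a - a') (b - b') = mk s t a b - mk s t a' b'"
  by (rule mk_eqI; simp)+

lemma lin_mk: "lin f ==> lin g ==> lin (\<lambda>v. mk s t (f v) (g v))"
  by (rule linI) (simp_all add: lin_simps mk_add mk_scl)

lemma mk_sum: "mk s t (\<Sum>j\<in>S. f j) (\<Sum>j\<in>S. g j) = (\<Sum>j\<in>S. mk s t (f j) (g j))"
  by (rule mk_eqI) (simp_all add: ix_sum)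

lemma prL_mk [simp]: "prL s (mk s t a b) = a" and prR_mk [simp]: "prR t (mk s t a b) = b"
  by (rule vec_eqI; auto)+

lemma VV_prL: "v \<in> VV (sumI s t I) n ==> prL s v \<in> VV I (n + s)"
  and VV_prR: "v \<in> VV (sumI s t I) n ==> prR t v \<in> VV I (n + t)"
  by (auto simp: VV_def sumI_def)

lemma VV_mk: "a \<in> VV I (n + s) ==> b \<in> VV I (n + t) ==> mk s t a b \<in> VV (sumI s t I) n"
proof -
  assume a: "a \<in> VV I (n + s)" and b: "b \<in> VV I (n + t)"
  have "ix (mk s t a b) (m, k) = 0" if "\<not> (m = n \<and> k \<in> sumI s t I n)" for m k
  proof (cases k)
    case (InL i)
    then have "\<not> (m + s = n + s \<and> i \<in> I (n + s))" using that by (auto simp: sumI_def)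
    then show ?thesis using a InL by (auto simp: VV_def)
  next
    case (InR i)
    then have "\<not> (m + t = n + t \<and> i \<in> I (n + t))" using that by (auto simp: sumI_def)
    then show ?thesis using b InR by (auto simp: VV_def)
  qed simp
  then show ?thesis by (simp add: VV_def)
qed

lemma mk_pr: "v \<in> VV (sumI s t I) n ==> mk s t (prL s v) (prR t v) = v"
  by (rule mk_eqI) (auto simp: VV_def sumI_def image_iff)

lemma mk_pt: "idl L ==> mk s t a b \<in> pt L \<longleftrightarrow> a \<in> pt L \<and> b \<in> pt L"
proof
  assume "mk s t a b \<in> pt L"
  then have "ix (mk s t a b) (m - s, InL i) \<in> L" "ix (mk s t a b) (m - t, InR i) \<in> L" for m i
    unfolding pt_def by blast+
  then show "a \<in> pt L \<and> b \<in> pt L" by (auto simp: pt_def)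
next
  assume L: "idl L" "a \<in> pt L \<and> b \<in> pt L"
  have "ix (mk s t a b) (m, k) \<in> L" for m k using L idl_0[OF L(1)] by (cases k) (auto simp: pt_def)
  then show "mk s t a b \<in> pt L" by (auto simp: pt_def)
qed

lemma finite_sumI: "(\<And>n. finite (I n)) ==> finite (sumI s t I n)"
  by (simp add: sumI_def)

context max_idl
begin

text \<open>Cohomology that is unbounded below becomes finitely generated when it is replaced by
  zero below \<open>n1\<close>. The bound for the generators moves to \<open>n1 + 2\<close> because
  \<open>gens\<close> looks two degrees down.\<close>

lemma fg_truncate:
  assumes gm: "gm c Z N T" and gens: "gens c Z N T n1"
  shows "fg c (\<lambda>n. if n < n1 then N n else Z n) N T"
proof -
  let ?Z = "\<lambda>n. if n < n1 then N n else Z n"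
  have "fdim (N n) (N n)" for n
    unfolding fdim_def spans_def using smod_0[OF gm_N[OF gm]] by (intro exI[of _ "{}"]) auto
  moreover have "T j z \<in> ?Z (n + 2)" if "j < c" "z \<in> ?Z n" for j z n
    using gm_TZ[OF gm that(1), of z n] gm_TN[OF gm that(1), of z n] gm_NZ[OF gm] that by (auto split: if_splits)
  moreover have "a \<in> M ==> z \<in> ?Z n ==> scl a z \<in> N n" for a z n
    using gm_M[OF gm] smod_scl[OF gm_N[OF gm]] by (auto split: if_splits)
  ultimately have "gm c ?Z N T"
    unfolding gm_def using gm_Z[OF gm] gm_N[OF gm] gm_NZ'[OF gm] gm_fd[OF gm] gm_lin[OF gm] gm_TN[OF gm]
      gm_comm[OF gm] gm_NZ[OF gm] by (auto split: if_splits)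
  moreover have "gens c ?Z N T (n1 + 2)"
    using gens unfolding gens_def by auto
  moreover have "\<forall>n<n1. ?Z n \<subseteq> N n" by simp
  ultimately show ?thesis unfolding fg_def by blast
qed

end

section \<open>Splitting of acyclic complexes, cones of operators and the transfer of growth\<close>

context local_quotient
begin

definition exact_at where
  "exact_at i I D n \<longleftrightarrow> (\<forall>v\<in>VV I n. D v \<in> pt (J i) --> (\<exists>w\<in>VV I (n - 1). v - D w \<in> pt (J i)))"

text \<open>Elimination in place of a determinant: \<open>1 - e s0 s0\<close> is invertible modulo
  \<open>K\<close>, so \<open>w s0\<close> can be expressed through the others, and the reduced
  coefficients are again in \<open>M\<close>.\<close>

lemma nakayama:
  assumes "finite S" "\<And>s. s \<in> S ==> w s - (\<Sum>t\<in>S. scl (e s t) (w t)) \<in> pt (J c)"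
    and "\<And>s t. s \<in> S ==> t \<in> S ==> e s t \<in> M"
  shows "\<forall>s\<in>S. w s \<in> pt (J c)"
  using assms
proof (induction S arbitrary: e rule: finite_induct)
  case (insert s0 S)
  let ?W = "pt (J c)"
  have "1 - e s0 s0 \<notin> M"
    using idl_add[OF idl_M, of "1 - e s0 s0" "e s0 s0"] insert.prems(2) one_M by auto
  then obtain u where u: "(1 - e s0 s0) * u - 1 \<in> K" using unit_K by blast
  let ?R = "\<lambda>s. \<Sum>t\<in>S. scl (e s t) (w t)"
  have rel: "w s - scl (e s s0) (w s0) - ?R s \<in> ?W" if "s \<in> insert s0 S" for s
    using insert.prems(1)[OF that] insert.hyps by (simp add: algebra_simps)
  have "scl u (w s0 - scl (e s0 s0) (w s0) - ?R s0) \<in> ?W" using rel smod_scl[OF smod_J] by blast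
  moreover have "scl ((1 - e s0 s0) * u - 1) (w s0) \<in> ?W"
    using scl_pt[OF idl_J] u K_Jx[of K x c] by blast
  ultimately have "scl u (w s0 - scl (e s0 s0) (w s0) - ?R s0) - scl ((1 - e s0 s0) * u - 1) (w s0) \<in> ?W"
    by (rule smod_diff[OF smod_J])
  then have w0: "w s0 - scl u (?R s0) \<in> ?W" by (simp add: scl_simps algebra_simps)
  have "w s - (\<Sum>t\<in>S. scl (e s t + e s s0 * u * e s0 t) (w t)) \<in> ?W" if "s \<in> S" for s
  proof -
    have 1: "scl (e s s0) (w s0 - scl u (?R s0)) \<in> ?W" using w0 smod_scl[OF smod_J] by blast
    have 2: "w s - scl (e s s0) (w s0) - ?R s \<in> ?W" using rel that by blast
    show ?thesis using smod_add[OF smod_J 1 2]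
      by (simp add: scl_simps scl_sum sum.distrib mult.assoc algebra_simps)
  qed
  then have IH: "\<forall>s\<in>S. w s \<in> ?W"
    by (rule insert.IH[of "\<lambda>s t. e s t + e s s0 * u * e s0 t"])
      (use insert.prems(2) in \<open>auto intro: idl_add[OF idl_M] idl_mult[OF idl_M]\<close>)
  then have "scl u (?R s0) \<in> ?W" by (auto intro!: smod_scl[OF smod_J] smod_sum[OF smod_J])
  then have "w s0 \<in> ?W" using smod_diff_cancel[OF smod_J w0] by blast
  then show ?case using IH by simp
qed simp

text \<open>The partial splittings of \<open>D\<close> are enlarged by Gaussian elimination as long as one of the remaining
  columns has an entry outside \<open>M\<close>; once none has, the remaining columns vanish by Nakayama's lemma.\<close>

lemma splitting_exists:
  assumes X: "cpx c I D T" and acyclic: "coc M I D n \<subseteq> cob M I D n"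
  shows "\<exists>s. lin s \<and> (\<forall>v\<in>VV I (n + 1). s v \<in> VV I n) \<and> (\<forall>v\<in>VV I n. D (s (D v)) - D v \<in> pt (J c))"
proof -
  note linD = cpx_linD[OF X] and fin = cpx_fin[OF X]
  let ?W = "pt (J c)"
  have JM: "v \<in> ?W ==> v \<in> pt M" for v :: "(int \<times> idx, 'r) vec" using pt_mono[OF J_M] by blast
  \<comment> \<open>\<open>s\<close> splits \<open>D\<close> on the columns in \<open>B\<close> and
    takes its values in their span. The sizes of such \<open>B\<close> are bounded, so one of
    largest size can be chosen.\<close>
  define P where "P B s \<longleftrightarrow> B \<subseteq> I n \<and> lin s \<and> (\<forall>v. s v \<in> VV (\<lambda>_. B) n) \<and>
      (\<forall>j\<in>B. D (s (D (ev n j))) - D (ev n j) \<in> ?W)" for B s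
  have "P {} (\<lambda>v. 0)" unfolding P_def by (auto intro: lin_0 smod_0[OF smod_VV])
  then have "\<exists>s. P {} s" by blast
  moreover have "\<forall>B. (\<exists>s. P B s) --> card B < Suc (card (I n))"
    using card_mono[OF fin] by (auto simp: P_def less_Suc_eq_le)
  ultimately have "\<exists>B. (\<exists>s. P B s) \<and> (\<forall>B'. (\<exists>s. P B' s) --> card B' \<le> card B)"
    by (rule ex_has_greatest_nat)
  then obtain B where B: "\<exists>s. P B s" "\<And>B'. \<exists>s. P B' s ==> card B' \<le> card B" by blast
  then obtain s where s: "P B s" by blast
  have BI: "B \<subseteq> I n" and lins: "lin s" and sB: "\<And>v. s v \<in> VV (\<lambda>_. B) n"
    and sD: "\<And>j. j \<in> B ==> D (s (D (ev n j))) - D (ev n j) \<in> ?W"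
    using s unfolding P_def by blast+
  have finB: "finite B" using finite_subset[OF BI fin] .
  have VB: "v \<in> VV I n" if "v \<in> VV (\<lambda>_. B) n" for v using that BI unfolding VV_def by blast
  have sV: "s v \<in> VV I n" for v using VB[OF sB] .
  have lDs: "lin (\<lambda>v. D (s v))" using lin_comp[OF linD lins] .
  have lDsD: "lin (\<lambda>v. D (s (D v)) - D v)" using lin_sub[OF lin_comp[OF lDs linD] linD] .
  have sDB: "D (s (D v)) - D v \<in> ?W" if "v \<in> VV (\<lambda>_. B) n" for v
    by (rule lin_on_basis[OF lDsD smod_J _ sD that]) (use finB in auto)
  define w where "w j = D (ev n j) - D (s (D (ev n j)))" for j
  have wM: "w j \<in> pt M" if j: "j \<in> I n - B" for j
  proof (rule ccontr)
    assume "w j \<notin> pt M"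
    then obtain p where p: "ix (w j) p \<notin> M" by (auto simp: pt_def)
    then obtain u where u: "ix (w j) p * u - 1 \<in> K" using unit_K by blast
    \<comment> \<open>A rank one correction. For \<open>v = D (ev n j)\<close> the entry at
      \<open>p\<close> is that of \<open>w j\<close>, which \<open>u\<close> inverts, so that column
      becomes split; for the columns in \<open>B\<close> the entry is already in
      \<open>J c\<close>.\<close>
    define s' where "s' v = s v + scl (u * ix (v - D (s v)) p) (ev n j - s (D (ev n j)))" for v
    have Ds': "D (s' v) = D (s v) + scl (u * ix (v - D (s v)) p) (w j)" for v
      by (simp add: s'_def w_def lin_simps[OF linD])
    have "P (insert j B) s'"
      unfolding P_def
    proof (intro conjI allI ballI)
      show "insert j B \<subseteq> I n" using j BI by blast
      show "lin s'"
        by (rule linI; rule vec_eqI) (auto simp: s'_def lin_simps[OF lins] lin_simps[OF linD] algebra_simps)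
      have mono: "v \<in> VV (\<lambda>_. B) n ==> v \<in> VV (\<lambda>_. insert j B) n" for v :: "(int \<times> idx, 'r) vec"
        unfolding VV_def by blast
      have "ev n j \<in> VV (\<lambda>_. insert j B) n" by (rule ev_VV) simp
      then show "s' v \<in> VV (\<lambda>_. insert j B) n" for v
        unfolding s'_def
        by (intro smod_add[OF smod_VV] smod_scl[OF smod_VV] smod_diff[OF smod_VV] mono[OF sB])
      fix k assume k: "k \<in> insert j B"
      show "D (s' (D (ev n k))) - D (ev n k) \<in> ?W"
      proof (cases "k = j")
        case True
        have "D (s' (D (ev n k))) - D (ev n k) = scl (ix (w j) p * u - 1) (w j)"
          unfolding Ds' True by (rule vec_eqI) (simp add: w_def algebra_simps)
        then show ?thesis using scl_pt[OF idl_J] u K_Jx[of K x c] by (metis subsetD)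
      next
        case False
        then have kB: "k \<in> B" using k by blast
        have "ix (D (ev n k) - D (s (D (ev n k)))) p \<in> J c"
          using ptD[OF smod_minus[OF smod_J sD[OF kB]], of p] by simp
        then have "scl (u * ix (D (ev n k) - D (s (D (ev n k)))) p) (w j) \<in> ?W"
          by (intro scl_pt[OF idl_J] idl_mult[OF idl_J])
        from smod_add[OF smod_J sD[OF kB] this] show ?thesis unfolding Ds' by (simp add: algebra_simps)
      qed
    qed
    then have "card (insert j B) \<le> card B" using B(2) by blast
    then show False using j finB by simp
  qed
  define Pi where "Pi v = D v - D (s (D v))" for v
  have lPi: "lin Pi" unfolding Pi_def[abs_def] using lin_sub[OF linD lin_comp[OF lDs linD]] .
  have ptJ: "v \<in> VV I m ==> v \<in> ?W ==> lin G ==> G v \<in> ?W" for v m and G :: "(int \<times> idx, 'r) vec => (int \<times> idx, 'r) vec"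
    using cpx_ptK[OF X _ idl_J] by blast
  \<comment> \<open>Put \<open>f = ev n j - s (D (ev n j))\<close>, so that \<open>D f = w j\<close>
    and \<open>f\<close> is a cocycle modulo \<open>M\<close>. Acyclicity allows subtraction of some
    \<open>D g\<close> that brings \<open>f\<close> into \<open>pt M\<close> without changing
    \<open>Pi f\<close>. Thus \<open>w j\<close> is a combination of the remaining columns with
    coefficients in \<open>M\<close>.\<close>
  have "\<exists>f\<in>VV I n. f \<in> pt M \<and> w j - Pi f \<in> ?W" if j: "j \<in> I n - B" for j
  proof -
    define f where "f = ev n j - s (D (ev n j))"
    have fV: "f \<in> VV I n" unfolding f_def using ev_VV sV smod_diff[OF smod_VV] j by blast
    have Df: "D f = w j" by (simp add: f_def w_def lin_simps[OF linD])
    have "f \<in> coc M I D n" using fV Df wM[OF j] by (simp add: coc_def)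
    then have "f \<in> cob M I D n" using acyclic by blast
    then obtain g where g: "g \<in> VV I (n - 1)" "f - D g \<in> pt M" by (auto simp: cob_def)
    have Dg: "D g \<in> VV I n" using cpx_D[OF X g(1)] by simp
    have DDg: "D (D g) \<in> ?W" using cpx_DD_J[OF X g(1)] .
    have "D (D g) \<in> VV I (n + 1)" using cpx_D[OF X Dg] .
    then have "D (s (D (D g))) \<in> ?W" using ptJ[OF _ DDg lDs] by blast
    then have PiDg: "Pi (D g) \<in> ?W" unfolding Pi_def using DDg smod_diff[OF smod_J] by blast
    have "D (s (w j)) = D (s (D (ev n j))) - D (s (D (s (D (ev n j)))))"
      by (simp add: w_def lin_simps[OF linD] lin_simps[OF lins])
    moreover have "D (s (D (s (D (ev n j))))) - D (s (D (ev n j))) \<in> ?W" by (rule sDB[OF sB])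
    ultimately have "D (s (w j)) \<in> ?W" using smod_minus[OF smod_J] by (metis minus_diff_eq)
    then have 1: "w j - Pi f \<in> ?W" by (simp add: Pi_def Df)
    have eq: "w j - Pi (f - D g) = (w j - Pi f) + Pi (D g)" by (simp add: lin_simps[OF lPi])
    have "w j - Pi (f - D g) \<in> ?W" unfolding eq by (rule smod_add[OF smod_J 1 PiDg])
    moreover have "f - D g \<in> VV I n" using smod_diff[OF smod_VV fV Dg] .
    ultimately show ?thesis using g(2) by blast
  qed
  then have "\<forall>j. \<exists>f. j \<in> I n - B --> f \<in> VV I n \<and> f \<in> pt M \<and> w j - Pi f \<in> ?W" by blast
  from choice[OF this] obtain f where
    f: "\<And>j. j \<in> I n - B ==> f j \<in> VV I n \<and> f j \<in> pt M \<and> w j - Pi (f j) \<in> ?W" by blast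
  have "\<forall>j\<in>I n - B. w j \<in> ?W"
  proof (rule nakayama[where e = "\<lambda>j k. ix (f j) (n, k)"])
    fix j assume j: "j \<in> I n - B"
    have PiB: "Pi (ev n k) \<in> ?W" if "k \<in> B" for k
      using smod_minus[OF smod_J sD[OF that]] by (simp add: Pi_def)
    have "Pi (f j) = (\<Sum>k\<in>I n. scl (ix (f j) (n, k)) (Pi (ev n k)))"
      by (subst VV_expand[OF fin]) (use f[OF j] in \<open>auto simp: lin_simps[OF lPi]\<close>)
    also have "\<dots> = (\<Sum>k\<in>I n - B. scl (ix (f j) (n, k)) (Pi (ev n k))) + (\<Sum>k\<in>B. scl (ix (f j) (n, k)) (Pi (ev n k)))"
      using sum.subset_diff[OF BI fin] by blast
    finally have eq: "Pi (f j) = (\<Sum>k\<in>I n - B. scl (ix (f j) (n, k)) (w k)) + (\<Sum>k\<in>B. scl (ix (f j) (n, k)) (Pi (ev n k)))"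
      by (simp add: w_def Pi_def)
    have "(\<Sum>k\<in>B. scl (ix (f j) (n, k)) (Pi (ev n k))) \<in> ?W"
      using PiB by (intro smod_sum[OF smod_J] smod_scl[OF smod_J])
    from smod_add[OF smod_J conjunct2[OF conjunct2[OF f[OF j]]] this]
    show "w j - (\<Sum>k\<in>I n - B. scl (ix (f j) (n, k)) (w k)) \<in> ?W" unfolding eq by simp
  next
    fix j k assume "j \<in> I n - B"
    then show "ix (f j) (n, k) \<in> M" using f unfolding pt_def by blast
  qed (use fin in simp)
  then have all: "D (s (D (ev n j))) - D (ev n j) \<in> ?W" if "j \<in> I n" for j
    using sD[of j] smod_minus[OF smod_J, of "w j"] that by (cases "j \<in> B") (auto simp: w_def)
  have "D (s (D v)) - D v \<in> ?W" if "v \<in> VV I n" for v by (rule lin_on_basis[OF lDsD smod_J fin all that])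
  then show ?thesis using lins sV by blast
qed

text \<open>Modulo \<open>J c\<close> the element \<open>v - s (D v)\<close> is a cycle and by
  exactness a boundary, chosen linearly as \<open>D (F v)\<close>. So \<open>s\<close> and
  \<open>F\<close> contract the complex in degree \<open>n\<close>, and \<open>F\<close> is a
  splitting one degree below.\<close>

lemma splitting_down:
  assumes X: "cpx c I D T" and ex: "exact_at c I D n"
    and s: "lin s" "\<And>v. v \<in> VV I (n + 1) ==> s v \<in> VV I n" "\<And>v. v \<in> VV I n ==> D (s (D v)) - D v \<in> pt (J c)"
  shows "coc M I D n \<subseteq> cob M I D n"
    and "\<exists>s'. lin s' \<and> (\<forall>v\<in>VV I n. s' v \<in> VV I (n - 1)) \<and> (\<forall>v\<in>VV I (n - 1). D (s' (D v)) - D v \<in> pt (J c))"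
proof -
  note linD = cpx_linD[OF X] and fin = cpx_fin[OF X]
  let ?W = "pt (J c)"
  have ex1: "\<exists>w\<in>VV I (n - 1). v - s (D v) - D w \<in> ?W" if v: "v \<in> VV I n" for v
  proof -
    have "v - s (D v) \<in> VV I n" using smod_diff[OF smod_VV v s(2)[OF cpx_D[OF X v]]] .
    moreover have "D (v - s (D v)) \<in> ?W"
      using smod_minus[OF smod_J s(3)[OF v]] by (simp add: lin_simps[OF linD])
    ultimately show ?thesis using ex unfolding exact_at_def by blast
  qed
  \<comment> \<open>The choice is made in all degrees at once, with a condition in degree
    \<open>n\<close> only; zero serves the other degrees.\<close>
  have "\<exists>F. lin F \<and> (\<forall>m. \<forall>v\<in>VV I m. F v \<in> VV I (m + (-1))) \<and>
      (\<forall>m. \<forall>i\<in>I m. m = n --> ev m i - s (D (ev m i)) - D (F (ev m i)) \<in> ?W)"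
  proof (rule lin_choice[OF fin])
    fix m i assume i: "i \<in> I m"
    show "\<exists>w\<in>VV I (m + (-1)). m = n --> ev m i - s (D (ev m i)) - D w \<in> ?W"
      using ex1[OF ev_VV, of i] i smod_0[OF smod_VV] by (cases "m = n") auto
  qed
  then obtain F where F: "lin F" "\<And>m v. v \<in> VV I m ==> F v \<in> VV I (m - 1)"
    "\<And>i. i \<in> I n ==> ev n i - s (D (ev n i)) - D (F (ev n i)) \<in> ?W" by auto
  have main: "v - s (D v) - D (F v) \<in> ?W" if "v \<in> VV I n" for v
    by (rule lin_on_basis[where G = "\<lambda>v. v - s (D v) - D (F v)", OF _ smod_J fin F(3) that])
      (intro lin_intros lin_comp[OF s(1) linD] lin_comp[OF linD F(1)])
  have JM: "v \<in> ?W ==> v \<in> pt M" for v :: "(int \<times> idx, 'r) vec" using pt_mono[OF J_M] by blast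
  show "coc M I D n \<subseteq> cob M I D n"
  proof
    fix v assume "v \<in> coc M I D n"
    then have v: "v \<in> VV I n" "D v \<in> pt M" by (auto simp: coc_def)
    have "s (D v) \<in> pt M" using cpx_ptK[OF X s(1) idl_M cpx_D[OF X v(1)] v(2)] .
    then have "v - s (D v) - D (F v) + s (D v) \<in> pt M" using JM[OF main[OF v(1)]] smod_add[OF smod_ptM] by blast
    then show "v \<in> cob M I D n" using v F(2) unfolding cob_def by (auto simp: algebra_simps)
  qed
  have "D (F (D v)) - D v \<in> ?W" if v: "v \<in> VV I (n - 1)" for v
  proof -
    have Dv: "D v \<in> VV I n" using cpx_D[OF X v] by simp
    have "s (D (D v)) \<in> ?W"
      using cpx_ptK[OF X s(1) idl_J cpx_D[OF X Dv] cpx_DD_J[OF X v]] .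
    from smod_minus[OF smod_J smod_add[OF smod_J main[OF Dv] this]] show ?thesis by (simp add: algebra_simps)
  qed
  then show "\<exists>s'. lin s' \<and> (\<forall>v\<in>VV I n. s' v \<in> VV I (n - 1)) \<and> (\<forall>v\<in>VV I (n - 1). D (s' (D v)) - D v \<in> ?W)"
    using F(1,2) by blast
qed

lemma acyclic_down:
  assumes X: "cpx c I D T" and ex: "\<And>n. exact_at c I D n" and "coc M I D n1 \<subseteq> cob M I D n1" "n \<le> n1"
  shows "coc M I D n \<subseteq> cob M I D n"
proof -
  have "\<exists>s. lin s \<and> (\<forall>v\<in>VV I (n1 - int k + 1). s v \<in> VV I (n1 - int k)) \<and>
      (\<forall>v\<in>VV I (n1 - int k). D (s (D v)) - D v \<in> pt (J c))" for k
  proof (induction k)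
    case 0 show ?case using splitting_exists[OF X assms(3)] by simp
  next
    case (Suc k)
    then obtain s where s: "lin s" "\<And>v. v \<in> VV I (n1 - int k + 1) ==> s v \<in> VV I (n1 - int k)"
      "\<And>v. v \<in> VV I (n1 - int k) ==> D (s (D v)) - D v \<in> pt (J c)" by blast
    have eq: "n1 - int (Suc k) = n1 - int k - 1" by simp
    show ?case using splitting_down(2)[OF X ex s] unfolding eq by simp
  qed
  from this[of "nat (n1 - n)"] assms(4)
  obtain s where "lin s" "\<And>v. v \<in> VV I (n + 1) ==> s v \<in> VV I n" "\<And>v. v \<in> VV I n ==> D (s (D v)) - D v \<in> pt (J c)"
    by auto
  from splitting_down(1)[OF X ex this] show ?thesis .
qed

lemma pol_cpx:
  assumes i: "i \<le> c" and X: "cpx i I D T" and p: "pol i T q p"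
  shows "lin p" and "\<And>v n. v \<in> VV I n ==> p v \<in> VV I (n + 2 * int q)"
    and "\<And>v n. v \<in> VV I n ==> D (p v) - p (D v) \<in> pt (J i)"
proof -
  note linD = cpx_linD[OF X]
  show lin: "lin p" using pol_lin[OF cpx_gm[OF i X] p] .
  have "v \<in> VV I n ==> p v \<in> VV I (n + 2 * int q) \<and> D (p v) - p (D v) \<in> pt (J i)" for v n
    using p
  proof (induction rule: pol.induct)
    case (pol_add q f g)
    then show ?case using smod_add[OF smod_J, where u = "D (f v) - f (D v)" and v = "D (g v) - g (D v)"]
      by (auto simp: smod_add[OF smod_VV] lin_simps[OF linD] algebra_simps)
  next
    case (pol_scl q f a)
    then show ?case using smod_scl[OF smod_J, where u = "D (f v) - f (D v)" and a = a]
      by (auto simp: smod_scl[OF smod_VV] lin_simps[OF linD] scl_simps)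
  next
    case (pol_op j q f)
    have f: "f v \<in> VV I (n + 2 * int q)" "D (f v) - f (D v) \<in> pt (J i)" "lin f"
      using pol_op pol_lin[OF cpx_gm[OF i X] pol_op(2)] by auto
    have fD: "f (D v) \<in> VV I (n + 2 * int q + 1)"
    proof -
      have "pol i T q f ==> u \<in> VV I m ==> f u \<in> VV I (m + 2 * int q)" for u m q f
      proof (induction rule: pol.induct)
        case (pol_op j q f)
        then show ?case using cpx_T[OF X pol_op(1), of "f u" "m + 2 * int q"] by (simp add: algebra_simps)
      qed (auto intro: smod_0[OF smod_VV] smod_add[OF smod_VV] smod_scl[OF smod_VV])
      from this[OF pol_op(2) cpx_D[OF X pol_op(4)]] show ?thesis by (simp add: algebra_simps)
    qed
    have "D (f v) - f (D v) \<in> VV I (n + 2 * int q + 1)" using smod_diff[OF smod_VV cpx_D[OF X f(1)] fD] .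
    from cpx_ptK[OF X cpx_linT[OF X pol_op(1)] idl_J this f(2)]
    have "T j (D (f v)) - T j (f (D v)) \<in> pt (J i)" by (simp add: lin_simps[OF cpx_linT[OF X pol_op(1)]])
    from smod_diff_trans[OF smod_J cpx_comm_D[OF i X pol_op(1) f(1)] this]
    show ?case using cpx_T[OF X pol_op(1) f(1)] by (simp add: algebra_simps)
  qed (auto simp: lin_simps[OF linD] smod_0[OF smod_J] smod_0[OF smod_VV])
  then show "\<And>v n. v \<in> VV I n ==> p v \<in> VV I (n + 2 * int q)"
    and "\<And>v n. v \<in> VV I n ==> D (p v) - p (D v) \<in> pt (J i)" by blast+
qed

text \<open>\<open>p\<close> commutes with \<open>D\<close> only modulo \<open>J c\<close>.
  Decomposing the commutator along the sequence yields the maps \<open>W j\<close>, which appear in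
  the square of \<open>DY\<close> and hence as off-diagonal parts of the operators on the
  cone.\<close>

lemma cone_exists:
  assumes X: "cpx c I D T" and p: "pol c T q p" and ex: "\<And>n. exact_at c I D n"
  defines "IY \<equiv> sumI 1 (2 * int q) I"
    and "DY \<equiv> \<lambda>v. mk 1 (2 * int q) (- D (prL 1 v)) (p (prL 1 v) + D (prR (2 * int q) v))"
  shows "\<exists>TY W. cpx c IY DY TY \<and> (\<forall>j v. TY j v = mk 1 (2 * int q) (T j (prL 1 v)) (W j (prL 1 v) + T j (prR (2 * int q) v)))
    \<and> (\<forall>j. lin (W j))"
    and "exact_at c IY DY n"
proof -
  note linD = cpx_linD[OF X] and linp = pol_cpx(1)[OF order_refl X p] and pV = pol_cpx(2)[OF order_refl X p]
    and pD = pol_cpx(3)[OF order_refl X p]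
  let ?q = "2 * int q"
  let ?L = "prL 1" and ?R = "prR ?q"
  have L: "v \<in> VV IY n ==> ?L v \<in> VV I (n + 1)" and R: "v \<in> VV IY n ==> ?R v \<in> VV I (n + ?q)" for v n
    unfolding IY_def by (rule VV_prL VV_prR; assumption)+
  have linDY: "lin DY" unfolding DY_def
    by (intro lin_mk lin_neg lin_plus lin_comp[OF linD] lin_comp[OF linp] lin_prL lin_prR)
  have DYV: "DY v \<in> VV IY (n + 1)" if v: "v \<in> VV IY n" for v n
    unfolding DY_def IY_def
  proof (rule VV_mk)
    show "- D (?L v) \<in> VV I (n + 1 + 1)" using cpx_D[OF X L[OF v]] smod_minus[OF smod_VV] by blast
    show "p (?L v) + D (?R v) \<in> VV I (n + 1 + ?q)"
      using cpx_D[OF X R[OF v]] pV[OF L[OF v]] by (intro smod_add[OF smod_VV]) (auto simp: algebra_simps)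
  qed
  have "\<exists>W. \<forall>j. lin (W j) \<and> (\<forall>n. \<forall>v\<in>VV I n. W j v \<in> VV I (n + (?q + 1))) \<and>
    (\<forall>n. \<forall>v\<in>VV I n. D (p v) - p (D v) - (\<Sum>j<c. scl (x j) (W j v)) \<in> pt K)"
  proof (rule lin_decompose)
    show "lin (\<lambda>v. D (p v) - p (D v))" by (intro lin_sub lin_comp[OF linD linp] lin_comp[OF linp linD])
    show "D (p v) - p (D v) \<in> VV I (n + (?q + 1))" if v: "v \<in> VV I n" for n v
      using cpx_D[OF X pV[OF v]] pV[OF cpx_D[OF X v]] by (intro smod_diff[OF smod_VV]) (auto simp: algebra_simps)
  qed (use idl_K cpx_fin[OF X] pD in auto)
  then obtain W where W: "\<And>j. lin (W j)" "\<And>j n v. v \<in> VV I n ==> W j v \<in> VV I (n + (?q + 1))"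
    "\<And>n v. v \<in> VV I n ==> D (p v) - p (D v) - (\<Sum>j<c. scl (x j) (W j v)) \<in> pt K" by blast
  define TY where "TY j v = mk 1 ?q (T j (?L v)) (W j (?L v) + T j (?R v))" for j v
  have "cpx c IY DY TY"
    unfolding cpx_def
  proof (intro conjI allI ballI impI)
    show "finite (IY n)" for n unfolding IY_def by (rule finite_sumI[OF cpx_fin[OF X]])
    fix j assume j: "j < c"
    show "lin (TY j)" unfolding TY_def[abs_def]
      by (intro lin_mk lin_plus lin_comp[OF cpx_linT[OF X j]] lin_comp[OF W(1)] lin_prL lin_prR)
    show "TY j v \<in> VV IY (n + 2)" if v: "v \<in> VV IY n" for n v
      unfolding TY_def IY_def
    proof (rule VV_mk)
      show "T j (?L v) \<in> VV I (n + 2 + 1)" using cpx_T[OF X j L[OF v]] by (simp add: algebra_simps)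
      show "W j (?L v) + T j (?R v) \<in> VV I (n + 2 + ?q)"
        using cpx_T[OF X j R[OF v]] W(2)[OF L[OF v], of j]
        by (intro smod_add[OF smod_VV]) (auto simp: algebra_simps)
    qed
  next
    fix n and v :: "(int \<times> idx, 'r) vec" assume v: "v \<in> VV IY n"
    have "DY (DY v) = mk 1 ?q (D (D (?L v))) ((D (p (?L v)) - p (D (?L v))) + D (D (?R v)))"
      by (simp add: DY_def lin_simps[OF linD] lin_simps[OF linp]) (simp add: algebra_simps)
    moreover have "(\<Sum>j<c. scl (x j) (TY j v)) = mk 1 ?q (\<Sum>j<c. scl (x j) (T j (?L v)))
        ((\<Sum>j<c. scl (x j) (W j (?L v))) + (\<Sum>j<c. scl (x j) (T j (?R v))))"
      by (simp add: TY_def mk_sum mk_scl[symmetric] scl_simps sum.distrib[symmetric])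
    ultimately have "DY (DY v) - (\<Sum>j<c. scl (x j) (TY j v)) = mk 1 ?q (D (D (?L v)) - (\<Sum>j<c. scl (x j) (T j (?L v))))
        ((D (p (?L v)) - p (D (?L v)) - (\<Sum>j<c. scl (x j) (W j (?L v)))) +
         (D (D (?R v)) - (\<Sum>j<c. scl (x j) (T j (?R v)))))"
      by (simp add: mk_diff[symmetric] algebra_simps)
    then show "DY (DY v) - (\<Sum>j<c. scl (x j) (TY j v)) \<in> pt K"
      using cpx_DD[OF X L[OF v]] W(3)[OF L[OF v]] cpx_DD[OF X R[OF v]]
      by (simp add: mk_pt[OF idl_K] smod_add[OF smod_ptK])
  qed (use linDY DYV in auto)
  then show "\<exists>TY W. cpx c IY DY TY \<and> (\<forall>j v. TY j v = mk 1 ?q (T j (?L v)) (W j (?L v) + T j (?R v))) \<and> (\<forall>j. lin (W j))"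
    using TY_def W(1) by blast
  show "exact_at c IY DY n"
    unfolding exact_at_def
  proof (intro ballI impI)
    fix v assume v: "v \<in> VV IY n" and "DY v \<in> pt (J c)"
    then have D: "- D (?L v) \<in> pt (J c)" "p (?L v) + D (?R v) \<in> pt (J c)"
      by (simp_all add: DY_def mk_pt[OF idl_J])
    have "D (?L v) \<in> pt (J c)" using smod_minus[OF smod_J D(1)] by simp
    \<comment> \<open>Exactness is used twice: first the component under \<open>D\<close> is a
      boundary \<open>D a\<close>, then \<open>?R v + p a\<close> is a cycle and equals some
      \<open>D b\<close>; the required preimage is \<open>(- a, b)\<close>.\<close>
    then obtain a where a: "a \<in> VV I n" "?L v - D a \<in> pt (J c)"
      using ex[of "n + 1"] L[OF v] unfolding exact_at_def by auto
    have Da: "?L v - D a \<in> VV I (n + 1)" using smod_diff[OF smod_VV L[OF v] cpx_D[OF X a(1)]] .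
    have 1: "p (?L v) - p (D a) \<in> pt (J c)"
      using cpx_ptK[OF X linp idl_J Da a(2)] by (simp add: lin_simps[OF linp])
    have 2: "D (p a) - p (D a) \<in> pt (J c)" by (rule pD[OF a(1)])
    have "p (?L v) + D (?R v) - (p (?L v) - p (D a)) + (D (p a) - p (D a)) \<in> pt (J c)"
      by (rule smod_add[OF smod_J smod_diff[OF smod_J D(2) 1] 2])
    then have "D (?R v + p a) \<in> pt (J c)" by (simp add: lin_simps[OF linD] algebra_simps)
    moreover have "?R v + p a \<in> VV I (n + ?q)" using smod_add[OF smod_VV R[OF v] pV[OF a(1)]] .
    ultimately obtain b where b: "b \<in> VV I (n + ?q - 1)" "?R v + p a - D b \<in> pt (J c)"
      using ex unfolding exact_at_def by blast
    let ?w = "mk 1 ?q (- a) b"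
    have "?w \<in> VV IY (n - 1)"
      unfolding IY_def by (rule VV_mk) (use a(1) b(1) smod_minus[OF smod_VV] in \<open>auto simp: algebra_simps\<close>)
    moreover have "v - DY ?w = mk 1 ?q (?L v - D a) (?R v + p a - D b)"
      by (subst mk_pr[OF v[unfolded IY_def], symmetric])
        (simp add: DY_def mk_diff[symmetric] lin_simps[OF linD] lin_simps[OF linp] algebra_simps)
    ultimately show "\<exists>w\<in>VV IY (n - 1). v - DY w \<in> pt (J c)"
      using a(2) b(2) by (metis mk_pt[OF idl_J])
  qed
qed

abbreviation hdim where
  "hdim I D n \<equiv> rdim (cob M I D n) (coc M I D n)"

text \<open>The positive side is controlled in high degrees only, where \<open>p\<close> is
  injective and the cone sees no more than the cokernel of \<open>p\<close>. The inequality used on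
  the negative side needs no injectivity, since the kernel of \<open>p\<close> is a quotient of the
  cohomology of the cone.\<close>

theorem growth_transfer:
  assumes "cpx c I D T" "\<And>n. exact_at c I D n" "\<exists>n1. gens c (coc M I D) (cob M I D) T n1"
    and "growth_le t (hdim I D)"
  shows "growth_le t (\<lambda>n. hdim I D (- n))"
  using assms
proof (induction t arbitrary: I D T)
  case 0
  note gm = cpx_gm[OF order_refl 0(1)]
  obtain n0 where n0: "\<And>n. n \<ge> n0 ==> hdim I D n = 0" using 0(4) by (auto simp: growth_le_0)
  have "coc M I D n0 \<subseteq> cob M I D n0" using rdim_zero_imp[OF gm_fd[OF gm] n0] by blast
  then have "coc M I D n \<subseteq> cob M I D n" if "n \<le> n0" for n using acyclic_down[OF 0(1,2)] that by blast
  then have "hdim I D n = 0" if "n \<le> n0" for n using rdim_self[OF gm_N[OF gm]] that by blast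
  then show ?case unfolding growth_le_0 by (intro exI[of _ "- n0"]) simp
next
  case (Suc t)
  note X = Suc.prems(1) and ex = Suc.prems(2)
  note gm = cpx_gm[OF order_refl X] and linD = cpx_linD[OF X] and fin = cpx_fin[OF X]
  obtain n1 where n1: "gens c (coc M I D) (cob M I D) T n1" using Suc.prems(3) by blast
  define Z where "Z n = (if n < n1 then cob M I D n else coc M I D n)" for n
  have fg: "fg c Z (cob M I D) T" using fg_truncate[OF gm n1] by (simp add: Z_def[abs_def])
  obtain q p n0 where p: "q \<ge> 1" "pol c T q p" and
    reg: "\<And>n v. n \<ge> n0 ==> v \<in> Z n ==> p v \<in> cob M I D (n + 2 * int q) ==> v \<in> cob M I D n"
    using filter_regular[OF fg] by blast
  let ?q = "2 * int q"
  let ?L = "prL 1" and ?R = "prR ?q" and ?mk = "mk 1 ?q"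
  note linp = pol_cpx(1)[OF order_refl X p(2)] and pV = pol_cpx(2)[OF order_refl X p(2)]
    and pD = pol_cpx(3)[OF order_refl X p(2)]
  define IY where "IY = sumI 1 ?q I"
  define DY where "DY = (\<lambda>v. ?mk (- D (?L v)) (p (?L v) + D (?R v)))"
  obtain TY W where Y: "cpx c IY DY TY" and TY: "\<And>j v. TY j v = ?mk (T j (?L v)) (W j (?L v) + T j (?R v))"
    and linW: "\<And>j. lin (W j)"
    using cone_exists(1)[OF X p(2) ex] unfolding IY_def DY_def by blast
  have exY: "exact_at c IY DY n" for n
    using cone_exists(2)[OF X p(2) ex] unfolding IY_def DY_def .
  note gmY = cpx_gm[OF order_refl Y]
  have L: "v \<in> VV IY n ==> ?L v \<in> VV I (n + 1)" and R: "v \<in> VV IY n ==> ?R v \<in> VV I (n + ?q)" for v n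
    unfolding IY_def by (rule VV_prL VV_prR; assumption)+
  have JM: "v \<in> pt (J c) ==> v \<in> pt M" for v :: "(int \<times> idx, 'r) vec" using pt_mono[OF J_M] by blast
  have pDM: "D (p v) - p (D v) \<in> pt M" if "v \<in> VV I n" for v n using JM[OF pD[OF that]] .
  have pM: "p v \<in> pt M" if "v \<in> VV I n" "v \<in> pt M" for v n using cpx_ptK[OF X linp idl_M that] .
  have mkV: "?mk a b \<in> VV IY n" if "a \<in> VV I (n + 1)" "b \<in> VV I (n + ?q)" for a b n
    unfolding IY_def using VV_mk[OF that] .
  have DYmk: "DY (?mk a b) = ?mk (- D a) (p a + D b)" for a b by (simp add: DY_def)
  have lin0: "lin (\<lambda>b. ?mk 0 b)" by (intro lin_mk lin_0 lin_id)
  have cocY: "?mk 0 b \<in> coc M IY DY n" if "b \<in> coc M I D (n + ?q)" for b n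
    using that mkV[OF smod_0[OF smod_VV]]
    by (auto simp: coc_def DYmk mk_pt[OF idl_M] lin_zero[OF linD] lin_zero[OF linp] smod_0[OF smod_ptM])
  have N': "b \<in> VV I (n + ?q) ==> \<exists>z\<in>coc M I D n. b - p z \<in> cob M I D (n + ?q) ==> ?mk 0 b \<in> cob M IY DY n" for b n
  proof -
    assume bV: "b \<in> VV I (n + ?q)" and "\<exists>z\<in>coc M I D n. b - p z \<in> cob M I D (n + ?q)"
    then obtain z w where z: "z \<in> VV I n" "D z \<in> pt M" "w \<in> VV I (n + ?q - 1)" "b - p z - D w \<in> pt M"
      by (auto simp: coc_def cob_def)
    have "?mk z w \<in> VV IY (n - 1)" by (rule mkV) (use z in \<open>auto simp: algebra_simps\<close>)
    moreover have "?mk 0 b - DY (?mk z w) \<in> pt M"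
      unfolding DYmk mk_diff[symmetric] mk_pt[OF idl_M] using z by (simp add: diff_diff_eq)
    ultimately show ?thesis using mkV[OF smod_0[OF smod_VV] bV] unfolding cob_def by blast
  qed
  \<comment> \<open>The first component of a cocycle of the cone is annihilated by \<open>p\<close>
    in cohomology, hence in high degrees a coboundary \<open>D w\<close>. Subtracting the
    differential of \<open>(- w, 0)\<close> leaves a class from the second summand.\<close>
  have surj: "\<exists>b\<in>coc M I D (n + ?q). y - ?mk 0 b \<in> cob M IY DY n"
    if n: "n \<ge> max n0 n1" and y: "y \<in> coc M IY DY n" for y n
  proof -
    have yV: "y \<in> VV IY n" and Dy: "- D (?L y) \<in> pt M" "p (?L y) + D (?R y) \<in> pt M"
      using y by (auto simp: coc_def DY_def mk_pt[OF idl_M])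
    have DL: "D (?L y) \<in> pt M" using smod_minus[OF smod_ptM Dy(1)] by simp
    have "?L y \<in> coc M I D (n + 1)" using L[OF yV] DL by (simp add: coc_def)
    then have LZ: "?L y \<in> Z (n + 1)" using n by (simp add: Z_def)
    have "p (?L y) \<in> cob M I D (n + 1 + ?q)"
      unfolding cob_def using pV[OF L[OF yV]] R[OF yV] smod_minus[OF smod_VV] Dy(2)
      by (auto intro!: bexI[of _ "- ?R y"] simp: lin_minus[OF linD] algebra_simps)
    then have "?L y \<in> cob M I D (n + 1)" using reg[OF _ LZ] n by simp
    then obtain w where w: "w \<in> VV I n" "?L y - D w \<in> pt M" by (auto simp: cob_def)
    define b where "b = ?R y + p w"
    have bV: "b \<in> VV I (n + ?q)" unfolding b_def using smod_add[OF smod_VV R[OF yV] pV[OF w(1)]] .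
    have "p (?L y) - p (D w) \<in> pt M"
      using pM[OF smod_diff[OF smod_VV L[OF yV] cpx_D[OF X w(1)]] w(2)] by (simp add: lin_simps[OF linp])
    from smod_add[OF smod_ptM smod_diff[OF smod_ptM Dy(2) this] pDM[OF w(1)]]
    have "D b \<in> pt M" by (simp add: b_def lin_simps[OF linD] algebra_simps)
    then have bc: "b \<in> coc M I D (n + ?q)" using bV by (simp add: coc_def)
    have "?mk (- w) 0 \<in> VV IY (n - 1)"
      by (rule mkV) (use w smod_minus[OF smod_VV] smod_0[OF smod_VV] in \<open>auto simp: algebra_simps\<close>)
    moreover have "y - ?mk 0 b - DY (?mk (- w) 0) = ?mk (?L y - D w) 0"
      by (subst mk_pr[OF yV[unfolded IY_def], symmetric])
        (simp add: DYmk mk_diff[symmetric] b_def lin_simps[OF linD] lin_simps[OF linp])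
    then have "y - ?mk 0 b - DY (?mk (- w) 0) \<in> pt M" using w(2) by (simp add: mk_pt[OF idl_M] smod_0[OF smod_ptM])
    moreover have "y - ?mk 0 b \<in> VV IY n" using smod_diff[OF smod_VV yV mkV[OF smod_0[OF smod_VV] bV]] .
    ultimately have "y - ?mk 0 b \<in> cob M IY DY n" unfolding cob_def by blast
    then show ?thesis using bc by blast
  qed
  \<comment> \<open>In high degrees the cohomology of the cone is the image of that of
    \<open>X\<close>, and the operators of the cone restrict to the \<open>T j\<close> on the second
    summand, so generation is inherited.\<close>
  have gensY: "gens c (coc M IY DY) (cob M IY DY) TY (max n0 n1 + 2)"
    unfolding gens_def
  proof (intro allI impI ballI)
    fix n y assume n: "max n0 n1 + 2 \<le> n" and y: "y \<in> coc M IY DY n"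
    obtain b where b: "b \<in> coc M I D (n + ?q)" "y - ?mk 0 b \<in> cob M IY DY n" using surj[OF _ y] n by (meson le_add_same_cancel1 order_trans zero_le_numeral)
    have n1q: "n1 \<le> n + ?q" using n by simp
    obtain f where f: "\<forall>j<c. f j \<in> coc M I D (n + ?q - 2)" "b - (\<Sum>j<c. T j (f j)) \<in> cob M I D (n + ?q)"
      using n1[unfolded gens_def, rule_format, OF n1q b(1)] by blast
    let ?d = "b - (\<Sum>j<c. T j (f j))"
    have "?mk 0 ?d \<in> cob M IY DY n"
    proof (rule N')
      show "?d \<in> VV I (n + ?q)" using f(2) by (simp add: cob_def)
      show "\<exists>z\<in>coc M I D n. ?d - p z \<in> cob M I D (n + ?q)"
        using f(2) smod_0[OF gm_Z[OF gm]] by (intro bexI[of _ 0]) (simp_all add: lin_zero[OF linp])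
    qed
    moreover have "?mk 0 ?d = ?mk 0 b - (\<Sum>j<c. TY j (?mk 0 (f j)))"
    proof -
      have "(\<Sum>j<c. TY j (?mk 0 (f j))) = ?mk (\<Sum>j<c. T j 0) (\<Sum>j<c. W j 0 + T j (f j))"
        by (simp add: TY mk_sum)
      also have "(\<Sum>j<c. T j 0) = 0" by (rule sum.neutral) (simp add: lin_zero[OF cpx_linT[OF X]])
      also have "(\<Sum>j<c. W j 0 + T j (f j)) = (\<Sum>j<c. T j (f j))" by (simp add: lin_zero[OF linW])
      finally show ?thesis by (simp add: mk_diff[symmetric])
    qed
    ultimately have "?mk 0 b - (\<Sum>j<c. TY j (?mk 0 (f j))) \<in> cob M IY DY n" by simp
    from smod_diff_trans[OF gm_N[OF gmY] b(2) this]
    have "y - (\<Sum>j<c. TY j (?mk 0 (f j))) \<in> cob M IY DY n" .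
    moreover have "\<forall>j<c. ?mk 0 (f j) \<in> coc M IY DY (n - 2)" using f(1) by (auto intro!: cocY simp: add_diff_eq diff_add_eq)
    ultimately show "\<exists>f. (\<forall>j<c. f j \<in> coc M IY DY (n - 2)) \<and> y - (\<Sum>j<c. TY j (f j)) \<in> cob M IY DY n"
      by (intro exI[of _ "\<lambda>j. ?mk 0 (f j)"]) blast
  qed
  have "growth_le (Suc t) (\<lambda>n. rdim (cob M I D n) (Z n))"
    by (rule growth_le_mono[OF Suc.prems(4), of n1]) (simp add: Z_def)
  note gr0 = this
  define N'' where "N'' n = {z. \<exists>y\<in>Z (n - ?q). z - p y \<in> cob M I D n}" for n
  have gr: "growth_le t (\<lambda>n. rdim (N'' n) (Z n))"
    unfolding N''_def by (rule growth_le_regular_quotient[OF fg p(2,1) _ gr0]) (rule reg)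
  have gr': "growth_le t (\<lambda>n. rdim (N'' (n + ?q)) (Z (n + ?q)))"
    using growth_le_shift[OF gr, of ?q] .
  have grY: "growth_le t (hdim IY DY)"
  proof (rule growth_le_mono[OF gr', of "max n0 n1"])
    fix n assume n: "max n0 n1 \<le> n"
    have Zn: "Z (n + ?q) = coc M I D (n + ?q)" "Z (n + ?q - ?q) = coc M I D n" using n by (auto simp: Z_def)
    show "hdim IY DY n \<le> rdim (N'' (n + ?q)) (Z (n + ?q))"
    proof (rule rdim_surj(1)[where \<phi> = "\<lambda>b. ?mk 0 b"])
      have "cob M I D (n + ?q) \<subseteq> N'' (n + ?q)"
        unfolding N''_def Zn using smod_0[OF gm_Z[OF gm]] by (auto intro!: bexI[of _ 0] simp: lin_zero[OF linp])
      then show "fdim (N'' (n + ?q)) (Z (n + ?q))" using fdim_mono[OF gm_fd[OF gm]] unfolding Zn by blast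
      show "?mk 0 b \<in> cob M IY DY n" if b: "b \<in> N'' (n + ?q)" for b
      proof -
        obtain z where z: "z \<in> coc M I D n" "b - p z \<in> cob M I D (n + ?q)" using b unfolding N''_def Zn by blast
        have "p z \<in> VV I (n + ?q)" using pV z(1) by (simp add: coc_def)
        moreover have "b - p z \<in> VV I (n + ?q)" using z(2) by (simp add: cob_def)
        ultimately have "b \<in> VV I (n + ?q)" using smod_diff_cancel[OF smod_VV] by blast
        then show ?thesis using N' z by blast
      qed
    qed (use lin0 gm_N[OF gmY] cocY surj[OF n] Zn in auto)
  qed
  have IH: "growth_le t (\<lambda>n. hdim IY DY (- n))" using Suc.IH[OF Y exY _ grY] gensY by blast
  \<comment> \<open>Valid in every degree: modulo the kernel of \<open>p\<close> the cohomology
    embeds into degree \<open>n + ?q\<close>, and the kernel is the image of the cohomology of the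
    cone in degree \<open>n - 1\<close>.\<close>
  have step: "hdim I D n \<le> hdim I D (n + ?q) + hdim IY DY (n - 1)" for n
  proof -
    define Ker where "Ker = {z \<in> coc M I D n. p z \<in> cob M I D (n + ?q)}"
    have smK: "smod Ker" unfolding smod_def Ker_def
      by (auto simp: lin_simps[OF linp] smod_0[OF gm_Z[OF gm]] smod_0[OF gm_N[OF gm]] smod_add[OF gm_Z[OF gm]]
          smod_add[OF gm_N[OF gm]] smod_scl[OF gm_Z[OF gm]] smod_scl[OF gm_N[OF gm]])
    have NK: "cob M I D n \<subseteq> Ker" unfolding Ker_def using gm_NZ[OF gm] pol_N[OF gm p(2)] by blast
    have KZ: "Ker \<subseteq> coc M I D n" by (auto simp: Ker_def)
    have fdK: "fdim Ker (coc M I D n)" using fdim_mono[OF gm_fd[OF gm] NK] .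
    have fdNK: "fdim (cob M I D n) Ker" using fdim_sub[OF gm_fd[OF gm] gm_N[OF gm] smK KZ gm_M[OF gm]] .
    have 1: "hdim I D n \<le> rdim (cob M I D n) Ker + rdim Ker (coc M I D n)"
      using rdim_subadd(1)[OF fdNK fdK gm_N[OF gm] smK KZ] .
    have 2: "rdim Ker (coc M I D n) \<le> hdim I D (n + ?q)"
    proof (rule rdim_inj[where \<phi> = p])
      show "scl a w \<in> Ker" if "a \<in> M" "w \<in> coc M I D n" for a w using NK gm_M[OF gm that] by blast
      show "w \<in> Ker" if "w \<in> coc M I D n" "p w \<in> cob M I D (n + ?q)" for w using that by (simp add: Ker_def)
    qed (use fdK smK gm_Z[OF gm] gm_M[OF gm] gm_fd[OF gm] gm_N[OF gm] linp pol_Z[OF gm p(2)] in auto)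
    have 3: "rdim (cob M I D n) Ker \<le> hdim IY DY (n - 1)"
    proof (rule rdim_surj(1)[where \<phi> = ?L])
      show "fdim (cob M IY DY (n - 1)) (coc M IY DY (n - 1))" by (rule gm_fd[OF gmY])
      show "lin ?L" by (rule lin_prL)
      show "smod (cob M I D n)" by (rule gm_N[OF gm])
      show "?L y \<in> Ker" if y: "y \<in> coc M IY DY (n - 1)" for y
      proof -
        have yV: "y \<in> VV IY (n - 1)" and Dy: "- D (?L y) \<in> pt M" "p (?L y) + D (?R y) \<in> pt M"
          using y by (auto simp: coc_def DY_def mk_pt[OF idl_M])
        have LV: "?L y \<in> VV I n" and RV: "?R y \<in> VV I (n + ?q - 1)" using L[OF yV] R[OF yV] by (auto simp: algebra_simps)
        have "p (?L y) \<in> cob M I D (n + ?q)"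
          unfolding cob_def using pV[OF LV] RV smod_minus[OF smod_VV] Dy(2)
          by (auto intro!: bexI[of _ "- ?R y"] simp: lin_minus[OF linD])
        moreover have "D (?L y) \<in> pt M" using smod_minus[OF smod_ptM Dy(1)] by simp
        ultimately show ?thesis using LV by (simp add: Ker_def coc_def)
      qed
      show "?L y \<in> cob M I D n" if y: "y \<in> cob M IY DY (n - 1)" for y
      proof -
        obtain w where w: "w \<in> VV IY (n - 1 - 1)" "y - DY w \<in> pt M" and yV: "y \<in> VV IY (n - 1)"
          using y by (auto simp: cob_def)
        have "?L (y - DY w) \<in> pt M" using w(2) by (auto simp: pt_def)
        then have "?L y - D (- ?L w) \<in> pt M" by (simp add: lin_simps[OF lin_prL] DY_def lin_simps[OF linD])
        moreover have "?L y \<in> VV I n" "- ?L w \<in> VV I (n - 1)" using L[OF yV] L[OF w(1)] smod_minus[OF smod_VV] by auto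
        ultimately show ?thesis unfolding cob_def by blast
      qed
      show "\<exists>y\<in>coc M IY DY (n - 1). z - ?L y \<in> cob M I D n" if z: "z \<in> Ker" for z
      proof -
        obtain w where w: "z \<in> VV I n" "D z \<in> pt M" "w \<in> VV I (n + ?q - 1)" "p z - D w \<in> pt M"
          using z by (auto simp: Ker_def coc_def cob_def)
        have "?mk z (- w) \<in> VV IY (n - 1)"
          by (rule mkV) (use w smod_minus[OF smod_VV] in \<open>auto simp: algebra_simps\<close>)
        moreover have "DY (?mk z (- w)) \<in> pt M"
          using w smod_minus[OF smod_ptM] by (auto simp: DYmk mk_pt[OF idl_M] lin_minus[OF linD])
        ultimately have "?mk z (- w) \<in> coc M IY DY (n - 1)" by (simp add: coc_def)
        then show ?thesis using smod_0[OF gm_N[OF gm]] by (intro bexI[of _ "?mk z (- w)"]) simp_all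
      qed
    qed
    show ?thesis using 1 2 3 by linarith
  qed
  show ?case
  \<comment> \<open>After the reflection \<open>n \<mapsto> - n\<close> the inequality
    \<open>step\<close> descends by \<open>?q\<close>, as \<open>growth_le_sum\<close>
    requires.\<close>
  proof (rule growth_le_sum[where L = ?q and k = "\<lambda>n. hdim IY DY (- n - 1)"])
    show "growth_le t (\<lambda>n. hdim IY DY (- n - 1))"
      using growth_le_shift[OF IH, of 1] by (simp add: algebra_simps)
    show "1 \<le> ?q" using p(1) by simp
    show "hdim I D (- n) \<le> hdim I D (- (n - ?q)) + hdim IY DY (- n - 1)" for n
      using step[of "- n"] by (simp add: algebra_simps)
  qed
qed

end

section \<open>Finite generation over the cohomology operators\<close>

text \<open>Extensions of linear maps obtained from exactness carry no information about degrees.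
  Projection puts their values into degree \<open>n\<close> and preserves congruences whose other
  side is already there.\<close>

definition prj :: "(int => idx set) => int => (int \<times> idx, 'r::comm_ring_1) vec => (int \<times> idx, 'r) vec" where
  "prj I n v = Vec (\<lambda>p. if fst p = n \<and> snd p \<in> I n then ix v p else 0)"

lemma lin_prj: "lin (prj I n)"
  by (rule linI; rule vec_eqI) (auto simp: prj_def)

lemma prj_VV: "prj I n v \<in> VV I n"
  by (auto simp: prj_def VV_def)

lemma prj_id: "v \<in> VV I n ==> prj I n v = v"
  by (rule vec_eqI) (auto simp: prj_def VV_def)

lemma prj_pt: "idl L ==> v \<in> pt L ==> prj I n v \<in> pt L"
  by (auto simp: prj_def pt_def idl_0)

lemma prj_cong:
  assumes "idl L" "u - w \<in> pt L" "u \<in> VV I n"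
  shows "u - prj I n w \<in> pt L"
proof -
  have "prj I n (u - w) \<in> pt L" using prj_pt assms by blast
  then show ?thesis by (simp add: lin_diff[OF lin_prj] prj_id[OF assms(3)])
qed

text \<open>Exactness of the dual complex, tested on linear maps.\<close>

definition coex :: "'r::comm_ring_1 set => (int => idx set) => ((int \<times> idx, 'r) vec => (int \<times> idx, 'r) vec) => int => bool" where
  "coex L I D n \<longleftrightarrow> (\<forall>G::(int \<times> idx, 'r) vec => (int \<times> idx, 'r) vec. lin G --> (\<forall>v\<in>VV I (n - 1). G (D v) \<in> pt L) -->
     (\<exists>G'. lin G' \<and> (\<forall>v\<in>VV I n. G v - G' (D v) \<in> pt L)))"

lemma lin_decompose_last:
  fixes G :: "(int \<times> idx, 'r::comm_ring_1) vec => (int \<times> idx, 'r) vec"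
  assumes "lin G" "idl K" "finite (I n)" "\<And>v. v \<in> VV I n ==> G v \<in> pt (Jx K x (Suc i))"
  shows "\<exists>W. lin W \<and> (\<forall>v\<in>VV I n. G v - scl (x i) (W v) \<in> pt (Jx K x i))"
proof -
  have "\<forall>k. \<exists>w. k \<in> I n --> G (ev n k) - scl (x i) w \<in> pt (Jx K x i)"
  proof
    fix k show "\<exists>w. k \<in> I n --> G (ev n k) - scl (x i) w \<in> pt (Jx K x i)"
    proof (cases "k \<in> I n")
      case True
      have "\<forall>p. \<exists>b. ix (G (ev n k)) p - x i * b \<in> Jx K x i"
        using ptD[OF assms(4)[OF ev_VV[of k I n, OF True]]] unfolding Jx_Suc by blast
      then obtain b where "\<And>p. ix (G (ev n k)) p - x i * b p \<in> Jx K x i" by metis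
      then show ?thesis by (intro exI[of _ "Vec b"]) (simp add: pt_def)
    qed simp
  qed
  from choice[OF this] obtain w where w: "\<And>k. k \<in> I n ==> G (ev n k) - scl (x i) (w k) \<in> pt (Jx K x i)" by blast
  define W where "W v = (\<Sum>k\<in>I n. scl (ix v (n, k)) (w k))" for v
  have linW: "lin W"
    by (rule linI) (simp_all add: W_def scl_simps sum.distrib scl_sum)
  have Wev: "W (ev n k) = w k" if k: "k \<in> I n" for k
  proof -
    have "W (ev n k) = (\<Sum>k'\<in>I n. if k' = k then w k' else 0)"
      unfolding W_def by (rule sum.cong) (auto simp: ix_ev scl_simps)
    then show ?thesis using assms(3) k by simp
  qed
  have lG: "lin (\<lambda>v. G v - scl (x i) (W v))" by (intro lin_sub assms(1) lin_scl_map linW)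
  have "G v - scl (x i) (W v) \<in> pt (Jx K x i)" if "v \<in> VV I n" for v
  proof (rule lin_on_basis[where G = "\<lambda>v. G v - scl (x i) (W v)", OF lG smod_pt[OF idl_Jx[OF assms(2)]] assms(3) _ that])
    show "G (ev n k) - scl (x i) (W (ev n k)) \<in> pt (Jx K x i)" if "k \<in> I n" for k
      using w[OF that] Wev[OF that] by simp
  qed
  then show ?thesis using linW by blast
qed

text \<open>A finite projective resolution, dualized; the projective modules are the images of the
  idempotents \<open>e\<close> on free modules.\<close>

definition fin_res :: "'r::comm_ring_1 set => (int => idx set) => ((int \<times> idx, 'r) vec => (int \<times> idx, 'r) vec)
    => ((int \<times> idx, 'r) vec => (int \<times> idx, 'r) vec) => int => bool" where
  "fin_res K IF dl e N \<longleftrightarrow> (\<forall>n. finite (IF n)) \<and> lin dl \<and> lin e \<and>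
     (\<forall>n. \<forall>v\<in>VV IF n. dl v \<in> VV IF (n + 1) \<and> e v \<in> VV IF n \<and> e (e v) - e v \<in> pt K \<and>
        dl (dl v) \<in> pt K \<and> dl (e v) - dl v \<in> pt K \<and> e (dl v) - dl v \<in> pt K \<and> (n > N --> e v \<in> pt K)) \<and>
     (\<forall>n\<ge>1. \<forall>G::(int \<times> idx, 'r) vec => (int \<times> idx, 'r) vec. lin G --> (\<forall>v\<in>VV IF (n - 1). G (dl v) \<in> pt K) -->
        (\<exists>G'. lin G' \<and> (\<forall>v\<in>VV IF n. G (e v) - G' (dl v) \<in> pt K)))"

section \<open>Comparison with a finite resolution and induction along the regular sequence\<close>

context local_quotient
begin

text \<open>The data of chain maps between the resolution given by the complex and the finite one, in
  degrees \<open>0\<close> and \<open>1\<close>, whose composite is homotopic to the identity in degree \<open>0\<close>.\<close>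

definition aug where
  "aug i I D IF dl e Zt f1 \<xi> g G1 s0 \<longleftrightarrow> lin Zt \<and> lin f1 \<and> (\<forall>j<i. lin (\<xi> j)) \<and> lin g \<and> lin G1 \<and> lin s0 \<and>
     (\<forall>w\<in>VV IF 0. Zt w \<in> VV I 0 \<and> Zt (e w) - Zt w \<in> pt K \<and> D (Zt w) - f1 (dl w) \<in> pt K \<and>
        (\<forall>j<i. scl (x j) (Zt w) - \<xi> j (dl w) \<in> pt K)) \<and>
     (\<forall>w\<in>VV IF 1. f1 w \<in> VV I 1 \<and> (\<forall>j<i. \<xi> j w \<in> VV I 0)) \<and>
     (\<forall>u\<in>VV I 0. g u \<in> VV IF 0 \<and> dl (g u) - G1 (D u) \<in> pt (J i) \<and> u - Zt (g u) - s0 (D u) \<in> pt (J i)) \<and>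
     (\<forall>u\<in>VV I 1. G1 u \<in> VV IF 1 \<and> s0 u \<in> VV I 0)"

text \<open>Comparison maps \<open>h\<close> from the complex to the dualized finite resolution and
  \<open>f\<close> back have a composite homotopic to the identity. Above degree \<open>N\<close>
  the composite is zero modulo \<open>K\<close>, and the homotopy becomes a contraction on cocycles
  modulo \<open>M\<close>.\<close>

lemma finite_resolution_acyclic:
  assumes X: "cpx 0 I D T" and coex: "\<And>n. n \<ge> 1 ==> coex K I D n"
    and F: "fin_res K IF dl e N" and aug: "aug 0 I D IF dl e Zt f1 \<xi> g G1 s0"
    and n: "n \<ge> 1" "n > N"
  shows "coc M I D n \<subseteq> cob M I D n"
proof -
  note linD = cpx_linD[OF X] and fin = cpx_fin[OF X]
  let ?W = "pt K"
  have linF: "lin dl" "lin e" and finF: "finite (IF n)"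
    and dlV: "v \<in> VV IF n ==> dl v \<in> VV IF (n + 1)" and eV: "v \<in> VV IF n ==> e v \<in> VV IF n"
    and ee: "v \<in> VV IF n ==> e (e v) - e v \<in> ?W" and dd: "v \<in> VV IF n ==> dl (dl v) \<in> ?W"
    and de: "v \<in> VV IF n ==> dl (e v) - dl v \<in> ?W" and ed: "v \<in> VV IF n ==> e (dl v) - dl v \<in> ?W"
    and eN: "v \<in> VV IF n ==> n > N ==> e v \<in> ?W" for v n
    using F unfolding fin_res_def by blast+
  have coexF: "\<exists>G'. lin G' \<and> (\<forall>v\<in>VV IF n. G (e v) - G' (dl v) \<in> ?W)"
    if "n \<ge> 1" "lin G" "\<And>v. v \<in> VV IF (n - 1) ==> G (dl v) \<in> ?W" for n and G :: "(int \<times> idx, 'r) vec => (int \<times> idx, 'r) vec"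
    using F that unfolding fin_res_def by blast
  have coexX: "\<exists>G'. lin G' \<and> (\<forall>v\<in>VV I n. G v - G' (D v) \<in> ?W)"
    if "n \<ge> 1" "lin G" "\<And>v. v \<in> VV I (n - 1) ==> G (D v) \<in> ?W" for n and G :: "(int \<times> idx, 'r) vec => (int \<times> idx, 'r) vec"
    using coex[OF that(1)] that(2,3) unfolding coex_def by blast
  have aug_lin: "lin Zt" "lin f1" "lin g" "lin G1" "lin s0"
    and Z0: "w \<in> VV IF 0 ==> Zt w \<in> VV I 0" "w \<in> VV IF 0 ==> Zt (e w) - Zt w \<in> ?W"
      "w \<in> VV IF 0 ==> D (Zt w) - f1 (dl w) \<in> ?W" "w \<in> VV IF 1 ==> f1 w \<in> VV I 1"
    and g0: "u \<in> VV I 0 ==> g u \<in> VV IF 0" "u \<in> VV I 0 ==> dl (g u) - G1 (D u) \<in> ?W"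
      "u \<in> VV I 0 ==> u - Zt (g u) - s0 (D u) \<in> ?W" "u \<in> VV I 1 ==> G1 u \<in> VV IF 1" "u \<in> VV I 1 ==> s0 u \<in> VV I 0"
    for w u
    using aug unfolding aug_def Jx_0 by blast+
  have ptI: "G v \<in> ?W" if "lin G" "v \<in> VV I n" "v \<in> ?W" for G :: "(int \<times> idx, 'r) vec => (int \<times> idx, 'r) vec" and v n
    using lin_pt[OF that(1) idl_K fin that(2,3)] .
  have ptF: "G v \<in> ?W" if "lin G" "v \<in> VV IF n" "v \<in> ?W" for G :: "(int \<times> idx, 'r) vec => (int \<times> idx, 'r) vec" and v n
    using lin_pt[OF that(1) idl_K finF that(2,3)] .
  have DD: "D (D v) \<in> ?W" if "v \<in> VV I n" for v n using cpx_DD[OF X that] by simp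
  note trans = smod_diff_trans[OF smod_ptK] and sym = smod_diff_sym[OF smod_ptK]
    and canc = smod_diff_cancel[OF smod_ptK] and dfW = smod_diff[OF smod_ptK] and dV = smod_diff[OF smod_VV]
  define Pf where "Pf m f \<longleftrightarrow> lin f \<and> (\<forall>w\<in>VV IF (int m). f w \<in> VV I (int m) \<and> f (e w) - f w \<in> ?W) \<and>
    (m = 0 --> f = Zt) \<and> (m \<ge> 1 --> (\<forall>w\<in>VV IF (int m - 1). D (f (dl w)) \<in> ?W))" for m f
  define Qf where "Qf m f f' \<longleftrightarrow> (\<forall>w\<in>VV IF (int m). D (f w) - f' (dl w) \<in> ?W)" for m :: nat and f f'
  have "\<exists>f. \<forall>m. Pf m (f m) \<and> Qf m (f m) (f (Suc m))"
  proof (rule dependent_nat_choice)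
    show "\<exists>f. Pf 0 f" unfolding Pf_def using aug_lin(1) Z0(1,2) by auto
    fix f m assume f: "Pf m f"
    have linf: "lin f" and fV: "\<And>w. w \<in> VV IF (int m) ==> f w \<in> VV I (int m)"
      and fe: "\<And>w. w \<in> VV IF (int m) ==> f (e w) - f w \<in> ?W" using f by (auto simp: Pf_def)
    have "\<exists>h. lin h \<and> (\<forall>w\<in>VV IF (int m). D (f w) - h (dl w) \<in> ?W)"
    proof (cases "m = 0")
      case True
      then show ?thesis using f aug_lin(2) Z0(3) by (auto simp: Pf_def)
    next
      case False
      then have "\<And>w. w \<in> VV IF (int m - 1) ==> D (f (dl w)) \<in> ?W" using f by (simp add: Pf_def)
      then obtain h where h: "lin h" "\<And>v. v \<in> VV IF (int m) ==> D (f (e v)) - h (dl v) \<in> ?W"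
        using coexF[OF _ lin_comp[OF linD linf], of "int m"] False by auto
      have "D (f w) - h (dl w) \<in> ?W" if w: "w \<in> VV IF (int m)" for w
      proof -
        have "D (f (e w) - f w) \<in> ?W" using ptI[OF linD dV[OF fV[OF eV[OF w]] fV[OF w]] fe[OF w]] .
        then have "D (f (e w)) - D (f w) \<in> ?W" by (simp add: lin_simps[OF linD])
        from trans[OF sym[OF this] h(2)[OF w]] show ?thesis .
      qed
      then show ?thesis using h(1) by blast
    qed
    then obtain h where h: "lin h" "\<And>w. w \<in> VV IF (int m) ==> D (f w) - h (dl w) \<in> ?W" by blast
    \<comment> \<open>Composition with \<open>e\<close> makes \<open>f'\<close> depend only on the
      projective module that is the image of \<open>e\<close>.\<close>
    define f' where "f' w = prj I (int (Suc m)) (h (e w))" for w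
    have linf': "lin f'" unfolding f'_def[abs_def] by (rule lin_comp[OF lin_prj lin_comp[OF h(1) linF(2)]])
    have Q: "D (f w) - f' (dl w) \<in> ?W" if w: "w \<in> VV IF (int m)" for w
    proof -
      have "h (e (dl w) - dl w) \<in> ?W" using ptF[OF h(1) dV[OF eV[OF dlV[OF w]] dlV[OF w]] ed[OF w]] .
      then have "D (f w) - h (e (dl w)) \<in> ?W"
        using trans[OF h(2)[OF w] sym] by (simp add: lin_simps[OF h(1)])
      moreover have "D (f w) \<in> VV I (int (Suc m))" using cpx_D[OF X fV[OF w]] by (simp add: add.commute)
      ultimately show ?thesis unfolding f'_def by (rule prj_cong[OF idl_K])
    qed
    have "Pf (Suc m) f'" unfolding Pf_def
    proof (intro conjI ballI impI linf')
      fix w :: "(int \<times> idx, 'r) vec" assume w: "w \<in> VV IF (int (Suc m))"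
      show "f' w \<in> VV I (int (Suc m))" unfolding f'_def by (rule prj_VV)
      have "h (e (e w) - e w) \<in> ?W" using ptF[OF h(1) dV[OF eV[OF eV[OF w]] eV[OF w]] ee[OF w]] .
      from prj_pt[OF idl_K this] show "f' (e w) - f' w \<in> ?W"
        by (simp add: f'_def lin_simps[OF h(1)] lin_simps[OF lin_prj])
    next
      fix w :: "(int \<times> idx, 'r) vec" assume "w \<in> VV IF (int (Suc m) - 1)"
      then have w: "w \<in> VV IF (int m)" by simp
      have V: "D (f w) \<in> VV I (int (Suc m))" using cpx_D[OF X fV[OF w]] by (simp add: add.commute)
      have "f' (dl w) \<in> VV I (int (Suc m))" unfolding f'_def by (rule prj_VV)
      from ptI[OF linD dV[OF V this] Q[OF w]] have "D (D (f w)) - D (f' (dl w)) \<in> ?W" by (simp add: lin_simps[OF linD])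
      then show "D (f' (dl w)) \<in> ?W" using smod_diff_cancel'[OF smod_ptK _ DD[OF fV[OF w]]] by blast
    qed simp_all
    then show "\<exists>f'. Pf (Suc m) f' \<and> Qf m f f'" using Q unfolding Qf_def by blast
  qed
  then obtain f where "\<And>m. Pf m (f m)" "\<And>m. Qf m (f m) (f (Suc m))" by blast
  then have f: "lin (f m)" "w \<in> VV IF (int m) ==> f m w \<in> VV I (int m)" "w \<in> VV IF (int m) ==> f m (e w) - f m w \<in> ?W"
    "f 0 = Zt" "w \<in> VV IF (int m) ==> D (f m w) - f (Suc m) (dl w) \<in> ?W" for m w
    unfolding Pf_def Qf_def by blast+
  define Pg where "Pg m h \<longleftrightarrow> lin h \<and> (\<forall>u\<in>VV I (int m). h u \<in> VV IF (int m)) \<and> (m = 0 --> h = g) \<and>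
    (m \<ge> 1 --> (\<forall>u\<in>VV I (int m - 1). dl (h (D u)) \<in> ?W))" for m h
  define Qg where "Qg m h h' \<longleftrightarrow> (\<forall>u\<in>VV I (int m). dl (h u) - h' (D u) \<in> ?W)" for m :: nat and h h'
  have "\<exists>h. \<forall>m. Pg m (h m) \<and> Qg m (h m) (h (Suc m))"
  proof (rule dependent_nat_choice)
    show "\<exists>h. Pg 0 h" unfolding Pg_def using aug_lin(3) g0(1) by auto
    fix h m assume h: "Pg m h"
    have linh: "lin h" and hV: "\<And>u. u \<in> VV I (int m) ==> h u \<in> VV IF (int m)" using h by (auto simp: Pg_def)
    have "\<exists>k. lin k \<and> (\<forall>u\<in>VV I (int m). dl (h u) - k (D u) \<in> ?W)"
    proof (cases "m = 0")
      case True
      then show ?thesis using h aug_lin(4) g0(2) by (auto simp: Pg_def)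
    next
      case False
      then have "\<And>u. u \<in> VV I (int m - 1) ==> dl (h (D u)) \<in> ?W" using h by (simp add: Pg_def)
      then show ?thesis using coexX[OF _ lin_comp[OF linF(1) linh], of "int m"] False by auto
    qed
    then obtain k where k: "lin k" "\<And>u. u \<in> VV I (int m) ==> dl (h u) - k (D u) \<in> ?W" by blast
    define h' where "h' u = prj IF (int (Suc m)) (k u)" for u
    have V: "dl (h u) \<in> VV IF (int (Suc m))" if "u \<in> VV I (int m)" for u
      using dlV[OF hV[OF that]] by (simp add: add.commute)
    have Q: "dl (h u) - h' (D u) \<in> ?W" if u: "u \<in> VV I (int m)" for u
      unfolding h'_def by (rule prj_cong[OF idl_K k(2)[OF u] V[OF u]])
    have "Pg (Suc m) h'" unfolding Pg_def
    proof (intro conjI ballI impI)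
      show "lin h'" unfolding h'_def[abs_def] by (rule lin_comp[OF lin_prj k(1)])
      show "h' u \<in> VV IF (int (Suc m))" for u unfolding h'_def by (rule prj_VV)
      fix u :: "(int \<times> idx, 'r) vec" assume "u \<in> VV I (int (Suc m) - 1)"
      then have u: "u \<in> VV I (int m)" by simp
      have "h' (D u) \<in> VV IF (int (Suc m))" unfolding h'_def by (rule prj_VV)
      from ptF[OF linF(1) dV[OF V[OF u] this] Q[OF u]]
      have "dl (dl (h u)) - dl (h' (D u)) \<in> ?W" by (simp add: lin_simps[OF linF(1)])
      then show "dl (h' (D u)) \<in> ?W" using smod_diff_cancel'[OF smod_ptK _ dd[OF hV[OF u]]] by blast
    qed simp_all
    then show "\<exists>h'. Pg (Suc m) h' \<and> Qg m h h'" using Q unfolding Qg_def by blast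
  qed
  then obtain h where "\<And>m. Pg m (h m)" "\<And>m. Qg m (h m) (h (Suc m))" by blast
  then have h: "lin (h m)" "u \<in> VV I (int m) ==> h m u \<in> VV IF (int m)" "h 0 = g"
    "u \<in> VV I (int m) ==> dl (h m u) - h (Suc m) (D u) \<in> ?W" for m u
    unfolding Pg_def Qg_def by blast+
  \<comment> \<open>The last clause says that \<open>u - f (h u) - D (s u)\<close> vanishes on
    boundaries in the next degree. Exactness of the dual then extends the homotopy by one more
    degree.\<close>
  define Ps where "Ps m s \<longleftrightarrow> lin s \<and> (\<forall>u\<in>VV I (int (Suc m)). s u \<in> VV I (int m)) \<and>
     (\<forall>u\<in>VV I (int m). D u - f (Suc m) (h (Suc m) (D u)) - D (s (D u)) \<in> ?W)" for m s
  define Qs where "Qs m s s' \<longleftrightarrow> (\<forall>u\<in>VV I (int (Suc m)). u - f (Suc m) (h (Suc m) u) - D (s u) - s' (D u) \<in> ?W)" for m s s'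
  have fhD: "D (f m (h m u)) - f (Suc m) (h (Suc m) (D u)) \<in> ?W" if u: "u \<in> VV I (int m)" for m u
  proof -
    have 1: "D (f m (h m u)) - f (Suc m) (dl (h m u)) \<in> ?W" using f(5)[OF h(2)[OF u]] .
    have Du: "D u \<in> VV I (int (Suc m))" using cpx_D[OF X u] by (simp add: add.commute)
    have V: "dl (h m u) \<in> VV IF (int (Suc m))" using dlV[OF h(2)[OF u]] by (simp add: add.commute)
    have 2: "f (Suc m) (dl (h m u)) - f (Suc m) (h (Suc m) (D u)) \<in> ?W"
      using ptF[OF f(1)[of "Suc m"] dV[OF V h(2)[OF Du]] h(4)[OF u]] by (simp add: lin_simps[OF f(1)])
    show ?thesis using trans[OF 1 2] .
  qed
  have Dstep: "D u - f (Suc m) (h (Suc m) (D u)) - D t \<in> ?W"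
    if u: "u \<in> VV I (int m)" and a: "a \<in> VV I (int m - 1)" and s: "t \<in> VV I (int m)"
      and rel: "u - f m (h m u) - D a - t \<in> ?W" for u a t m
  proof -
    have Da: "D a \<in> VV I (int m)" using cpx_D[OF X a] by simp
    have "u - f m (h m u) - D a - t \<in> VV I (int m)"
      using u f(2)[OF h(2)[OF u]] Da s by (intro dV)
    from ptI[OF linD this rel] have 1: "D u - D (f m (h m u)) - D (D a) - D t \<in> ?W"
      by (simp add: lin_simps[OF linD])
    have "D u - D (f m (h m u)) - D (D a) - D t + (D (f m (h m u)) - f (Suc m) (h (Suc m) (D u))) + D (D a) \<in> ?W"
      by (rule smod_add[OF smod_ptK smod_add[OF smod_ptK 1 fhD[OF u]] DD[OF a]])
    then show ?thesis by (simp add: algebra_simps)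
  qed
  have "\<exists>s. \<forall>m. Ps m (s m) \<and> Qs m (s m) (s (Suc m))"
  proof (rule dependent_nat_choice)
    have "D u - f (Suc 0) (h (Suc 0) (D u)) - D (s0 (D u)) \<in> ?W" if u: "u \<in> VV I (int 0)" for u
    proof (rule Dstep[OF u smod_0[OF smod_VV]])
      show "s0 (D u) \<in> VV I (int 0)" using g0(5) cpx_D[OF X u] by simp
      show "u - f 0 (h 0 u) - D 0 - s0 (D u) \<in> ?W" using g0(3)[of u] u f(4) h(3) by (simp add: lin_zero[OF linD])
    qed
    then show "\<exists>s. Ps 0 s" unfolding Ps_def using aug_lin(5) g0(5) by (intro exI[of _ s0]) auto
    fix s m assume s: "Ps m s"
    have lins: "lin s" and sV: "\<And>u. u \<in> VV I (int (Suc m)) ==> s u \<in> VV I (int m)"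
      and sD: "\<And>u. u \<in> VV I (int m) ==> D u - f (Suc m) (h (Suc m) (D u)) - D (s (D u)) \<in> ?W"
      using s by (auto simp: Ps_def)
    let ?\<phi> = "\<lambda>u. u - f (Suc m) (h (Suc m) u) - D (s u)"
    have lin\<phi>: "lin ?\<phi>" by (intro lin_intros lin_comp[OF f(1) h(1)] lin_comp[OF linD lins])
    obtain k where k: "lin k" "\<And>u. u \<in> VV I (int (Suc m)) ==> ?\<phi> u - k (D u) \<in> ?W"
      using coexX[OF _ lin\<phi>, of "int (Suc m)"] sD by auto
    define s' where "s' u = prj I (int (Suc m)) (k u)" for u
    have Q: "?\<phi> u - s' (D u) \<in> ?W" if u: "u \<in> VV I (int (Suc m))" for u
    proof -
      have "?\<phi> u \<in> VV I (int (Suc m))"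
        using u f(2)[OF h(2)[OF u]] cpx_D[OF X sV[OF u]] by (intro dV) (auto simp: add.commute)
      then show ?thesis unfolding s'_def by (rule prj_cong[OF idl_K k(2)[OF u]])
    qed
    have "Ps (Suc m) s'" unfolding Ps_def
    proof (intro conjI ballI)
      show "lin s'" unfolding s'_def[abs_def] by (rule lin_comp[OF lin_prj k(1)])
      show sV': "s' u \<in> VV I (int (Suc m))" for u unfolding s'_def by (rule prj_VV)
      fix u :: "(int \<times> idx, 'r) vec" assume u: "u \<in> VV I (int (Suc m))"
      show "D u - f (Suc (Suc m)) (h (Suc (Suc m)) (D u)) - D (s' (D u)) \<in> ?W"
        by (rule Dstep[OF u _ sV' Q[OF u]]) (use sV[OF u] in simp)
    qed
    then show "\<exists>s'. Ps (Suc m) s' \<and> Qs m s s'" using Q unfolding Qs_def by blast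
  qed
  then obtain s where s: "\<And>m. Ps m (s m)" "\<And>m. Qs m (s m) (s (Suc m))" by blast
  show ?thesis
  proof
    fix u :: "(int \<times> idx, 'r) vec" assume "u \<in> coc M I D n"
    then have u: "u \<in> VV I n" "D u \<in> pt M" by (auto simp: coc_def)
    define m where "m = nat (n - 1)"
    have nm: "n = int (Suc m)" using n by (simp add: m_def)
    have hu: "h (Suc m) u \<in> VV IF n" using h(2)[of u "Suc m"] u nm by simp
    \<comment> \<open>Beyond \<open>N\<close> the idempotent \<open>e\<close> is zero modulo
      \<open>K\<close>, and \<open>f\<close> does not distinguish \<open>h u\<close> from
      \<open>e (h u)\<close>.\<close>
    have "f (Suc m) (e (h (Suc m) u)) \<in> ?W" using ptF[OF f(1) eV[OF hu] eN[OF hu n(2)]] .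
    then have fW: "f (Suc m) (h (Suc m) u) \<in> ?W"
      using smod_diff_cancel'[OF smod_ptK f(3)[of "h (Suc m) u" "Suc m"]] hu nm by simp
    have rel: "u - f (Suc m) (h (Suc m) u) - D (s m u) - s (Suc m) (D u) \<in> ?W"
      using s(2)[of m] u(1) nm unfolding Qs_def by blast
    have lins: "lin (s (Suc m))" and sV: "s m u \<in> VV I (n - 1)" using s(1) u(1) nm unfolding Ps_def by auto
    have 1: "s (Suc m) (D u) \<in> pt M" using cpx_ptK[OF X lins idl_M cpx_D[OF X u(1)] u(2)] .
    have "u - f (Suc m) (h (Suc m) u) - D (s m u) - s (Suc m) (D u) + f (Suc m) (h (Suc m) u) + s (Suc m) (D u) \<in> pt M"
      by (rule smod_add[OF smod_ptM smod_add[OF smod_ptM pt_mono[OF K_M rel] pt_mono[OF K_M fW]] 1])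
    then have "u - D (s m u) \<in> pt M" by (simp add: algebra_simps)
    then show "u \<in> cob M I D n" using u(1) sV unfolding cob_def by blast
  qed
qed

text \<open>One element of the regular sequence is traded for a summand: over the ring modulo the first \<open>i\<close>
  elements the complex becomes \<open>X\<^sup>n \<oplus> X\<^sup>n\<^sup>-\<^sup>1\<close>, with the \<open>i\<close>-th operator as part of the differential.\<close>

theorem cohomology_operators_generate:
  assumes "i \<le> c" "cpx i I D T" "\<And>n. n \<ge> 1 ==> coex (J i) I D n" "\<And>n. n < 0 ==> I n = {}"
    and "fin_res K IF dl e N" "aug i I D IF dl e Zt f1 \<xi> g G1 s0"
  shows "\<exists>n1. gens i (coc M I D) (cob M I D) T n1"
  using assms
proof (induction i arbitrary: I D T Zt f1 \<xi> g G1 s0)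
  case 0
  have "coc M I D n \<subseteq> cob M I D n" if "n \<ge> max 1 (N + 1)" for n
    by (rule finite_resolution_acyclic[OF 0(2) _ 0(5,6)]) (use 0(3) that in \<open>simp_all add: Jx_0\<close>)
  then have "gens 0 (coc M I D) (cob M I D) T (max 1 (N + 1))" unfolding gens_def by auto
  then show ?case by blast
next
  case (Suc i)
  note X = Suc.prems(2) and coex = Suc.prems(3) and neg = Suc.prems(4) and fres = Suc.prems(5) and aug = Suc.prems(6)
  have i: "i < c" "i \<le> c" using Suc.prems(1) by auto
  note linD = cpx_linD[OF X] and fin = cpx_fin[OF X] and linTi = cpx_linT[OF X lessI] and gmX = cpx_gm[OF Suc.prems(1) X]
  let ?T = "T i" and ?x = "x i"
  let ?L = "prL 0" and ?R = "prR (-1)" and ?mk = "mk 0 (-1)"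
  define IY where "IY = sumI 0 (-1) I"
  \<comment> \<open>On \<open>(a, b)\<close> this is \<open>(D a - T i b, x i a - D b)\<close>. The
    diagonal of its square is \<open>D (D a) - x i T i a\<close>, so only the first \<open>i\<close>
    elements remain; the corner is the commutator of \<open>T i\<close> with \<open>D\<close>, which
    lies in \<open>J i\<close>.\<close>
  define DY where "DY = (\<lambda>v. ?mk (D (?L v) - ?T (?R v)) (scl ?x (?L v) - D (?R v)))"
  have L: "v \<in> VV IY n ==> ?L v \<in> VV I n" and R: "v \<in> VV IY n ==> ?R v \<in> VV I (n - 1)"
    for v :: "(int \<times> idx, 'r) vec" and n
    using VV_prL[of v 0 "-1" I n] VV_prR[of v 0 "-1" I n] unfolding IY_def by simp_all
  have mkV: "?mk a b \<in> VV IY n" if "a \<in> VV I n" "b \<in> VV I (n - 1)" for a b :: "(int \<times> idx, 'r) vec" and n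
    unfolding IY_def using VV_mk[of a I n 0 b "-1"] that by simp
  have mkpr: "v = ?mk (?L v) (?R v)" if "v \<in> VV IY n" for v :: "(int \<times> idx, 'r) vec" and n
    using mk_pr[of v 0 "-1" I n] that by (simp add: IY_def)
  have DYmk: "DY (?mk a b) = ?mk (D a - ?T b) (scl ?x a - D b)" for a b by (simp add: DY_def)
  have linDY: "lin DY" unfolding DY_def
    by (intro lin_mk lin_sub lin_comp[OF linD] lin_comp[OF linTi] lin_scl_map lin_prL lin_prR)
  have DV: "D v \<in> VV I (n + 1)" if "v \<in> VV I n" for v n using cpx_D[OF X that] .
  have DV': "D v \<in> VV I n" if "v \<in> VV I (n - 1)" for v n using cpx_D[OF X that] by simp
  have TV: "T j v \<in> VV I (n + 2)" if "j < Suc i" "v \<in> VV I n" for j v n using cpx_T[OF X that] .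
  have TV': "T j v \<in> VV I (n + 1)" if "j < Suc i" "v \<in> VV I (n - 1)" for j v n
    using cpx_T[OF X that] by (simp add: algebra_simps)
  have DYV: "DY v \<in> VV IY (n + 1)" if v: "v \<in> VV IY n" for v n
    unfolding DY_def
    by (rule mkV) (use DV[OF L[OF v]] DV'[OF R[OF v]] TV'[OF lessI R[OF v]] smod_scl[OF smod_VV L[OF v]] in
        \<open>auto intro!: smod_diff[OF smod_VV]\<close>)
  have "\<exists>W. \<forall>j. lin (W j) \<and> (\<forall>n. \<forall>v\<in>VV I n. W j v \<in> VV I (n + 3)) \<and>
    (\<forall>n. \<forall>v\<in>VV I n. ?T (D v) - D (?T v) - (\<Sum>j<i. scl (x j) (W j v)) \<in> pt K)"
  proof (rule lin_decompose)
    show "lin (\<lambda>v. ?T (D v) - D (?T v))" by (intro lin_sub lin_comp[OF linD linTi] lin_comp[OF linTi linD])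
    show "?T (D v) - D (?T v) \<in> VV I (n + 3)" if v: "v \<in> VV I n" for n v
      using DV[OF TV[OF lessI v]] TV[OF lessI DV[OF v]] by (intro smod_diff[OF smod_VV]) (auto simp: add.commute)
    show "?T (D v) - D (?T v) \<in> pt (J i)" if "v \<in> VV I n" for n v
      using smod_diff_sym[OF smod_J cpx_comm_D_last[OF i(1) X that]] .
  qed (use idl_K fin in auto)
  then obtain W where W: "\<And>j. lin (W j)" "\<And>j n v. v \<in> VV I n ==> W j v \<in> VV I (n + 3)"
    "\<And>n v. v \<in> VV I n ==> ?T (D v) - D (?T v) - (\<Sum>j<i. scl (x j) (W j v)) \<in> pt K" by blast
  define TY where "TY j v = ?mk (T j (?L v) + W j (?R v)) (T j (?R v))" for j v
  have DDi: "D (D v) - scl ?x (?T v) - (\<Sum>j<i. scl (x j) (T j v)) \<in> pt K" if "v \<in> VV I n" for v n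
    using cpx_DD[OF X that] by (simp add: algebra_simps)
  have Y: "cpx i IY DY TY"
    unfolding cpx_def
  proof (intro conjI allI ballI impI)
    show "finite (IY n)" for n unfolding IY_def by (rule finite_sumI[OF fin])
    fix j assume j: "j < i"
    then have j': "j < Suc i" by simp
    show "lin (TY j)" unfolding TY_def[abs_def]
      by (intro lin_mk lin_plus lin_comp[OF cpx_linT[OF X j']] lin_comp[OF W(1)] lin_prL lin_prR)
    show "TY j v \<in> VV IY (n + 2)" if v: "v \<in> VV IY n" for n v
      unfolding TY_def
    proof (rule mkV)
      show "T j (?L v) + W j (?R v) \<in> VV I (n + 2)"
        using TV[OF j' L[OF v]] W(2)[OF R[OF v], of j] by (intro smod_add[OF smod_VV]) (auto simp: algebra_simps)
      show "T j (?R v) \<in> VV I (n + 2 - 1)" using TV[OF j' R[OF v]] by (simp add: algebra_simps)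
    qed
  next
    fix n and v :: "(int \<times> idx, 'r) vec" assume v: "v \<in> VV IY n"
    have 1: "DY (DY v) = ?mk ((D (D (?L v)) - scl ?x (?T (?L v))) + (?T (D (?R v)) - D (?T (?R v))))
        (D (D (?R v)) - scl ?x (?T (?R v)))"
      by (simp add: DY_def lin_simps[OF linD] lin_simps[OF linTi] scl_simps) (simp add: algebra_simps)
    have 2: "(\<Sum>j<i. scl (x j) (TY j v)) = ?mk ((\<Sum>j<i. scl (x j) (T j (?L v))) + (\<Sum>j<i. scl (x j) (W j (?R v))))
        (\<Sum>j<i. scl (x j) (T j (?R v)))"
      by (simp add: TY_def mk_sum mk_scl[symmetric] scl_simps sum.distrib[symmetric])
    have 3: "DY (DY v) - (\<Sum>j<i. scl (x j) (TY j v)) =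
        ?mk ((D (D (?L v)) - scl ?x (?T (?L v)) - (\<Sum>j<i. scl (x j) (T j (?L v)))) +
             (?T (D (?R v)) - D (?T (?R v)) - (\<Sum>j<i. scl (x j) (W j (?R v)))))
            (D (D (?R v)) - scl ?x (?T (?R v)) - (\<Sum>j<i. scl (x j) (T j (?R v))))"
      unfolding 1 2 mk_diff[symmetric] by (simp add: algebra_simps)
    show "DY (DY v) - (\<Sum>j<i. scl (x j) (TY j v)) \<in> pt K"
      unfolding 3 using DDi[OF L[OF v]] W(3)[OF R[OF v]] DDi[OF R[OF v]]
      by (simp add: mk_pt[OF idl_K] smod_add[OF smod_ptK])
  qed (use linDY DYV in auto)
  have lmk1: "lin (\<lambda>a. ?mk a 0)" and lmk2: "lin (\<lambda>b. ?mk 0 b)" by (intro lin_mk lin_0 lin_id)+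
  have mk_split: "?mk a b = ?mk a 0 + ?mk 0 b" for a b :: "(int \<times> idx, 'r) vec" by (simp add: mk_add[symmetric])
  \<comment> \<open>Modulo \<open>J (Suc i)\<close> the part \<open>Ga\<close> vanishes on
    boundaries and extends along \<open>D\<close>. The error is a multiple of \<open>x i\<close>,
    absorbed by \<open>G2\<close>; in the remaining relation regularity cancels the factor
    \<open>x i\<close>.\<close>
  have coexY: "coex (J i) IY DY n" if n: "n \<ge> 1" for n
    unfolding coex_def
  proof (intro allI impI)
    fix G :: "(int \<times> idx, 'r) vec => (int \<times> idx, 'r) vec"
    assume linG: "lin G" and G: "\<forall>v\<in>VV IY (n - 1). G (DY v) \<in> pt (J i)"
    define Ga where "Ga = (\<lambda>u. G (?mk u 0))"
    define Gb where "Gb = (\<lambda>w. G (?mk 0 w))"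
    have linGa: "lin Ga" and linGb: "lin Gb" unfolding Ga_def Gb_def
      using lin_comp[OF linG lmk1] lin_comp[OF linG lmk2] by auto
    have Gmk: "G (?mk a b) = Ga a + Gb b" for a b
      unfolding Ga_def Gb_def using lin_add[OF linG] mk_split[of a b] by simp
    have A: "Ga (D u) + scl ?x (Gb u) \<in> pt (J i)" if u: "u \<in> VV I (n - 1)" for u
    proof -
      have "G (DY (?mk u 0)) \<in> pt (J i)" using G mkV[OF u smod_0[OF smod_VV]] by blast
      then show ?thesis by (simp add: DYmk Gmk lin_simps[OF linD] lin_simps[OF linTi] lin_simps[OF linGb])
    qed
    have "Ga (D u) \<in> pt (J (Suc i))" if "u \<in> VV I (n - 1)" for u
    proof -
      have "Ga (D u) + scl ?x (Gb u) \<in> pt (J (Suc i))" using pt_mono[OF Jx_mono[OF idl_K] A[OF that], of "Suc i"] by simp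
      moreover have "scl ?x (Gb u) \<in> pt (J (Suc i))" using x_Jx[OF idl_K, of i "Suc i"] by (auto simp: pt_def)
      ultimately have "Ga (D u) + scl ?x (Gb u) - scl ?x (Gb u) \<in> pt (J (Suc i))" by (rule smod_diff[OF smod_J])
      then show ?thesis by simp
    qed
    then obtain G1' where G1': "lin G1'" "\<And>v. v \<in> VV I n ==> Ga v - G1' (D v) \<in> pt (J (Suc i))"
      using coex[OF n] linGa unfolding coex_def by blast
    have "\<exists>G2. lin G2 \<and> (\<forall>v\<in>VV I n. Ga v - G1' (D v) - scl ?x (G2 v) \<in> pt (J i))"
      by (rule lin_decompose_last) (use G1' linGa idl_K fin lin_sub[OF linGa lin_comp[OF G1'(1) linD]] in auto)
    then obtain G2 where G2: "lin G2" "\<And>v. v \<in> VV I n ==> Ga v - G1' (D v) - scl ?x (G2 v) \<in> pt (J i)" by blast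
    have E: "Gb w + G1' (?T w) + G2 (D w) \<in> pt (J i)" if w: "w \<in> VV I (n - 1)" for w
    proof -
      have Dw: "D w \<in> VV I n" using DV'[OF w] .
      have "D (D w) - scl ?x (?T w) \<in> pt (J i)"
      proof -
        have "D (D w) - scl ?x (?T w) - (\<Sum>j<i. scl (x j) (T j w)) \<in> pt (J i)" using pt_mono[OF K_Jx DDi[OF w]] .
        moreover have "(\<Sum>j<i. scl (x j) (T j w)) \<in> pt (J i)"
          using x_Jx[OF idl_K] by (intro smod_sum[OF smod_J]) (auto simp: pt_def)
        ultimately show ?thesis by (rule smod_diff_cancel[OF smod_J])
      qed
      moreover have "D (D w) - scl ?x (?T w) \<in> VV I (n + 1)"
        using DV[OF Dw] TV'[OF lessI w] by (intro smod_diff[OF smod_VV] smod_scl[OF smod_VV])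
      ultimately have "G1' (D (D w) - scl ?x (?T w)) \<in> pt (J i)" by (intro cpx_ptK[OF X G1'(1) idl_J])
      then have 1: "G1' (D (D w)) - scl ?x (G1' (?T w)) \<in> pt (J i)" by (simp add: lin_simps[OF G1'(1)])
      have "(Ga (D w) + scl ?x (Gb w)) - (Ga (D w) - G1' (D (D w)) - scl ?x (G2 (D w)))
          - (G1' (D (D w)) - scl ?x (G1' (?T w))) \<in> pt (J i)"
        by (rule smod_diff[OF smod_J smod_diff[OF smod_J A[OF w] G2(2)[OF Dw]] 1])
      then have "scl ?x (Gb w + G1' (?T w) + G2 (D w)) \<in> pt (J i)" by (simp add: scl_simps algebra_simps)
      then show ?thesis using reg[OF i(1)] by (simp add: pt_def)
    qed
    have "G v - (G1' (?L (DY v)) + G2 (?R (DY v))) \<in> pt (J i)" if v: "v \<in> VV IY n" for v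
    proof -
      have "G v = Ga (?L v) + Gb (?R v)" using Gmk mkpr[OF v] by metis
      then have "G v - (G1' (?L (DY v)) + G2 (?R (DY v))) =
          (Ga (?L v) - G1' (D (?L v)) - scl ?x (G2 (?L v))) + (Gb (?R v) + G1' (?T (?R v)) + G2 (D (?R v)))"
        by (simp add: DY_def lin_simps[OF G1'(1)] lin_simps[OF G2(1)])
      then show ?thesis using smod_add[OF smod_J G2(2)[OF L[OF v]] E[OF R[OF v]]] by simp
    qed
    moreover have "lin (\<lambda>v. G1' (?L v) + G2 (?R v))"
      by (intro lin_plus lin_comp[OF G1'(1) lin_prL] lin_comp[OF G2(1) lin_prR])
    ultimately show "\<exists>G'. lin G' \<and> (\<forall>v\<in>VV IY n. G v - G' (DY v) \<in> pt (J i))"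
      by (intro exI[of _ "\<lambda>v. G1' (?L v) + G2 (?R v)"]) blast
  qed
  have negY: "IY n = {}" if "n < 0" for n using neg[of n] neg[of "n - 1"] that by (simp add: IY_def sumI_def)
  have aug_lin: "lin Zt" "lin f1" "j < Suc i ==> lin (\<xi> j)" "lin g" "lin G1" "lin s0"
    and Z0: "w \<in> VV IF 0 ==> Zt w \<in> VV I 0" "w \<in> VV IF 0 ==> Zt (e w) - Zt w \<in> pt K"
      "w \<in> VV IF 0 ==> D (Zt w) - f1 (dl w) \<in> pt K" "w \<in> VV IF 1 ==> f1 w \<in> VV I 1"
      "w \<in> VV IF 0 ==> j < Suc i ==> scl (x j) (Zt w) - \<xi> j (dl w) \<in> pt K"
      "w \<in> VV IF 1 ==> j < Suc i ==> \<xi> j w \<in> VV I 0"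
    and g0: "u \<in> VV I 0 ==> g u \<in> VV IF 0" "u \<in> VV I 0 ==> dl (g u) - G1 (D u) \<in> pt (J (Suc i))"
      "u \<in> VV I 0 ==> u - Zt (g u) - s0 (D u) \<in> pt (J (Suc i))" "u \<in> VV I 1 ==> G1 u \<in> VV IF 1"
      "u \<in> VV I 1 ==> s0 u \<in> VV I 0"
    for w u j
    using aug unfolding aug_def by blast+
  have dllin: "lin dl" and dlV: "v \<in> VV IF n ==> dl v \<in> VV IF (n + 1)" for v n
    using fres unfolding fin_res_def by blast+
  have V0: "VV I (- 1) = {0 :: (int \<times> idx, 'r) vec}" using neg[of "-1"] by (auto simp: VV_def intro: vec_eqI)
  \<comment> \<open>The comparison identities hold modulo \<open>J (Suc i)\<close>. Their errors are
    divided by \<open>x i\<close>; the quotients act on the second component of \<open>DY v\<close>,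
    which is \<open>x i u\<close>, and so repair the identities modulo \<open>J i\<close>.\<close>
  have "\<exists>W. lin W \<and> (\<forall>u\<in>VV I 0. dl (g u) - G1 (D u) - scl ?x (W u) \<in> pt (J i))"
    by (rule lin_decompose_last)
      (use g0(2) idl_K fin lin_sub[OF lin_comp[OF dllin aug_lin(4)] lin_comp[OF aug_lin(5) linD]] in auto)
  then obtain U where U: "lin U" "\<And>u. u \<in> VV I 0 ==> dl (g u) - G1 (D u) - scl ?x (U u) \<in> pt (J i)" by blast
  have "\<exists>W. lin W \<and> (\<forall>u\<in>VV I 0. u - Zt (g u) - s0 (D u) - scl ?x (W u) \<in> pt (J i))"
    by (rule lin_decompose_last)
      (use g0(3) idl_K fin lin_sub[OF lin_sub[OF lin_id lin_comp[OF aug_lin(1,4)]] lin_comp[OF aug_lin(6) linD]] in auto)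
  then obtain U' where U': "lin U'" "\<And>u. u \<in> VV I 0 ==> u - Zt (g u) - s0 (D u) - scl ?x (U' u) \<in> pt (J i)" by blast
  \<comment> \<open>Multiplication by \<open>x i\<close> on the augmentation factors through
    \<open>dl\<close> by way of \<open>\<xi> i\<close>. This supplies the second component of the
    comparison map in degree one.\<close>
  define ZY where "ZY = (\<lambda>w. ?mk (Zt w) 0)"
  define fY where "fY = (\<lambda>w. ?mk (f1 w) (\<xi> i w))"
  define xiY where "xiY = (\<lambda>j w. ?mk (\<xi> j w) 0)"
  define gY where "gY = (\<lambda>v. g (?L v))"
  define GY where "GY = (\<lambda>v. prj IF 1 (G1 (?L v) + U (?R v)))"
  define sY where "sY = (\<lambda>v. ?mk (prj I 0 (s0 (?L v) + U' (?R v))) 0)"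
  have augY: "aug i IY DY IF dl e ZY fY xiY gY GY sY"
    unfolding aug_def
  proof (intro conjI allI impI ballI)
    show "lin ZY" "lin fY" "lin gY" "lin GY" "lin sY" unfolding ZY_def fY_def gY_def GY_def sY_def
      by (intro lin_mk lin_0 aug_lin(1,2) aug_lin(3)[OF lessI] lin_comp[OF aug_lin(4) lin_prL]
          lin_comp[OF lin_prj lin_plus] lin_comp[OF aug_lin(5) lin_prL] lin_comp[OF U(1) lin_prR]
          lin_comp[OF aug_lin(6) lin_prL] lin_comp[OF U'(1) lin_prR])+
    show "lin (xiY j)" if "j < i" for j unfolding xiY_def by (intro lin_mk lin_0 aug_lin(3)) (use that in simp)
  next
    fix w :: "(int \<times> idx, 'r) vec" assume w: "w \<in> VV IF 0"
    show "ZY w \<in> VV IY 0" unfolding ZY_def by (rule mkV[OF Z0(1)[OF w] smod_0[OF smod_VV]])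
    show "ZY (e w) - ZY w \<in> pt K" unfolding ZY_def mk_diff[symmetric]
      using Z0(2)[OF w] smod_0[OF smod_ptK] by (simp add: mk_pt[OF idl_K])
    show "DY (ZY w) - fY (dl w) \<in> pt K" unfolding ZY_def fY_def DYmk mk_diff[symmetric]
      using Z0(3)[OF w] Z0(5)[OF w lessI] by (simp add: mk_pt[OF idl_K] lin_simps[OF linD] lin_simps[OF linTi])
    show "scl (x j) (ZY w) - xiY j (dl w) \<in> pt K" if "j < i" for j
      using Z0(5)[OF w, of j] that smod_0[OF smod_ptK] unfolding ZY_def xiY_def mk_scl[symmetric] mk_diff[symmetric]
      by (simp add: mk_pt[OF idl_K] scl_simps)
  next
    fix w :: "(int \<times> idx, 'r) vec" assume w: "w \<in> VV IF 1"
    show "fY w \<in> VV IY 1" unfolding fY_def by (rule mkV[OF Z0(4)[OF w]]) (use Z0(6)[OF w lessI] in simp)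
    show "xiY j w \<in> VV IY 0" if "j < i" for j
      unfolding xiY_def by (rule mkV[OF Z0(6)[OF w] smod_0[OF smod_VV]]) (use that in simp)
  next
    fix v :: "(int \<times> idx, 'r) vec" assume v: "v \<in> VV IY 0"
    define u where "u = ?L v"
    have u: "u \<in> VV I 0" using L[OF v] by (simp add: u_def)
    have "?R v = 0" using R[OF v] V0 by simp
    then have vu: "v = ?mk u 0" using mkpr[OF v] by (simp add: u_def)
    show "gY v \<in> VV IF 0" unfolding gY_def using g0(1)[OF L[OF v]] by simp
    have DYv: "?L (DY v) = D u" "?R (DY v) = scl ?x u"
      unfolding vu DYmk by (simp_all add: lin_simps[OF linD] lin_simps[OF linTi])
    have gv: "gY v = g u" by (simp add: gY_def u_def)
    have "dl (g u) - (G1 (D u) + U (scl ?x u)) \<in> pt (J i)"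
      using U(2)[OF u] by (simp add: lin_simps[OF U(1)] diff_diff_eq)
    moreover have "dl (g u) \<in> VV IF 1" using dlV[OF g0(1)[OF u]] by simp
    ultimately show "dl (gY v) - GY (DY v) \<in> pt (J i)"
      unfolding GY_def DYv gv by (rule prj_cong[OF idl_J])
    have "u - Zt (g u) - (s0 (D u) + U' (scl ?x u)) \<in> pt (J i)"
      using U'(2)[OF u] by (simp add: lin_simps[OF U'(1)] diff_diff_eq add.assoc)
    moreover have "u - Zt (g u) \<in> VV I 0" using smod_diff[OF smod_VV u Z0(1)[OF g0(1)[OF u]]] .
    ultimately have "u - Zt (g u) - prj I 0 (s0 (D u) + U' (scl ?x u)) \<in> pt (J i)" by (rule prj_cong[OF idl_J])
    moreover have "v - ZY (gY v) - sY (DY v) = ?mk (u - Zt (g u) - prj I 0 (s0 (D u) + U' (scl ?x u))) 0"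
      unfolding sY_def ZY_def DYv gv by (subst vu) (simp add: mk_diff[symmetric])
    ultimately show "v - ZY (gY v) - sY (DY v) \<in> pt (J i)"
      using smod_0[OF smod_J] by (simp add: mk_pt[OF idl_J])
  next
    fix v :: "(int \<times> idx, 'r) vec" assume v: "v \<in> VV IY 1"
    show "GY v \<in> VV IF 1" unfolding GY_def by (rule prj_VV)
    show "sY v \<in> VV IY 0" unfolding sY_def by (rule mkV[OF prj_VV smod_0[OF smod_VV]])
  qed
  obtain n1 where n1: "gens i (coc M IY DY) (cob M IY DY) TY n1"
    using Suc.IH[OF i(2) Y coexY negY fres augY] by blast
  note gmY = cpx_gm[OF i(2) Y]
  have "coc M IY DY n \<subseteq> cob M IY DY n" if "n < 0" for n
  proof -
    have "VV IY n = {0 :: (int \<times> idx, 'r) vec}" using negY[OF that] by (auto simp: VV_def intro: vec_eqI)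
    then have "coc M IY DY n \<subseteq> {0}" by (auto simp: coc_def)
    then show ?thesis using smod_0[OF gm_N[OF gmY]] by blast
  qed
  then have fgY: "fg i (coc M IY DY) (cob M IY DY) TY" unfolding fg_def using gmY n1 by blast
  have cocY: "?mk u 0 \<in> coc M IY DY n" if "u \<in> coc M I D n" for u n
    using that mkV[OF _ smod_0[OF smod_VV]] scl_pt[OF idl_M x_M[OF i(1)]]
    by (auto simp: coc_def DYmk mk_pt[OF idl_M] lin_simps[OF linD] lin_simps[OF linTi])
  have TYmk: "TY j (?mk u 0) = ?mk (T j u) 0" if "j < i" for j u
    using cpx_linT[OF X, of j] that by (simp add: TY_def lin_zero[OF W(1)] lin_zero)
  \<comment> \<open>The image of the cohomology of \<open>X\<close> in that of \<open>Y\<close>. As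
    a submodule of a finitely generated module it is itself finitely generated.\<close>
  define G where "G n = {v \<in> coc M IY DY n. \<exists>u\<in>coc M I D n. v - ?mk u 0 \<in> cob M IY DY n}" for n
  have gsG: "gsub i (coc M IY DY) (cob M IY DY) TY G"
    unfolding gsub_def
  proof (intro allI conjI impI ballI)
    fix n
    show "smod (G n)" unfolding smod_def
    proof (intro conjI ballI allI)
      show "0 \<in> G n" unfolding G_def
        using smod_0[OF gm_Z[OF gmY]] smod_0[OF gm_Z[OF gmX]] smod_0[OF gm_N[OF gmY]]
        by (auto intro!: bexI[of _ 0] simp: lin_zero[OF lmk1])
      fix v v' assume "v \<in> G n" "v' \<in> G n"
      then obtain u u' where u: "v \<in> coc M IY DY n" "v' \<in> coc M IY DY n" "u \<in> coc M I D n" "u' \<in> coc M I D n"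
        "v - ?mk u 0 \<in> cob M IY DY n" "v' - ?mk u' 0 \<in> cob M IY DY n" by (auto simp: G_def)
      have "v + v' - ?mk (u + u') 0 \<in> cob M IY DY n"
        using smod_add[OF gm_N[OF gmY] u(5,6)] by (simp add: lin_add[OF lmk1] algebra_simps)
      then show "v + v' \<in> G n" unfolding G_def using u smod_add[OF gm_Z[OF gmY]] smod_add[OF gm_Z[OF gmX]] by blast
    next
      fix a v assume "v \<in> G n"
      then obtain u where u: "v \<in> coc M IY DY n" "u \<in> coc M I D n" "v - ?mk u 0 \<in> cob M IY DY n" by (auto simp: G_def)
      have "scl a v - ?mk (scl a u) 0 \<in> cob M IY DY n"
        using smod_scl[OF gm_N[OF gmY] u(3), of a] by (simp add: lin_scl[OF lmk1] scl_simps)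
      then show "scl a v \<in> G n" unfolding G_def using u smod_scl[OF gm_Z[OF gmY]] smod_scl[OF gm_Z[OF gmX]] by blast
    qed
    show "cob M IY DY n \<subseteq> G n" unfolding G_def using gm_NZ[OF gmY] smod_0[OF gm_Z[OF gmX]]
      by (auto intro!: bexI[of _ 0] simp: lin_zero[OF lmk1])
    show "G n \<subseteq> coc M IY DY n" by (auto simp: G_def)
    fix j v assume j: "j < i" and "v \<in> G n"
    then obtain u where u: "v \<in> coc M IY DY n" "u \<in> coc M I D n" "v - ?mk u 0 \<in> cob M IY DY n" by (auto simp: G_def)
    have "TY j v - ?mk (T j u) 0 \<in> cob M IY DY (n + 2)"
      using gm_TN[OF gmY j u(3)] by (simp add: lin_diff[OF gm_lin[OF gmY j]] TYmk[OF j])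
    then show "TY j v \<in> G (n + 2)" unfolding G_def
      using gm_TZ[OF gmY j u(1)] gm_TZ[OF gmX _ u(2), of j] j by auto
  qed
  obtain n2 where n2: "gens i G (cob M IY DY) TY n2" using submodule_fg[OF fgY gsG] by blast
  have "gens (Suc i) (coc M I D) (cob M I D) T n2"
    unfolding gens_def
  proof (intro allI impI ballI)
    fix n u assume n: "n2 \<le> n" and u: "u \<in> coc M I D n"
    have "?mk u 0 \<in> G n" unfolding G_def using cocY[OF u] u smod_0[OF gm_N[OF gmY]] by (auto intro!: bexI[of _ u])
    then obtain f where f: "\<forall>j<i. f j \<in> G (n - 2)" "?mk u 0 - (\<Sum>j<i. TY j (f j)) \<in> cob M IY DY n"
      using n2 n unfolding gens_def by blast
    then have "\<forall>j. \<exists>w. j < i --> w \<in> coc M I D (n - 2) \<and> f j - ?mk w 0 \<in> cob M IY DY (n - 2)" by (auto simp: G_def)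
    then obtain w where w: "\<And>j. j < i ==> w j \<in> coc M I D (n - 2)" "\<And>j. j < i ==> f j - ?mk (w j) 0 \<in> cob M IY DY (n - 2)"
      by metis
    have "TY j (f j) - ?mk (T j (w j)) 0 \<in> cob M IY DY n" if j: "j < i" for j
      using gm_TN[OF gmY j w(2)[OF j]] by (simp add: lin_diff[OF gm_lin[OF gmY j]] TYmk[OF j])
    then have "(\<Sum>j<i. TY j (f j) - ?mk (T j (w j)) 0) \<in> cob M IY DY n" by (intro smod_sum[OF gm_N[OF gmY]]) auto
    from smod_add[OF gm_N[OF gmY] f(2) this]
    have "?mk u 0 - (\<Sum>j<i. ?mk (T j (w j)) 0) \<in> cob M IY DY n" by (simp add: sum_subtractf)
    moreover define r where "r = u - (\<Sum>j<i. T j (w j))"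
    ultimately have "?mk r 0 \<in> cob M IY DY n" by (simp add: lin_diff[OF lmk1] lin_sum[OF lmk1])
    then obtain y where y: "y \<in> VV IY (n - 1)" "?mk r 0 - DY y \<in> pt M" by (auto simp: cob_def)
    define a where "a = ?L y"
    define b where "b = ?R y"
    have ab: "a \<in> VV I (n - 1)" "b \<in> VV I (n - 2)" using L[OF y(1)] R[OF y(1)] by (simp_all add: a_def b_def)
    have "?mk r 0 - DY y = ?mk (r - (D a - ?T b)) (0 - (scl ?x a - D b))"
      unfolding DY_def a_def b_def mk_diff ..
    then have 1: "r - (D a - ?T b) \<in> pt M" and 2: "D b - scl ?x a \<in> pt M"
      using y(2) by (simp_all add: mk_pt[OF idl_M])
    \<comment> \<open>So an element \<open>r\<close> of the kernel of the map to \<open>Y\<close> is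
      \<open>T i (- b)\<close> up to a coboundary, with \<open>- b\<close> a cocycle modulo
      \<open>M\<close>: the coefficient of the last operator.\<close>
    have "D b \<in> pt M" using smod_diff_cancel[OF smod_ptM 2 scl_pt[OF idl_M x_M[OF i(1)]]] .
    then have bc: "- b \<in> coc M I D (n - 2)" using smod_minus[OF gm_Z[OF gmX]] ab by (simp add: coc_def)
    have rV: "r \<in> VV I n"
    proof -
      have "T j (w j) \<in> VV I n" if "j < i" for j using TV[of j "w j" "n - 2"] w(1)[OF that] that by (simp add: coc_def)
      then show ?thesis unfolding r_def using u by (auto simp: coc_def intro!: smod_diff[OF smod_VV] smod_sum[OF smod_VV])
    qed
    have Tb: "?T b \<in> VV I n" using TV[OF lessI ab(2)] by simp
    have "r + ?T b - D a \<in> pt M" using 1 by (simp add: algebra_simps)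
    then have "r + ?T b \<in> cob M I D n" unfolding cob_def using smod_add[OF smod_VV rV Tb] ab(1) by blast
    moreover have "r + ?T b = u - (\<Sum>j<Suc i. T j ((w(i := - b)) j))"
      by (simp add: r_def lin_minus[OF linTi] algebra_simps)
    ultimately show "\<exists>f. (\<forall>j<Suc i. f j \<in> coc M I D (n - 2)) \<and> u - (\<Sum>j<Suc i. T j (f j)) \<in> cob M I D n"
      using w(1) bc by (intro exI[of _ "w(i := - b)"]) (auto simp: less_Suc_eq)
  qed
  then show ?case by blast
qed

text \<open>The negative degrees are cut off, so that the positive part is a resolution.\<close>

theorem symmetric_growth_step:
  assumes fin: "\<And>n. finite (I n)" and linD: "lin D" and DV: "\<And>n v. v \<in> VV I n ==> D v \<in> VV I (n + 1)"
    and DM: "\<And>n v. v \<in> VV I n ==> D v \<in> pt M"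
    and DD: "\<And>n v. v \<in> VV I n ==> D (D v) \<in> pt (J c)"
    and exact: "\<And>n. exact_at c I D n" and coex: "\<And>n. coex (J c) I D n"
    and F: "fin_res K IF dl e N" and aug: "aug c I D IF dl e Zt f1 \<xi> g G1 s0"
    and gr: "growth_le t (\<lambda>n. card (I n))"
  shows "growth_le t (\<lambda>n. card (I (- n)))"
proof -
  have "\<exists>T. cpx c I D T" by (rule cpx_exists[OF fin linD DV DD])
  then obtain T where X: "cpx c I D T" ..
  note gm = cpx_gm[OF order_refl X]
  \<comment> \<open>Minimality makes the differential zero modulo \<open>M\<close>, so the vectors
    \<open>ev n i\<close> form a basis of the cohomology.\<close>
  have hcard: "hdim I D n = card (I n)" for n
  proof -
    have Z: "coc M I D n = VV I n" using DM by (auto simp: coc_def)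
    have "v \<in> cob M I D n \<longleftrightarrow> v \<in> VV I n \<and> v \<in> pt M" for v
    proof
      assume "v \<in> cob M I D n"
      then obtain w where w: "v \<in> VV I n" "w \<in> VV I (n - 1)" "v - D w \<in> pt M" by (auto simp: cob_def)
      then show "v \<in> VV I n \<and> v \<in> pt M" using smod_diff_cancel[OF smod_ptM w(3) DM[OF w(2)]] by blast
    next
      assume "v \<in> VV I n \<and> v \<in> pt M"
      then show "v \<in> cob M I D n" unfolding cob_def using smod_0[OF smod_VV]
        by (auto intro!: bexI[of _ 0] simp: lin_zero[OF linD])
    qed
    then have N: "cob M I D n = VV I n \<inter> pt M" by blast
    let ?E = "ev n ` I n :: (int \<times> idx, 'r) vec set"
    have inj: "inj_on (ev n :: idx => (int \<times> idx, 'r) vec) (I n)"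
      by (rule inj_onI) (metis Pair_inject ix_ev zero_neq_one)
    have sum: "(\<Sum>s\<in>?E. scl (f s) s) = (\<Sum>i\<in>I n. scl (f (ev n i)) (ev n i))" for f
      by (simp add: sum.reindex[OF inj])
    have "spans ?E (cob M I D n) (coc M I D n)" unfolding spans_def Z
    proof (intro conjI ballI)
      fix w :: "(int \<times> idx, 'r) vec" assume w: "w \<in> VV I n"
      let ?f = "\<lambda>s. ix w (n, inv_into (I n) (ev n) s)"
      have "(\<Sum>s\<in>?E. scl (?f s) s) = (\<Sum>i\<in>I n. scl (ix w (n, i)) (ev n i))"
        unfolding sum by (rule sum.cong) (simp_all add: inv_into_f_f[OF inj])
      also have "\<dots> = w" using VV_expand[OF fin w] ..
      finally show "\<exists>f. w - (\<Sum>s\<in>?E. scl (f s) s) \<in> cob M I D n"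
        using smod_0[OF gm_N[OF gm]] by (intro exI[of _ ?f]) simp
    qed (use fin ev_VV in auto)
    then have le: "hdim I D n \<le> card (I n)" using rdim_le card_image[OF inj] by metis
    have "indep ?E (cob M I D n)" unfolding indep_def
    proof (intro conjI allI impI ballI)
      fix f s assume f: "(\<Sum>s\<in>?E. scl (f s) s) \<in> cob M I D n" and "s \<in> ?E"
      then obtain i where i: "i \<in> I n" "s = ev n i" by blast
      have "ix (\<Sum>s\<in>?E. scl (f s) s) (n, i) = (\<Sum>k\<in>I n. if k = i then f (ev n k) else 0)"
        unfolding sum ix_sum by (rule sum.cong) (auto simp: ix_ev)
      also have "\<dots> = f s" using fin i by simp
      finally have eq: "ix (\<Sum>s\<in>?E. scl (f s) s) (n, i) = f s" .
      have "(\<Sum>s\<in>?E. scl (f s) s) \<in> pt M" using f unfolding N by blast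
      from ptD[OF this, of "(n, i)"] show "f s \<in> M" unfolding eq .
    qed (use fin in simp)
    from indep_le_rdim[OF this _ gm_fd[OF gm] gm_N[OF gm] gm_M[OF gm]]
    have "card ?E \<le> hdim I D n" using ev_VV unfolding Z by blast
    then show ?thesis using le card_image[OF inj] by simp
  qed
  define I' where "I' n = (if n < 0 then {} else I n)" for n
  have VVI': "VV I' n = (if n < 0 then {0} else VV I n :: (int \<times> idx, 'r) vec set)" for n
    by (auto simp: VV_def I'_def intro: vec_eqI)
  have VVsub: "v \<in> VV I' n ==> v \<in> VV I n" for v :: "(int \<times> idx, 'r) vec" and n
    using smod_0[OF smod_VV] by (auto simp: VVI' split: if_splits)
  have up: "G v \<in> VV I' (n + int k)" if "lin G" "\<And>v. v \<in> VV I n ==> G v \<in> VV I (n + int k)" "v \<in> VV I' n"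
    for G :: "(int \<times> idx, 'r) vec => (int \<times> idx, 'r) vec" and n k v
  proof (cases "n < 0")
    case True
    then show ?thesis using that smod_0[OF smod_VV] by (simp add: VVI'[of n] lin_zero)
  next
    case False
    then have "\<not> n + int k < 0" by simp
    then show ?thesis using that False by (simp add: VVI')
  qed
  have X': "cpx c I' D T"
    unfolding cpx_def
  proof (intro conjI allI ballI impI)
    show "finite (I' n)" for n using fin by (simp add: I'_def)
    show "D v \<in> VV I' (n + 1)" if "v \<in> VV I' n" for n v using up[OF linD, of n 1] DV that by simp
    show "T j v \<in> VV I' (n + 2)" if "j < c" "v \<in> VV I' n" for j n v
      using up[OF cpx_linT[OF X that(1)], of n 2] cpx_T[OF X that(1)] that(2) by simp
    show "D (D v) - (\<Sum>j<c. scl (x j) (T j v)) \<in> pt K" if "v \<in> VV I' n" for n v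
      using cpx_DD[OF X VVsub[OF that]] .
  qed (use linD cpx_linT[OF X] in auto)
  have coex': "coex (J c) I' D n" if "n \<ge> 1" for n
    using coex[of n] that unfolding coex_def by (simp add: VVI')
  have aug': "aug c I' D IF dl e Zt f1 \<xi> g G1 s0" using aug unfolding aug_def by (simp add: VVI')
  have "\<exists>n1. gens c (coc M I' D) (cob M I' D) T n1"
    by (rule cohomology_operators_generate[OF order_refl X' coex' _ F aug']) (simp_all add: I'_def)
  then obtain n1 where n1: "gens c (coc M I' D) (cob M I' D) T n1" ..
  \<comment> \<open>For \<open>n \<ge> 3\<close> the degrees \<open>n - 2\<close>,
    \<open>n - 1\<close> and \<open>n\<close> are not touched by the truncation.\<close>
  have "gens c (coc M I D) (cob M I D) T (max n1 3)"
    unfolding gens_def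
  proof (intro allI impI ballI)
    fix n z assume n: "max n1 3 \<le> n" and z: "z \<in> coc M I D n"
    have eq: "coc M I' D n = coc M I D n" "coc M I' D (n - 2) = coc M I D (n - 2)" "cob M I' D n = cob M I D n"
      using n by (auto simp: coc_def cob_def VVI')
    show "\<exists>f. (\<forall>j<c. f j \<in> coc M I D (n - 2)) \<and> z - (\<Sum>j<c. T j (f j)) \<in> cob M I D n"
      using n1 n z unfolding gens_def eq[symmetric] by simp
  qed
  then have "\<exists>n1. gens c (coc M I D) (cob M I D) T n1" by blast
  from growth_transfer[OF X exact this] gr show ?thesis by (simp add: hcard)
qed

end

section \<open>Complexes given by matrices\<close>

definition bI :: "(int => nat) => int => idx set" where
  "bI \<beta> n = Base ` {..<\<beta> n}"

text \<open>Matrices act on row vectors, so that \<open>mop\<close> of the matrices of a complex gives the dual complex.\<close>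

definition mop :: "(int => nat) => (int => nat) => int => (int => nat => nat => 'r::comm_ring_1)
    => (int \<times> idx, 'r) vec => (int \<times> idx, 'r) vec" where
  "mop \<beta> \<beta>' s A v = Vec (\<lambda>(m, t). case t of
     Base j => if j < \<beta>' m then \<Sum>i<\<beta> (m - s). A (m - s) i j * ix v (m - s, Base i) else 0 | _ => 0)"

lemma ix_mop: "ix (mop \<beta> \<beta>' s A v) (m, t) = (case t of
     Base j => if j < \<beta>' m then \<Sum>i<\<beta> (m - s). A (m - s) i j * ix v (m - s, Base i) else 0 | _ => 0)"
  by (simp add: mop_def)

lemma ix_mop_other [simp]: "ix (mop \<beta> \<beta>' s A v) (m, InL t) = 0" "ix (mop \<beta> \<beta>' s A v) (m, InR t) = 0"
  by (simp_all add: ix_mop)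

lemma finite_bI: "finite (bI \<beta> n)" and card_bI: "card (bI \<beta> n) = \<beta> n"
  by (simp_all add: bI_def card_image inj_on_def)

lemma lin_mop: "lin (mop \<beta> \<beta>' s A)"
  by (rule linI; rule vec_eqI)
    (auto simp: ix_mop sum.distrib sum_distrib_left algebra_simps split: idx.split)

lemma mop_VV:
  assumes "v \<in> VV (bI \<beta>) n"
  shows "mop \<beta> \<beta>' s A v \<in> VV (bI \<beta>') (n + s)"
proof -
  have "ix (mop \<beta> \<beta>' s A v) (m, t) = 0" if nt: "\<not> (m = n + s \<and> t \<in> bI \<beta>' (n + s))" for m t
  proof (cases t)
    case (Base j)
    show ?thesis
    proof (cases "m = n + s")
      case True
      then show ?thesis using nt Base by (auto simp: bI_def ix_mop)
    next
      case False
      then have "ix v (m - s, Base i) = 0" for i using assms by (auto simp: VV_def)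
      then show ?thesis by (simp add: ix_mop Base)
    qed
  qed (simp_all add: ix_mop)
  then show ?thesis by (auto simp: VV_def)
qed

lemma mop_VV': "v \<in> VV (bI \<beta>) n ==> m = n + s ==> mop \<beta> \<beta>' s A v \<in> VV (bI \<beta>') m"
  using mop_VV by blast

lemma ix_mop_ev:
  assumes "i < \<beta> n"
  shows "ix (mop \<beta> \<beta>' s A (ev n (Base i))) (m, Base j) = (if m = n + s \<and> j < \<beta>' m then A n i j else 0)"
proof -
  have "(\<Sum>k<\<beta> (m - s). A (m - s) k j * ix (ev n (Base i)) (m - s, Base k)) =
      (\<Sum>k<\<beta> (m - s). if k = i then (if m = n + s then A n i j else 0) else 0)"
    by (rule sum.cong) (auto simp: ix_ev)
  also have "\<dots> = (if m = n + s then A n i j else 0)" using assms by auto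
  finally have "(\<Sum>k<\<beta> (m - s). A (m - s) k j * ix (ev n (Base i)) (m - s, Base k)) = (if m = n + s then A n i j else 0)" .
  then show ?thesis unfolding ix_mop prod.case idx.case by (simp only:) auto
qed

lemma ix_mop_mop:
  assumes "i < \<beta> n"
  shows "ix (mop \<beta>' \<beta>'' s' B (mop \<beta> \<beta>' s A (ev n (Base i)))) (m, Base j) =
    (if m = n + s + s' \<and> j < \<beta>'' m then \<Sum>k<\<beta>' (n + s). A n i k * B (n + s) k j else 0)"
proof (cases "m = n + s + s'")
  case True
  then have "m - s' = n + s" by simp
  then show ?thesis using True by (simp add: ix_mop[of \<beta>'] ix_mop_ev[of i \<beta> n, OF assms] mult.commute)
next
  case False
  then have "m - s' \<noteq> n + s" by auto
  then show ?thesis using False by (simp add: ix_mop[of \<beta>'] ix_mop_ev[of i \<beta> n, OF assms])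
qed

lemma mop_ptI:
  assumes "lin G" "idl L" "v \<in> VV (bI \<beta>) n" "\<And>i m t. i < \<beta> n ==> ix (G (ev n (Base i))) (m, t) \<in> L"
  shows "G v \<in> pt L"
  by (rule lin_on_basis[OF assms(1) smod_pt[OF assms(2)] finite_bI _ assms(3)]) (auto simp: bI_def pt_def assms(4))

lemma lin_mop_ev:
  assumes "lin G" "i < \<beta> n"
  shows "G (mop \<beta> \<beta>' s A (ev n (Base i))) = (\<Sum>j<\<beta>' (n + s). scl (A n i j) (G (ev (n + s) (Base j))))"
proof -
  let ?u = "mop \<beta> \<beta>' s A (ev n (Base i))"
  have "?u \<in> VV (bI \<beta>') (n + s)" by (rule mop_VV[OF ev_VV]) (use assms(2) in \<open>simp add: bI_def\<close>)
  then have "?u = (\<Sum>t\<in>bI \<beta>' (n + s). scl (ix ?u (n + s, t)) (ev (n + s) t))" by (rule VV_expand[OF finite_bI])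
  also have "\<dots> = (\<Sum>j<\<beta>' (n + s). scl (A n i j) (ev (n + s) (Base j)))"
    unfolding bI_def by (subst sum.reindex) (auto simp: inj_on_def ix_mop_ev[of i \<beta> n, OF assms(2)] intro!: sum.cong)
  finally show ?thesis by (simp add: lin_simps[OF assms(1)])
qed

text \<open>The cokernel of the \<open>\<beta> \<times> \<gamma>\<close> matrix \<open>b\<close> over the ring modulo \<open>L\<close> is a retract of a module with a finite
  projective resolution over the ring modulo \<open>K\<close>. The modules of the resolution are the images of the
  idempotent matrices \<open>E n\<close>, and \<open>z\<close> and \<open>g\<close> are lifts to degree zero of the inclusion and the retraction.\<close>

definition pd_rel where
  "pd_rel K L x c \<beta> \<gamma> b N k E \<Delta> z g \<longleftrightarrow>
     (\<forall>n. \<forall>l<k n. \<forall>m<k n. (\<Sum>j<k n. E n l j * E n j m) - E n l m \<in> K) \<and>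
     (\<forall>n. \<forall>l<k n. \<forall>m<k (Suc n). (\<Sum>j<k n. E n l j * \<Delta> n j m) - \<Delta> n l m \<in> K) \<and>
     (\<forall>n. \<forall>l<k n. \<forall>m<k (Suc n). (\<Sum>j<k (Suc n). \<Delta> n l j * E (Suc n) j m) - \<Delta> n l m \<in> K) \<and>
     (\<forall>n. \<forall>l<k n. \<forall>m<k (Suc (Suc n)). (\<Sum>j<k (Suc n). \<Delta> n l j * \<Delta> (Suc n) j m) \<in> K) \<and>
     (\<forall>n>N. \<forall>l<k n. \<forall>m<k n. E n l m \<in> K) \<and>
     (\<forall>n v. (\<forall>l<k n. (\<Sum>j<k (Suc n). \<Delta> n l j * v j) \<in> K) -->
        (\<exists>w. \<forall>j<k (Suc n). (\<Sum>m<k (Suc n). E (Suc n) j m * v m) - (\<Sum>m<k (Suc (Suc n)). \<Delta> (Suc n) j m * w m) \<in> K)) \<and>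
     (\<forall>i<\<beta>. \<forall>l<k 0. (\<Sum>m<k 0. E 0 l m * z i m) - z i l \<in> K) \<and>
     (\<forall>j<\<gamma>. \<exists>f. \<forall>l<k 0. (\<Sum>i<\<beta>. b i j * z i l) - (\<Sum>m<k 1. \<Delta> 0 l m * f m) \<in> K) \<and>
     (\<forall>h<c. \<forall>i<\<beta>. \<exists>f. \<forall>l<k 0. x h * z i l - (\<Sum>m<k 1. \<Delta> 0 l m * f m) \<in> K) \<and>
     (\<forall>m<k 1. \<exists>f. \<forall>i<\<beta>. (\<Sum>l<k 0. g l i * \<Delta> 0 l m) - (\<Sum>j<\<gamma>. b i j * f j) \<in> L) \<and>
     (\<forall>i'<\<beta>. \<exists>f. \<forall>i<\<beta>. (if i = i' then 1 else 0) - (\<Sum>l<k 0. z i' l * g l i) - (\<Sum>j<\<gamma>. b i j * f j) \<in> L)"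
  for k :: "nat => nat"

definition pd_data where
  "pd_data K L x c \<beta> \<gamma> b \<longleftrightarrow> (\<exists>N k E \<Delta> z g. pd_rel K L x c \<beta> \<gamma> b N k E \<Delta> z g)"

text \<open>For matrices \<open>a\<close> of size \<open>p \<times> q\<close> and \<open>b\<close>
  of size \<open>q \<times> r\<close> acting on columns, the kernel of \<open>a\<close> lies in the
  image of \<open>b\<close> modulo \<open>L\<close>. That products vanish is always stated
  separately.\<close>

definition exact_columns where
  "exact_columns L p q r a b \<longleftrightarrow> (\<forall>v. (\<forall>i<p. (\<Sum>j<q. a i j * v j) \<in> L) -->
     (\<exists>w. \<forall>j<q. v j - (\<Sum>k<r. b j k * w k) \<in> L))" for p q r :: nat

context local_quotient
begin

text \<open>A linear map on degree \<open>n\<close> is a family of columns, one for each coordinate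
  of its values; exactness is applied to each column, and the solutions are assembled into
  \<open>G'\<close>.\<close>

lemma coex_matrix:
  fixes a :: "int => nat => nat => 'r"
  assumes L: "idl L" and ex: "exact_columns L (\<beta> (n - 1)) (\<beta> n) (\<beta> (n + 1)) (a n) (a (n + 1))"
  shows "coex L (bI \<beta>) (mop \<beta> \<beta> 1 (\<lambda>n. a (n + 1))) n"
  unfolding coex_def
proof (intro allI impI)
  let ?D = "mop \<beta> \<beta> 1 (\<lambda>n. a (n + 1))"
  fix G :: "(int \<times> idx, 'r) vec => (int \<times> idx, 'r) vec"
  assume linG: "lin G" and G: "\<forall>v\<in>VV (bI \<beta>) (n - 1). G (?D v) \<in> pt L"
  have "\<exists>w. \<forall>j<\<beta> n. ix (G (ev n (Base j))) p - (\<Sum>k<\<beta> (n + 1). a (n + 1) j k * w k) \<in> L" for p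
  proof -
    have "(\<Sum>j<\<beta> n. a n i j * ix (G (ev n (Base j))) p) \<in> L" if i: "i < \<beta> (n - 1)" for i
    proof -
      have e: "ev (n - 1) (Base i) \<in> VV (bI \<beta>) (n - 1)" by (rule ev_VV) (use i in \<open>simp add: bI_def\<close>)
      have "G (?D (ev (n - 1) (Base i))) = (\<Sum>j<\<beta> n. scl (a n i j) (G (ev n (Base j))))"
        using lin_mop_ev[where \<beta> = \<beta> and \<beta>' = \<beta> and n = "n - 1" and s = 1 and A = "\<lambda>n. a (n + 1)", OF linG i] by simp
      moreover have "G (?D (ev (n - 1) (Base i))) \<in> pt L" using G e by blast
      ultimately have "(\<Sum>j<\<beta> n. scl (a n i j) (G (ev n (Base j)))) \<in> pt L" by simp
      from ptD[OF this, of p] show ?thesis by (simp add: ix_sum)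
    qed
    then show ?thesis
      using ex[unfolded exact_columns_def, rule_format, of "\<lambda>j. ix (G (ev n (Base j))) p"] by blast
  qed
  then obtain w where w: "\<And>p j. j < \<beta> n ==> ix (G (ev n (Base j))) p - (\<Sum>k<\<beta> (n + 1). a (n + 1) j k * w p k) \<in> L"
    by metis
  define G' where "G' v = Vec (\<lambda>p. \<Sum>k<\<beta> (n + 1). ix v (n + 1, Base k) * w p k)" for v
  have linG': "lin G'"
    by (rule linI; rule vec_eqI) (auto simp: G'_def sum.distrib sum_distrib_left algebra_simps)
  have "G v - G' (?D v) \<in> pt L" if v: "v \<in> VV (bI \<beta>) n" for v
  proof (rule mop_ptI[where G = "\<lambda>v. G v - G' (?D v)", OF lin_sub[OF linG lin_comp[OF linG' lin_mop]] L v])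
    fix i m t assume i: "i < \<beta> n"
    have "ix (G' (?D (ev n (Base i)))) (m, t) = (\<Sum>k<\<beta> (n + 1). a (n + 1) i k * w (m, t) k)"
      by (simp add: G'_def ix_mop_ev[of i \<beta> n, OF i])
    then show "ix (G (ev n (Base i)) - G' (?D (ev n (Base i)))) (m, t) \<in> L" using w[OF i, of "(m, t)"] by simp
  qed
  then show "\<exists>G'. lin G' \<and> (\<forall>v\<in>VV (bI \<beta>) n. G v - G' (?D v) \<in> pt L)" using linG' by blast
qed

lemma exact_matrix:
  fixes a :: "int => nat => nat => 'r"
  assumes ex: "exact_columns (J c) (\<beta> (n + 1)) (\<beta> n) (\<beta> (n - 1)) (\<lambda>i j. a (n + 1) j i) (\<lambda>i j. a n j i)"
  shows "exact_at c (bI \<beta>) (mop \<beta> \<beta> 1 (\<lambda>n. a (n + 1))) n"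
  unfolding exact_at_def
proof (intro ballI impI)
  let ?D = "mop \<beta> \<beta> 1 (\<lambda>n. a (n + 1))"
  fix v assume v: "v \<in> VV (bI \<beta>) n" and Dv: "?D v \<in> pt (J c)"
  have "(\<Sum>j<\<beta> n. a (n + 1) j i * ix v (n, Base j)) \<in> J c" if "i < \<beta> (n + 1)" for i
    using ptD[OF Dv, of "(n + 1, Base i)"] that by (simp add: ix_mop)
  then obtain w where w: "\<And>j. j < \<beta> n ==> ix v (n, Base j) - (\<Sum>k<\<beta> (n - 1). a n k j * w k) \<in> J c"
    using ex[unfolded exact_columns_def, rule_format, of "\<lambda>j. ix v (n, Base j)"] by blast
  define u where "u = Vec (\<lambda>(m, t). case t of Base j => if m = n - 1 \<and> j < \<beta> m then w j else 0 | _ => 0)"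
  have u: "u \<in> VV (bI \<beta>) (n - 1)" by (auto simp: u_def VV_def bI_def split: idx.split)
  have "ix (v - ?D u) (m, t) \<in> J c" for m t
  proof (cases "m = n \<and> t \<in> bI \<beta> n")
    case True
    then obtain j where j: "t = Base j" "j < \<beta> n" "m = n" by (auto simp: bI_def)
    then show ?thesis using w[of j] by (simp add: ix_mop u_def)
  next
    case False
    have "v - ?D u \<in> VV (bI \<beta>) n" using v mop_VV'[OF u, of n] by (intro smod_diff[OF smod_VV]) auto
    then have "ix (v - ?D u) (m, t) = 0" using False unfolding VV_def by blast
    then show ?thesis using idl_0[OF idl_J] by simp
  qed
  then have "v - ?D u \<in> pt (J c)" by (auto simp: pt_def simp del: ix_simps)
  then show "\<exists>w\<in>VV (bI \<beta>) (n - 1). v - ?D w \<in> pt (J c)" using u by blast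
qed

theorem matrix_growth_step:
  fixes a :: "int => nat => nat => 'r"
  assumes min: "\<And>n i j. i < \<beta> (n - 1) ==> j < \<beta> n ==> a n i j \<in> M"
    and dd: "\<And>n i j. i < \<beta> (n - 1) ==> j < \<beta> (n + 1) ==> (\<Sum>k<\<beta> n. a n i k * a (n + 1) k j) \<in> J c"
    and colex: "\<And>n. exact_columns (J c) (\<beta> (n - 1)) (\<beta> n) (\<beta> (n + 1)) (a n) (a (n + 1))"
    and rowex: "\<And>n. exact_columns (J c) (\<beta> (n + 1)) (\<beta> n) (\<beta> (n - 1)) (\<lambda>i j. a (n + 1) j i) (\<lambda>i j. a n j i)"
    and pd: "pd_data K (J c) x c (\<beta> 0) (\<beta> 1) (a 1)"
    and gr: "growth_le t \<beta>"
  shows "growth_le t (\<lambda>n. \<beta> (- n))"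
proof -
  let ?D = "mop \<beta> \<beta> 1 (\<lambda>n. a (n + 1))"
  obtain N k E \<Delta> z g where "pd_rel K (J c) x c (\<beta> 0) (\<beta> 1) (a 1) N k E \<Delta> z g"
    using pd unfolding pd_data_def by blast
  note rel = this[unfolded pd_rel_def]
  from rel have EE: "\<And>n l m. l < k n ==> m < k n ==> (\<Sum>j<k n. E n l j * E n j m) - E n l m \<in> K"
    by (elim conjE) blast
  from rel have E\<Delta>: "\<And>n l m. l < k n ==> m < k (Suc n) ==> (\<Sum>j<k n. E n l j * \<Delta> n j m) - \<Delta> n l m \<in> K"
    by (elim conjE) blast
  from rel have \<Delta>E: "\<And>n l m. l < k n ==> m < k (Suc n) ==> (\<Sum>j<k (Suc n). \<Delta> n l j * E (Suc n) j m) - \<Delta> n l m \<in> K"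
    by (elim conjE) blast
  from rel have \<Delta>\<Delta>: "\<And>n l m. l < k n ==> m < k (Suc (Suc n)) ==> (\<Sum>j<k (Suc n). \<Delta> n l j * \<Delta> (Suc n) j m) \<in> K"
    by (elim conjE) blast
  from rel have EN: "\<And>n l m. n > N ==> l < k n ==> m < k n ==> E n l m \<in> K"
    by (elim conjE) blast
  from rel have ex: "\<And>n v. (\<And>l. l < k n ==> (\<Sum>j<k (Suc n). \<Delta> n l j * v j) \<in> K) ==>
        (\<exists>w. \<forall>j<k (Suc n). (\<Sum>m<k (Suc n). E (Suc n) j m * v m) - (\<Sum>m<k (Suc (Suc n)). \<Delta> (Suc n) j m * w m) \<in> K)"
    by (elim conjE) blast
  from rel have Ez: "\<And>i l. i < \<beta> 0 ==> l < k 0 ==> (\<Sum>m<k 0. E 0 l m * z i m) - z i l \<in> K"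
    by (elim conjE) blast
  from rel have f1: "\<And>j. j < \<beta> 1 ==> \<exists>f. \<forall>l<k 0. (\<Sum>i<\<beta> 0. a 1 i j * z i l) - (\<Sum>m<k 1. \<Delta> 0 l m * f m) \<in> K"
    by (elim conjE) simp
  from rel have xi: "\<And>h i. h < c ==> i < \<beta> 0 ==> \<exists>f. \<forall>l<k 0. x h * z i l - (\<Sum>m<k 1. \<Delta> 0 l m * f m) \<in> K"
    by (elim conjE) simp
  from rel have G1: "\<And>m. m < k 1 ==> \<exists>f. \<forall>i<\<beta> 0. (\<Sum>l<k 0. g l i * \<Delta> 0 l m) - (\<Sum>j<\<beta> 1. a 1 i j * f j) \<in> J c"
    by (elim conjE) simp
  from rel have s0: "\<And>i'. i' < \<beta> 0 ==> \<exists>f. \<forall>i<\<beta> 0. (if i = i' then 1 else 0) - (\<Sum>l<k 0. z i' l * g l i) - (\<Sum>j<\<beta> 1. a 1 i j * f j) \<in> J c"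
    by (elim conjE) simp
  obtain f1 where f1: "\<And>j l. j < \<beta> 1 ==> l < k 0 ==> (\<Sum>i<\<beta> 0. a 1 i j * z i l) - (\<Sum>m<k 1. \<Delta> 0 l m * f1 j m) \<in> K"
    using f1 by metis
  obtain xi where xi: "\<And>h i l. h < c ==> i < \<beta> 0 ==> l < k 0 ==> x h * z i l - (\<Sum>m<k 1. \<Delta> 0 l m * xi h i m) \<in> K"
    using xi by metis
  obtain G1 where G1: "\<And>m i. m < k 1 ==> i < \<beta> 0 ==> (\<Sum>l<k 0. g l i * \<Delta> 0 l m) - (\<Sum>j<\<beta> 1. a 1 i j * G1 m j) \<in> J c"
    using G1 by metis
  obtain s0 where s0: "\<And>i' i. i' < \<beta> 0 ==> i < \<beta> 0 ==>
      (if i = i' then 1 else 0) - (\<Sum>l<k 0. z i' l * g l i) - (\<Sum>j<\<beta> 1. a 1 i j * s0 i' j) \<in> J c"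
    using s0 by metis
  \<comment> \<open>The ranks in the finite resolution, continued by zero in negative
    degrees.\<close>
  define kk where "kk n = (if n < 0 then 0 else k (nat n))" for n :: int
  have kk: "kk (int n) = k n" "kk (int n + 1) = k (Suc n)" "kk (int n + 1 + 1) = k (Suc (Suc n))" "kk 0 = k 0" "kk 1 = k 1"
      "kk (2 + int n) = k (Suc (Suc n))" for n
    by (simp_all add: kk_def nat_add_distrib)
  have kpos: "i < kk n ==> \<exists>m. n = int m" for i n
    by (intro exI[of _ "nat n"]) (auto simp: kk_def split: if_splits)
  define dl where "dl = mop kk kk 1 (\<lambda>n. \<Delta> (nat n))"
  define e where "e = mop kk kk 0 (\<lambda>n. E (nat n))"
  define Zt where "Zt = mop kk \<beta> 0 (\<lambda>n l i. z i l)"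
  let ?f1 = "mop kk \<beta> 0 (\<lambda>n m j. f1 j m)"
  let ?xi = "\<lambda>h. mop kk \<beta> (-1) (\<lambda>n m i. xi h i m)"
  let ?g = "mop \<beta> kk 0 (\<lambda>n i l. g l i)"
  let ?G1 = "mop \<beta> kk 0 (\<lambda>n j m. G1 m j)"
  let ?s0 = "mop \<beta> \<beta> (-1) (\<lambda>n j i. s0 i j)"
  have nz: "nat (int n + 1) = Suc n" for n by simp
  have res: "fin_res K (bI kk) dl e (int N)"
    unfolding fin_res_def
  proof (intro conjI allI ballI impI)
    show "finite (bI kk n)" for n by (rule finite_bI)
    show ldl: "lin dl" and le: "lin e" by (simp_all add: dl_def e_def lin_mop)
    fix n and v :: "(int \<times> idx, 'r) vec" assume v: "v \<in> VV (bI kk) n"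
    show "dl v \<in> VV (bI kk) (n + 1)" unfolding dl_def by (rule mop_VV[OF v])
    show "e v \<in> VV (bI kk) n" unfolding e_def by (rule mop_VV'[OF v]) simp
    show "e (e v) - e v \<in> pt K"
    proof (rule mop_ptI[where G = "\<lambda>v. e (e v) - e v", OF lin_sub[OF lin_comp[OF le le] le] idl_K v])
      fix i m t assume i: "i < kk n"
      then obtain n' where n': "n = int n'" using kpos by blast
      show "ix (e (e (ev n (Base i))) - e (ev n (Base i))) (m, t) \<in> K"
        using EE[of i n'] i unfolding e_def
        by (cases t) (auto simp: ix_mop_mop ix_mop_ev n' kk idl_0[OF idl_K])
    qed
    show "dl (dl v) \<in> pt K"
    proof (rule mop_ptI[where G = "\<lambda>v. dl (dl v)", OF lin_comp[OF ldl ldl] idl_K v])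
      fix i m t assume i: "i < kk n"
      then obtain n' where n': "n = int n'" using kpos by blast
      show "ix (dl (dl (ev n (Base i)))) (m, t) \<in> K"
        using \<Delta>\<Delta>[of i n'] i unfolding dl_def
        by (cases t) (auto simp: ix_mop_mop n' nz kk idl_0[OF idl_K])
    qed
    show "dl (e v) - dl v \<in> pt K"
    proof (rule mop_ptI[where G = "\<lambda>v. dl (e v) - dl v", OF lin_sub[OF lin_comp[OF ldl le] ldl] idl_K v])
      fix i m t assume i: "i < kk n"
      then obtain n' where n': "n = int n'" using kpos by blast
      show "ix (dl (e (ev n (Base i))) - dl (ev n (Base i))) (m, t) \<in> K"
        using E\<Delta>[of i n'] i unfolding e_def dl_def
        by (cases t) (auto simp: ix_mop_mop ix_mop_ev n' nz kk idl_0[OF idl_K])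
    qed
    show "e (dl v) - dl v \<in> pt K"
    proof (rule mop_ptI[where G = "\<lambda>v. e (dl v) - dl v", OF lin_sub[OF lin_comp[OF le ldl] ldl] idl_K v])
      fix i m t assume i: "i < kk n"
      then obtain n' where n': "n = int n'" using kpos by blast
      show "ix (e (dl (ev n (Base i))) - dl (ev n (Base i))) (m, t) \<in> K"
        using \<Delta>E[of i n'] i unfolding e_def dl_def
        by (cases t) (auto simp: ix_mop_mop ix_mop_ev n' nz kk idl_0[OF idl_K])
    qed
    show "e v \<in> pt K" if N: "int N < n"
    proof (rule mop_ptI[OF le idl_K v])
      fix i m t assume i: "i < kk n"
      then obtain n' where n': "n = int n'" using kpos by blast
      show "ix (e (ev n (Base i))) (m, t) \<in> K"
        using EN[of n' i] i N unfolding e_def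
        by (cases t) (auto simp: ix_mop_ev n' kk idl_0[OF idl_K])
    qed
  next
    fix n :: int and G :: "(int \<times> idx, 'r) vec => (int \<times> idx, 'r) vec"
    assume n: "1 \<le> n" and linG: "lin G" and G: "\<forall>v\<in>VV (bI kk) (n - 1). G (dl v) \<in> pt K"
    obtain n' where n': "n = int (Suc n')" using n zero_less_imp_eq_int[of n] by (metis Suc_pred' less_le_trans zero_less_one)
    have ne: "n - 1 = int n'" "nat n = Suc n'" "nat (n - 1) = n'" "nat (n + 1) = Suc (Suc n')" using n' by auto
    have kn: "kk (n - 1) = k n'" "kk n = k (Suc n')" "kk (n + 1) = k (Suc (Suc n'))" using n by (simp_all add: kk_def ne)
    let ?v = "\<lambda>p j. ix (G (ev n (Base j))) p"
    have "\<exists>w. \<forall>j<k (Suc n'). (\<Sum>m<k (Suc n'). E (Suc n') j m * ?v p m) - (\<Sum>m<k (Suc (Suc n')). \<Delta> (Suc n') j m * w m) \<in> K" for p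
    proof (rule ex)
      fix l assume l: "l < k n'"
      then have l': "l < kk (n - 1)" by (simp add: kn)
      have "ev (n - 1) (Base l) \<in> VV (bI kk) (n - 1)" by (rule ev_VV) (use l' in \<open>simp add: bI_def\<close>)
      then have "G (dl (ev (n - 1) (Base l))) \<in> pt K" using G by blast
      from ptD[OF this, of p] show "(\<Sum>j<k (Suc n'). \<Delta> n' l j * ?v p j) \<in> K"
        unfolding dl_def lin_mop_ev[where \<beta> = kk and n = "n - 1", OF linG l'] by (simp add: ix_sum kn ne(3))
    qed
    then have "\<forall>p. \<exists>w. \<forall>j<k (Suc n'). (\<Sum>m<k (Suc n'). E (Suc n') j m * ?v p m) - (\<Sum>m<k (Suc (Suc n')). \<Delta> (Suc n') j m * w m) \<in> K" ..
    from choice[OF this] obtain w where "\<forall>p. \<forall>j<k (Suc n').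
      (\<Sum>m<k (Suc n'). E (Suc n') j m * ?v p m) - (\<Sum>m<k (Suc (Suc n')). \<Delta> (Suc n') j m * w p m) \<in> K" ..
    then have w: "j < k (Suc n') ==>
      (\<Sum>m<k (Suc n'). E (Suc n') j m * ?v p m) - (\<Sum>m<k (Suc (Suc n')). \<Delta> (Suc n') j m * w p m) \<in> K" for p j
      by blast
    define G' where "G' u = Vec (\<lambda>p. \<Sum>m<k (Suc (Suc n')). ix u (n + 1, Base m) * w p m)" for u
    have linG': "lin G'"
      by (rule linI; rule vec_eqI) (auto simp: G'_def sum.distrib sum_distrib_left algebra_simps)
    have "G (e v) - G' (dl v) \<in> pt K" if v: "v \<in> VV (bI kk) n" for v
    proof (rule mop_ptI[where G = "\<lambda>v. G (e v) - G' (dl v)", OF _ idl_K v])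
      show "lin (\<lambda>v. G (e v) - G' (dl v))" unfolding e_def dl_def
        by (intro lin_sub lin_comp[OF linG lin_mop] lin_comp[OF linG' lin_mop])
      fix j m t assume j: "j < kk n"
      have "ix (G' (dl (ev n (Base j)))) (m, t) = (\<Sum>i<k (Suc (Suc n')). \<Delta> (Suc n') j i * w (m, t) i)"
        using j by (simp add: G'_def dl_def ix_mop_ev kn ne(2-))
      moreover have "ix (G (e (ev n (Base j)))) (m, t) = (\<Sum>i<k (Suc n'). E (Suc n') j i * ?v (m, t) i)"
        unfolding e_def lin_mop_ev[where \<beta> = kk and n = n, OF linG j] by (simp add: ix_sum kn ne)
      ultimately show "ix (G (e (ev n (Base j))) - G' (dl (ev n (Base j)))) (m, t) \<in> K"
        using w[of j "(m, t)"] j by (simp add: kn)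
    qed
    then show "\<exists>G'. lin G' \<and> (\<forall>v\<in>VV (bI kk) n. G (e v) - G' (dl v) \<in> pt K)" using linG' by blast
  qed
  have aug: "aug c (bI \<beta>) ?D (bI kk) dl e Zt ?f1 ?xi ?g ?G1 ?s0"
    unfolding aug_def
  proof (intro conjI allI ballI impI)
    show "lin Zt" by (simp add: Zt_def lin_mop)
    fix w :: "(int \<times> idx, 'r) vec" assume w: "w \<in> VV (bI kk) 0"
    show "Zt w \<in> VV (bI \<beta>) 0" unfolding Zt_def by (rule mop_VV'[OF w]) simp
    show "Zt (e w) - Zt w \<in> pt K"
    proof (rule mop_ptI[where G = "\<lambda>w. Zt (e w) - Zt w", OF _ idl_K w])
      show "lin (\<lambda>w. Zt (e w) - Zt w)" unfolding Zt_def e_def by (intro lin_sub lin_comp[OF lin_mop lin_mop] lin_mop)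
      fix l m t assume l: "l < kk 0"
      show "ix (Zt (e (ev 0 (Base l))) - Zt (ev 0 (Base l))) (m, t) \<in> K"
        using Ez[of _ l] l unfolding e_def Zt_def
        by (cases t) (auto simp: ix_mop_mop ix_mop_ev kk idl_0[OF idl_K])
    qed
    show "?D (Zt w) - ?f1 (dl w) \<in> pt K"
    proof (rule mop_ptI[where G = "\<lambda>w. ?D (Zt w) - ?f1 (dl w)", OF _ idl_K w])
      show "lin (\<lambda>w. ?D (Zt w) - ?f1 (dl w))" unfolding Zt_def dl_def by (intro lin_sub lin_comp[OF lin_mop lin_mop] lin_mop)
      fix l m t assume l: "l < kk 0"
      show "ix (?D (Zt (ev 0 (Base l))) - ?f1 (dl (ev 0 (Base l)))) (m, t) \<in> K"
        using f1[of _ l] l unfolding dl_def Zt_def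
        by (cases t) (auto simp: ix_mop_mop kk idl_0[OF idl_K] mult.commute)
    qed
    show "scl (x h) (Zt w) - ?xi h (dl w) \<in> pt K" if h: "h < c" for h
    proof (rule mop_ptI[where G = "\<lambda>w. scl (x h) (Zt w) - ?xi h (dl w)", OF _ idl_K w])
      show "lin (\<lambda>w. scl (x h) (Zt w) - ?xi h (dl w))" unfolding Zt_def dl_def by (intro lin_sub lin_scl_map lin_comp[OF lin_mop lin_mop] lin_mop)
      fix l m t assume l: "l < kk 0"
      show "ix (scl (x h) (Zt (ev 0 (Base l))) - ?xi h (dl (ev 0 (Base l)))) (m, t) \<in> K"
        using xi[OF h, of _ l] l unfolding dl_def Zt_def
        by (cases t) (auto simp: ix_mop_mop ix_mop_ev kk idl_0[OF idl_K])
    qed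
  next
    fix w :: "(int \<times> idx, 'r) vec" assume w: "w \<in> VV (bI kk) 1"
    show "?f1 w \<in> VV (bI \<beta>) 1" by (rule mop_VV'[OF w]) simp
    show "?xi h w \<in> VV (bI \<beta>) 0" for h by (rule mop_VV'[OF w]) simp
  next
    fix u :: "(int \<times> idx, 'r) vec" assume u: "u \<in> VV (bI \<beta>) 0"
    show "?g u \<in> VV (bI kk) 0" by (rule mop_VV'[OF u]) simp
    show "dl (?g u) - ?G1 (?D u) \<in> pt (J c)"
    proof (rule mop_ptI[where G = "\<lambda>u. dl (?g u) - ?G1 (?D u)", OF _ idl_J u])
      show "lin (\<lambda>u. dl (?g u) - ?G1 (?D u))" unfolding dl_def by (intro lin_sub lin_comp[OF lin_mop lin_mop] lin_mop)
      fix i m t assume i: "i < \<beta> 0"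
      show "ix (dl (?g (ev 0 (Base i))) - ?G1 (?D (ev 0 (Base i)))) (m, t) \<in> J c"
        using G1[of _ i] i unfolding dl_def
        by (cases t) (auto simp: ix_mop_mop kk idl_0[OF idl_J])
    qed
    show "u - Zt (?g u) - ?s0 (?D u) \<in> pt (J c)"
    proof (rule mop_ptI[where G = "\<lambda>u. u - Zt (?g u) - ?s0 (?D u)", OF _ idl_J u])
      show "lin (\<lambda>u. u - Zt (?g u) - ?s0 (?D u))" unfolding Zt_def by (intro lin_sub lin_id lin_comp[OF lin_mop lin_mop])
      fix i m t assume i: "i < \<beta> 0"
      show "ix (ev 0 (Base i) - Zt (?g (ev 0 (Base i))) - ?s0 (?D (ev 0 (Base i)))) (m, t) \<in> J c"
        using s0[of _ i] i unfolding Zt_def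
        by (cases t) (auto simp: ix_mop_mop ix_ev kk idl_0[OF idl_J] mult.commute eq_commute[of i])
    qed
  next
    fix u :: "(int \<times> idx, 'r) vec" assume u: "u \<in> VV (bI \<beta>) 1"
    show "?G1 u \<in> VV (bI kk) 1" by (rule mop_VV'[OF u]) simp
    show "?s0 u \<in> VV (bI \<beta>) 0" by (rule mop_VV'[OF u]) simp
  qed (rule lin_mop)+
  have "growth_le t (\<lambda>n. card (bI \<beta> (- n)))"
  proof (rule symmetric_growth_step[where I = "bI \<beta>", OF finite_bI lin_mop _ _ _ _ _ res aug])
    show "?D v \<in> VV (bI \<beta>) (n + 1)" if "v \<in> VV (bI \<beta>) n" for n v by (rule mop_VV[OF that])
    show "?D v \<in> pt M" if "v \<in> VV (bI \<beta>) n" for n v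
    proof (rule mop_ptI[OF lin_mop idl_M that])
      fix i m t assume i: "i < \<beta> n"
      show "ix (?D (ev n (Base i))) (m, t) \<in> M"
        using min[of i "n + 1"] i by (cases t) (auto simp: ix_mop_ev idl_0[OF idl_M])
    qed
    show "?D (?D v) \<in> pt (J c)" if "v \<in> VV (bI \<beta>) n" for n v
    proof (rule mop_ptI[where G = "\<lambda>v. ?D (?D v)", OF lin_comp[OF lin_mop lin_mop] idl_J that])
      fix i m t assume i: "i < \<beta> n"
      show "ix (?D (?D (ev n (Base i)))) (m, t) \<in> J c"
        using dd[of i "n + 1"] i by (cases t) (auto simp: ix_mop_mop idl_0[OF idl_J])
    qed
    show "exact_at c (bI \<beta>) ?D n" for n by (rule exact_matrix[OF rowex])
    show "coex (J c) (bI \<beta>) ?D n" for n by (rule coex_matrix[OF idl_J colex])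
    show "growth_le t (\<lambda>n. card (bI \<beta> n))" using gr by (simp add: card_bI)
  qed
  then show ?thesis by (simp add: card_bI)
qed

theorem matrix_growth_symmetric:
  fixes a :: "int => nat => nat => 'r"
  assumes min: "\<And>n i j. i < \<beta> (n - 1) ==> j < \<beta> n ==> a n i j \<in> M"
    and dd: "\<And>n i j. i < \<beta> (n - 1) ==> j < \<beta> (n + 1) ==> (\<Sum>k<\<beta> n. a n i k * a (n + 1) k j) \<in> J c"
    and colex: "\<And>n. exact_columns (J c) (\<beta> (n - 1)) (\<beta> n) (\<beta> (n + 1)) (a n) (a (n + 1))"
    and rowex: "\<And>n. exact_columns (J c) (\<beta> (n + 1)) (\<beta> n) (\<beta> (n - 1)) (\<lambda>i j. a (n + 1) j i) (\<lambda>i j. a n j i)"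
    and pd: "pd_data K (J c) x c (\<beta> 0) (\<beta> 1) (a 1)"
    and pd': "pd_data K (J c) x c (\<beta> (-1)) (\<beta> (-2)) (\<lambda>i j. a (-1) j i)"
  shows "growth_le t \<beta> \<longleftrightarrow> growth_le t (\<lambda>n. \<beta> (- n))"
proof
  show "growth_le t \<beta> ==> growth_le t (\<lambda>n. \<beta> (- n))"
    by (rule matrix_growth_step[where a = a, OF min dd colex rowex pd])
next
  assume gr: "growth_le t (\<lambda>n. \<beta> (- n))"
  \<comment> \<open>Dualizing reverses the degrees, and the shift by one puts
    \<open>\<beta> (- 1)\<close> into degree zero. Then \<open>a' 1\<close> is the transpose of
    \<open>a (- 1)\<close>, the matrix in \<open>pd'\<close>.\<close>
  define b where "b = (\<lambda>n. \<beta> (- n - 1))"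
  define a' where "a' = (\<lambda>n i j. a (- n) j i)"
  have "growth_le t (\<lambda>n. b (- n))"
  proof (rule matrix_growth_step[where a = a'])
    show "growth_le t b" using growth_le_shift[OF gr, of 1] by (simp add: b_def)
    show "a' n i j \<in> M" if "i < b (n - 1)" "j < b n" for n i j
      using min[of j "- n" i] that by (simp add: a'_def b_def)
    show "(\<Sum>k<b n. a' n i k * a' (n + 1) k j) \<in> J c" if "i < b (n - 1)" "j < b (n + 1)" for n i j
      using dd[of j "- n - 1" i] that by (simp add: a'_def b_def mult.commute)
    show "exact_columns (J c) (b (n - 1)) (b n) (b (n + 1)) (a' n) (a' (n + 1))" for n
      using rowex[of "- n - 1"] by (simp add: a'_def b_def)
    show "exact_columns (J c) (b (n + 1)) (b n) (b (n - 1)) (\<lambda>i j. a' (n + 1) j i) (\<lambda>i j. a' n j i)" for n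
      using colex[of "- n - 1"] by (simp add: a'_def b_def)
    show "pd_data K (J c) x c (b 0) (b 1) (a' 1)" using pd' by (simp add: a'_def b_def)
  qed
  from growth_le_shift[OF this, of 1] show "growth_le t \<beta>" by (simp add: b_def)
qed

end

section \<open>Presenting rings as quotients of polynomial rings\<close>

text \<open>Every commutative ring record is the image of a polynomial ring over the integers, whose type is an
  instance of \<open>comm_ring_1\<close>; statements about the ring become congruences modulo the kernel.\<close>

locale ring_cover = cring B for B :: "('c, 'm) ring_scheme" (structure) +
  fixes \<pi> :: "'r::comm_ring_1 => 'c"
  assumes cov_closed [simp]: "\<pi> p \<in> carrier B"
    and cov_add: "\<pi> (p + q) = \<pi> p \<oplus> \<pi> q"
    and cov_mult: "\<pi> (p * q) = \<pi> p \<otimes> \<pi> q"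
    and cov_one: "\<pi> 1 = \<one>"
    and cov_surj: "b \<in> carrier B ==> \<exists>p. \<pi> p = b"
begin

definition lift where
  "lift b = (SOME p. \<pi> p = b)"

lemma cov_lift: "b \<in> carrier B ==> \<pi> (lift b) = b"
  unfolding lift_def by (rule someI_ex[OF cov_surj])

lemma cov_zero: "\<pi> 0 = \<zero>"
proof -
  have "\<pi> 0 \<oplus> \<pi> 0 = \<pi> 0" using cov_add[of 0 0] by simp
  then show ?thesis by (metis cov_closed r_zero add.l_cancel zero_closed)
qed

lemma cov_uminus: "\<pi> (- p) = \<ominus> \<pi> p"
proof -
  have "\<pi> (- p) \<oplus> \<pi> p = \<zero>" using cov_add[of "- p" p] by (simp add: cov_zero)
  then show ?thesis by (metis cov_closed minus_equality)
qed

lemma cov_diff_eq: "\<pi> (p - q) = \<zero> \<longleftrightarrow> \<pi> p = \<pi> q"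
proof -
  have "\<pi> (p - q) = \<pi> p \<oplus> \<ominus> \<pi> q" using cov_add[of p "- q"] by (simp add: cov_uminus)
  then show ?thesis by (metis cov_closed r_right_minus_eq minus_eq)
qed

definition ker where
  "ker = {p. \<pi> p = \<zero>}"

lemma idl_ker: "idl ker"
  by (auto simp: idl_def ker_def cov_zero cov_add cov_mult)

lemma ker_diff: "p - q \<in> ker \<longleftrightarrow> \<pi> p = \<pi> q"
  by (simp add: ker_def cov_diff_eq)

lemma idl_preimage:
  assumes "ideal I B"
  shows "idl {p. \<pi> p \<in> I}"
proof -
  interpret ideal I B by fact
  show ?thesis by (auto simp: idl_def cov_zero cov_add cov_mult I_l_closed)
qed

end

text \<open>There is one variable for each element of the type \<open>'c\<close>. Additively the
  polynomial ring is free abelian on the monomials, so the map comes from the universal property,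
  and multiplicativity is checked on generators.\<close>

lemma polynomial_cover:
  fixes B :: "('c, 'm) ring_scheme"
  assumes "cring B"
  shows "\<exists>\<pi> :: (('c \<Rightarrow>\<^sub>0 nat) \<Rightarrow>\<^sub>0 int) => 'c. ring_cover B \<pi>"
proof -
  interpret cring B by fact
  \<comment> \<open>Variables named by elements outside the carrier are sent to one.\<close>
  define val where "val x = (if x \<in> carrier B then x else \<one>\<^bsub>B\<^esub>)" for x
  have val [simp]: "val x \<in> carrier B" for x by (simp add: val_def)
  define mon where "mon m = (\<Otimes>\<^bsub>B\<^esub>x\<in>Poly_Mapping.keys m. val x [^]\<^bsub>B\<^esub> Poly_Mapping.lookup m x)" for m :: "'c \<Rightarrow>\<^sub>0 nat"
  have mon_closed [simp]: "mon m \<in> carrier B" for m unfolding mon_def by (intro finprod_closed) auto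
  have mon_eq: "mon m = (\<Otimes>\<^bsub>B\<^esub>x\<in>S. val x [^]\<^bsub>B\<^esub> Poly_Mapping.lookup m x)"
    if "finite S" "Poly_Mapping.keys m \<subseteq> S" for m S
    unfolding mon_def
    by (rule finprod_mono_neutral_cong_left) (use that in \<open>auto simp: in_keys_iff\<close>)
  have mon_add: "mon (m + n) = mon m \<otimes>\<^bsub>B\<^esub> mon n" for m n
  proof -
    let ?S = "Poly_Mapping.keys m \<union> Poly_Mapping.keys n"
    have "mon (m + n) = (\<Otimes>\<^bsub>B\<^esub>x\<in>?S. val x [^]\<^bsub>B\<^esub> Poly_Mapping.lookup (m + n) x)"
      by (rule mon_eq) (use keys_add[of m n] in auto)
    also have "\<dots> = (\<Otimes>\<^bsub>B\<^esub>x\<in>?S. val x [^]\<^bsub>B\<^esub> Poly_Mapping.lookup m x \<otimes>\<^bsub>B\<^esub> val x [^]\<^bsub>B\<^esub> Poly_Mapping.lookup n x)"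
      by (intro finprod_cong') (auto simp: lookup_add nat_pow_mult)
    also have "\<dots> = (\<Otimes>\<^bsub>B\<^esub>x\<in>?S. val x [^]\<^bsub>B\<^esub> Poly_Mapping.lookup m x) \<otimes>\<^bsub>B\<^esub>
        (\<Otimes>\<^bsub>B\<^esub>x\<in>?S. val x [^]\<^bsub>B\<^esub> Poly_Mapping.lookup n x)"
      by (intro finprod_multf) auto
    also have "\<dots> = mon m \<otimes>\<^bsub>B\<^esub> mon n" using mon_eq[of ?S m] mon_eq[of ?S n] by simp
    finally show ?thesis .
  qed
  have mon0: "mon 0 = \<one>\<^bsub>B\<^esub>" by (simp add: mon_def)
  obtain \<pi> where \<pi>: "\<pi> \<in> hom (free_Abelian_group UNIV) (add_monoid B)" "\<And>m. \<pi> (frag_of m) = mon m"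
    using comm_group.free_Abelian_group_universal[OF a_comm_group, of mon UNIV] mon_closed by (auto simp: image_subset_iff)
  have closed: "\<pi> p \<in> carrier B" for p using \<pi>(1) by (auto simp: hom_def Pi_iff)
  have add: "\<pi> (p + q) = \<pi> p \<oplus>\<^bsub>B\<^esub> \<pi> q" for p q using \<pi>(1) by (auto simp: hom_def)
  have zero: "\<pi> 0 = \<zero>\<^bsub>B\<^esub>" using hom_one[OF \<pi>(1)] comm_group.axioms(2)[OF a_comm_group] by simp
  have minus: "\<pi> (- p) = \<ominus>\<^bsub>B\<^esub> \<pi> p" for p
    using add[of "- p" p] closed by (simp add: zero minus_equality)
  have diff: "\<pi> (p - q) = \<pi> p \<ominus>\<^bsub>B\<^esub> \<pi> q" for p q using add[of p "- q"] by (simp add: minus minus_eq)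
  have mult1: "\<pi> (frag_of m * q) = mon m \<otimes>\<^bsub>B\<^esub> \<pi> q" for m q
  proof -
    have "Poly_Mapping.keys q \<subseteq> UNIV" by simp
    then show ?thesis
    proof (induction q rule: frag_induction)
      case (one n)
      have "frag_of m * frag_of n = frag_of (m + n)" by (simp add: mult_single)
      then show ?case by (simp add: \<pi>(2) mon_add)
    next
      case (diff a b)
      have "frag_of m * (a - b) = frag_of m * a - frag_of m * b" by (simp add: algebra_simps)
      then show ?case using diff closed
        by (simp add: \<open>\<And>p q. \<pi> (p - q) = _\<close> minus_eq r_distr r_minus)
    qed (simp add: zero)
  qed
  have mult: "\<pi> (p * q) = \<pi> p \<otimes>\<^bsub>B\<^esub> \<pi> q" for p q
  proof -
    have "Poly_Mapping.keys p \<subseteq> UNIV" by simp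
    then show ?thesis
    proof (induction p rule: frag_induction)
      case (one n)
      then show ?case by (simp add: \<pi>(2) mult1)
    next
      case (diff a b)
      have "(a - b) * q = a * q - b * q" by (simp add: algebra_simps)
      then show ?case using diff closed
        by (simp add: \<open>\<And>p q. \<pi> (p - q) = _\<close> minus_eq l_distr l_minus)
    qed (simp add: zero closed)
  qed
  have one: "\<pi> 1 = \<one>\<^bsub>B\<^esub>" using \<pi>(2)[of 0] by (simp add: mon0)
  have surj: "\<exists>p. \<pi> p = b" if "b \<in> carrier B" for b
  proof
    show "\<pi> (frag_of (Poly_Mapping.single b 1)) = b"
      using that by (simp add: \<pi>(2) mon_def val_def)
  qed
  have "ring_cover B \<pi>"
    by unfold_locales (use closed add mult one surj in auto)
  then show ?thesis by blast
qed

section \<open>Local rings\<close>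

lemma local_max_ideal:
  assumes "noetherian_local_ring B"
  shows "maximalideal (max_ideal B) B"
  using assms theI'[of "\<lambda>I. maximalideal I B"] by (simp add: noetherian_local_ring_def max_ideal_def)

text \<open>A nonunit generates a proper ideal, and Zorn's lemma puts it into a maximal one, which
  is the only maximal ideal. Chains have upper bounds because in a Noetherian ring their union is
  one of their members.\<close>

lemma local_unit:
  assumes B: "noetherian_local_ring B" and a: "a \<in> carrier B" "a \<notin> max_ideal B"
  shows "\<exists>b\<in>carrier B. a \<otimes>\<^bsub>B\<^esub> b = \<one>\<^bsub>B\<^esub>"
proof (rule ccontr)
  assume no: "\<not> ?thesis"
  interpret cring B using B by (simp add: noetherian_local_ring_def)
  interpret noetherian_ring B using B by (simp add: noetherian_local_ring_def)
  define S where "S = {I. ideal I B \<and> a \<in> I \<and> \<one>\<^bsub>B\<^esub> \<notin> I}"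
  have P: "PIdl\<^bsub>B\<^esub> a \<in> S"
  proof -
    have "\<one>\<^bsub>B\<^esub> \<notin> PIdl\<^bsub>B\<^esub> a"
    proof
      assume "\<one>\<^bsub>B\<^esub> \<in> PIdl\<^bsub>B\<^esub> a"
      then obtain b where b: "b \<in> carrier B" "\<one>\<^bsub>B\<^esub> = b \<otimes>\<^bsub>B\<^esub> a" by (auto simp: cgenideal_def)
      then show False using no m_comm[OF a(1) b(1)] by force
    qed
    then show ?thesis using cgenideal_ideal[OF a(1)] cgenideal_self[OF a(1)] by (simp add: S_def)
  qed
  have "\<exists>U\<in>S. \<forall>Y\<in>F. Y \<subseteq> U" if F: "subset.chain S F" for F
  proof (cases "F = {}")
    case True
    then show ?thesis using P by blast
  next
    case False
    have "subset.chain {I. ideal I B} F" using F by (auto simp: subset.chain_def S_def)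
    then have "\<Union>F \<in> F" using ideal_chain_is_trivial[OF False] by blast
    moreover from this have "\<Union>F \<in> S" using F by (auto simp: subset.chain_def)
    ultimately show ?thesis by blast
  qed
  then obtain I where I: "I \<in> S" "\<forall>Y\<in>S. I \<subseteq> Y --> Y = I" using subset_Zorn[of S] by blast
  have "maximalideal I B"
  proof (rule maximalidealI)
    show "ideal I B" "carrier B \<noteq> I" using I by (auto simp: S_def)
    fix Y assume Y: "ideal Y B" "I \<subseteq> Y" "Y \<subseteq> carrier B"
    show "Y = I \<or> Y = carrier B"
    proof (cases "\<one>\<^bsub>B\<^esub> \<in> Y")
      case True
      then show ?thesis using ideal.one_imp_carrier[OF Y(1)] by blast
    next
      case False
      then show ?thesis using I Y by (auto simp: S_def)
    qed
  qed
  then have "I = max_ideal B"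
    using local_max_ideal[OF B] B unfolding noetherian_local_ring_def by blast
  then show False using I a by (simp add: S_def)
qed

lemma local_one:
  assumes "noetherian_local_ring B"
  shows "\<one>\<^bsub>B\<^esub> \<notin> max_ideal B"
proof -
  interpret maximalideal "max_ideal B" B using local_max_ideal[OF assms] .
  show ?thesis using I_notcarr one_imp_carrier by blast
qed

context ring_cover
begin

definition maxM where
  "maxM = {p. \<pi> p \<in> max_ideal B}"

context
  assumes loc: "noetherian_local_ring B"
begin

lemma idl_maxM: "idl maxM"
  unfolding maxM_def using idl_preimage maximalideal.is_maximalideal[OF local_max_ideal[OF loc]]
  by (simp add: maximalideal_def)

lemma unit_ker: "a \<notin> maxM ==> \<exists>b. a * b - 1 \<in> ker"
proof -
  assume "a \<notin> maxM"
  then obtain b where b: "b \<in> carrier B" "\<pi> a \<otimes> b = \<one>" using local_unit[OF loc, of "\<pi> a"] by (auto simp: maxM_def)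
  then show ?thesis by (intro exI[of _ "lift b"]) (simp add: ker_diff cov_mult cov_one cov_lift)
qed

lemma ker_maxM: "ker \<subseteq> maxM"
proof -
  have "\<zero> \<in> max_ideal B" using local_max_ideal[OF loc] ideal.axioms(1) additive_subgroup.zero_closed
    unfolding maximalideal_def by blast
  then show ?thesis by (auto simp: ker_def maxM_def)
qed

lemma max_idl_maxM: "max_idl maxM"
proof
  show "idl maxM" by (rule idl_maxM)
  show "1 \<notin> maxM" using local_one[OF loc] by (simp add: maxM_def cov_one)
  show "\<exists>b. a * b - 1 \<in> maxM" if "a \<notin> maxM" for a using unit_ker[OF that] ker_maxM by blast
qed

end

end

section \<open>Coordinates in free modules\<close>

text \<open>Linear combinations with coefficients in the cover; by \<open>lc_lc\<close>, a change of
  generators becomes multiplication by a matrix over \<open>'r\<close>.\<close>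

primrec lc :: "('r => 'a) => ('a, 'b, 'm) module_scheme => (nat => 'b) => (nat => 'r) => nat => 'b" where
  "lc \<pi> M y v 0 = \<zero>\<^bsub>M\<^esub>"
| "lc \<pi> M y v (Suc n) = lc \<pi> M y v n \<oplus>\<^bsub>M\<^esub> \<pi> (v n) \<odot>\<^bsub>M\<^esub> y n"

text \<open>Coordinates are taken in the cover and are unique only modulo \<open>L\<close>, which
  will be the kernel of the cover.\<close>

definition basis :: "('r => 'a) => ('a, 'b, 'm) module_scheme => (nat => 'b) => nat => 'r set => bool" where
  "basis \<pi> M y n L \<longleftrightarrow> (\<forall>j<n. y j \<in> carrier M) \<and> (\<forall>x\<in>carrier M. \<exists>v. x = lc \<pi> M y v n) \<and>
     (\<forall>v. lc \<pi> M y v n = \<zero>\<^bsub>M\<^esub> --> (\<forall>j<n. v j \<in> L))"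

lemma lc_cong: "(\<And>i. i < n ==> \<pi> (v i) = \<pi> (v' i)) ==> (\<And>i. i < n ==> y i = y' i) ==>
    lc \<pi> M y v n = lc \<pi> M y' v' n"
  by (induction n) auto

lemma module_hom_zero:
  assumes "module R M" "module R N" "f \<in> module_hom R M N"
  shows "f \<zero>\<^bsub>M\<^esub> = \<zero>\<^bsub>N\<^esub>"
proof -
  interpret M: module R M by fact
  interpret N: module R N by fact
  have "f \<zero>\<^bsub>M\<^esub> \<oplus>\<^bsub>N\<^esub> f \<zero>\<^bsub>M\<^esub> = f \<zero>\<^bsub>M\<^esub>" "f \<zero>\<^bsub>M\<^esub> \<in> carrier N"
    using assms(3) M.zero_closed M.l_zero[OF M.zero_closed] unfolding module_hom_def by (fastforce simp: Pi_iff)+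
  then show ?thesis by (metis N.r_zero N.add.l_cancel N.zero_closed)
qed

context ring_cover
begin

context
  fixes M :: "('c, 'b, 'k) module_scheme"
  assumes M: "module B M"
begin

interpretation M: module B M by (rule M)

lemma lc_closed: "(\<And>i. i < n ==> y i \<in> carrier M) ==> lc \<pi> M y v n \<in> carrier M"
  by (induction n) auto

lemma lc_add: "(\<And>i. i < n ==> y i \<in> carrier M) ==>
    lc \<pi> M y (\<lambda>i. v i + w i) n = lc \<pi> M y v n \<oplus>\<^bsub>M\<^esub> lc \<pi> M y w n"
  by (induction n) (simp_all add: cov_add M.smult_l_distr M.a_ac lc_closed)

lemma lc_scl: "(\<And>i. i < n ==> y i \<in> carrier M) ==>
    lc \<pi> M y (\<lambda>i. p * v i) n = \<pi> p \<odot>\<^bsub>M\<^esub> lc \<pi> M y v n"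
  by (induction n) (simp_all add: cov_mult M.smult_assoc1 M.smult_r_distr lc_closed)

lemma lc_ker: "(\<And>i. i < n ==> y i \<in> carrier M) ==> (\<And>i. i < n ==> v i \<in> ker) ==>
    lc \<pi> M y v n = \<zero>\<^bsub>M\<^esub>"
  by (induction n) (simp_all add: ker_def M.smult_l_null)

lemma lc_diff:
  assumes "\<And>i. i < n ==> y i \<in> carrier M" "lc \<pi> M y v n = lc \<pi> M y w n"
  shows "lc \<pi> M y (\<lambda>i. v i - w i) n = \<zero>\<^bsub>M\<^esub>"
proof -
  have "lc \<pi> M y (\<lambda>i. (v i - w i) + w i) n = lc \<pi> M y (\<lambda>i. v i - w i) n \<oplus>\<^bsub>M\<^esub> lc \<pi> M y w n"
    by (rule lc_add) (rule assms(1))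
  then show ?thesis using assms by (simp add: lc_closed)
qed

lemma lc_unit: "(\<And>i. i < n ==> y i \<in> carrier M) ==> j < n ==>
    lc \<pi> M y (\<lambda>i. if i = j then 1 else 0) n = y j"
proof (induction n)
  case (Suc n)
  show ?case
  proof (cases "j = n")
    case True
    have "lc \<pi> M y (\<lambda>i. if i = j then 1 else 0) n = \<zero>\<^bsub>M\<^esub>"
      using Suc.prems True by (intro lc_ker) (auto simp: ker_def cov_zero)
    then show ?thesis using True Suc.prems by (simp add: cov_one)
  next
    case False
    then show ?thesis using Suc by (simp add: cov_zero M.smult_l_null)
  qed
qed simp

lemma lc_lc:
  assumes y: "\<And>i. i < n ==> y i \<in> carrier M"
  shows "lc \<pi> M (\<lambda>j. lc \<pi> M y (\<lambda>i. a i j) n) v m = lc \<pi> M y (\<lambda>i. \<Sum>j<m. a i j * v j) n"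
proof (induction m)
  case 0
  then show ?case using lc_ker[of n y "\<lambda>i. 0"] y by (simp add: ker_def cov_zero)
next
  case (Suc m)
  have "lc \<pi> M y (\<lambda>i. \<Sum>j<Suc m. a i j * v j) n
      = lc \<pi> M y (\<lambda>i. (\<Sum>j<m. a i j * v j) + v m * a i m) n" by (simp add: mult.commute)
  also have "\<dots> = lc \<pi> M y (\<lambda>i. \<Sum>j<m. a i j * v j) n \<oplus>\<^bsub>M\<^esub> \<pi> (v m) \<odot>\<^bsub>M\<^esub> lc \<pi> M y (\<lambda>i. a i m) n"
    using y by (simp add: lc_add lc_scl)
  finally show ?case using Suc by simp
qed

lemma hom_lc:
  assumes N: "module B N" and f: "f \<in> module_hom B M N" and y: "\<And>i. i < n ==> y i \<in> carrier M"
  shows "f (lc \<pi> M y v n) = lc \<pi> N (\<lambda>i. f (y i)) v n"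
  using y
proof (induction n)
  case 0
  then show ?case using module_hom_zero[OF M N f] by simp
next
  case (Suc n)
  then show ?case using f by (simp add: module_hom_def lc_closed)
qed

lemma hom_image_zero:
  assumes "f \<in> module_hom B M (self_module B)"
  shows "f \<zero>\<^bsub>M\<^esub> = \<zero>"
proof -
  have "f \<zero>\<^bsub>M\<^esub> \<oplus> f \<zero>\<^bsub>M\<^esub> = f \<zero>\<^bsub>M\<^esub>" "f \<zero>\<^bsub>M\<^esub> \<in> carrier B"
    using assms M.zero_closed M.l_zero[OF M.zero_closed]
    unfolding module_hom_def by (fastforce simp: Pi_iff self_module_def)+
  then show ?thesis by (metis r_zero add.l_cancel zero_closed)
qed

lemma functional_lc:
  assumes f: "f \<in> module_hom B M (self_module B)" and y: "\<And>i. i < n ==> y i \<in> carrier M"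
    and r: "\<And>i. i < n ==> \<pi> (r i) = f (y i)"
  shows "f (lc \<pi> M y v n) = \<pi> (\<Sum>i<n. r i * v i)"
  using y r
proof (induction n)
  case 0
  then show ?case using hom_image_zero[OF f] by (simp add: cov_zero)
next
  case (Suc n)
  then have "f (\<pi> (v n) \<odot>\<^bsub>M\<^esub> y n) = \<pi> (r n * v n)"
    using f m_comm[of "\<pi> (v n)" "f (y n)"] by (simp add: module_hom_def self_module_def cov_mult Pi_iff)
  then show ?case using f Suc by (simp add: module_hom_def lc_closed self_module_def cov_add)
qed

text \<open>Coordinates are chosen arbitrarily; the choice does not matter after
  \<open>\<pi>\<close>, and this makes the functional with coefficients \<open>r\<close>
  linear.\<close>

lemma functional_exists:
  assumes b: "basis \<pi> M y n ker"
  shows "\<exists>F\<in>carrier (dual_module B M). \<forall>v. F (lc \<pi> M y v n) = \<pi> (\<Sum>i<n. r i * v i)"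
proof -
  have y: "\<And>i. i < n ==> y i \<in> carrier M" using b by (simp add: basis_def)
  obtain co where co: "\<And>x. x \<in> carrier M ==> x = lc \<pi> M y (co x) n"
    using b unfolding basis_def by metis
  define F where "F = restrict (\<lambda>x. \<pi> (\<Sum>i<n. r i * co x i)) (carrier M)"
  have F: "F (lc \<pi> M y v n) = \<pi> (\<Sum>i<n. r i * v i)" for v
  proof -
    have cl: "lc \<pi> M y v n \<in> carrier M" using y by (rule lc_closed)
    have "\<forall>i<n. co (lc \<pi> M y v n) i - v i \<in> ker"
      using b lc_diff[OF y co[OF cl, symmetric]] unfolding basis_def by blast
    then have "\<pi> ((\<Sum>i<n. r i * co (lc \<pi> M y v n) i) - (\<Sum>i<n. r i * v i)) = \<zero>"
      using idl_sum[OF idl_ker, of "{..<n}" "\<lambda>i. r i * (co (lc \<pi> M y v n) i - v i)"]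
        idl_ker unfolding sum_subtractf[symmetric] right_diff_distrib[symmetric]
      by (auto simp: ker_def idl_def)
    then show ?thesis using cl by (simp add: F_def cov_diff_eq)
  qed
  have "F \<in> carrier (dual_module B M)"
    unfolding dual_module_def hom_module_def module_hom_def
  proof (simp add: self_module_def, intro conjI ballI)
    show "F \<in> carrier M \<rightarrow> carrier B" "F \<in> extensional (carrier M)" by (auto simp: F_def)
    fix x x' assume x: "x \<in> carrier M" "x' \<in> carrier M"
    have "F (x \<oplus>\<^bsub>M\<^esub> x') = F (lc \<pi> M y (\<lambda>i. co x i + co x' i) n)"
      using co x y by (simp add: lc_add)
    also have "\<dots> = F x \<oplus> F x'" unfolding F
      using x by (simp add: F_def distrib_left sum.distrib cov_add)
    finally show "F (x \<oplus>\<^bsub>M\<^esub> x') = F x \<oplus> F x'" .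
  next
    fix a x assume x: "a \<in> carrier B" "x \<in> carrier M"
    have "F (a \<odot>\<^bsub>M\<^esub> x) = F (lc \<pi> M y (\<lambda>i. lift a * co x i) n)"
      using co x y by (simp add: lc_scl cov_lift)
    also have "\<dots> = \<pi> (lift a * (\<Sum>i<n. r i * co x i))" unfolding F
      by (simp add: sum_distrib_left mult.left_commute)
    also have "\<dots> = a \<otimes> F x" using x by (simp add: F_def cov_mult cov_lift)
    finally show "F (a \<odot>\<^bsub>M\<^esub> x) = a \<otimes> F x" .
  qed
  then show ?thesis using F by blast
qed

end

end

section \<open>Free modules, direct sums and invariance of rank\<close>

lemma free_module_sel [simp]:
  "carrier (free_module R n) = {..<n} \<rightarrow>\<^sub>E carrier R" "\<zero>\<^bsub>free_module R n\<^esub> = (\<lambda>i\<in>{..<n}. \<zero>\<^bsub>R\<^esub>)"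
  "x \<oplus>\<^bsub>free_module R n\<^esub> y = (\<lambda>i\<in>{..<n}. x i \<oplus>\<^bsub>R\<^esub> y i)"
  "a \<odot>\<^bsub>free_module R n\<^esub> x = (\<lambda>i\<in>{..<n}. a \<otimes>\<^bsub>R\<^esub> x i)"
  by (simp_all add: free_module_def)

lemma direct_sum_sel [simp]:
  "carrier (direct_sum M N) = carrier M \<times> carrier N" "\<zero>\<^bsub>direct_sum M N\<^esub> = (\<zero>\<^bsub>M\<^esub>, \<zero>\<^bsub>N\<^esub>)"
  "u \<oplus>\<^bsub>direct_sum M N\<^esub> v = (fst u \<oplus>\<^bsub>M\<^esub> fst v, snd u \<oplus>\<^bsub>N\<^esub> snd v)"
  "a \<odot>\<^bsub>direct_sum M N\<^esub> u = (a \<odot>\<^bsub>M\<^esub> fst u, a \<odot>\<^bsub>N\<^esub> snd u)"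
  by (simp_all add: direct_sum_def case_prod_unfold)

lemma moduleI':
  assumes R: "cring R"
    and c: "\<zero>\<^bsub>M\<^esub> \<in> carrier M" "\<And>x y. x \<in> carrier M ==> y \<in> carrier M ==> x \<oplus>\<^bsub>M\<^esub> y \<in> carrier M"
      "\<And>a x. a \<in> carrier R ==> x \<in> carrier M ==> a \<odot>\<^bsub>M\<^esub> x \<in> carrier M"
    and g: "\<And>x y z. x \<in> carrier M ==> y \<in> carrier M ==> z \<in> carrier M ==> (x \<oplus>\<^bsub>M\<^esub> y) \<oplus>\<^bsub>M\<^esub> z = x \<oplus>\<^bsub>M\<^esub> (y \<oplus>\<^bsub>M\<^esub> z)"
      "\<And>x y. x \<in> carrier M ==> y \<in> carrier M ==> x \<oplus>\<^bsub>M\<^esub> y = y \<oplus>\<^bsub>M\<^esub> x"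
      "\<And>x. x \<in> carrier M ==> \<zero>\<^bsub>M\<^esub> \<oplus>\<^bsub>M\<^esub> x = x"
      "\<And>x. x \<in> carrier M ==> (\<ominus>\<^bsub>R\<^esub> \<one>\<^bsub>R\<^esub>) \<odot>\<^bsub>M\<^esub> x \<oplus>\<^bsub>M\<^esub> x = \<zero>\<^bsub>M\<^esub>"
    and s: "\<And>a b x. a \<in> carrier R ==> b \<in> carrier R ==> x \<in> carrier M ==> (a \<oplus>\<^bsub>R\<^esub> b) \<odot>\<^bsub>M\<^esub> x = a \<odot>\<^bsub>M\<^esub> x \<oplus>\<^bsub>M\<^esub> b \<odot>\<^bsub>M\<^esub> x"
      "\<And>a x y. a \<in> carrier R ==> x \<in> carrier M ==> y \<in> carrier M ==> a \<odot>\<^bsub>M\<^esub> (x \<oplus>\<^bsub>M\<^esub> y) = a \<odot>\<^bsub>M\<^esub> x \<oplus>\<^bsub>M\<^esub> a \<odot>\<^bsub>M\<^esub> y"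
      "\<And>a b x. a \<in> carrier R ==> b \<in> carrier R ==> x \<in> carrier M ==> (a \<otimes>\<^bsub>R\<^esub> b) \<odot>\<^bsub>M\<^esub> x = a \<odot>\<^bsub>M\<^esub> (b \<odot>\<^bsub>M\<^esub> x)"
      "\<And>x. x \<in> carrier M ==> \<one>\<^bsub>R\<^esub> \<odot>\<^bsub>M\<^esub> x = x"
  shows "module R M"
proof -
  interpret cring R by fact
  show ?thesis
  proof (rule moduleI)
    show "abelian_group M"
    proof (rule abelian_groupI)
      fix x assume "x \<in> carrier M"
      then show "\<exists>y\<in>carrier M. y \<oplus>\<^bsub>M\<^esub> x = \<zero>\<^bsub>M\<^esub>"
        using g(4) c(3) by (intro bexI[of _ "(\<ominus>\<^bsub>R\<^esub> \<one>\<^bsub>R\<^esub>) \<odot>\<^bsub>M\<^esub> x"]) auto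
    qed (use c g in auto)
  qed (use R c g s in auto)
qed

lemma module_free_module:
  assumes "cring R" shows "module R (free_module R n)"
proof -
  interpret cring R by fact
  show ?thesis
    by (rule moduleI'[OF assms])
      (auto simp: fun_eq_iff restrict_def PiE_iff extensional_def a_ac m_assoc l_distr r_distr l_minus l_neg r_neg)
qed

lemma module_direct_sum:
  assumes "module R M" "module R N" shows "module R (direct_sum M N)"
proof -
  interpret M: module R M by fact
  interpret N: module R N by fact
  have neg: "x \<oplus>\<^bsub>M\<^esub> (\<ominus>\<^bsub>R\<^esub> \<one>\<^bsub>R\<^esub>) \<odot>\<^bsub>M\<^esub> x = \<zero>\<^bsub>M\<^esub>" if "x \<in> carrier M" for x
    using that M.smult_l_minus[of "\<one>\<^bsub>R\<^esub>" x] by (simp add: M.M.l_neg M.M.r_neg)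
  have neg': "x \<oplus>\<^bsub>N\<^esub> (\<ominus>\<^bsub>R\<^esub> \<one>\<^bsub>R\<^esub>) \<odot>\<^bsub>N\<^esub> x = \<zero>\<^bsub>N\<^esub>" if "x \<in> carrier N" for x
    using that N.smult_l_minus[of "\<one>\<^bsub>R\<^esub>" x] by (simp add: N.M.l_neg N.M.r_neg)
  show ?thesis
    by (rule moduleI'[OF M.is_cring])
      (auto simp: M.a_ac N.a_ac M.smult_l_distr N.smult_l_distr M.smult_r_distr N.smult_r_distr
        M.smult_assoc1 N.smult_assoc1 neg neg')
qed

lemma ideal_smult_self:
  assumes "cring R" "ideal I R"
  shows "ideal_smult R I (self_module R) = I"
proof -
  interpret cring R by fact
  interpret I: ideal I R by fact
  have eq: "finsum (self_module R) f S = finsum R f S" for f :: "nat => _" and S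
    by (simp add: finsum_def self_module_def finprod_def)
  show ?thesis
  proof (intro equalityI subsetI)
    fix x assume "x \<in> ideal_smult R I (self_module R)"
    then obtain n :: nat and a y where x: "x = (\<Oplus>\<^bsub>R\<^esub>i\<in>{..<n}. a i \<otimes>\<^bsub>R\<^esub> y i)"
      and a: "a \<in> {..<n} \<rightarrow> I" and y: "y \<in> {..<n} \<rightarrow> carrier R"
      unfolding ideal_smult_def eq by (auto simp: self_module_def)
    have ay: "a i \<in> carrier R" "y i \<in> carrier R" "a i \<otimes>\<^bsub>R\<^esub> y i \<in> I" if "i < n" for i
      using that a y I.I_r_closed by (auto intro: I.Icarr)
    have "(\<Oplus>\<^bsub>R\<^esub>i\<in>{..<k}. a i \<otimes>\<^bsub>R\<^esub> y i) \<in> I" if "k \<le> n" for k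
      using that
    proof (induction k)
      case (Suc k)
      have "(\<Oplus>\<^bsub>R\<^esub>i\<in>{..<Suc k}. a i \<otimes>\<^bsub>R\<^esub> y i) = a k \<otimes>\<^bsub>R\<^esub> y k \<oplus>\<^bsub>R\<^esub> (\<Oplus>\<^bsub>R\<^esub>i\<in>{..<k}. a i \<otimes>\<^bsub>R\<^esub> y i)"
        unfolding lessThan_Suc by (rule finsum_insert) (use Suc.prems ay in auto)
      then show ?case using Suc ay by (simp add: I.a_closed)
    qed simp
    then show "x \<in> I" using x by simp
  next
    fix x assume x: "x \<in> I"
    then have xR: "x \<in> carrier R" by (rule I.Icarr)
    have "x = (\<Oplus>\<^bsub>R\<^esub>i\<in>{..<1::nat}. x \<otimes>\<^bsub>R\<^esub> \<one>\<^bsub>R\<^esub>)"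
      using xR finsum_insert[of "{}" "0::nat" "\<lambda>i. x \<otimes>\<^bsub>R\<^esub> \<one>\<^bsub>R\<^esub>"] by (simp add: lessThan_Suc)
    then show "x \<in> ideal_smult R I (self_module R)"
      unfolding ideal_smult_def eq mem_Collect_eq using x
      by (intro exI[of _ "1::nat"] exI[of _ "\<lambda>i. x"] exI[of _ "\<lambda>i. \<one>\<^bsub>R\<^esub>"]) (auto simp: self_module_def)
  qed
qed

context ring_cover
begin

definition unit_vec :: "nat => nat => nat => 'c" where
  "unit_vec n j = (\<lambda>i\<in>{..<n}. if i = j then \<one> else \<zero>)"

lemma lc_free: "k \<le> n ==> lc \<pi> (free_module B n) (unit_vec n) v k = (\<lambda>i\<in>{..<n}. if i < k then \<pi> (v i) else \<zero>)"
proof (induction k)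
  case (Suc k)
  then show ?case by (auto simp: fun_eq_iff unit_vec_def less_Suc_eq)
qed auto

lemma iso_free_module:
  assumes M: "module B M" and iso: "module_iso B M (free_module B n)"
  shows "\<exists>\<theta> y. \<theta> \<in> module_hom B M (free_module B n) \<and> (\<forall>j<n. y j \<in> carrier M) \<and>
    (\<forall>v. \<forall>i<n. \<theta> (lc \<pi> M y v n) i = \<pi> (v i)) \<and>
    (\<forall>x\<in>carrier M. x = lc \<pi> M y (\<lambda>i. lift (\<theta> x i)) n)"
proof -
  obtain \<theta> where \<theta>: "\<theta> \<in> module_hom B M (free_module B n)"
    and b: "bij_betw \<theta> (carrier M) (carrier (free_module B n))" using iso unfolding module_iso_def by blast
  have e: "unit_vec n j \<in> carrier (free_module B n)" for j by (auto simp: unit_vec_def)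
  define y where "y j = inv_into (carrier M) \<theta> (unit_vec n j)" for j
  have y: "y j \<in> carrier M" "\<theta> (y j) = unit_vec n j" for j
    unfolding y_def using b e[of j] by (auto simp: bij_betw_def inv_into_into f_inv_into_f simp del: free_module_sel)
  have lc: "\<theta> (lc \<pi> M y v n) = (\<lambda>i\<in>{..<n}. \<pi> (v i))" for v
  proof -
    have "\<theta> (lc \<pi> M y v n) = lc \<pi> (free_module B n) (unit_vec n) v n"
      using hom_lc[OF M module_free_module[OF is_cring] \<theta>, of n y v] y by simp
    also have "\<dots> = (\<lambda>i\<in>{..<n}. \<pi> (v i))" by (auto simp: lc_free fun_eq_iff)
    finally show ?thesis .
  qed
  have "x = lc \<pi> M y (\<lambda>i. lift (\<theta> x i)) n" if x: "x \<in> carrier M" for x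
  proof (rule inj_onD[OF bij_betw_imp_inj_on[OF b] _ x])
    have "\<theta> x \<in> carrier (free_module B n)" using \<theta> x by (auto simp: module_hom_def)
    then show "\<theta> x = \<theta> (lc \<pi> M y (\<lambda>i. lift (\<theta> x i)) n)"
      unfolding lc by (auto simp: fun_eq_iff PiE_iff extensional_def cov_lift)
    show "lc \<pi> M y (\<lambda>i. lift (\<theta> x i)) n \<in> carrier M" using M y(1) by (rule lc_closed)
  qed
  then show ?thesis using \<theta> y lc by (intro exI[of _ \<theta>] exI[of _ y]) simp
qed

lemma free_module_basis:
  assumes "module B M" "module_iso B M (free_module B n)"
  shows "\<exists>y. basis \<pi> M y n ker"
proof -
  obtain \<theta> y where \<theta>: "\<theta> \<in> module_hom B M (free_module B n)" and y: "\<forall>j<n. y j \<in> carrier M"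
    and lc: "\<forall>v. \<forall>i<n. \<theta> (lc \<pi> M y v n) i = \<pi> (v i)"
    and x: "\<forall>x\<in>carrier M. x = lc \<pi> M y (\<lambda>i. lift (\<theta> x i)) n" using iso_free_module[OF assms] by blast
  have "v i \<in> ker" if "lc \<pi> M y v n = \<zero>\<^bsub>M\<^esub>" "i < n" for v i
  proof -
    have "\<pi> (v i) = \<theta> \<zero>\<^bsub>M\<^esub> i" using lc that by metis
    then show ?thesis using module_hom_zero[OF assms(1) module_free_module[OF is_cring] \<theta>] that by (simp add: ker_def)
  qed
  then show ?thesis using y x unfolding basis_def by blast
qed

text \<open>If \<open>m > n\<close>, some coefficients \<open>c\<close>, not all in
  \<open>maxM\<close>, give a combination of \<open>y'\<close> with coordinates in
  \<open>maxM\<close> with respect to \<open>y\<close>. Expressing it again through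
  \<open>y'\<close> forces all \<open>c s\<close> into \<open>maxM\<close>.\<close>

lemma basis_rank_le:
  assumes loc: "noetherian_local_ring B" and M: "module B M"
    and y: "basis \<pi> M y n ker" and y': "basis \<pi> M y' m ker"
  shows "m \<le> n"
proof (rule ccontr)
  assume "\<not> m \<le> n"
  interpret m: max_idl maxM by (rule max_idl_maxM[OF loc])
  have yc: "\<And>i. i < n ==> y i \<in> carrier M" "\<And>i. i < m ==> y' i \<in> carrier M" using y y' by (auto simp: basis_def)
  have "\<forall>j. \<exists>v. j < m --> y' j = lc \<pi> M y v n" "\<forall>j. \<exists>v. j < n --> y j = lc \<pi> M y' v m"
    using y y' unfolding basis_def by blast+
  then obtain a a' where a: "\<And>j. j < m ==> y' j = lc \<pi> M y (a j) n" "\<And>j. j < n ==> y j = lc \<pi> M y' (a' j) m"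
    by metis
  obtain c where c: "\<exists>s\<in>{..<m}. c s \<notin> maxM" "\<forall>b\<in>{..<n}. (\<Sum>s\<in>{..<m}. c s * a s b) \<in> maxM"
    using m.homogeneous_system[of "{..<n}" "{..<m}" "\<lambda>s b. a s b"] \<open>\<not> m \<le> n\<close> by auto
  define u where "u b = (\<Sum>s<m. a s b * c s)" for b
  have "lc \<pi> M y' c m = lc \<pi> M (\<lambda>s. lc \<pi> M y (\<lambda>b. a s b) n) c m" by (rule lc_cong) (auto simp: a)
  also have "\<dots> = lc \<pi> M y u n" unfolding u_def by (rule lc_lc[OF M yc(1)])
  also have "\<dots> = lc \<pi> M (\<lambda>b. lc \<pi> M y' (\<lambda>s. a' b s) m) u n" by (rule lc_cong) (auto simp: a(2))
  also have "\<dots> = lc \<pi> M y' (\<lambda>s. \<Sum>b<n. a' b s * u b) m" by (rule lc_lc[OF M yc(2)])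
  finally have eq: "lc \<pi> M y' c m = lc \<pi> M y' (\<lambda>s. \<Sum>b<n. a' b s * u b) m" .
  have "lc \<pi> M y' (\<lambda>s. c s - (\<Sum>b<n. a' b s * u b)) m = \<zero>\<^bsub>M\<^esub>"
    using yc(2) eq by (rule lc_diff[OF M])
  then have k: "c s - (\<Sum>b<n. a' b s * u b) \<in> maxM" if "s < m" for s
    using y' that ker_maxM[OF loc] unfolding basis_def by blast
  have "(\<Sum>b<n. a' b s * u b) \<in> maxM" for s
    using c(2) by (intro idl_sum[OF m.idl_M] idl_mult[OF m.idl_M]) (simp add: u_def mult.commute)
  then have "c s \<in> maxM" if "s < m" for s
    using idl_add[OF m.idl_M k[OF that], of "\<Sum>b<n. a' b s * u b"] by simp
  then show False using c(1) by blast
qed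

lemma fg_free_basis:
  assumes loc: "noetherian_local_ring B" and M: "fg_free B M"
  shows "\<exists>y. basis \<pi> M y (free_rank B M) ker"
proof -
  obtain n where n: "module_iso B M (free_module B n)" and m: "module B M" using M by (auto simp: fg_free_def)
  have "n' = n" if "module_iso B M (free_module B n')" for n'
    using basis_rank_le[OF loc m] free_module_basis[OF m n] free_module_basis[OF m that]
    by (meson le_antisym)
  then have "free_rank B M = n" unfolding free_rank_def using n by blast
  then show ?thesis using free_module_basis[OF m n] by simp
qed

lemma basis_unique:
  assumes M: "module B M" and b: "basis \<pi> M y n ker" and eq: "lc \<pi> M y v n = lc \<pi> M y w n" and i: "i < n"
  shows "\<pi> (v i) = \<pi> (w i)"
  using b lc_diff[OF M _ eq] i unfolding basis_def by (metis ker_diff)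

text \<open>Used to turn minimality of the complex into a condition on the entries of its
  matrices.\<close>

lemma ideal_smult_coordinates:
  assumes M: "module B M" and b: "basis \<pi> M y n ker" and I: "ideal I B"
    and x: "lc \<pi> M y v n \<in> ideal_smult B I M" and i: "i < n"
  shows "\<pi> (v i) \<in> I"
proof -
  interpret M: module B M by fact
  interpret I: ideal I B by fact
  have y: "\<And>i. i < n ==> y i \<in> carrier M" using b by (simp add: basis_def)
  obtain m :: nat and a z where eq: "lc \<pi> M y v n = (\<Oplus>\<^bsub>M\<^esub>i\<in>{..<m}. a i \<odot>\<^bsub>M\<^esub> z i)"
    and a: "a \<in> {..<m} \<rightarrow> I" and z: "z \<in> {..<m} \<rightarrow> carrier M" using x unfolding ideal_smult_def by blast
  have az: "a i \<in> I" "a i \<in> carrier B" "z i \<in> carrier M" if "i < m" for i using that a z by (auto intro: I.Icarr)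
  have "\<exists>w. (\<Oplus>\<^bsub>M\<^esub>i\<in>{..<k}. a i \<odot>\<^bsub>M\<^esub> z i) = lc \<pi> M y w n \<and> (\<forall>i<n. \<pi> (w i) \<in> I)" if "k \<le> m" for k
    using that
  proof (induction k)
    case 0
    have "lc \<pi> M y (\<lambda>i. 0) n = \<zero>\<^bsub>M\<^esub>" using y idl_0[OF idl_ker] by (intro lc_ker[OF M]) auto
    then show ?case by (intro exI[of _ "\<lambda>i. 0"]) (simp add: cov_zero)
  next
    case (Suc k)
    then obtain w where w: "(\<Oplus>\<^bsub>M\<^esub>i\<in>{..<k}. a i \<odot>\<^bsub>M\<^esub> z i) = lc \<pi> M y w n" "\<forall>i<n. \<pi> (w i) \<in> I" by auto
    obtain u where u: "z k = lc \<pi> M y u n" using b az Suc.prems unfolding basis_def by (meson Suc_le_eq)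
    have "(\<Oplus>\<^bsub>M\<^esub>i\<in>{..<Suc k}. a i \<odot>\<^bsub>M\<^esub> z i) = a k \<odot>\<^bsub>M\<^esub> z k \<oplus>\<^bsub>M\<^esub> (\<Oplus>\<^bsub>M\<^esub>i\<in>{..<k}. a i \<odot>\<^bsub>M\<^esub> z i)"
      unfolding lessThan_Suc by (rule M.finsum_insert) (use Suc.prems az in auto)
    also have "\<dots> = lc \<pi> M y (\<lambda>i. lift (a k) * u i + w i) n"
      using lc_add[OF M y] lc_scl[OF M y] Suc.prems az(2) by (simp add: u w(1) cov_lift)
    finally have "(\<Oplus>\<^bsub>M\<^esub>i\<in>{..<Suc k}. a i \<odot>\<^bsub>M\<^esub> z i) = lc \<pi> M y (\<lambda>i. lift (a k) * u i + w i) n" .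
    then show ?case
      using w(2) az Suc.prems
      by (intro exI[of _ "\<lambda>i. lift (a k) * u i + w i"]) (simp add: cov_add cov_mult cov_lift I.I_r_closed)
  qed
  from this[of m] obtain w where "lc \<pi> M y v n = lc \<pi> M y w n" "\<forall>i<n. \<pi> (w i) \<in> I" using eq by auto
  then show ?thesis using basis_unique[OF M b] i by metis
qed

text \<open>Columns are elements of the \<open>C n\<close> and rows are functionals on them, so
  exactness of the complex and of its dual become exactness of the matrices and of their
  transposes.\<close>

lemma complex_matrices:
  fixes C :: "int => ('c, 'e, 'k) module_scheme"
  assumes loc: "noetherian_local_ring B" and ta: "totally_acyclic B C d" and mi: "minimal_complex B C d"
  defines "\<beta> \<equiv> betti B C"
  shows "\<exists>y a. (\<forall>n. basis \<pi> (C n) (y n) (\<beta> n) ker) \<and>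
    (\<forall>n v. d n (lc \<pi> (C n) (y n) v (\<beta> n))
        = lc \<pi> (C (n - 1)) (y (n - 1)) (\<lambda>i. \<Sum>j<\<beta> n. a n i j * v j) (\<beta> (n - 1))) \<and>
    (\<forall>n i j. i < \<beta> (n - 1) --> j < \<beta> n --> a n i j \<in> maxM) \<and>
    (\<forall>n i k. i < \<beta> (n - 1) --> k < \<beta> (n + 1) --> (\<Sum>j<\<beta> n. a n i j * a (n + 1) j k) \<in> ker) \<and>
    (\<forall>n. exact_columns ker (\<beta> (n - 1)) (\<beta> n) (\<beta> (n + 1)) (a n) (a (n + 1))) \<and>
    (\<forall>n. exact_columns ker (\<beta> (n + 1)) (\<beta> n) (\<beta> (n - 1)) (\<lambda>i j. a (n + 1) j i) (\<lambda>i j. a n j i))"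
proof -
  have fg: "fg_free B (C n)" and dh: "d n \<in> module_hom B (C n) (C (n - 1))"
    and dd: "x \<in> carrier (C (n + 1)) ==> d n (d (n + 1) x) = \<zero>\<^bsub>C (n - 1)\<^esub>"
    and ex: "d (n + 1) ` carrier (C (n + 1)) = {x \<in> carrier (C n). d n x = \<zero>\<^bsub>C (n - 1)\<^esub>}" for n x
    using ta unfolding totally_acyclic_def free_complex_def exact_complex_def by blast+
  have m: "module B (C n)" for n using fg by (simp add: fg_free_def)
  have "\<forall>n. \<exists>y. basis \<pi> (C n) y (\<beta> n) ker" using fg_free_basis[OF loc fg] by (simp add: \<beta>_def betti_def)
  then obtain y where b: "\<And>n. basis \<pi> (C n) (y n) (\<beta> n) ker" by metis
  have y: "\<And>i. i < \<beta> n ==> y n i \<in> carrier (C n)" for n using b by (simp add: basis_def)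
  have ym: "\<And>i. i < \<beta> (n - 1) ==> y (n - 1) i \<in> carrier (C (n - 1))" for n by (rule y)
  have span: "\<exists>v. x = lc \<pi> (C n) (y n) v (\<beta> n)" if "x \<in> carrier (C n)" for x n
    using b[of n] that by (simp add: basis_def)
  have dc: "d n x \<in> carrier (C (n - 1))" if "x \<in> carrier (C n)" for n x
    using dh[of n] that by (auto simp: module_hom_def)
  have "\<forall>n. \<exists>a. \<forall>j. j < \<beta> n --> d n (y n j) = lc \<pi> (C (n - 1)) (y (n - 1)) (a j) (\<beta> (n - 1))"
    by (intro allI choice) (use span[OF dc[OF y]] in blast)
  from choice[OF this] obtain a' where a': "\<And>n j. j < \<beta> n ==> d n (y n j) = lc \<pi> (C (n - 1)) (y (n - 1)) (a' n j) (\<beta> (n - 1))"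
    by blast
  define a where "a n i j = a' n j i" for n i j
  have dl: "d n (lc \<pi> (C n) (y n) v (\<beta> n))
      = lc \<pi> (C (n - 1)) (y (n - 1)) (\<lambda>i. \<Sum>j<\<beta> n. a n i j * v j) (\<beta> (n - 1))" for n v
  proof -
    have "d n (lc \<pi> (C n) (y n) v (\<beta> n)) = lc \<pi> (C (n - 1)) (\<lambda>j. d n (y n j)) v (\<beta> n)"
      by (rule hom_lc[OF m m dh y])
    also have "\<dots> = lc \<pi> (C (n - 1)) (\<lambda>j. lc \<pi> (C (n - 1)) (y (n - 1)) (\<lambda>i. a n i j) (\<beta> (n - 1))) v (\<beta> n)"
      by (rule lc_cong) (simp_all add: a' a_def)
    also have "\<dots> = lc \<pi> (C (n - 1)) (y (n - 1)) (\<lambda>i. \<Sum>j<\<beta> n. a n i j * v j) (\<beta> (n - 1))"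
      by (rule lc_lc[OF m ym])
    finally show ?thesis .
  qed
  have min: "a n i j \<in> maxM" if "i < \<beta> (n - 1)" "j < \<beta> n" for n i j
  proof -
    have "d n (y n j) \<in> ideal_smult B (max_ideal B) (C (n - 1))"
      using mi y[of j n] that(2) unfolding minimal_complex_def by (metis diff_add_cancel image_subset_iff)
    then have "\<pi> (a' n j i) \<in> max_ideal B"
      unfolding a'[OF that(2)]
      using ideal_smult_coordinates[OF m b maximalideal.axioms(1)[OF local_max_ideal[OF loc]] _ that(1)] by blast
    then show ?thesis by (simp add: a_def maxM_def)
  qed
  have col: "exact_columns ker (\<beta> (n - 1)) (\<beta> n) (\<beta> (n + 1)) (a n) (a (n + 1))" for n
    unfolding exact_columns_def
  proof (intro allI impI)
    fix v assume "\<forall>i<\<beta> (n - 1). (\<Sum>j<\<beta> n. a n i j * v j) \<in> ker"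
    then have "d n (lc \<pi> (C n) (y n) v (\<beta> n)) = \<zero>\<^bsub>C (n - 1)\<^esub>"
      unfolding dl by (intro lc_ker[OF m ym]) auto
    moreover have "lc \<pi> (C n) (y n) v (\<beta> n) \<in> carrier (C n)" using y by (rule lc_closed[OF m])
    ultimately obtain x where "x \<in> carrier (C (n + 1))" "lc \<pi> (C n) (y n) v (\<beta> n) = d (n + 1) x"
      using ex[of n] by blast
    then obtain w where "lc \<pi> (C n) (y n) v (\<beta> n) = d (n + 1) (lc \<pi> (C (n + 1)) (y (n + 1)) w (\<beta> (n + 1)))"
      using span by blast
    then have "lc \<pi> (C n) (y n) v (\<beta> n)
        = lc \<pi> (C n) (y n) (\<lambda>j. \<Sum>k<\<beta> (n + 1). a (n + 1) j k * w k) (\<beta> n)" by (simp add: dl)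
    then show "\<exists>w. \<forall>j<\<beta> n. v j - (\<Sum>k<\<beta> (n + 1). a (n + 1) j k * w k) \<in> ker"
      unfolding ker_diff using basis_unique[OF m b] by blast
  qed
  have ddk: "(\<Sum>j<\<beta> n. a n i j * a (n + 1) j k) \<in> ker" if "i < \<beta> (n - 1)" "k < \<beta> (n + 1)" for n i k
  proof -
    have "d (n + 1) (y (n + 1) k) = lc \<pi> (C n) (y n) (\<lambda>j. a (n + 1) j k) (\<beta> n)"
      using a'[OF that(2)] by (simp add: a_def)
    then have "lc \<pi> (C (n - 1)) (y (n - 1)) (\<lambda>i. \<Sum>j<\<beta> n. a n i j * a (n + 1) j k) (\<beta> (n - 1)) = \<zero>\<^bsub>C (n - 1)\<^esub>"
      using dd[OF y[OF that(2)]] dl by metis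
    then show ?thesis using b that(1) unfolding basis_def by blast
  qed
  have row: "exact_columns ker (\<beta> (n + 1)) (\<beta> n) (\<beta> (n - 1)) (\<lambda>i j. a (n + 1) j i) (\<lambda>i j. a n j i)" for n
    unfolding exact_columns_def
  proof (intro allI impI)
    fix v assume v: "\<forall>i<\<beta> (n + 1). (\<Sum>j<\<beta> n. a (n + 1) j i * v j) \<in> ker"
    \<comment> \<open>The vector \<open>v\<close> is read as the functional with these coefficients;
      it vanishes on boundaries.\<close>
    obtain F where F: "F \<in> carrier (dual_module B (C n))" "\<And>u. F (lc \<pi> (C n) (y n) u (\<beta> n)) = \<pi> (\<Sum>j<\<beta> n. v j * u j)"
      using functional_exists[OF m b] by blast
    \<comment> \<open>The reindexed dual complex has the dual of \<open>C n\<close> in degree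
      \<open>- n\<close>, hence the signs.\<close>
    have ex': "dual_diff C d (- n + 1) ` carrier (dual_complex B C (- n + 1))
        = {x \<in> carrier (dual_complex B C (- n)). dual_diff C d (- n) x = \<zero>\<^bsub>dual_complex B C (- n - 1)\<^esub>}"
      using ta unfolding totally_acyclic_def exact_complex_def by blast
    have "F (d (n + 1) x) = \<zero>" if x: "x \<in> carrier (C (n + 1))" for x
    proof -
      obtain u where u: "x = lc \<pi> (C (n + 1)) (y (n + 1)) u (\<beta> (n + 1))" using span[OF x] by blast
      have "F (d (n + 1) x) = \<pi> (\<Sum>j<\<beta> n. v j * (\<Sum>k<\<beta> (n + 1). a (n + 1) j k * u k))"
        using F(2) by (simp add: u dl)
      also have "(\<Sum>j<\<beta> n. v j * (\<Sum>k<\<beta> (n + 1). a (n + 1) j k * u k))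
          = (\<Sum>k<\<beta> (n + 1). u k * (\<Sum>j<\<beta> n. a (n + 1) j k * v j))"
        by (simp add: sum_distrib_left mult_ac sum.swap[of _ "{..<\<beta> n}"])
      finally have "F (d (n + 1) x) = \<pi> (\<Sum>k<\<beta> (n + 1). u k * (\<Sum>j<\<beta> n. a (n + 1) j k * v j))" .
      moreover have "(\<Sum>k<\<beta> (n + 1). u k * (\<Sum>j<\<beta> n. a (n + 1) j k * v j)) \<in> ker"
        by (rule idl_sum[OF idl_ker], rule idl_mult[OF idl_ker]) (use v in simp)
      ultimately show ?thesis by (simp add: ker_def)
    qed
    then have "dual_diff C d (- n) F = \<zero>\<^bsub>dual_complex B C (- n - 1)\<^esub>"
      by (simp add: dual_diff_def dual_complex_def dual_module_def hom_module_def compose_def self_module_def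
          add.commute cong: restrict_cong)
    moreover have "F \<in> carrier (dual_complex B C (- n))" using F(1) by (simp add: dual_complex_def)
    ultimately obtain G where G: "G \<in> carrier (dual_complex B C (- n + 1))" "F = dual_diff C d (- n + 1) G"
      using ex' by blast
    have Gh: "G \<in> module_hom B (C (n - 1)) (self_module B)"
      using G(1) by (simp add: dual_complex_def dual_module_def hom_module_def)
    have FG: "F x = G (d n x)" if "x \<in> carrier (C n)" for x
      using that by (simp add: G(2) dual_diff_def compose_def)
    define w where "w k = lift (G (y (n - 1) k))" for k
    have w: "\<pi> (w k) = G (y (n - 1) k)" if "k < \<beta> (n - 1)" for k
      using Gh ym[OF that] by (auto simp: w_def module_hom_def self_module_def intro!: cov_lift)
    have "v j - (\<Sum>k<\<beta> (n - 1). a n k j * w k) \<in> ker" if j: "j < \<beta> n" for j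
    proof -
      have "F (y n j) = \<pi> (\<Sum>i<\<beta> n. v i * (if i = j then 1 else 0))"
        using F(2)[of "\<lambda>i. if i = j then 1 else 0"] lc_unit[OF m y j] by simp
      also have "\<dots> = \<pi> (v j)" using j by (simp add: sum.delta if_distrib[of "\<lambda>x. _ * x"] cong: if_cong)
      finally have "\<pi> (v j) = G (lc \<pi> (C (n - 1)) (y (n - 1)) (\<lambda>k. a n k j) (\<beta> (n - 1)))"
        using FG[OF y[OF j]] a'[OF j] by (simp add: a_def)
      also have "\<dots> = \<pi> (\<Sum>k<\<beta> (n - 1). w k * a n k j)"
        by (rule functional_lc[OF m Gh ym w])
      finally show ?thesis by (simp add: ker_diff mult.commute)
    qed
    then show "\<exists>w. \<forall>j<\<beta> n. v j - (\<Sum>k<\<beta> (n - 1). a n k j * w k) \<in> ker" by blast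
  qed
  show ?thesis
    by (intro exI[of _ y] exI[of _ a] conjI allI impI) (use b dl min ddk col row in blast)+
qed

end

section \<open>Tensor products\<close>

lemma algebra_module_sel [simp]:
  "carrier (algebra_module h S) = carrier S" "\<zero>\<^bsub>algebra_module h S\<^esub> = \<zero>\<^bsub>S\<^esub>"
  "x \<oplus>\<^bsub>algebra_module h S\<^esub> y = x \<oplus>\<^bsub>S\<^esub> y" "a \<odot>\<^bsub>algebra_module h S\<^esub> x = h a \<otimes>\<^bsub>S\<^esub> x"
  by (simp_all add: algebra_module_def restrict_scalars_def self_module_def)

lemma module_algebra_module:
  assumes "cring R" "cring S" "h \<in> ring_hom R S"
  shows "module R (algebra_module h S)"
proof -
  interpret S: cring S by fact
  interpret R: cring R by fact
  interpret ring_hom_cring R S h by unfold_locales (rule assms(3))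
  show ?thesis
    by (rule moduleI'[OF assms(1)])
      (simp_all add: S.a_ac S.m_assoc S.l_distr S.r_distr S.l_minus S.r_neg)
qed

context
  fixes R :: "('a, 'r) ring_scheme" and M :: "('a, 'b, 'm) module_scheme" and N :: "('a, 'c, 'n) module_scheme"
begin

definition tensor_class :: "('b \<times> 'c \<Rightarrow>\<^sub>0 int) => ('b \<times> 'c \<Rightarrow>\<^sub>0 int) set" where
  "tensor_class z = tensor_relations R M N #>\<^bsub>free_Abelian_group (carrier M \<times> carrier N)\<^esub> z"

context
  assumes M: "module R M" and N: "module R N"
begin

interpretation M: module R M by (rule M)
interpretation N: module R N by (rule N)

lemma tensor_relations_subgroup:
  "subgroup (tensor_relations R M N) (free_Abelian_group (carrier M \<times> carrier N))"
proof -
  have "Poly_Mapping.keys (frag_of p - frag_of q - frag_of r) \<subseteq> {p, q, r}"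
    "Poly_Mapping.keys (frag_of p - frag_of q) \<subseteq> {p, q}" for p q r :: "'b \<times> 'c"
    using keys_diff[of "frag_of p" "frag_of q"] keys_diff[of "frag_of p - frag_of q" "frag_of r"] by auto
  then show ?thesis unfolding tensor_relations_def
    by (intro group.generate_is_subgroup) (fastforce dest: subsetD)+
qed

lemma tensor_relations_keys: "z \<in> tensor_relations R M N ==> Poly_Mapping.keys z \<subseteq> carrier M \<times> carrier N"
  using subsetD[OF subgroup.subset[OF tensor_relations_subgroup], of z] by simp

lemma tensor_relations_0: "0 \<in> tensor_relations R M N"
  using subgroup.one_closed[OF tensor_relations_subgroup] by simp

lemma tensor_relations_add:
  "u \<in> tensor_relations R M N ==> v \<in> tensor_relations R M N ==> u + v \<in> tensor_relations R M N"
  using subgroup.m_closed[OF tensor_relations_subgroup] by simp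

lemma tensor_relations_minus: "u \<in> tensor_relations R M N ==> - u \<in> tensor_relations R M N"
  using subgroup.m_inv_closed[OF tensor_relations_subgroup] tensor_relations_keys by force

lemma tensor_relations_diff:
  "u \<in> tensor_relations R M N ==> v \<in> tensor_relations R M N ==> u - v \<in> tensor_relations R M N"
  using tensor_relations_add[OF _ tensor_relations_minus, of u v] by simp

lemma tensor_relations_sum:
  "(\<And>i. i \<in> I ==> f i \<in> tensor_relations R M N) ==> sum f I \<in> tensor_relations R M N"
  by (induction I rule: infinite_finite_induct) (simp_all add: tensor_relations_0 tensor_relations_add)

lemma tensor_add_left: "x \<in> carrier M ==> x' \<in> carrier M ==> y \<in> carrier N ==>
    frag_of (x \<oplus>\<^bsub>M\<^esub> x', y) - frag_of (x, y) - frag_of (x', y) \<in> tensor_relations R M N"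
  unfolding tensor_relations_def by (rule generate.incl) blast

lemma tensor_add_right: "x \<in> carrier M ==> y \<in> carrier N ==> y' \<in> carrier N ==>
    frag_of (x, y \<oplus>\<^bsub>N\<^esub> y') - frag_of (x, y) - frag_of (x, y') \<in> tensor_relations R M N"
  unfolding tensor_relations_def by (rule generate.incl) blast

lemma tensor_balanced: "a \<in> carrier R ==> x \<in> carrier M ==> y \<in> carrier N ==>
    frag_of (a \<odot>\<^bsub>M\<^esub> x, y) - frag_of (x, a \<odot>\<^bsub>N\<^esub> y) \<in> tensor_relations R M N"
  unfolding tensor_relations_def by (rule generate.incl) blast

lemma tensor_zero_left: "y \<in> carrier N ==> frag_of (\<zero>\<^bsub>M\<^esub>, y) \<in> tensor_relations R M N"
  using tensor_relations_minus[OF tensor_add_left[of "\<zero>\<^bsub>M\<^esub>" "\<zero>\<^bsub>M\<^esub>" y]] by simp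

lemma tensor_zero_right: "x \<in> carrier M ==> frag_of (x, \<zero>\<^bsub>N\<^esub>) \<in> tensor_relations R M N"
  using tensor_relations_minus[OF tensor_add_right[of x "\<zero>\<^bsub>N\<^esub>" "\<zero>\<^bsub>N\<^esub>"]] by simp

lemma tensor_relations_induct [consumes 1, case_names zero diff left right balanced]:
  assumes z: "z \<in> tensor_relations R M N" and zero: "P 0" and diff: "\<And>u v. P u ==> P v ==> P (u - v)"
    and l: "\<And>x x' y. x \<in> carrier M ==> x' \<in> carrier M ==> y \<in> carrier N ==>
        P (frag_of (x \<oplus>\<^bsub>M\<^esub> x', y) - frag_of (x, y) - frag_of (x', y))"
    and r: "\<And>x y y'. x \<in> carrier M ==> y \<in> carrier N ==> y' \<in> carrier N ==>
        P (frag_of (x, y \<oplus>\<^bsub>N\<^esub> y') - frag_of (x, y) - frag_of (x, y'))"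
    and s: "\<And>a x y. a \<in> carrier R ==> x \<in> carrier M ==> y \<in> carrier N ==>
        P (frag_of (a \<odot>\<^bsub>M\<^esub> x, y) - frag_of (x, a \<odot>\<^bsub>N\<^esub> y))"
  shows "P z"
proof -
  have minus: "P (- u)" if "P u" for u using diff[OF zero that] by simp
  from z[unfolded tensor_relations_def] have "z \<in> tensor_relations R M N \<and> P z"
  proof (induction rule: generate.induct)
    case one
    then show ?case using zero tensor_relations_0 by simp
  next
    case (incl h)
    then show ?case
      by (elim UnE CollectE exE conjE; hypsubst; intro conjI tensor_add_left tensor_add_right tensor_balanced l r s)
  next
    case (inv h)
    then have "h \<in> tensor_relations R M N \<and> P h"
      by (elim UnE CollectE exE conjE; hypsubst; intro conjI tensor_add_left tensor_add_right tensor_balanced l r s)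
    then show ?case using minus tensor_relations_minus tensor_relations_keys by simp
  next
    case (eng u v)
    then show ?case using diff[of u "- v"] minus[of v] tensor_relations_add by simp
  qed
  then show ?thesis ..
qed

lemma tensor_class_eq: "tensor_class z = tensor_class w \<longleftrightarrow> z - w \<in> tensor_relations R M N"
proof
  assume "tensor_class z = tensor_class w"
  moreover have "z \<in> tensor_class z" using tensor_relations_0 by (force simp: tensor_class_def r_coset_def)
  ultimately show "z - w \<in> tensor_relations R M N" by (auto simp: tensor_class_def r_coset_def)
next
  have *: "tensor_class z \<subseteq> tensor_class w" if "z - w \<in> tensor_relations R M N" for z w
  proof
    fix u assume "u \<in> tensor_class z"
    then have "u - z \<in> tensor_relations R M N" by (auto simp: tensor_class_def r_coset_def)
    then have "u - w \<in> tensor_relations R M N" using tensor_relations_add[OF _ that, of "u - z"] by simp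
    then show "u \<in> tensor_class w" by (force simp: tensor_class_def r_coset_def)
  qed
  assume "z - w \<in> tensor_relations R M N"
  then show "tensor_class z = tensor_class w" using *[of z w] *[of w z] tensor_relations_minus[of "z - w"] by auto
qed

lemma tensor_group_carrier:
  "carrier (tensor_group R M N) = tensor_class ` {z. Poly_Mapping.keys z \<subseteq> carrier M \<times> carrier N}"
  by (auto simp: tensor_group_def FactGroup_def RCOSETS_def tensor_class_def)

lemma tensor_group_one: "\<one>\<^bsub>tensor_group R M N\<^esub> = tensor_class 0"
  by (auto simp: tensor_group_def FactGroup_def tensor_class_def r_coset_def)

lemma tensor_group_mult: "monoid.mult (tensor_group R M N) (tensor_class z) (tensor_class w) = tensor_class (z + w)"
proof -
  have "u + z + (v + w) \<in> tensor_class (z + w)" if "u \<in> tensor_relations R M N" "v \<in> tensor_relations R M N" for u v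
    using tensor_relations_add[OF that] by (force simp: tensor_class_def r_coset_def algebra_simps)
  moreover have "\<exists>u'\<in>tensor_relations R M N. \<exists>v\<in>tensor_relations R M N. u + (z + w) = u' + z + (v + w)"
    if "u \<in> tensor_relations R M N" for u
    using that tensor_relations_0 by (intro bexI[of _ u] bexI[of _ 0]) (simp_all add: algebra_simps)
  ultimately show ?thesis
    by (auto simp: tensor_group_def FactGroup_def set_mult_def tensor_class_def r_coset_def)
qed

text \<open>The universal property for maps that are bilinear modulo an additive subgroup
  \<open>S\<close>; the target is a group type with a subset, so no quotient type is formed.\<close>

lemma tensor_evaluation:
  fixes b :: "'b => 'c => 'g::ab_group_add"
  assumes S: "0 \<in> S" "\<And>u v. u \<in> S ==> v \<in> S ==> u - v \<in> S"
    and l: "\<And>x x' y. x \<in> carrier M ==> x' \<in> carrier M ==> y \<in> carrier N ==> b (x \<oplus>\<^bsub>M\<^esub> x') y - b x y - b x' y \<in> S"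
    and r: "\<And>x y y'. x \<in> carrier M ==> y \<in> carrier N ==> y' \<in> carrier N ==> b x (y \<oplus>\<^bsub>N\<^esub> y') - b x y - b x y' \<in> S"
    and s: "\<And>a x y. a \<in> carrier R ==> x \<in> carrier M ==> y \<in> carrier N ==> b (a \<odot>\<^bsub>M\<^esub> x) y - b x (a \<odot>\<^bsub>N\<^esub> y) \<in> S"
  shows "\<exists>h. (\<forall>u v. h (u - v) = h u - h v) \<and> (\<forall>x y. h (frag_of (x, y)) = b x y) \<and>
    (\<forall>z\<in>tensor_relations R M N. h z \<in> S)"
proof -
  define G where "G = \<lparr>carrier = UNIV :: 'g set, monoid.mult = (+), one = 0 :: 'g\<rparr>"
  have G: "comm_group G"
    unfolding G_def by (rule comm_groupI) (auto simp: add_ac intro!: exI[of _ "- x" for x])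
  obtain h where h: "h \<in> hom (free_Abelian_group UNIV) G" "\<And>p. h (frag_of p) = b (fst p) (snd p)"
    using comm_group.free_Abelian_group_universal[OF G, of "\<lambda>p. b (fst p) (snd p)" UNIV] by (auto simp: G_def)
  have "h (u + v) = h u + h v" for u v using h(1) by (simp add: hom_def G_def)
  then have d: "h (u - v) = h u - h v" for u v by (metis diff_add_cancel eq_diff_eq)
  then have h0: "h 0 = 0" by (metis diff_self)
  have "h z \<in> S" if "z \<in> tensor_relations R M N" for z
    using that by (induction rule: tensor_relations_induct) (simp_all add: h0 S d h(2) l r s)
  then show ?thesis using d h(2) by (intro exI[of _ h]) simp
qed

end

end

lemma tensor_map_class:
  assumes M: "module R M" and N: "module R N" and M': "module R M'" and N': "module R N'"
    and f: "f \<in> module_hom R M M'" and g: "g \<in> module_hom R N N'"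
  shows "tensor_map R M' N' f g (tensor_class R M N z) = tensor_class R M' N' (frag_extend (\<lambda>(x, y). frag_of (f x, g y)) z)"
proof -
  let ?e = "frag_extend (\<lambda>(x, y). frag_of (f x, g y))"
  have ff: "f x \<in> carrier M'" "f (x \<oplus>\<^bsub>M\<^esub> x') = f x \<oplus>\<^bsub>M'\<^esub> f x'" "a \<in> carrier R ==> f (a \<odot>\<^bsub>M\<^esub> x) = a \<odot>\<^bsub>M'\<^esub> f x"
    if "x \<in> carrier M" "x' \<in> carrier M" for x x' a using f that by (auto simp: module_hom_def)
  have gg: "g x \<in> carrier N'" "g (x \<oplus>\<^bsub>N\<^esub> x') = g x \<oplus>\<^bsub>N'\<^esub> g x'" "a \<in> carrier R ==> g (a \<odot>\<^bsub>N\<^esub> x) = a \<odot>\<^bsub>N'\<^esub> g x"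
    if "x \<in> carrier N" "x' \<in> carrier N" for x x' a using g that by (auto simp: module_hom_def)
  have T: "?e u \<in> tensor_relations R M' N'" if "u \<in> tensor_relations R M N" for u
    using that
  proof (induction rule: tensor_relations_induct[OF M N, consumes 1, case_names zero diff left right balanced])
    case zero
    then show ?case using tensor_relations_0[OF M' N'] by simp
  next
    case (diff u v)
    then show ?case using tensor_relations_diff[OF M' N'] by (simp add: frag_extend_diff)
  next
    case (left x x' y)
    then show ?case using tensor_add_left[OF M' N'] by (simp add: frag_extend_diff ff gg)
  next
    case (right x y y')
    then show ?case using tensor_add_right[OF M' N'] by (simp add: frag_extend_diff ff gg)
  next
    case (balanced a x y)
    then show ?case using tensor_balanced[OF M' N'] by (simp add: frag_extend_diff ff gg)
  qed
  have "tensor_class R M' N' (?e c) = tensor_class R M' N' (?e z)" if "c \<in> tensor_class R M N z" for c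
  proof -
    have "c - z \<in> tensor_relations R M N" using that by (auto simp: tensor_class_def r_coset_def)
    from T[OF this] show ?thesis by (simp add: tensor_class_eq[OF M' N'] frag_extend_diff)
  qed
  moreover have "z \<in> tensor_class R M N z"
    using tensor_relations_0[OF M N] by (force simp: tensor_class_def r_coset_def)
  ultimately show ?thesis unfolding tensor_map_def tensor_class_def[symmetric] by blast
qed

section \<open>Change of rings\<close>

text \<open>The column space of \<open>b\<close> modulo \<open>L\<close>. Entries from
  \<open>\<beta>\<close> on are unconstrained, so all vectors modulo \<open>imm\<close> form the
  cokernel of \<open>b\<close>.\<close>

definition imm :: "'r::comm_ring_1 set => nat => nat => (nat => nat => 'r) => (nat, 'r) vec set" where
  "imm L \<beta> \<gamma> b = {v. \<exists>y. \<forall>i<\<beta>. ix v i - (\<Sum>j<\<gamma>. b i j * y j) \<in> L}"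

lemma smod_imm:
  assumes L: "idl L"
  shows "smod (imm L \<beta> \<gamma> b)"
  unfolding smod_def
proof (intro conjI ballI allI)
  show "0 \<in> imm L \<beta> \<gamma> b" unfolding imm_def using idl_0[OF L] by (auto intro!: exI[of _ "\<lambda>_. 0"])
next
  fix u v assume "u \<in> imm L \<beta> \<gamma> b" "v \<in> imm L \<beta> \<gamma> b"
  then obtain y y' where "\<And>i. i < \<beta> ==> ix u i - (\<Sum>j<\<gamma>. b i j * y j) \<in> L" "\<And>i. i < \<beta> ==> ix v i - (\<Sum>j<\<gamma>. b i j * y' j) \<in> L"
    unfolding imm_def by blast
  then have "ix (u + v) i - (\<Sum>j<\<gamma>. b i j * (y j + y' j)) \<in> L" if "i < \<beta>" for i
    using that idl_add[OF L, of "ix u i - (\<Sum>j<\<gamma>. b i j * y j)" "ix v i - (\<Sum>j<\<gamma>. b i j * y' j)"]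
    by (simp add: algebra_simps sum.distrib)
  then show "u + v \<in> imm L \<beta> \<gamma> b" unfolding imm_def mem_Collect_eq by (intro exI[of _ "\<lambda>j. y j + y' j"]) simp
next
  fix c u assume "u \<in> imm L \<beta> \<gamma> b"
  then obtain y where "\<And>i. i < \<beta> ==> ix u i - (\<Sum>j<\<gamma>. b i j * y j) \<in> L" unfolding imm_def by blast
  then have "ix (scl c u) i - (\<Sum>j<\<gamma>. b i j * (c * y j)) \<in> L" if "i < \<beta>" for i
    using that idl_mult[OF L, of "ix u i - (\<Sum>j<\<gamma>. b i j * y j)" c]
    by (simp add: right_diff_distrib sum_distrib_left mult.left_commute)
  then show "scl c u \<in> imm L \<beta> \<gamma> b" unfolding imm_def mem_Collect_eq by (intro exI[of _ "\<lambda>j. c * y j"]) simp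
qed

locale ring_change = A: ring_cover A \<pi> + A': ring_cover A' \<pi>'
  for A :: "('a, 'm) ring_scheme" and \<pi> :: "'p::comm_ring_1 => 'a"
    and A' :: "('s, 'n) ring_scheme" and \<pi>' :: "'q::comm_ring_1 => 's" +
  fixes \<phi> :: "'a => 's"
  assumes \<phi>: "\<phi> \<in> ring_hom A A'"
begin

abbreviation "AM \<equiv> algebra_module \<phi> A'"

lemma module_AM: "module A AM"
  by (rule module_algebra_module) (use \<phi> A.is_cring A'.is_cring in auto)

text \<open>Chosen representatives of the values of \<open>\<phi>\<close>; sums and products are
  respected only modulo the kernel of \<open>\<pi>'\<close>.\<close>

definition lf :: "'p => 'q" where
  "lf p = A'.lift (\<phi> (\<pi> p))"

lemma lf: "\<pi>' (lf p) = \<phi> (\<pi> p)"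
  unfolding lf_def using \<phi> by (intro A'.cov_lift) (auto simp: ring_hom_def)

lemma phi_simps:
  "\<phi> (\<pi> p) \<in> carrier A'" "\<phi> (\<pi> (p + q)) = \<phi> (\<pi> p) \<oplus>\<^bsub>A'\<^esub> \<phi> (\<pi> q)" "\<phi> (\<pi> (p * q)) = \<phi> (\<pi> p) \<otimes>\<^bsub>A'\<^esub> \<phi> (\<pi> q)"
  "\<phi> (\<pi> 1) = \<pi>' 1" "\<phi> (\<pi> 0) = \<pi>' 0"
proof -
  interpret ring_hom_cring A A' \<phi> by unfold_locales (rule \<phi>)
  show "\<phi> (\<pi> p) \<in> carrier A'" "\<phi> (\<pi> (p + q)) = \<phi> (\<pi> p) \<oplus>\<^bsub>A'\<^esub> \<phi> (\<pi> q)" "\<phi> (\<pi> (p * q)) = \<phi> (\<pi> p) \<otimes>\<^bsub>A'\<^esub> \<phi> (\<pi> q)"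
    "\<phi> (\<pi> 1) = \<pi>' 1" "\<phi> (\<pi> 0) = \<pi>' 0"
    by (simp_all add: A.cov_add A.cov_mult A.cov_one A'.cov_one A.cov_zero A'.cov_zero)
qed

lemma phi_sum: "(\<And>j. j < (n::nat) ==> \<pi>' (b j) = \<phi> (\<pi> (a j))) ==> \<pi>' (\<Sum>j<n. b j * lf (y j)) = \<phi> (\<pi> (\<Sum>j<n. a j * y j))"
  by (induction n) (simp_all add: phi_simps A'.cov_add A'.cov_mult lf)

text \<open>\<open>rep x u\<close> is to be read as: \<open>x\<close> has the coordinates
  \<open>u\<close>. The hypotheses make this a homomorphism from \<open>N\<close> to the cokernel of
  \<open>\<alpha>\<close>, and \<open>h\<close> is the induced map from the tensor product to the
  cokernel of \<open>b\<close>.\<close>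

lemma tensor_coordinates:
  fixes N :: "('a, 'b, 'k) module_scheme" and rep :: "'b => (nat => 'p) => bool"
  assumes N: "module A N"
    and tot: "\<And>x. x \<in> carrier N ==> \<exists>u. rep x u"
    and radd: "\<And>x x' u u'. x \<in> carrier N ==> x' \<in> carrier N ==> rep x u ==> rep x' u' ==> rep (x \<oplus>\<^bsub>N\<^esub> x') (\<lambda>i. u i + u' i)"
    and rscl: "\<And>p x u. x \<in> carrier N ==> rep x u ==> rep (\<pi> p \<odot>\<^bsub>N\<^esub> x) (\<lambda>i. p * u i)"
    and uniq: "\<And>x u u'. x \<in> carrier N ==> rep x u ==> rep x u' ==>
        \<exists>y. \<forall>i<\<beta>. u i - u' i - (\<Sum>j<\<gamma>. \<alpha> i j * y j) \<in> A.ker"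
    and b: "\<And>i j. i < \<beta> ==> j < \<gamma> ==> \<pi>' (b i j) = \<phi> (\<pi> (\<alpha> i j))"
  shows "\<exists>h :: ('b \<times> 's \<Rightarrow>\<^sub>0 int) => (nat, 'q) vec. (\<forall>u v. h (u - v) = h u - h v) \<and>
    (\<forall>z\<in>tensor_relations A N AM. h z \<in> imm A'.ker \<beta> \<gamma> b) \<and>
    (\<forall>x\<in>carrier N. \<forall>u w u'. rep x u --> (\<forall>i<\<beta>. \<pi>' (u' i) = \<phi> (\<pi> (u i))) -->
      h (frag_of (x, \<pi>' w)) - Vec (\<lambda>i. w * u' i) \<in> imm A'.ker \<beta> \<gamma> b)"
proof -
  note sm = smod_imm[OF A'.idl_ker, of \<beta> \<gamma> b]
  obtain cc where cc: "\<And>x. x \<in> carrier N ==> rep x (cc x)" using tot by metis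
  define f where "f x s = Vec (\<lambda>i. A'.lift s * lf (cc x i))" for x s
  have key: "f x (\<pi>' w) - Vec (\<lambda>i. w * u' i) \<in> imm A'.ker \<beta> \<gamma> b"
    if x: "x \<in> carrier N" and u: "rep x u" and u': "\<And>i. i < \<beta> ==> \<pi>' (u' i) = \<phi> (\<pi> (u i))" for x u w u'
  proof -
    obtain y where y: "\<And>i. i < \<beta> ==> cc x i - u i - (\<Sum>j<\<gamma>. \<alpha> i j * y j) \<in> A.ker" using uniq[OF x cc[OF x] u] by blast
    have "\<pi>' (A'.lift (\<pi>' w) * lf (cc x i)) = \<pi>' (w * u' i + (\<Sum>j<\<gamma>. b i j * (w * lf (y j))))" if i: "i < \<beta>" for i
    proof -
      have "\<pi> (cc x i) = \<pi> (u i + (\<Sum>j<\<gamma>. \<alpha> i j * y j))" using y[OF i] unfolding A.ker_diff[symmetric] by (simp add: algebra_simps)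
      then have "\<phi> (\<pi> (cc x i)) = \<pi>' (u' i + (\<Sum>j<\<gamma>. b i j * lf (y j)))"
        using i by (simp add: phi_simps(2) A'.cov_add u' phi_sum[of \<gamma> "b i" "\<alpha> i" y] b)
      then have "\<pi>' (A'.lift (\<pi>' w) * lf (cc x i)) = \<pi>' (w * (u' i + (\<Sum>j<\<gamma>. b i j * lf (y j))))"
        by (simp add: A'.cov_mult lf A'.cov_lift)
      then show ?thesis by (simp add: distrib_left sum_distrib_left mult.left_commute)
    qed
    then show ?thesis unfolding imm_def f_def
      by (auto simp: A'.ker_diff[symmetric] algebra_simps intro!: exI[of _ "\<lambda>j. w * lf (y j)"])
  qed
  have key': "f x s - Vec (\<lambda>i. w * u' i) \<in> imm A'.ker \<beta> \<gamma> b"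
    if "x \<in> carrier N" "rep x u" "\<And>i. i < \<beta> ==> \<pi>' (u' i) = \<phi> (\<pi> (u i))" "\<pi>' w = s" for x u w u' s
    using key[OF that(1-3), of w] that(4) by simp
  have l: "f (x \<oplus>\<^bsub>N\<^esub> x') s - f x s - f x' s \<in> imm A'.ker \<beta> \<gamma> b"
    if "x \<in> carrier N" "x' \<in> carrier N" "s \<in> carrier AM" for x x' s
  proof -
    interpret N: module A N by (rule N)
    have "f (x \<oplus>\<^bsub>N\<^esub> x') s - Vec (\<lambda>i. A'.lift s * (lf (cc x i) + lf (cc x' i))) \<in> imm A'.ker \<beta> \<gamma> b"
      using that by (intro key'[of _ "\<lambda>i. cc x i + cc x' i"] radd cc)
        (simp_all add: A'.cov_add lf phi_simps A'.cov_lift)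
    moreover have "Vec (\<lambda>i. A'.lift s * (lf (cc x i) + lf (cc x' i))) = f x s + f x' s"
      by (auto simp: f_def vec_eq_iff algebra_simps)
    ultimately show ?thesis by (simp add: diff_diff_add)
  qed
  have r: "f x (s \<oplus>\<^bsub>AM\<^esub> s') - f x s - f x s' \<in> imm A'.ker \<beta> \<gamma> b"
    if "x \<in> carrier N" "s \<in> carrier AM" "s' \<in> carrier AM" for x s s'
  proof -
    have "f x (s \<oplus>\<^bsub>AM\<^esub> s') - Vec (\<lambda>i. (A'.lift s + A'.lift s') * lf (cc x i)) \<in> imm A'.ker \<beta> \<gamma> b"
      using that by (intro key'[of _ "cc x"] cc) (simp_all add: A'.cov_add lf A'.cov_lift)
    moreover have "Vec (\<lambda>i. (A'.lift s + A'.lift s') * lf (cc x i)) = f x s + f x s'"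
      by (auto simp: f_def vec_eq_iff algebra_simps)
    ultimately show ?thesis by (simp add: diff_diff_add)
  qed
  have s: "f (a \<odot>\<^bsub>N\<^esub> x) s - f x (a \<odot>\<^bsub>AM\<^esub> s) \<in> imm A'.ker \<beta> \<gamma> b"
    if a: "a \<in> carrier A" "x \<in> carrier N" "s \<in> carrier AM" for a x s
  proof -
    interpret N: module A N by (rule N)
    have la: "\<pi> (A.lift a) = a" using a by (simp add: A.cov_lift)
    have "f (a \<odot>\<^bsub>N\<^esub> x) s - Vec (\<lambda>i. A'.lift s * (lf (A.lift a) * lf (cc x i))) \<in> imm A'.ker \<beta> \<gamma> b"
      using a rscl[OF a(2) cc[OF a(2)], of "A.lift a"]
      by (intro key'[of _ "\<lambda>i. A.lift a * cc x i"])
        (simp_all add: A'.cov_mult lf phi_simps A'.cov_lift la)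
    moreover have "f x (a \<odot>\<^bsub>AM\<^esub> s) - Vec (\<lambda>i. A'.lift s * lf (A.lift a) * lf (cc x i)) \<in> imm A'.ker \<beta> \<gamma> b"
      using a phi_simps(1)[of "A.lift a"] by (intro key'[of _ "cc x"] cc) (simp_all add: A'.cov_mult lf A'.cov_lift la A'.m_comm)
    ultimately show ?thesis using smod_diff[OF sm] by (fastforce simp: mult.assoc)
  qed
  obtain h where "\<And>u v. h (u - v) = h u - h v" "\<And>x y. h (frag_of (x, y)) = f x y"
    "\<And>z. z \<in> tensor_relations A N AM ==> h z \<in> imm A'.ker \<beta> \<gamma> b"
    using tensor_evaluation[OF N module_AM, of "imm A'.ker \<beta> \<gamma> b" f] l r s smod_0[OF sm] smod_diff[OF sm] by blast
  then show ?thesis using key by (intro exI[of _ h]) simp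
qed

lemma tensor_lc_left:
  assumes N: "module A N" and y: "\<And>i. i < n ==> y i \<in> carrier N" and t: "t \<in> carrier A'"
  shows "frag_of (lc \<pi> N y v n, t) - (\<Sum>i<n. frag_of (y i, \<phi> (\<pi> (v i)) \<otimes>\<^bsub>A'\<^esub> t)) \<in> tensor_relations A N AM"
  using y
proof (induction n)
  case 0
  then show ?case using tensor_zero_left[OF N module_AM] t by simp
next
  case (Suc n)
  interpret N: module A N by (rule N)
  let ?T = "tensor_relations A N AM" and ?l = "lc \<pi> N y v n" and ?s = "\<Sum>i<n. frag_of (y i, \<phi> (\<pi> (v i)) \<otimes>\<^bsub>A'\<^esub> t)"
  have "frag_of (?l \<oplus>\<^bsub>N\<^esub> \<pi> (v n) \<odot>\<^bsub>N\<^esub> y n, t) - frag_of (?l, t) - frag_of (\<pi> (v n) \<odot>\<^bsub>N\<^esub> y n, t) \<in> ?T"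
    using Suc.prems t by (intro tensor_add_left[OF N module_AM]) (simp_all add: A.lc_closed[OF N])
  moreover have "frag_of (\<pi> (v n) \<odot>\<^bsub>N\<^esub> y n, t) - frag_of (y n, \<pi> (v n) \<odot>\<^bsub>AM\<^esub> t) \<in> ?T"
    using Suc.prems t by (intro tensor_balanced[OF N module_AM]) simp_all
  moreover have "frag_of (?l, t) - ?s \<in> ?T" using Suc by simp
  ultimately have "(frag_of (?l \<oplus>\<^bsub>N\<^esub> \<pi> (v n) \<odot>\<^bsub>N\<^esub> y n, t) - frag_of (?l, t) - frag_of (\<pi> (v n) \<odot>\<^bsub>N\<^esub> y n, t))
    + (frag_of (\<pi> (v n) \<odot>\<^bsub>N\<^esub> y n, t) - frag_of (y n, \<pi> (v n) \<odot>\<^bsub>AM\<^esub> t)) + (frag_of (?l, t) - ?s) \<in> ?T"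
    using tensor_relations_add[OF N module_AM] by blast
  then show ?case by (simp add: algebra_simps)
qed

lemma tensor_sum_right:
  assumes N: "module A N" and x: "x \<in> carrier N"
  shows "frag_of (x, \<pi>' (\<Sum>j<n. f j)) - (\<Sum>j<(n::nat). frag_of (x, \<pi>' (f j))) \<in> tensor_relations A N AM"
proof (induction n)
  case 0
  then show ?case using tensor_zero_right[OF N module_AM x] by (simp add: A'.cov_zero)
next
  case (Suc n)
  have "frag_of (x, \<pi>' (\<Sum>j<n. f j) \<oplus>\<^bsub>AM\<^esub> \<pi>' (f n)) - frag_of (x, \<pi>' (\<Sum>j<n. f j)) - frag_of (x, \<pi>' (f n))
      \<in> tensor_relations A N AM"
    using x by (intro tensor_add_right[OF N module_AM]) simp_all
  from tensor_relations_add[OF N module_AM this Suc] show ?case by (simp add: A'.cov_add A'.a_comm algebra_simps)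
qed

end

text \<open>The submodules of \<open>R\<^sup>p\<close>, with the elements wrapped as singletons to fit the type of the test modules
  of \<open>flat_module\<close>.\<close>

definition vset :: "('a, 'm) ring_scheme => nat => (nat => 'a) set => ('a, (nat => 'a) set) module" where
  "vset R p E = \<lparr>carrier = (\<lambda>v. {v}) ` E, monoid.mult = undefined, monoid.one = undefined,
     ring.zero = {\<zero>\<^bsub>free_module R p\<^esub>},
     ring.add = (\<lambda>x y. {the_elem x \<oplus>\<^bsub>free_module R p\<^esub> the_elem y}),
     smult = (\<lambda>a x. {a \<odot>\<^bsub>free_module R p\<^esub> the_elem x})\<rparr>"

lemma vset_sel [simp]:
  "carrier (vset R p E) = (\<lambda>v. {v}) ` E" "\<zero>\<^bsub>vset R p E\<^esub> = {\<zero>\<^bsub>free_module R p\<^esub>}"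
  "x \<oplus>\<^bsub>vset R p E\<^esub> y = {the_elem x \<oplus>\<^bsub>free_module R p\<^esub> the_elem y}"
  "a \<odot>\<^bsub>vset R p E\<^esub> x = {a \<odot>\<^bsub>free_module R p\<^esub> the_elem x}"
  by (simp_all add: vset_def)

lemma module_vset:
  assumes R: "cring R" and E: "E \<subseteq> carrier (free_module R p)" "\<zero>\<^bsub>free_module R p\<^esub> \<in> E"
    "\<And>u v. u \<in> E ==> v \<in> E ==> u \<oplus>\<^bsub>free_module R p\<^esub> v \<in> E"
    "\<And>a v. a \<in> carrier R ==> v \<in> E ==> a \<odot>\<^bsub>free_module R p\<^esub> v \<in> E"
  shows "module R (vset R p E)"
proof -
  interpret F: module R "free_module R p" using R by (rule module_free_module)
  have sub: "v \<in> carrier (free_module R p)" if "v \<in> E" for v using E(1) that by blast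
  have neg: "v \<oplus>\<^bsub>free_module R p\<^esub> (\<ominus>\<^bsub>R\<^esub> \<one>\<^bsub>R\<^esub>) \<odot>\<^bsub>free_module R p\<^esub> v = \<zero>\<^bsub>free_module R p\<^esub>" if "v \<in> E" for v
    using F.smult_l_minus[of "\<one>\<^bsub>R\<^esub>" v] sub[OF that] by (simp add: F.M.r_neg del: free_module_sel)
  show ?thesis
    by (rule moduleI'[OF R])
      (auto simp: E F.smult_l_distr F.smult_r_distr F.smult_assoc1 F.a_ac sub neg simp del: free_module_sel)
qed

lemma (in ring_cover) lc_vset: "k \<le> n ==>
    lc \<pi> (vset B n E) (\<lambda>j. {unit_vec n j}) v k = {\<lambda>i\<in>{..<n}. if i < k then \<pi> (v i) else \<zero>}"
proof (induction k)
  case (Suc k)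
  then show ?case by (auto simp: fun_eq_iff unit_vec_def less_Suc_eq)
qed auto

text \<open>Flatness is applied to the inclusion of the image of \<open>a\<close> into the free
  module. By exactness that image is the cokernel of \<open>b\<close>, so an element of its tensor
  product with \<open>A'\<close> can be tested in coordinates modulo the columns of
  \<open>b'\<close>.\<close>

lemma (in ring_change) flat_exact_columns:
  assumes flat: "flat_module A AM" and ex: "exact_columns A.ker p q r a b"
    and a': "\<And>i j. i < p ==> j < q ==> \<pi>' (a' i j) = \<phi> (\<pi> (a i j))"
    and b': "\<And>i j. i < q ==> j < r ==> \<pi>' (b' i j) = \<phi> (\<pi> (b i j))"
  shows "exact_columns A'.ker p q r a' b'"
  unfolding exact_columns_def
proof (intro allI impI)
  fix v' assume v': "\<forall>i<p. (\<Sum>j<q. a' i j * v' j) \<in> A'.ker"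
  define E where "E = {v \<in> carrier (free_module A p). \<exists>u. \<forall>i<p. v i = \<pi> (\<Sum>j<q. a i j * u j)}"
  let ?I = "vset A p E" and ?N = "vset A p (carrier (free_module A p))"
  interpret F: module A "free_module A p" using A.is_cring by (rule module_free_module)
  have N: "module A ?N" by (rule module_vset[OF A.is_cring]) (auto simp del: free_module_sel)
  have I: "module A ?I"
  proof (rule module_vset[OF A.is_cring])
    show "E \<subseteq> carrier (free_module A p)" by (auto simp: E_def simp del: free_module_sel)
    show "\<zero>\<^bsub>free_module A p\<^esub> \<in> E" unfolding E_def by (auto intro!: exI[of _ "\<lambda>_. 0"] simp: A.cov_zero)
    fix x y assume "x \<in> E" "y \<in> E"
    then obtain u w where "x \<in> carrier (free_module A p)" "y \<in> carrier (free_module A p)"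
      "\<And>i. i < p ==> x i = \<pi> (\<Sum>j<q. a i j * u j)" "\<And>i. i < p ==> y i = \<pi> (\<Sum>j<q. a i j * w j)"
      unfolding E_def by blast
    then show "x \<oplus>\<^bsub>free_module A p\<^esub> y \<in> E"
      unfolding E_def by (auto intro!: exI[of _ "\<lambda>j. u j + w j"] simp: distrib_left sum.distrib A.cov_add)
  next
    fix c x assume c: "c \<in> carrier A" "x \<in> E"
    then obtain u where "x \<in> carrier (free_module A p)" "\<And>i. i < p ==> x i = \<pi> (\<Sum>j<q. a i j * u j)"
      unfolding E_def by blast
    moreover have "\<pi> (\<Sum>j<q. a i j * (A.lift c * u j)) = c \<otimes>\<^bsub>A\<^esub> \<pi> (\<Sum>j<q. a i j * u j)" for i
    proof -
      have "(\<Sum>j<q. a i j * (A.lift c * u j)) = A.lift c * (\<Sum>j<q. a i j * u j)"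
        by (simp add: sum_distrib_left mult.left_commute)
      then show ?thesis using c by (simp add: A.cov_mult A.cov_lift)
    qed
    ultimately show "c \<odot>\<^bsub>free_module A p\<^esub> x \<in> E"
      unfolding E_def using c(1) by (auto intro!: exI[of _ "\<lambda>j. A.lift c * u j"])
  qed
  have id: "id \<in> module_hom A ?I ?N" by (auto simp: module_hom_def E_def simp del: free_module_sel)
  have idA: "id \<in> module_hom A AM AM" by (simp add: module_hom_def)
  define Xe where "Xe j = {\<lambda>i\<in>{..<p}. \<pi> (a i j)}" for j
  have Xe: "Xe j \<in> carrier ?I" if "j < q" for j
  proof -
    have "\<pi> (\<Sum>j'<q. a i j' * (if j' = j then 1 else 0)) = \<pi> (a i j)" for i
      using that by (simp add: if_distrib[of "\<lambda>x. _ * x"] cong: if_cong)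
    then show ?thesis unfolding Xe_def E_def
      by (auto split: if_splits intro!: imageI exI[of _ "\<lambda>j'. if j' = j then 1 else 0"])
  qed
  \<comment> \<open>The tensor with coordinates \<open>v'\<close> over the generators
    \<open>Xe j\<close> of the image of \<open>a\<close>. In the tensor product with the free module
    it becomes zero because \<open>a' v' = 0\<close>.\<close>
  define z where "z = (\<Sum>j<q. frag_of (Xe j, \<pi>' (v' j)))"
  have zk: "Poly_Mapping.keys z \<subseteq> carrier ?I \<times> carrier AM"
    unfolding z_def by (rule order_trans[OF keys_sum]) (use Xe in auto)
  let ?T = "tensor_relations A ?N AM"
  define y where "y j = {A.unit_vec p j}" for j
  have y: "y i \<in> carrier ?N" for i by (auto simp: y_def A.unit_vec_def)
  have "z - 0 \<in> ?T"
  proof -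
    have 1: "z - (\<Sum>j<q. \<Sum>i<p. frag_of (y i, \<pi>' (a' i j * v' j))) \<in> ?T"
      unfolding z_def sum_subtractf[symmetric]
    proof (rule tensor_relations_sum[OF N module_AM])
      fix j assume j: "j \<in> {..<q}"
      have "Xe j = lc \<pi> ?N y (\<lambda>i. a i j) p"
        unfolding y_def[abs_def] A.lc_vset[OF order_refl] Xe_def by (auto simp: fun_eq_iff)
      then show "frag_of (Xe j, \<pi>' (v' j)) - (\<Sum>i<p. frag_of (y i, \<pi>' (a' i j * v' j))) \<in> ?T"
        using tensor_lc_left[OF N y, where t = "\<pi>' (v' j)" and v = "\<lambda>i. a i j" and n = p] j a'
        by (simp add: A'.cov_mult)
    qed
    have 2: "(\<Sum>i<p. \<Sum>j<q. frag_of (y i, \<pi>' (a' i j * v' j))) \<in> ?T"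
    proof (rule tensor_relations_sum[OF N module_AM])
      fix i assume "i \<in> {..<p}"
      then have "frag_of (y i, \<pi>' (\<Sum>j<q. a' i j * v' j)) \<in> ?T"
        using v' tensor_zero_right[OF N module_AM y] by (simp add: A'.ker_def)
      from tensor_relations_diff[OF N module_AM this tensor_sum_right[OF N y, of i "\<lambda>j. a' i j * v' j" q]]
      show "(\<Sum>j<q. frag_of (y i, \<pi>' (a' i j * v' j))) \<in> ?T" by simp
    qed
    show ?thesis using tensor_relations_add[OF N module_AM 1 2] unfolding sum.swap[of _ "{..<q}" "{..<p}"] by simp
  qed
  then have eq: "tensor_class A ?N AM z = tensor_class A ?N AM 0" by (simp only: tensor_class_eq[OF N module_AM])
  have ext: "frag_extend (\<lambda>(x, y). frag_of (id x, id y)) w = w" for w :: "(nat => 'a) set \<times> 's \<Rightarrow>\<^sub>0 int"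
    using frag_expansion[of w] by (simp add: case_prod_unfold)
  have "tensor_map A ?N AM id id (tensor_class A ?I AM z) = tensor_map A ?N AM id id (tensor_class A ?I AM 0)"
    unfolding tensor_map_class[OF I module_AM N module_AM id idA] ext by (rule eq)
  moreover have "inj_on (tensor_map A ?N AM id id) (carrier (tensor_group A ?I AM))"
    using flat I N id unfolding flat_module_def by (meson inj_on_id)
  moreover have "tensor_class A ?I AM z \<in> carrier (tensor_group A ?I AM)" "tensor_class A ?I AM 0 \<in> carrier (tensor_group A ?I AM)"
    unfolding tensor_group_carrier[OF I module_AM] using zk by (auto simp del: vset_sel algebra_module_sel)
  ultimately have "tensor_class A ?I AM z = tensor_class A ?I AM 0" by (simp only: inj_on_eq_iff)
  then have zI: "z \<in> tensor_relations A ?I AM" using tensor_class_eq[OF I module_AM, of z 0] by simp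
  \<comment> \<open>Coordinates of \<open>x\<close> are its preimages under \<open>a\<close>; two of
    them differ by a column of \<open>b\<close>, by exactness.\<close>
  define rep where "rep x u \<longleftrightarrow> (\<forall>i<p. the_elem x i = \<pi> (\<Sum>j<q. a i j * u j))" for x u
  have "\<exists>h :: ((nat => 'a) set \<times> 's \<Rightarrow>\<^sub>0 int) => (nat, 'q) vec. (\<forall>u v. h (u - v) = h u - h v) \<and>
    (\<forall>z\<in>tensor_relations A ?I AM. h z \<in> imm A'.ker q r b') \<and>
    (\<forall>x\<in>carrier ?I. \<forall>u w u'. rep x u --> (\<forall>i<q. \<pi>' (u' i) = \<phi> (\<pi> (u i))) -->
      h (frag_of (x, \<pi>' w)) - Vec (\<lambda>i. w * u' i) \<in> imm A'.ker q r b')"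
  proof (rule tensor_coordinates[OF I])
    show "\<exists>u. rep x u" if "x \<in> carrier ?I" for x using that by (auto simp: rep_def E_def)
    show "rep (x \<oplus>\<^bsub>?I\<^esub> x') (\<lambda>i. u i + u' i)" if "rep x u" "rep x' u'" for x x' u u'
      using that by (simp add: rep_def distrib_left sum.distrib A.cov_add)
    show "rep (\<pi> c \<odot>\<^bsub>?I\<^esub> x) (\<lambda>i. c * u i)" if "rep x u" for c x u
      using that by (simp add: rep_def mult.left_commute[of _ c] sum_distrib_left[symmetric] A.cov_mult)
    show "\<exists>y. \<forall>i<q. u i - u' i - (\<Sum>j<r. b i j * y j) \<in> A.ker" if "rep x u" "rep x u'" for x u u'
    proof -
      have "\<pi> (\<Sum>j<q. a i j * u j) = \<pi> (\<Sum>j<q. a i j * u' j)" if "i < p" for i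
        using \<open>rep x u\<close> \<open>rep x u'\<close> that unfolding rep_def by metis
      then have "\<forall>i<p. (\<Sum>j<q. a i j * (u j - u' j)) \<in> A.ker"
        unfolding right_diff_distrib sum_subtractf A.ker_diff by blast
      then show ?thesis by (rule mp[OF spec[OF ex[unfolded exact_columns_def], of "\<lambda>j. u j - u' j"]])
    qed
    show "\<pi>' (b' i j) = \<phi> (\<pi> (b i j))" if "i < q" "j < r" for i j using b' that .
  qed
  then obtain h :: "((nat => 'a) set \<times> 's \<Rightarrow>\<^sub>0 int) => (nat, 'q) vec" where hd: "\<And>u v. h (u - v) = h u - h v"
    and hT: "\<And>z. z \<in> tensor_relations A ?I AM ==> h z \<in> imm A'.ker q r b'"
    and hp: "\<And>x u w u'. x \<in> carrier ?I ==> rep x u ==> (\<And>i. i < q ==> \<pi>' (u' i) = \<phi> (\<pi> (u i))) ==>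
      h (frag_of (x, \<pi>' w)) - Vec (\<lambda>i. w * u' i) \<in> imm A'.ker q r b'" by blast
  note sm = smod_imm[OF A'.idl_ker, of q r b']
  have h0: "h 0 = 0" using hd[of 0 0] by simp
  have hadd: "h (u + v) = h u + h v" for u v using hd[of u "- v"] hd[of 0 v] h0 by simp
  have hz: "h z = (\<Sum>j<q. h (frag_of (Xe j, \<pi>' (v' j))))" unfolding z_def
    by (induction q) (simp_all add: h0 hadd)
  have "(\<Sum>j<q. h (frag_of (Xe j, \<pi>' (v' j))) - Vec (\<lambda>i. v' j * (if i = j then 1 else 0))) \<in> imm A'.ker q r b'"
  proof (rule smod_sum[OF sm])
    fix j assume j: "j \<in> {..<q}"
    show "h (frag_of (Xe j, \<pi>' (v' j))) - Vec (\<lambda>i. v' j * (if i = j then 1 else 0)) \<in> imm A'.ker q r b'"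
    proof (rule hp[of _ "\<lambda>i. if i = j then 1 else 0"])
      show "Xe j \<in> carrier ?I" using Xe j by blast
      show "rep (Xe j) (\<lambda>i. if i = j then 1 else 0)"
        using j by (simp add: rep_def Xe_def if_distrib[of "\<lambda>x. _ * x"] cong: if_cong)
      show "\<pi>' (if i = j then 1 else 0) = \<phi> (\<pi> (if i = j then 1 else 0))" for i by (simp add: phi_simps)
    qed
  qed
  then have "(\<Sum>j<q. Vec (\<lambda>i. v' j * (if i = j then 1 else 0))) \<in> imm A'.ker q r b'"
    unfolding sum_subtractf hz[symmetric] by (rule smod_diff_cancel'[OF sm _ hT[OF zI]])
  then show "\<exists>w. \<forall>j<q. v' j - (\<Sum>k<r. b' j k * w k) \<in> A'.ker"
    by (simp add: imm_def ix_sum if_distrib[of "\<lambda>x. _ * x"] cong: if_cong)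
qed

section \<open>Projective resolutions as matrices\<close>

text \<open>The dual basis of a projective module: \<open>\<iota> x l\<close> is the value at
  \<open>x\<close> of the functional belonging to the generator \<open>p l\<close>, lifted to the
  cover and therefore linear only modulo \<open>K\<close>.\<close>

definition dual_basis :: "('r::comm_ring_1 => 'a) => ('a, 'b, 'm) module_scheme => (nat => 'b) => ('b => nat => 'r)
    => nat => 'r set => bool" where
  "dual_basis \<pi> P p \<iota> n K \<longleftrightarrow> (\<forall>l<n. p l \<in> carrier P) \<and> (\<forall>x\<in>carrier P. lc \<pi> P p (\<iota> x) n = x) \<and>
     (\<forall>x\<in>carrier P. \<forall>y\<in>carrier P. \<forall>l<n. \<iota> (x \<oplus>\<^bsub>P\<^esub> y) l - \<iota> x l - \<iota> y l \<in> K) \<and>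
     (\<forall>w. \<forall>x\<in>carrier P. \<forall>l<n. \<iota> (\<pi> w \<odot>\<^bsub>P\<^esub> x) l - w * \<iota> x l \<in> K)"

context ring_cover
begin

lemma fg_projective_dual_basis:
  fixes P :: "('c, 'b, 'k) module_scheme"
  assumes "fg_projective B P"
  shows "\<exists>n p \<iota>. dual_basis \<pi> P p \<iota> n ker"
proof -
  obtain n and Q :: "('c, nat => 'c) module" where P: "module B P" and Q: "module B Q"
    and iso: "module_iso B (direct_sum P Q) (free_module B n)" using assms unfolding fg_projective_def by blast
  interpret P: module B P by fact
  interpret Q: module B Q by fact
  obtain \<theta> y where \<theta>: "\<theta> \<in> module_hom B (direct_sum P Q) (free_module B n)"
    and y: "\<And>j. j < n ==> y j \<in> carrier (direct_sum P Q)"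
    and x: "\<And>x. x \<in> carrier (direct_sum P Q) ==> x = lc \<pi> (direct_sum P Q) y (\<lambda>i. lift (\<theta> x i)) n"
    using iso_free_module[OF module_direct_sum[OF P Q] iso] by blast
  define \<iota> where "\<iota> u i = lift (\<theta> (u, \<zero>\<^bsub>Q\<^esub>) i)" for u i
  have fst: "fst (lc \<pi> (direct_sum P Q) y v k) = lc \<pi> P (\<lambda>j. fst (y j)) v k" for v k
    by (induction k) simp_all
  have \<theta>c: "\<theta> (u, \<zero>\<^bsub>Q\<^esub>) i \<in> carrier B" if "u \<in> carrier P" "i < n" for u i
    using \<theta> that by (auto simp: module_hom_def PiE_iff Pi_iff)
  have \<iota>: "\<pi> (\<iota> u i) = \<theta> (u, \<zero>\<^bsub>Q\<^esub>) i" if "u \<in> carrier P" "i < n" for u i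
    unfolding \<iota>_def using \<theta>c[OF that] by (rule cov_lift)
  have add: "\<theta> (u \<oplus>\<^bsub>P\<^esub> v, \<zero>\<^bsub>Q\<^esub>) i = \<theta> (u, \<zero>\<^bsub>Q\<^esub>) i \<oplus> \<theta> (v, \<zero>\<^bsub>Q\<^esub>) i" if "u \<in> carrier P" "v \<in> carrier P" "i < n" for u v i
  proof -
    have "\<theta> ((u, \<zero>\<^bsub>Q\<^esub>) \<oplus>\<^bsub>direct_sum P Q\<^esub> (v, \<zero>\<^bsub>Q\<^esub>)) = \<theta> (u, \<zero>\<^bsub>Q\<^esub>) \<oplus>\<^bsub>free_module B n\<^esub> \<theta> (v, \<zero>\<^bsub>Q\<^esub>)"
      using \<theta> that unfolding module_hom_def by (auto simp del: direct_sum_sel(3,4) free_module_sel)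
    then show ?thesis using that by simp
  qed
  have scl: "\<theta> (\<pi> w \<odot>\<^bsub>P\<^esub> u, \<zero>\<^bsub>Q\<^esub>) i = \<pi> w \<otimes> \<theta> (u, \<zero>\<^bsub>Q\<^esub>) i" if "u \<in> carrier P" "i < n" for u w i
  proof -
    have "\<theta> (\<pi> w \<odot>\<^bsub>direct_sum P Q\<^esub> (u, \<zero>\<^bsub>Q\<^esub>)) = \<pi> w \<odot>\<^bsub>free_module B n\<^esub> \<theta> (u, \<zero>\<^bsub>Q\<^esub>)"
      using \<theta> that unfolding module_hom_def by (auto simp del: direct_sum_sel(3,4) free_module_sel)
    then show ?thesis using that by simp
  qed
  have "dual_basis \<pi> P (\<lambda>l. fst (y l)) \<iota> n ker"
    unfolding dual_basis_def
  proof (intro conjI allI ballI impI)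
    show "fst (y l) \<in> carrier P" if "l < n" for l using y[OF that] by auto
    show "lc \<pi> P (\<lambda>l. fst (y l)) (\<iota> u) n = u" if "u \<in> carrier P" for u
      using x[of "(u, \<zero>\<^bsub>Q\<^esub>)"] fst[of "\<lambda>i. lift (\<theta> (u, \<zero>\<^bsub>Q\<^esub>) i)" n] that by (simp add: \<iota>_def[abs_def])
    show "\<iota> (u \<oplus>\<^bsub>P\<^esub> v) l - \<iota> u l - \<iota> v l \<in> ker" if "u \<in> carrier P" "v \<in> carrier P" "l < n" for u v l
    proof -
      have "\<pi> (\<iota> (u \<oplus>\<^bsub>P\<^esub> v) l) = \<pi> (\<iota> u l + \<iota> v l)" using that by (simp add: cov_add \<iota> add)
      then show ?thesis unfolding ker_diff[symmetric] by (simp add: diff_diff_add)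
    qed
    show "\<iota> (\<pi> w \<odot>\<^bsub>P\<^esub> u) l - w * \<iota> u l \<in> ker" if "u \<in> carrier P" "l < n" for u w l
      using that by (simp add: ker_diff cov_mult \<iota> scl)
  qed
  then show ?thesis by blast
qed

lemma dual_basis_lc:
  fixes P :: "('c, 'b, 'k) module_scheme"
  assumes P: "module B P" and d: "dual_basis \<pi> P p \<iota> n ker" and l: "l < n"
    and y: "\<And>j. j < m ==> y j \<in> carrier P"
  shows "\<iota> (lc \<pi> P y v m) l - (\<Sum>j<m. \<iota> (y j) l * v j) \<in> ker"
proof -
  have add: "\<iota> (x \<oplus>\<^bsub>P\<^esub> y) l - \<iota> x l - \<iota> y l \<in> ker" if "x \<in> carrier P" "y \<in> carrier P" for x y
    using d l that by (simp add: dual_basis_def)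
  have scl: "\<iota> (\<pi> w \<odot>\<^bsub>P\<^esub> x) l - w * \<iota> x l \<in> ker" if "x \<in> carrier P" for w x
    using d l that by (simp add: dual_basis_def)
  interpret P: module B P by fact
  show ?thesis using y
  proof (induction m)
    case 0
    show ?case using idl_minus[OF idl_ker add[of "\<zero>\<^bsub>P\<^esub>" "\<zero>\<^bsub>P\<^esub>"]] by simp
  next
    case (Suc m)
    let ?l = "lc \<pi> P y v m" and ?t = "\<pi> (v m) \<odot>\<^bsub>P\<^esub> y m"
    have "(\<iota> (?l \<oplus>\<^bsub>P\<^esub> ?t) l - \<iota> ?l l - \<iota> ?t l) + (\<iota> ?t l - v m * \<iota> (y m) l) + (\<iota> ?l l - (\<Sum>j<m. \<iota> (y j) l * v j)) \<in> ker"
      using Suc by (intro idl_add[OF idl_ker] add scl) (simp_all add: lc_closed[OF P])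
    then show ?case by (simp add: algebra_simps)
  qed
qed

end

text \<open>\<open>A'\<close> and \<open>B\<close> have covers by the same ring, compatible with
  \<open>\<psi>\<close>, so lifting a matrix from \<open>A'\<close> to \<open>B\<close> does not
  change its entries in the cover.\<close>

locale ring_deform = ring_change A \<pi> A' \<pi>' \<phi> + B: ring_cover B \<pi>\<^sub>B
  for A :: "('a, 'm) ring_scheme" and \<pi> :: "'p::comm_ring_1 => 'a"
    and A' :: "('s, 'n) ring_scheme" and \<pi>' :: "'q::comm_ring_1 => 's" and \<phi> :: "'a => 's"
    and B :: "('c, 'l) ring_scheme" and \<pi>\<^sub>B :: "'q => 'c" +
  fixes \<psi> :: "'c => 's"
  assumes psi: "\<pi>' p = \<psi> (\<pi>\<^sub>B p)"
begin

text \<open>\<open>rep\<close> gives a map from \<open>N\<close> to the cokernel of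
  \<open>\<alpha>\<close>, and the elements \<open>y i\<close> give a map back. After base change
  the cokernel of \<open>b\<close> is thus a retract of a module with a finite resolution over
  \<open>B\<close>.\<close>

lemma pd_data_exists:
  fixes N :: "('a, 'b, 'k) module_scheme" and rep :: "'b => (nat => 'p) => bool"
    and \<alpha> :: "nat => nat => 'p" and \<beta> \<gamma> c :: nat
  assumes N: "module A N"
    and tot: "\<And>x. x \<in> carrier N ==> \<exists>u. rep x u"
    and radd: "\<And>x x' u u'. x \<in> carrier N ==> x' \<in> carrier N ==> rep x u ==> rep x' u' ==> rep (x \<oplus>\<^bsub>N\<^esub> x') (\<lambda>i. u i + u' i)"
    and rscl: "\<And>p x u. x \<in> carrier N ==> rep x u ==> rep (\<pi> p \<odot>\<^bsub>N\<^esub> x) (\<lambda>i. p * u i)"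
    and uniq: "\<And>x u u'. x \<in> carrier N ==> rep x u ==> rep x u' ==>
        \<exists>y. \<forall>i<\<beta>. u i - u' i - (\<Sum>j<\<gamma>. \<alpha> i j * y j) \<in> A.ker"
    and b: "\<And>i j. i < \<beta> ==> j < \<gamma> ==> \<pi>' (b i j) = \<phi> (\<pi> (\<alpha> i j))"
    and y: "\<And>i. i < \<beta> ==> y i \<in> carrier N" and repy: "\<And>i'. i' < \<beta> ==> rep (y i') (\<lambda>i. if i = i' then 1 else 0)"
    and y\<alpha>: "\<And>j. j < \<gamma> ==> lc \<pi> N y (\<lambda>i. \<alpha> i j) \<beta> = \<zero>\<^bsub>N\<^esub>"
    and x: "\<And>j. j < c ==> x j \<in> A'.ker"
    and pd: "projective_dimension B (restrict_scalars \<psi> (base_change A A' \<phi> N)) < \<infinity>"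
  shows "pd_data B.ker A'.ker x c \<beta> \<gamma> b"
proof -
  let ?BC = "restrict_scalars \<psi> (base_change A A' \<phi> N)" and ?T = "tensor_relations A N AM"
  let ?S = "imm A'.ker \<beta> \<gamma> b" and ?KS = "{z. Poly_Mapping.keys z \<subseteq> carrier N \<times> carrier A'}"
  note sm = smod_imm[OF A'.idl_ker, of \<beta> \<gamma> b]
  define cls where "cls z = tensor_class A N AM z" for z
  define ext where "ext s = frag_extend (\<lambda>(x :: 'b, t). frag_of (x, s \<otimes>\<^bsub>A'\<^esub> t))" for s
  have carr: "carrier ?BC = cls ` ?KS"
    by (simp add: restrict_scalars_def base_change_def tensor_group_carrier[OF N module_AM] cls_def[abs_def])
  have zero: "\<zero>\<^bsub>?BC\<^esub> = cls 0"
    by (simp add: restrict_scalars_def base_change_def tensor_group_one[OF N module_AM] cls_def)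
  have add: "cls z \<oplus>\<^bsub>?BC\<^esub> cls w = cls (z + w)" for z w
    by (simp add: restrict_scalars_def base_change_def tensor_group_mult[OF N module_AM] cls_def)
  have scl: "\<pi>\<^sub>B w \<odot>\<^bsub>?BC\<^esub> cls z = cls (ext (\<pi>' w) z)" for w z
  proof -
    have "(\<lambda>t. \<pi>' w \<otimes>\<^bsub>A'\<^esub> t) \<in> module_hom A AM AM"
      using ring_hom_closed[OF \<phi>] by (simp add: module_hom_def A'.r_distr A'.m_lcomm)
    moreover have "id \<in> module_hom A N N" by (simp add: module_hom_def)
    ultimately show ?thesis
      by (simp add: restrict_scalars_def base_change_def cls_def psi[symmetric] ext_def
          tensor_map_class[OF N module_AM N module_AM])
  qed
  have cls_eq: "cls z = cls w \<longleftrightarrow> z - w \<in> ?T" for z w unfolding cls_def by (rule tensor_class_eq[OF N module_AM])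
  have cls_0: "cls z = cls 0" if "z \<in> ?T" for z using that cls_eq[of z 0] by simp
  have "\<exists>h :: ('b \<times> 's \<Rightarrow>\<^sub>0 int) => (nat, 'q) vec. (\<forall>u v. h (u - v) = h u - h v) \<and> (\<forall>z\<in>?T. h z \<in> ?S) \<and>
    (\<forall>x\<in>carrier N. \<forall>u w u'. rep x u --> (\<forall>i<\<beta>. \<pi>' (u' i) = \<phi> (\<pi> (u i))) -->
      h (frag_of (x, \<pi>' w)) - Vec (\<lambda>i. w * u' i) \<in> ?S)"
    by (rule tensor_coordinates[OF N tot radd rscl uniq b])
  then obtain h :: "('b \<times> 's \<Rightarrow>\<^sub>0 int) => (nat, 'q) vec" where hd: "\<And>u v. h (u - v) = h u - h v"
    and hT: "\<And>z. z \<in> ?T ==> h z \<in> ?S"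
    and hp: "\<And>x u w u'. x \<in> carrier N ==> rep x u ==> (\<And>i. i < \<beta> ==> \<pi>' (u' i) = \<phi> (\<pi> (u i))) ==>
      h (frag_of (x, \<pi>' w)) - Vec (\<lambda>i. w * u' i) \<in> ?S" by blast
  have h0: "h 0 = 0" using hd[of 0 0] by simp
  have hadd: "h (u + v) = h u + h v" for u v using hd[of u "- v"] hd[of 0 v] h0 by simp
  have h_ext: "h (ext (\<pi>' w) z) - scl w (h z) \<in> ?S" if "z \<in> ?KS" for w z
  proof -
    have "Poly_Mapping.keys z \<subseteq> carrier N \<times> carrier A'" using that by simp
    then show ?thesis
    proof (induction z rule: frag_induction)
      case zero
      then show ?case using smod_0[OF sm] by (simp add: ext_def h0 scl_simps)
    next
      case (one p)
      obtain n t where p: "p = (n, t)" "n \<in> carrier N" "t \<in> carrier A'" using one by blast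
      obtain u where u: "rep n u" using tot[OF p(2)] by blast
      obtain w' where w': "t = \<pi>' w'" using A'.cov_surj[OF p(3)] by blast
      have 1: "h (frag_of (n, \<pi>' (w * w'))) - Vec (\<lambda>i. w * w' * lf (u i)) \<in> ?S"
        using p(2) u lf by (rule hp)
      have "h (frag_of (n, \<pi>' w')) - Vec (\<lambda>i. w' * lf (u i)) \<in> ?S"
        using p(2) u lf by (rule hp)
      from smod_scl[OF sm this, of w]
      have 2: "scl w (h (frag_of (n, \<pi>' w'))) - Vec (\<lambda>i. w * w' * lf (u i)) \<in> ?S"
      proof -
        have "scl w (Vec (\<lambda>i. w' * lf (u i))) = Vec (\<lambda>i. w * w' * lf (u i))" by (simp add: vec_eq_iff mult.assoc)
        then show ?thesis using \<open>scl w _ \<in> ?S\<close> by (simp add: scl_simps(3))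
      qed
      have "h (frag_of (n, \<pi>' (w * w'))) - scl w (h (frag_of (n, \<pi>' w'))) \<in> ?S"
        using smod_diff[OF sm 1 2] by simp
      then show ?case by (simp add: p w' ext_def A'.cov_mult)
    next
      case (diff a b)
      from smod_diff[OF sm this] show ?case by (simp add: ext_def frag_extend_diff hd scl_simps algebra_simps)
    qed
  qed
  \<comment> \<open>The map \<open>h\<close> on cosets, through a chosen representative; it is
    independent of the choice modulo \<open>?S\<close> because \<open>h\<close> sends relations into
    \<open>?S\<close>.\<close>
  define R where "R U = h (SOME z. z \<in> ?KS \<and> cls z = U)" for U
  have R: "R (cls z) - h z \<in> ?S" if "z \<in> ?KS" for z
  proof -
    define z' where "z' = (SOME z'. z' \<in> ?KS \<and> cls z' = cls z)"
    have "z' \<in> ?KS \<and> cls z' = cls z" unfolding z'_def by (rule someI[of _ z]) (use that in simp)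
    then have "h (z' - z) \<in> ?S" using hT cls_eq by blast
    moreover have "R (cls z) = h z'" unfolding R_def z'_def ..
    ultimately show ?thesis by (simp add: hd)
  qed
  have "\<exists>n (P :: nat => ('c, nat => 'c) module) \<delta> \<epsilon>. projective_resolution B ?BC P \<delta> \<epsilon> \<and> (\<forall>i>n. carrier (P i) = {\<zero>\<^bsub>P i\<^esub>})"
  proof (rule ccontr)
    assume no: "\<not> ?thesis"
    have "{enat n | n. \<exists>(P :: nat => ('c, nat => 'c) module) \<delta> \<epsilon>.
        projective_resolution B ?BC P \<delta> \<epsilon> \<and> (\<forall>i>n. carrier (P i) = {\<zero>\<^bsub>P i\<^esub>})} = {}" using no by simp
    then show False using pd unfolding projective_dimension_def by (simp only: Inf_enat_def) simp
  qed
  then obtain nn and P :: "nat => ('c, nat => 'c) module" and \<delta> \<epsilon> where res: "projective_resolution B ?BC P \<delta> \<epsilon>"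
    and fin: "\<And>i. i > nn ==> carrier (P i) = {\<zero>\<^bsub>P i\<^esub>}" by (elim exE conjE) blast
  have fgp: "fg_projective B (P i)" and \<delta>: "\<delta> i \<in> module_hom B (P (Suc i)) (P i)" and \<epsilon>: "\<epsilon> \<in> module_hom B (P 0) ?BC"
    and \<epsilon>s: "\<epsilon> ` carrier (P 0) = carrier ?BC"
    and ex0: "\<delta> 0 ` carrier (P 1) = {x \<in> carrier (P 0). \<epsilon> x = \<zero>\<^bsub>?BC\<^esub>}"
    and exS: "\<delta> (Suc i) ` carrier (P (Suc (Suc i))) = {x \<in> carrier (P (Suc i)). \<delta> i x = \<zero>\<^bsub>P i\<^esub>}" for i
    using res unfolding projective_resolution_def by blast+
  have mP: "module B (P i)" for i using fgp by (simp add: fg_projective_def)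
  have "\<forall>i. \<exists>t. dual_basis \<pi>\<^sub>B (P i) (fst t) (fst (snd t)) (snd (snd t)) B.ker"
    using B.fg_projective_dual_basis[OF fgp] by (metis fst_conv snd_conv)
  from choice[OF this] obtain t where t: "\<And>i. dual_basis \<pi>\<^sub>B (P i) (fst (t i)) (fst (snd (t i))) (snd (snd (t i))) B.ker"
    by blast
  define p \<iota> k where "p i = fst (t i)" and "\<iota> i = fst (snd (t i))" and "k i = snd (snd (t i))" for i
  have db: "dual_basis \<pi>\<^sub>B (P i) (p i) (\<iota> i) (k i) B.ker" for i using t[of i] by (simp add: p_def \<iota>_def k_def)
  have p: "\<And>l. l < k i ==> p i l \<in> carrier (P i)" and lcp: "x \<in> carrier (P i) ==> lc \<pi>\<^sub>B (P i) (p i) (\<iota> i x) (k i) = x" for i x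
    using db[of i] by (simp_all add: dual_basis_def)
  have dlc: "\<iota> i (lc \<pi>\<^sub>B (P i) y v m) l - (\<Sum>j<m. \<iota> i (y j) l * v j) \<in> B.ker"
    if "l < k i" "\<And>j. j < m ==> y j \<in> carrier (P i)" for i y v m l
    using B.dual_basis_lc[OF mP db that] .
  have sym: "a - b \<in> B.ker" if "b - a \<in> B.ker" for a b using idl_minus[OF B.idl_ker that] by simp
  have \<iota>0: "\<iota> i \<zero>\<^bsub>P i\<^esub> l \<in> B.ker" if "l < k i" for i l using dlc[of l i 0] that by simp
  have \<delta>c: "\<delta> i x \<in> carrier (P i)" if "x \<in> carrier (P (Suc i))" for i x using \<delta>[of i] that by (auto simp: module_hom_def)
  have \<delta>lc: "\<delta> i (lc \<pi>\<^sub>B (P (Suc i)) y v m) = lc \<pi>\<^sub>B (P i) (\<lambda>j. \<delta> i (y j)) v m"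
    if "\<And>j. j < m ==> y j \<in> carrier (P (Suc i))" for i y v m
    by (rule B.hom_lc[OF mP mP \<delta> that])
  define E where "E n l m = \<iota> n (p n m) l" for n l m
  define D where "D n l m = \<iota> n (\<delta> n (p (Suc n) m)) l" for n l m
  have iE: "(\<Sum>j<k n. E n l j * \<iota> n x j) - \<iota> n x l \<in> B.ker" if "x \<in> carrier (P n)" "l < k n" for n x l
  proof -
    have "\<iota> n x l - (\<Sum>j<k n. E n l j * \<iota> n x j) \<in> B.ker"
      using dlc[of l n "k n" "p n" "\<iota> n x", OF that(2) p] lcp[OF that(1)] by (simp add: E_def)
    then show ?thesis by (rule sym)
  qed
  have iD: "(\<Sum>j<k (Suc n). D n l j * \<iota> (Suc n) x j) - \<iota> n (\<delta> n x) l \<in> B.ker"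
    if "x \<in> carrier (P (Suc n))" "l < k n" for n x l
  proof -
    have "\<iota> n (\<delta> n x) l - (\<Sum>j<k (Suc n). D n l j * \<iota> (Suc n) x j) \<in> B.ker"
      using dlc[of l n "k (Suc n)" "\<lambda>j. \<delta> n (p (Suc n) j)" "\<iota> (Suc n) x", OF that(2)] p \<delta>c
        \<delta>lc[of "k (Suc n)" "p (Suc n)" n "\<iota> (Suc n) x"] lcp[OF that(1)] by (simp add: D_def)
    then show ?thesis by (rule sym)
  qed
  have \<epsilon>add: "\<epsilon> (u \<oplus>\<^bsub>P 0\<^esub> v) = \<epsilon> u \<oplus>\<^bsub>?BC\<^esub> \<epsilon> v" and \<epsilon>scl: "\<epsilon> (\<pi>\<^sub>B w \<odot>\<^bsub>P 0\<^esub> u) = \<pi>\<^sub>B w \<odot>\<^bsub>?BC\<^esub> \<epsilon> u"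
    if "u \<in> carrier (P 0)" "v \<in> carrier (P 0)" for u v w
    using \<epsilon> that by (simp_all add: module_hom_def)
  have \<epsilon>c: "\<exists>z\<in>?KS. \<epsilon> u = cls z" if "u \<in> carrier (P 0)" for u
  proof -
    have "\<epsilon> u \<in> cls ` ?KS" unfolding carr[symmetric] \<epsilon>s[symmetric] using that by (rule imageI)
    then show ?thesis by (rule imageE) (rule bexI)
  qed
  interpret P0: module B "P 0" by (rule mP)
  have \<epsilon>0: "\<epsilon> \<zero>\<^bsub>P 0\<^esub> = cls 0"
  proof -
    obtain z where z: "\<epsilon> \<zero>\<^bsub>P 0\<^esub> = cls z" using \<epsilon>c[OF P0.zero_closed] by (elim bexE)
    then have "cls (z + z) = cls z" using \<epsilon>add[of "\<zero>\<^bsub>P 0\<^esub>" "\<zero>\<^bsub>P 0\<^esub>"] by (simp add: add)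
    then show ?thesis using z cls_eq[of "z + z" z] cls_0 by simp
  qed
  have KS: "z + w \<in> ?KS" "ext (\<pi>' v) z \<in> ?KS" if "z \<in> ?KS" "w \<in> ?KS" for z w v
  proof -
    show "z + w \<in> ?KS" using that keys_add[of z w] by auto
    show "ext (\<pi>' v) z \<in> ?KS"
      unfolding ext_def mem_Collect_eq by (rule order_trans[OF keys_frag_extend]) (use that in auto)
  qed
  \<comment> \<open>The augmentation followed by the map to the cokernel of \<open>b\<close>, on
    representatives; it is linear modulo \<open>?S\<close>, and its values on the generators
    \<open>p 0 l\<close> form the matrix \<open>g\<close>.\<close>
  define G where "G u = R (\<epsilon> u)" for u
  have Gadd: "G (u \<oplus>\<^bsub>P 0\<^esub> v) - G u - G v \<in> ?S" if uv: "u \<in> carrier (P 0)" "v \<in> carrier (P 0)" for u v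
  proof -
    obtain z where z: "z \<in> ?KS" "\<epsilon> u = cls z" using \<epsilon>c[OF uv(1)] by (elim bexE)
    obtain w where w: "w \<in> ?KS" "\<epsilon> v = cls w" using \<epsilon>c[OF uv(2)] by (elim bexE)
    have "(R (cls (z + w)) - h (z + w)) - (R (cls z) - h z) - (R (cls w) - h w) \<in> ?S"
      by (intro smod_diff[OF sm] R KS z w)
    then show ?thesis by (simp add: G_def \<epsilon>add[OF uv] z w add hadd algebra_simps)
  qed
  have Gscl: "G (\<pi>\<^sub>B w \<odot>\<^bsub>P 0\<^esub> u) - scl w (G u) \<in> ?S" if u: "u \<in> carrier (P 0)" for u w
  proof -
    obtain z where z: "z \<in> ?KS" "\<epsilon> u = cls z" using \<epsilon>c[OF u] by (elim bexE)
    have "(R (cls (ext (\<pi>' w) z)) - h (ext (\<pi>' w) z)) + (h (ext (\<pi>' w) z) - scl w (h z)) - scl w (R (cls z) - h z) \<in> ?S"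
      by (rule smod_diff[OF sm smod_add[OF sm R[OF KS(2)[OF z(1) z(1)]] h_ext[OF z(1)]] smod_scl[OF sm R[OF z(1)]]])
    then show ?thesis by (simp add: G_def \<epsilon>scl[OF u u] z scl scl_simps)
  qed
  have Glc: "G (lc \<pi>\<^sub>B (P 0) y v m) - (\<Sum>j<m. scl (v j) (G (y j))) \<in> ?S" if "\<And>j. j < m ==> y j \<in> carrier (P 0)" for y v m
    using that
  proof (induction m)
    case 0
    show ?case using smod_minus[OF sm Gadd[of "\<zero>\<^bsub>P 0\<^esub>" "\<zero>\<^bsub>P 0\<^esub>"]] by simp
  next
    case (Suc m)
    let ?l = "lc \<pi>\<^sub>B (P 0) y v m" and ?t = "\<pi>\<^sub>B (v m) \<odot>\<^bsub>P 0\<^esub> y m"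
    have "(G (?l \<oplus>\<^bsub>P 0\<^esub> ?t) - G ?l - G ?t) + (G ?t - scl (v m) (G (y m))) + (G ?l - (\<Sum>j<m. scl (v j) (G (y j)))) \<in> ?S"
      using Suc by (intro smod_add[OF sm] Gadd Gscl) (simp_all add: B.lc_closed[OF mP])
    then show ?case by (simp add: algebra_simps)
  qed
  \<comment> \<open>Preimages in \<open>P 0\<close> of the classes of \<open>y i\<close> tensored
    with one; their coordinates form the matrix \<open>z\<close>.\<close>
  have "\<forall>i. \<exists>u. i < \<beta> --> u \<in> carrier (P 0) \<and> \<epsilon> u = cls (frag_of (y i, \<pi>' 1))"
  proof (intro allI)
    fix i
    have "cls (frag_of (y i, \<pi>' 1)) \<in> \<epsilon> ` carrier (P 0)" if "i < \<beta>" unfolding \<epsilon>s carr using y[OF that] by (auto intro!: imageI)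
    then show "\<exists>u. i < \<beta> --> u \<in> carrier (P 0) \<and> \<epsilon> u = cls (frag_of (y i, \<pi>' 1))" by (metis imageE)
  qed
  from choice[OF this] obtain y' where y': "\<And>i. i < \<beta> ==> y' i \<in> carrier (P 0)"
    and \<epsilon>y': "\<And>i. i < \<beta> ==> \<epsilon> (y' i) = cls (frag_of (y i, \<pi>' 1))" by blast
  have \<epsilon>lc: "\<epsilon> (lc \<pi>\<^sub>B (P 0) y' v m) = cls (\<Sum>i<m. frag_of (y i, \<pi>' (v i)))" if "m \<le> \<beta>" for v m
    using that
  proof (induction m)
    case (Suc m)
    then have ym: "y' m \<in> carrier (P 0)" and "m < \<beta>" using y' by auto
    then have "\<epsilon> (lc \<pi>\<^sub>B (P 0) y' v m) \<oplus>\<^bsub>?BC\<^esub> \<epsilon> (\<pi>\<^sub>B (v m) \<odot>\<^bsub>P 0\<^esub> y' m) = cls (\<Sum>i<Suc m. frag_of (y i, \<pi>' (v i)))"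
      using Suc \<epsilon>y'[of m]
      by (simp add: \<epsilon>scl[OF ym ym] scl ext_def add A'.cov_mult[symmetric])
    then show ?case using Suc.prems y' by (simp add: \<epsilon>add B.lc_closed[OF mP])
  qed (simp add: \<epsilon>0)
  define z where "z i l = \<iota> 0 (y' i) l" for i l
  define g where "g l i = ix (G (p 0 l)) i" for l i
  have lift0: "\<exists>f. \<forall>l<k 0. \<iota> 0 u l - (\<Sum>m<k 1. D 0 l m * f m) \<in> B.ker" if "u \<in> carrier (P 0)" "\<epsilon> u = cls 0" for u
  proof -
    have "u \<in> \<delta> 0 ` carrier (P (Suc 0))" unfolding ex0[unfolded One_nat_def] zero using that by simp
    then obtain w where w: "u = \<delta> 0 w" "w \<in> carrier (P (Suc 0))" by (rule imageE)
    show ?thesis using sym[OF iD[OF w(2)]] w(1) by (intro exI[of _ "\<iota> (Suc 0) w"]) simp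
  qed
  have "pd_rel B.ker A'.ker x c \<beta> \<gamma> b nn k E D z g"
    unfolding pd_rel_def
  proof (intro conjI allI impI)
    show "(\<Sum>j<k n. E n l j * E n j m) - E n l m \<in> B.ker" if "l < k n" "m < k n" for n l m
      using iE[OF p[OF that(2)] that(1)] by (simp add: E_def)
    show "(\<Sum>j<k n. E n l j * D n j m) - D n l m \<in> B.ker" if "l < k n" "m < k (Suc n)" for n l m
      using iE[OF \<delta>c[OF p[OF that(2)]] that(1)] by (simp add: D_def)
    show "(\<Sum>j<k (Suc n). D n l j * E (Suc n) j m) - D n l m \<in> B.ker" if "l < k n" "m < k (Suc n)" for n l m
      using iD[OF p[OF that(2)] that(1)] by (simp add: D_def E_def)
    show "(\<Sum>j<k (Suc n). D n l j * D (Suc n) j m) \<in> B.ker" if "l < k n" "m < k (Suc (Suc n))" for n l m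
    proof -
      have c: "\<delta> (Suc n) (p (Suc (Suc n)) m) \<in> carrier (P (Suc n))" using \<delta>c p that(2) by blast
      have "\<delta> n (\<delta> (Suc n) (p (Suc (Suc n)) m)) = \<zero>\<^bsub>P n\<^esub>"
        using equalityD1[OF exS[of n]] imageI[OF p[OF that(2)], of "\<delta> (Suc n)"] by (simp add: subset_iff)
      then show ?thesis using idl_add[OF B.idl_ker iD[OF c that(1)] \<iota>0[OF that(1)]] by (simp add: D_def)
    qed
    show "E n l m \<in> B.ker" if "nn < n" "l < k n" "m < k n" for n l m
      using fin[OF that(1)] p[OF that(3)] \<iota>0[OF that(2)] by (simp add: E_def)
    show "\<exists>w. \<forall>j<k (Suc n). (\<Sum>m<k (Suc n). E (Suc n) j m * v m) - (\<Sum>m<k (Suc (Suc n)). D (Suc n) j m * w m) \<in> B.ker"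
      if v: "\<forall>l<k n. (\<Sum>j<k (Suc n). D n l j * v j) \<in> B.ker" for n v
    proof -
      define u where "u = lc \<pi>\<^sub>B (P (Suc n)) (p (Suc n)) v (k (Suc n))"
      have u: "u \<in> carrier (P (Suc n))" unfolding u_def using p by (rule B.lc_closed[OF mP])
      have "\<iota> n (\<delta> n u) l \<in> B.ker" if l: "l < k n" for l
      proof -
        have "\<iota> n (\<delta> n u) l - (\<Sum>j<k (Suc n). D n l j * v j) \<in> B.ker"
          unfolding u_def using \<delta>lc[of "k (Suc n)" "p (Suc n)" n v, OF p] dlc[of l n "k (Suc n)" "\<lambda>j. \<delta> n (p (Suc n) j)" v, OF l] \<delta>c p
          by (simp add: D_def)
        then show ?thesis using v l idl_add[OF B.idl_ker] by fastforce
      qed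
      then have "\<delta> n u = \<zero>\<^bsub>P n\<^esub>"
        using lcp[OF \<delta>c[OF u]] B.lc_ker[OF mP p, where v = "\<iota> n (\<delta> n u)"] by simp
      then have "u \<in> \<delta> (Suc n) ` carrier (P (Suc (Suc n)))" unfolding exS using u by simp
      then obtain w where w: "u = \<delta> (Suc n) w" "w \<in> carrier (P (Suc (Suc n)))" by (rule imageE)
      have "(\<Sum>m<k (Suc n). E (Suc n) j m * v m) - (\<Sum>m<k (Suc (Suc n)). D (Suc n) j m * \<iota> (Suc (Suc n)) w m) \<in> B.ker"
        if j: "j < k (Suc n)" for j
      proof -
        have 1: "\<iota> (Suc n) u j - (\<Sum>m<k (Suc n). E (Suc n) j m * v m) \<in> B.ker"
          unfolding u_def using dlc[of j "Suc n" "k (Suc n)" "p (Suc n)" v, OF j p] by (simp add: E_def)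
        have 2: "(\<Sum>m<k (Suc (Suc n)). D (Suc n) j m * \<iota> (Suc (Suc n)) w m) - \<iota> (Suc n) u j \<in> B.ker"
          using iD[OF w(2) j] w(1) by simp
        show ?thesis using idl_add[OF B.idl_ker sym[OF 1] sym[OF 2]] by simp
      qed
      then show ?thesis by blast
    qed
    show "(\<Sum>m<k 0. E 0 l m * z i m) - z i l \<in> B.ker" if "i < \<beta>" "l < k 0" for i l
      using iE[OF y'[OF that(1)] that(2)] by (simp add: z_def)
    show "\<exists>f. \<forall>l<k 0. (\<Sum>i<\<beta>. b i j * z i l) - (\<Sum>m<k 1. D 0 l m * f m) \<in> B.ker" if j: "j < \<gamma>" for j
    proof -
      let ?u = "lc \<pi>\<^sub>B (P 0) y' (\<lambda>i. b i j) \<beta>"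
      have tl: "frag_of (lc \<pi> N y (\<lambda>i. \<alpha> i j) \<beta>, \<pi>' 1)
          - (\<Sum>i<\<beta>. frag_of (y i, \<phi> (\<pi> (\<alpha> i j)) \<otimes>\<^bsub>A'\<^esub> \<pi>' 1)) \<in> ?T"
        by (rule tensor_lc_left[OF N y]) simp_all
      have "(\<Sum>i<\<beta>. frag_of (y i, \<pi>' (b i j))) = (\<Sum>i<\<beta>. frag_of (y i, \<phi> (\<pi> (\<alpha> i j)) \<otimes>\<^bsub>A'\<^esub> \<pi>' 1))"
        using b j by (intro sum.cong refl) (simp add: A'.cov_one phi_simps)
      also have "\<dots> \<in> ?T"
        using tensor_relations_diff[OF N module_AM tensor_zero_left[OF N module_AM, of "\<pi>' 1"] tl] y\<alpha>[OF j] by simp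
      finally have "\<epsilon> ?u = cls 0" unfolding \<epsilon>lc[OF order_refl] by (rule cls_0)
      moreover have "?u \<in> carrier (P 0)" using y' by (rule B.lc_closed[OF mP])
      ultimately obtain f where f: "\<And>l. l < k 0 ==> \<iota> 0 ?u l - (\<Sum>m<k 1. D 0 l m * f m) \<in> B.ker" using lift0 by blast
      have "(\<Sum>i<\<beta>. b i j * z i l) - (\<Sum>m<k 1. D 0 l m * f m) \<in> B.ker" if l: "l < k 0" for l
        using idl_add[OF B.idl_ker sym[OF dlc[of l 0 \<beta> y' "\<lambda>i. b i j", OF l y']] f[OF l]] by (simp add: z_def mult.commute)
      then show ?thesis by blast
    qed
    show "\<exists>f. \<forall>l<k 0. x j * z i l - (\<Sum>m<k 1. D 0 l m * f m) \<in> B.ker" if j: "j < c" and i: "i < \<beta>" for j i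
    proof -
      \<comment> \<open>\<open>x j\<close> is zero in \<open>A'\<close> and so acts as zero on the
        base change; its multiple of \<open>y' i\<close> is therefore a boundary.\<close>
      let ?u = "\<pi>\<^sub>B (x j) \<odot>\<^bsub>P 0\<^esub> y' i"
      have "\<epsilon> ?u = cls (frag_of (y i, \<zero>\<^bsub>A'\<^esub>))"
        using x[OF j] by (simp add: \<epsilon>scl[OF y'[OF i] y'[OF i]] \<epsilon>y'[OF i] scl ext_def A'.ker_def)
      then have "\<epsilon> ?u = cls 0" using cls_0 tensor_zero_right[OF N module_AM y[OF i]] by simp
      moreover have "?u \<in> carrier (P 0)" using y'[OF i] by simp
      ultimately obtain f where f: "\<And>l. l < k 0 ==> \<iota> 0 ?u l - (\<Sum>m<k 1. D 0 l m * f m) \<in> B.ker" using lift0 by blast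
      have "x j * z i l - (\<Sum>m<k 1. D 0 l m * f m) \<in> B.ker" if l: "l < k 0" for l
      proof -
        have "\<iota> 0 ?u l - x j * z i l \<in> B.ker" using db[of 0] l y'[OF i] by (simp add: dual_basis_def z_def)
        from idl_add[OF B.idl_ker sym[OF this] f[OF l]] show ?thesis by simp
      qed
      then show ?thesis by blast
    qed
    show "\<exists>f. \<forall>i<\<beta>. (\<Sum>l<k 0. g l i * D 0 l m) - (\<Sum>j<\<gamma>. b i j * f j) \<in> A'.ker" if m: "m < k 1" for m
    proof -
      have pm: "p (Suc 0) m \<in> carrier (P (Suc 0))" using p m by simp
      have "\<epsilon> (\<delta> 0 (p (Suc 0) m)) = cls 0"
        using equalityD1[OF ex0] imageI[OF pm, of "\<delta> 0"] zero by (simp add: subset_iff)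
      then have "G (\<delta> 0 (p (Suc 0) m)) \<in> ?S" using R[of 0] by (simp add: G_def h0)
      moreover have "G (\<delta> 0 (p (Suc 0) m)) - (\<Sum>l<k 0. scl (D 0 l m) (G (p 0 l))) \<in> ?S"
        using Glc[of "k 0" "p 0" "\<iota> 0 (\<delta> 0 (p (Suc 0) m))", OF p] lcp[OF \<delta>c[OF pm]] by (simp add: D_def)
      ultimately have "(\<Sum>l<k 0. scl (D 0 l m) (G (p 0 l))) \<in> ?S" by (rule smod_diff_cancel'[OF sm, rotated])
      then show ?thesis by (simp add: imm_def ix_sum g_def mult.commute)
    qed
    show "\<exists>f. \<forall>i<\<beta>. (if i = i' then 1 else 0) - (\<Sum>l<k 0. z i' l * g l i) - (\<Sum>j<\<gamma>. b i j * f j) \<in> A'.ker" if i': "i' < \<beta>" for i'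
    proof -
      have fo: "frag_of (y i', \<pi>' 1) \<in> ?KS" using y[OF i'] by simp
      have 1: "G (y' i') - h (frag_of (y i', \<pi>' 1)) \<in> ?S" unfolding G_def \<epsilon>y'[OF i'] by (rule R[OF fo])
      have 2: "h (frag_of (y i', \<pi>' 1)) - Vec (\<lambda>i. 1 * (if i = i' then 1 else 0)) \<in> ?S"
        by (rule hp[OF y[OF i'] repy[OF i']]) (simp add: phi_simps)
      have 3: "G (y' i') - (\<Sum>l<k 0. scl (z i' l) (G (p 0 l))) \<in> ?S"
        using Glc[of "k 0" "p 0" "\<iota> 0 (y' i')", OF p] lcp[OF y'[OF i']] by (simp add: z_def)
      have "Vec (\<lambda>i. if i = i' then 1 else 0) - (\<Sum>l<k 0. scl (z i' l) (G (p 0 l))) \<in> ?S"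
        using smod_diff[OF sm 3 smod_add[OF sm 1 2]] by simp
      then show ?thesis by (simp add: imm_def ix_sum g_def)
    qed
  qed
  then show ?thesis unfolding pd_data_def by blast
qed

end

section \<open>Presentations\<close>

lemma dual_module_sel [simp]:
  "carrier (dual_module R M) = module_hom R M (self_module R) \<inter> extensional (carrier M)"
  "\<zero>\<^bsub>dual_module R M\<^esub> = (\<lambda>x\<in>carrier M. \<zero>\<^bsub>R\<^esub>)"
  "f \<oplus>\<^bsub>dual_module R M\<^esub> g = (\<lambda>x\<in>carrier M. f x \<oplus>\<^bsub>R\<^esub> g x)"
  "a \<odot>\<^bsub>dual_module R M\<^esub> f = (\<lambda>x\<in>carrier M. a \<otimes>\<^bsub>R\<^esub> f x)"
  by (simp_all add: dual_module_def hom_module_def self_module_def)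

lemma functional_iff:
  "f \<in> module_hom R M (self_module R) \<longleftrightarrow> (\<forall>x\<in>carrier M. f x \<in> carrier R) \<and>
     (\<forall>x\<in>carrier M. \<forall>y\<in>carrier M. f (x \<oplus>\<^bsub>M\<^esub> y) = f x \<oplus>\<^bsub>R\<^esub> f y) \<and>
     (\<forall>a\<in>carrier R. \<forall>x\<in>carrier M. f (a \<odot>\<^bsub>M\<^esub> x) = a \<otimes>\<^bsub>R\<^esub> f x)"
  by (auto simp: module_hom_def self_module_def)

lemma module_dual:
  assumes "module R M"
  shows "module R (dual_module R M)"
proof -
  interpret module R M by fact
  show ?thesis
  proof (rule moduleI'[OF is_cring])
    show "f \<oplus>\<^bsub>dual_module R M\<^esub> g \<in> carrier (dual_module R M)"
      if "f \<in> carrier (dual_module R M)" "g \<in> carrier (dual_module R M)" for f g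
      using that by (auto simp: functional_iff R.a_ac r_distr)
    show "a \<odot>\<^bsub>dual_module R M\<^esub> f \<in> carrier (dual_module R M)"
      if "a \<in> carrier R" "f \<in> carrier (dual_module R M)" for f a
      using that by (auto simp: functional_iff r_distr m_lcomm)
    show "\<zero>\<^bsub>dual_module R M\<^esub> \<in> carrier (dual_module R M)" by (simp add: functional_iff)
  qed (auto simp: functional_iff fun_eq_iff restrict_def extensional_def R.a_ac l_distr r_distr m_assoc l_minus R.r_neg)
qed

lemma module_submodule:
  assumes "module R M" "Y \<subseteq> carrier M" "\<zero>\<^bsub>M\<^esub> \<in> Y" "\<And>x y. x \<in> Y ==> y \<in> Y ==> x \<oplus>\<^bsub>M\<^esub> y \<in> Y"
    "\<And>a x. a \<in> carrier R ==> x \<in> Y ==> a \<odot>\<^bsub>M\<^esub> x \<in> Y"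
  shows "module R (M\<lparr>carrier := Y\<rparr>)"
proof -
  interpret module R M by fact
  have sub: "x \<in> carrier M" if "x \<in> Y" for x using assms(2) that by blast
  have neg: "x \<oplus>\<^bsub>M\<^esub> (\<ominus>\<^bsub>R\<^esub> \<one>\<^bsub>R\<^esub>) \<odot>\<^bsub>M\<^esub> x = \<zero>\<^bsub>M\<^esub>" if "x \<in> Y" for x
    using smult_l_minus[of "\<one>\<^bsub>R\<^esub>" x] sub[OF that] by (simp add: M.r_neg)
  show ?thesis
    by (rule moduleI'[OF is_cring])
      (simp_all add: assms sub a_ac smult_l_distr smult_r_distr smult_assoc1 neg M.a_ac)
qed

lemma lc_carrier_update [simp]: "lc \<pi> (M\<lparr>carrier := Y\<rparr>) y v n = lc \<pi> M y v n"
  by (induction n) simp_all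

lemma (in ring_cover) lc_zero_vec:
  "module B M ==> lc \<pi> M (\<lambda>i. \<zero>\<^bsub>M\<^esub>) v n = \<zero>\<^bsub>M\<^esub>"
proof (induction n)
  case (Suc n)
  interpret module B M by fact
  show ?case using Suc by simp
qed simp

lemma lc_direct_sum: "lc \<pi> (direct_sum M N) y v n = (lc \<pi> M (\<lambda>i. fst (y i)) v n, lc \<pi> N (\<lambda>i. snd (y i)) v n)"
  by (induction n) simp_all

text \<open>What is presented is a retract of \<open>N\<close>: \<open>rep\<close> encodes a
  homomorphism from \<open>N\<close> to the cokernel of \<open>\<alpha>\<close>, and
  \<open>y\<close> a homomorphism back whose composite with \<open>rep\<close> is the
  identity.\<close>

definition presentation :: "('r::comm_ring_1 => 'a) => ('a, 'b, 'm) module_scheme => 'r set => nat => nat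
    => (nat => nat => 'r) => ('b => (nat => 'r) => bool) => (nat => 'b) => bool" where
  "presentation \<pi> N K \<beta> \<gamma> \<alpha> rep y \<longleftrightarrow>
     (\<forall>x\<in>carrier N. \<exists>u. rep x u) \<and>
     (\<forall>x\<in>carrier N. \<forall>x'\<in>carrier N. \<forall>u u'. rep x u --> rep x' u' --> rep (x \<oplus>\<^bsub>N\<^esub> x') (\<lambda>i. u i + u' i)) \<and>
     (\<forall>p. \<forall>x\<in>carrier N. \<forall>u. rep x u --> rep (\<pi> p \<odot>\<^bsub>N\<^esub> x) (\<lambda>i. p * u i)) \<and>
     (\<forall>x\<in>carrier N. \<forall>u u'. rep x u --> rep x u' --> (\<exists>w. \<forall>i<\<beta>. u i - u' i - (\<Sum>j<\<gamma>. \<alpha> i j * w j) \<in> K)) \<and>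
     (\<forall>i<\<beta>. y i \<in> carrier N) \<and> (\<forall>i'<\<beta>. rep (y i') (\<lambda>i. if i = i' then 1 else 0)) \<and>
     (\<forall>j<\<gamma>. lc \<pi> N y (\<lambda>i. \<alpha> i j) \<beta> = \<zero>\<^bsub>N\<^esub>)"

context ring_cover
begin

context
  fixes C :: "int => ('c, 'e) module" and d \<beta> y a
  assumes m: "\<And>n. module B (C n)" and dh: "\<And>n. d n \<in> module_hom B (C n) (C (n - 1))"
    and b: "\<And>n. basis \<pi> (C n) (y n) (\<beta> n) ker"
    and dl: "\<And>n v. d n (lc \<pi> (C n) (y n) v (\<beta> n))
        = lc \<pi> (C (n - 1)) (y (n - 1)) (\<lambda>i. \<Sum>j<\<beta> n. a n i j * v j) (\<beta> (n - 1))"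
    and dd: "\<And>n i k. i < \<beta> (n - 1) ==> k < \<beta> (n + 1) ==> (\<Sum>j<\<beta> n. a n i j * a (n + 1) j k) \<in> ker"
    and col: "\<And>n. exact_columns ker (\<beta> (n - 1)) (\<beta> n) (\<beta> (n + 1)) (a n) (a (n + 1))"
    and row: "\<And>n. exact_columns ker (\<beta> (n + 1)) (\<beta> n) (\<beta> (n - 1)) (\<lambda>i j. a (n + 1) j i) (\<lambda>i j. a n j i)"
begin

abbreviation (input) "MC \<equiv> complex_image C d"

lemma basis_closed: "i < \<beta> n ==> y n i \<in> carrier (C n)"
  using b by (simp add: basis_def)

lemma span0: "x \<in> carrier (C n) ==> \<exists>u. x = lc \<pi> (C n) (y n) u (\<beta> n)"
  using b by (simp add: basis_def)

lemma lcc: "lc \<pi> (C n) (y n) u (\<beta> n) \<in> carrier (C n)"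
  by (rule lc_closed[OF m basis_closed])

lemma lc_basis:
  "lc \<pi> (C n) (y n) (\<lambda>i. u i + v i) (\<beta> n) = lc \<pi> (C n) (y n) u (\<beta> n) \<oplus>\<^bsub>C n\<^esub> lc \<pi> (C n) (y n) v (\<beta> n)"
  "lc \<pi> (C n) (y n) (\<lambda>i. p * v i) (\<beta> n) = \<pi> p \<odot>\<^bsub>C n\<^esub> lc \<pi> (C n) (y n) v (\<beta> n)"
  "j < \<beta> n ==> lc \<pi> (C n) (y n) (\<lambda>i. if i = j then 1 else 0) (\<beta> n) = y n j"
  by (rule lc_add[OF m basis_closed], simp) (rule lc_scl[OF m basis_closed], simp, rule lc_unit[OF m basis_closed])

lemma d0:
  "x \<in> carrier (C 0) ==> d 0 x \<in> carrier (C (- 1))"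
  "x \<in> carrier (C 0) ==> x' \<in> carrier (C 0) ==> d 0 (x \<oplus>\<^bsub>C 0\<^esub> x') = d 0 x \<oplus>\<^bsub>C (- 1)\<^esub> d 0 x'"
  "p \<in> carrier B ==> x \<in> carrier (C 0) ==> d 0 (p \<odot>\<^bsub>C 0\<^esub> x) = p \<odot>\<^bsub>C (- 1)\<^esub> d 0 x"
  using dh[of 0] by (auto simp: module_hom_def)

lemma module_MC: "module B MC"
  unfolding complex_image_def
proof (rule module_submodule[OF m])
  interpret C0: module B "C 0" by (rule m)
  show "d 0 ` carrier (C 0) \<subseteq> carrier (C (- 1))" using d0(1) by blast
  have "d 0 \<zero>\<^bsub>C 0\<^esub> = \<zero>\<^bsub>C (- 1)\<^esub>" using module_hom_zero[OF m m dh[of 0]] by simp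
  then show "\<zero>\<^bsub>C (- 1)\<^esub> \<in> d 0 ` carrier (C 0)" using C0.zero_closed by (metis imageI)
  show "x \<oplus>\<^bsub>C (- 1)\<^esub> x' \<in> d 0 ` carrier (C 0)" if "x \<in> d 0 ` carrier (C 0)" "x' \<in> d 0 ` carrier (C 0)" for x x'
    using that d0(2)[symmetric] by auto
  show "p \<odot>\<^bsub>C (- 1)\<^esub> x \<in> d 0 ` carrier (C 0)" if "p \<in> carrier B" "x \<in> d 0 ` carrier (C 0)" for p x
    using that d0(3)[symmetric] by auto
qed

lemma MC_sel: "carrier MC = d 0 ` carrier (C 0)" "\<zero>\<^bsub>MC\<^esub> = \<zero>\<^bsub>C (- 1)\<^esub>" "x \<oplus>\<^bsub>MC\<^esub> x' = x \<oplus>\<^bsub>C (- 1)\<^esub> x'"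
  "p \<odot>\<^bsub>MC\<^esub> x = p \<odot>\<^bsub>C (- 1)\<^esub> x" "lc \<pi> MC z v n = lc \<pi> (C (- 1)) z v n"
  by (simp_all add: complex_image_def)

lemma d0_lc: "d 0 (lc \<pi> (C 0) (y 0) v (\<beta> 0))
    = lc \<pi> (C (- 1)) (y (- 1)) (\<lambda>i. \<Sum>j<\<beta> 0. a 0 i j * v j) (\<beta> (- 1))"
  using dl[of 0 v] by simp

lemma d0_basis: "j < \<beta> 0 ==> d 0 (y 0 j) = lc \<pi> (C (- 1)) (y (- 1)) (\<lambda>i. a 0 i j) (\<beta> (- 1))"
  using d0_lc[of "\<lambda>i. if i = j then 1 else 0"] lc_basis(3)[of j 0]
  by (simp add: if_distrib[of "\<lambda>x. _ * x"] cong: if_cong)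

lemma d0_relation:
  assumes "j < \<beta> 1"
  shows "lc \<pi> (C (- 1)) (\<lambda>i. d 0 (y 0 i)) (\<lambda>i. a 1 i j) (\<beta> 0) = \<zero>\<^bsub>C (- 1)\<^esub>"
proof -
  have "lc \<pi> (C (- 1)) (\<lambda>i. d 0 (y 0 i)) (\<lambda>i. a 1 i j) (\<beta> 0) = d 0 (lc \<pi> (C 0) (y 0) (\<lambda>i. a 1 i j) (\<beta> 0))"
    using hom_lc[OF m m dh[of 0] basis_closed, where n = "\<beta> 0" and v = "\<lambda>i. a 1 i j"] by simp
  also have "\<dots> = \<zero>\<^bsub>C (- 1)\<^esub>"
    unfolding d0_lc using dd[of _ 0 j] assms basis_closed by (intro lc_ker[OF m]) simp_all
  finally show ?thesis .
qed

lemma presentation_image: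
  "\<exists>rep z. presentation \<pi> (direct_sum MC (dual_module B MC)) ker (\<beta> 0) (\<beta> 1) (a 1) rep z"
proof -
  let ?N = "direct_sum MC (dual_module B MC)"
  \<comment> \<open>Only the first component is read. By exactness at \<open>C 0\<close> the image
    of \<open>d 0\<close> is the cokernel of \<open>a 1\<close>.\<close>
  define rep where "rep n u \<longleftrightarrow> fst n = d 0 (lc \<pi> (C 0) (y 0) u (\<beta> 0))" for n :: "'e \<times> ('e => 'c)" and u
  define z where "z i = (d 0 (y 0 i), \<zero>\<^bsub>dual_module B MC\<^esub>)" for i
  interpret D: module B "dual_module B MC" by (rule module_dual[OF module_MC])
  have "presentation \<pi> ?N ker (\<beta> 0) (\<beta> 1) (a 1) rep z"
    unfolding presentation_def
  proof (intro conjI ballI allI impI)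
    show "\<exists>u. rep n u" if "n \<in> carrier ?N" for n
      using that span0[of _ 0] by (fastforce simp: rep_def MC_sel)
    show "rep (n \<oplus>\<^bsub>?N\<^esub> n') (\<lambda>i. u i + u' i)" if "rep n u" "rep n' u'" for n n' u u'
      using that lc_basis(1)[of 0] d0(2) lcc by (simp add: rep_def MC_sel)
    show "rep (\<pi> p \<odot>\<^bsub>?N\<^esub> n) (\<lambda>i. p * u i)" if "rep n u" for p n u
      using that lc_basis(2)[of 0] d0(3) lcc by (simp add: rep_def MC_sel)
    show "\<exists>w. \<forall>i<\<beta> 0. u i - u' i - (\<Sum>j<\<beta> 1. a 1 i j * w j) \<in> ker" if "rep n u" "rep n u'" for n u u'
    proof -
      have eq: "lc \<pi> (C (- 1)) (y (- 1)) (\<lambda>i. \<Sum>j<\<beta> 0. a 0 i j * u j) (\<beta> (- 1))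
          = lc \<pi> (C (- 1)) (y (- 1)) (\<lambda>i. \<Sum>j<\<beta> 0. a 0 i j * u' j) (\<beta> (- 1))"
        using that unfolding rep_def d0_lc by simp
      have "\<forall>i<\<beta> (0 - 1). (\<Sum>j<\<beta> 0. a 0 i j * (u j - u' j)) \<in> ker"
        unfolding right_diff_distrib sum_subtractf ker_diff using basis_unique[OF m b eq] by simp
      from mp[OF spec[OF col[of 0, unfolded exact_columns_def], of "\<lambda>j. u j - u' j"] this]
      show ?thesis by simp
    qed
    show "z i \<in> carrier ?N" if "i < \<beta> 0" for i
      unfolding z_def using basis_closed[OF that] D.zero_closed by (simp add: MC_sel del: dual_module_sel)
    show "rep (z i') (\<lambda>i. if i = i' then 1 else 0)" if "i' < \<beta> 0" for i'
      using lc_basis(3)[OF that] by (simp add: rep_def z_def)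
    show "lc \<pi> ?N z (\<lambda>i. a 1 i j) (\<beta> 0) = \<zero>\<^bsub>?N\<^esub>" if "j < \<beta> 1" for j
      using d0_relation[OF that] lc_zero_vec[OF module_dual[OF module_MC]]
      by (simp add: z_def lc_direct_sum MC_sel del: dual_module_sel)
  qed
  then show ?thesis by blast
qed

lemma lc_dual_apply:
  assumes "x \<in> carrier M" "\<And>i. i < n ==> \<eta> i x = \<pi> (w i)"
  shows "lc \<pi> (dual_module B M) \<eta> v n x = \<pi> (\<Sum>i<n. v i * w i)"
  using assms by (induction n) (simp_all add: cov_zero cov_add cov_mult)

text \<open>A functional on the image, composed with \<open>d 0\<close>, vanishes on boundaries in
  \<open>C 0\<close> and by exactness of the dual comes from a functional on \<open>C (- 1)\<close>,
  unique up to the rows of \<open>a (- 1)\<close>. So the dual is the cokernel of the transpose of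
  \<open>a (- 1)\<close>.\<close>

lemma presentation_dual:
  "\<exists>rep z. presentation \<pi> (direct_sum MC (dual_module B MC)) ker (\<beta> (- 1)) (\<beta> (- 2)) (\<lambda>i j. a (- 1) j i) rep z"
proof -
  let ?D = "dual_module B MC"
  let ?N = "direct_sum MC ?D"
  define rep where "rep n r \<longleftrightarrow> (\<forall>j<\<beta> 0. snd n (d 0 (y 0 j)) = \<pi> (\<Sum>k<\<beta> (- 1). r k * a 0 k j))"
    for n :: "'e \<times> ('e => 'c)" and r :: "nat => 'r"
  interpret D: module B ?D by (rule module_dual[OF module_MC])
  interpret MC: module B MC by (rule module_MC)
  have ym: "d 0 (y 0 j) \<in> carrier MC" if "j < \<beta> 0" for j using basis_closed[OF that] by (simp add: MC_sel)
  have "\<forall>i. \<exists>F\<in>carrier (dual_module B (C (- 1))). \<forall>v. F (lc \<pi> (C (- 1)) (y (- 1)) v (\<beta> (- 1)))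
      = \<pi> (\<Sum>k<\<beta> (- 1). (if k = i then 1 else 0) * v k)"
    \<comment> \<open>The coordinate functionals of \<open>C (- 1)\<close>; their restrictions to
      the image of \<open>d 0\<close> are the generators \<open>\<eta> i\<close>.\<close>
    by (rule allI, rule functional_exists[OF m b])
  then obtain F where F: "\<And>i. F i \<in> carrier (dual_module B (C (- 1)))"
    and Flc: "\<And>i v. F i (lc \<pi> (C (- 1)) (y (- 1)) v (\<beta> (- 1))) = \<pi> (\<Sum>k<\<beta> (- 1). (if k = i then 1 else 0) * v k)"
    by metis
  have sub: "x \<in> carrier (C (- 1))" if "x \<in> carrier MC" for x using that d0(1) by (auto simp: MC_sel(1))
  define \<eta> where "\<eta> i = restrict (F i) (carrier MC)" for i
  have \<eta>: "\<eta> i \<in> carrier ?D" for i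
    using F[of i] MC.a_closed MC.smult_closed sub unfolding \<eta>_def by (auto simp: functional_iff MC_sel(3,4))
  define z where "z i = (\<zero>\<^bsub>MC\<^esub>, \<eta> i)" for i
  have "presentation \<pi> ?N ker (\<beta> (- 1)) (\<beta> (- 2)) (\<lambda>i j. a (- 1) j i) rep z"
    unfolding presentation_def
  proof (intro conjI ballI allI impI)
    show "\<exists>r. rep n r" if n: "n \<in> carrier ?N" for n
    proof -
      have f: "snd n \<in> module_hom B MC (self_module B)" using n by auto
      define v where "v j = lift (snd n (d 0 (y 0 j)))" for j
      have v: "\<pi> (v j) = snd n (d 0 (y 0 j))" if "j < \<beta> 0" for j
        unfolding v_def using f ym[OF that] by (intro cov_lift) (simp add: functional_iff)
      have "(\<Sum>j<\<beta> 0. a (0 + 1) j i * v j) \<in> ker" if i: "i < \<beta> (0 + 1)" for i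
      proof -
        have "\<pi> (\<Sum>j<\<beta> 0. v j * a 1 j i) = snd n (lc \<pi> MC (\<lambda>j. d 0 (y 0 j)) (\<lambda>j. a 1 j i) (\<beta> 0))"
          by (rule functional_lc[OF module_MC f ym v, symmetric])
        also have "\<dots> = \<zero>" using hom_image_zero[OF module_MC f] d0_relation i by (simp add: MC_sel)
        finally show ?thesis by (simp add: ker_def mult.commute)
      qed
      then obtain w where "\<And>j. j < \<beta> 0 ==> v j - (\<Sum>k<\<beta> (- 1). a 0 k j * w k) \<in> ker"
        using spec[OF row[of 0, unfolded exact_columns_def], of v] by auto
      then have "rep n w" unfolding rep_def by (simp add: ker_diff v mult.commute)
      then show ?thesis by (rule exI[of "rep n"])
    qed
    show "rep (n \<oplus>\<^bsub>?N\<^esub> n') (\<lambda>i. u i + u' i)" if "rep n u" "rep n' u'" for n n' u u'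
      using that ym by (simp add: rep_def distrib_right sum.distrib cov_add)
    show "rep (\<pi> p \<odot>\<^bsub>?N\<^esub> n) (\<lambda>i. p * u i)" if "rep n u" for p n u
      using that ym by (simp add: rep_def mult.assoc sum_distrib_left[symmetric] cov_mult)
    show "\<exists>w. \<forall>i<\<beta> (- 1). u i - u' i - (\<Sum>j<\<beta> (- 2). a (- 1) j i * w j) \<in> ker" if "rep n u" "rep n u'" for n u u'
    proof -
      have "\<pi> (\<Sum>k<\<beta> (- 1). u k * a 0 k j) = \<pi> (\<Sum>k<\<beta> (- 1). u' k * a 0 k j)" if "j < \<beta> 0" for j
        using \<open>rep n u\<close> \<open>rep n u'\<close> that unfolding rep_def by metis
      then have "\<forall>j<\<beta> (- 1 + 1). (\<Sum>k<\<beta> (- 1). a (- 1 + 1) k j * (u k - u' k)) \<in> ker"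
        unfolding right_diff_distrib sum_subtractf ker_diff by (simp add: mult.commute)
      from mp[OF spec[OF row[of "- 1", unfolded exact_columns_def], of "\<lambda>j. u j - u' j"] this]
      show ?thesis by simp
    qed
    show "z i \<in> carrier ?N" if "i < \<beta> (- 1)" for i
      unfolding z_def using MC.zero_closed \<eta> by (simp del: dual_module_sel)
    show "rep (z i') (\<lambda>i. if i = i' then 1 else 0)" if "i' < \<beta> (- 1)" for i'
      unfolding rep_def
    proof (intro allI impI)
      fix j assume j: "j < \<beta> 0"
      show "snd (z i') (d 0 (y 0 j)) = \<pi> (\<Sum>k<\<beta> (- 1). (if k = i' then 1 else 0) * a 0 k j)"
        using ym[OF j] by (simp only: z_def \<eta>_def snd_conv restrict_apply if_True d0_basis[OF j] Flc)
    qed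
    show "lc \<pi> ?N z (\<lambda>i. a (- 1) j i) (\<beta> (- 1)) = \<zero>\<^bsub>?N\<^esub>" if j: "j < \<beta> (- 2)" for j
    proof -
      have cl: "lc \<pi> ?D \<eta> (\<lambda>i. a (- 1) j i) (\<beta> (- 1)) \<in> carrier ?D" using \<eta> by (rule lc_closed[OF module_dual[OF module_MC]])
      have "lc \<pi> ?D \<eta> (\<lambda>i. a (- 1) j i) (\<beta> (- 1)) x = \<zero>" if x: "x \<in> carrier MC" for x
      proof -
        obtain x0 where x0: "x = d 0 x0" "x0 \<in> carrier (C 0)" using x unfolding MC_sel(1) by (rule imageE)
        obtain u where u0: "x0 = lc \<pi> (C 0) (y 0) u (\<beta> 0)" using span0[OF x0(2)] by (elim exE)
        have u: "x = lc \<pi> (C (- 1)) (y (- 1)) (\<lambda>i. \<Sum>k<\<beta> 0. a 0 i k * u k) (\<beta> (- 1))"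
          unfolding x0(1) u0 by (rule d0_lc)
        have "\<eta> i x = \<pi> (\<Sum>k<\<beta> 0. a 0 i k * u k)" if "i < \<beta> (- 1)" for i
          using x Flc[of i "\<lambda>i. \<Sum>k<\<beta> 0. a 0 i k * u k"] that unfolding u[symmetric]
          by (simp add: \<eta>_def if_distrib[of "\<lambda>x. x * _"] cong: if_cong)
        then have "lc \<pi> ?D \<eta> (\<lambda>i. a (- 1) j i) (\<beta> (- 1)) x = \<pi> (\<Sum>i<\<beta> (- 1). a (- 1) j i * (\<Sum>k<\<beta> 0. a 0 i k * u k))"
          by (rule lc_dual_apply[OF x])
        also have "(\<Sum>i<\<beta> (- 1). a (- 1) j i * (\<Sum>k<\<beta> 0. a 0 i k * u k))
            = (\<Sum>k<\<beta> 0. u k * (\<Sum>i<\<beta> (- 1). a (- 1) j i * a 0 i k))"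
          by (simp add: sum_distrib_left mult_ac sum.swap[of _ "{..<\<beta> (- 1)}"])
        finally have eq: "lc \<pi> ?D \<eta> (\<lambda>i. a (- 1) j i) (\<beta> (- 1)) x = \<pi> (\<Sum>k<\<beta> 0. u k * (\<Sum>i<\<beta> (- 1). a (- 1) j i * a 0 i k))" .
        have "(\<Sum>k<\<beta> 0. u k * (\<Sum>i<\<beta> (- 1). a (- 1) j i * a 0 i k)) \<in> ker"
          by (rule idl_sum[OF idl_ker], rule idl_mult[OF idl_ker]) (use dd[of j "- 1"] j in simp)
        then show ?thesis by (simp add: eq ker_def)
      qed
      then have "lc \<pi> ?D \<eta> (\<lambda>i. a (- 1) j i) (\<beta> (- 1)) = \<zero>\<^bsub>?D\<^esub>"
        using cl by (auto simp: fun_eq_iff extensional_def)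
      then show ?thesis using lc_zero_vec[OF module_MC] by (simp add: lc_direct_sum z_def del: dual_module_sel)
    qed
  qed
  then show ?thesis by blast
qed

end

end

section \<open>Quasi-deformations\<close>

lemma (in ring_cover) ideal_image:
  assumes J: "idl J"
  shows "ideal (\<pi> ` J) B"
proof (rule idealI)
  show "ring B" by (rule ring_axioms)
  show "subgroup (\<pi> ` J) (add_monoid B)"
  proof
    show "\<pi> ` J \<subseteq> carrier (add_monoid B)" by auto
    show "x \<otimes>\<^bsub>add_monoid B\<^esub> y \<in> \<pi> ` J" if "x \<in> \<pi> ` J" "y \<in> \<pi> ` J" for x y
      using that by (auto simp: cov_add[symmetric] intro!: imageI idl_add[OF J])
    show "\<one>\<^bsub>add_monoid B\<^esub> \<in> \<pi> ` J" using imageI[OF idl_0[OF J], of \<pi>] by (simp add: cov_zero)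
    show "inv\<^bsub>add_monoid B\<^esub> x \<in> \<pi> ` J" if xJ: "x \<in> \<pi> ` J" for x
    proof -
      obtain p where p: "x = \<pi> p" "p \<in> J" using xJ by (rule imageE)
      have "inv\<^bsub>add_monoid B\<^esub> x = \<pi> (- p)" unfolding p a_inv_def[symmetric] by (simp only: cov_uminus)
      then show ?thesis by (simp add: idl_minus[OF J p(2)])
    qed
  qed
  show "x \<otimes> a \<in> \<pi> ` J" "a \<otimes> x \<in> \<pi> ` J" if "a \<in> \<pi> ` J" "x \<in> carrier B" for a x
  proof -
    obtain p where "a = \<pi> p" "p \<in> J" using \<open>a \<in> \<pi> ` J\<close> by (rule imageE)
    moreover obtain q where "\<pi> q = x" using cov_surj[OF \<open>x \<in> carrier B\<close>] by (elim exE)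
    ultimately have "x \<otimes> a = \<pi> (q * p)" "q * p \<in> J" "a \<otimes> x = \<pi> (p * q)" "p * q \<in> J"
      by (simp_all add: cov_mult idl_mult[OF J] idl_mult_right[OF J])
    then show "x \<otimes> a \<in> \<pi> ` J" "a \<otimes> x \<in> \<pi> ` J" by simp_all
  qed
qed

text \<open>On the cover, the ideals generated by initial parts of the sequence become the ideals
  \<open>Jx ker x i\<close>, and their products with the ring as a module are these ideals
  again.\<close>

lemma (in ring_cover) regular_sequence_cover:
  assumes loc: "noetherian_local_ring B" and xs: "set xs \<subseteq> max_ideal B"
    and reg: "regular_sequence B (self_module B) xs"
  defines "x \<equiv> \<lambda>j. lift (xs ! j)"
  shows "local_quotient maxM ker x (length xs)"
    and "p \<in> Jx ker x (length xs) \<longleftrightarrow> \<pi> p \<in> Idl (set xs)"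
proof -
  have xc: "set xs \<subseteq> carrier B" using reg by (simp add: regular_sequence_def)
  have x: "\<pi> (x j) = xs ! j" if "j < length xs" for j unfolding x_def using xc that by (intro cov_lift) auto
  have tk: "set (take i xs) \<subseteq> carrier B" for i using xc set_take_subset[of i xs] by blast
  have J: "p \<in> Jx ker x i \<longleftrightarrow> \<pi> p \<in> Idl (set (take i xs))" if i: "i \<le> length xs" for p i
  proof
    interpret I: ideal "Idl (set (take i xs))" B by (rule genideal_ideal[OF tk])
    assume "p \<in> Jx ker x i"
    then obtain b where "\<pi> p = \<pi> (\<Sum>j<i. x j * b j)" by (auto simp: Jx_def ker_diff)
    moreover have "\<pi> (\<Sum>j<k. x j * b j) \<in> Idl (set (take i xs))" if "k \<le> i" for k
      using that
    proof (induction k)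
      case 0
      then show ?case by (simp add: cov_zero)
    next
      case (Suc k)
      then have "xs ! k \<in> set (take i xs)" using i by (auto simp: in_set_conv_nth intro!: exI[of _ k])
      then have "xs ! k \<in> Idl (set (take i xs))" using genideal_self[OF tk] by blast
      then show ?case using Suc i by (simp add: cov_add cov_mult x I.I_r_closed)
    qed
    ultimately show "\<pi> p \<in> Idl (set (take i xs))" by simp
  next
    assume p: "\<pi> p \<in> Idl (set (take i xs))"
    have "set (take i xs) \<subseteq> \<pi> ` Jx ker x i"
    proof
      fix s assume "s \<in> set (take i xs)"
      then obtain j where "j < i" "s = xs ! j" using i by (auto simp: in_set_conv_nth)
      then show "s \<in> \<pi> ` Jx ker x i"
        using x_Jx[OF idl_ker, of j i x 1] x[of j] i by (auto intro!: image_eqI[of _ _ "x j"])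
    qed
    then have "Idl (set (take i xs)) \<subseteq> \<pi> ` Jx ker x i"
      by (intro genideal_minimal ideal_image idl_Jx idl_ker)
    then obtain q where "\<pi> p = \<pi> q" "q \<in> Jx ker x i" using p by blast
    then show "p \<in> Jx ker x i"
      using idl_add[OF idl_Jx[OF idl_ker] subsetD[OF K_Jx, of "p - q" ker x i], of q] by (simp add: ker_diff)
  qed
  show "p \<in> Jx ker x (length xs) \<longleftrightarrow> \<pi> p \<in> Idl (set xs)" using J[of "length xs" p] by simp
  interpret m: max_idl maxM by (rule max_idl_maxM[OF loc])
  show "local_quotient maxM ker x (length xs)"
  proof
    show "idl ker" by (rule idl_ker)
    show "ker \<subseteq> maxM" by (rule ker_maxM[OF loc])
    show "x j \<in> maxM" if "j < length xs" for j using x[OF that] xs that by (auto simp: maxM_def)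
    show "\<exists>b. a * b - 1 \<in> ker" if "a \<notin> maxM" for a by (rule unit_ker[OF loc that])
    show "a \<in> Jx ker x i" if "i < length xs" "x i * a \<in> Jx ker x i" for i a
    proof -
      have "xs ! i \<otimes> \<pi> a \<in> Idl (set (take i xs))" using that J[of i] x by (simp add: cov_mult)
      moreover have "ideal_smult B (Idl (set (take i xs))) (self_module B) = Idl (set (take i xs))"
        by (rule ideal_smult_self[OF is_cring genideal_ideal[OF tk]])
      moreover have self: "carrier (self_module B) = carrier B" "u \<odot>\<^bsub>self_module B\<^esub> v = u \<otimes> v" for u v
        by (simp_all add: self_module_def)
      moreover have "xs ! i \<otimes> \<pi> a \<in> ideal_smult B (Idl (set (take i xs))) (self_module B) -->
          \<pi> a \<in> ideal_smult B (Idl (set (take i xs))) (self_module B)"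
        using reg that(1) cov_closed[of a] unfolding regular_sequence_def self by blast
      ultimately have "\<pi> a \<in> Idl (set (take i xs))" by simp
      then show ?thesis using that(1) J[of i] by simp
    qed
  qed
qed

lemma (in ring_deform) pd_data_presentation:
  fixes c :: nat
  assumes N: "module A N" and pr: "presentation \<pi> N A.ker \<beta> \<gamma> \<alpha> rep z" and x: "\<And>j. j < c ==> x j \<in> A'.ker"
    and pd: "projective_dimension B (restrict_scalars \<psi> (base_change A A' \<phi> N)) < \<infinity>"
  shows "pd_data B.ker A'.ker x c \<beta> \<gamma> (\<lambda>i j. lf (\<alpha> i j))"
proof (rule pd_data_exists[of N rep \<beta> \<alpha> \<gamma> "\<lambda>i j. lf (\<alpha> i j)" z c x])
  note pr' = pr[unfolded presentation_def]
  show "\<exists>u. rep n u" if "n \<in> carrier N" for n using conjunct1[OF pr'] that by blast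
  show "rep (n \<oplus>\<^bsub>N\<^esub> n') (\<lambda>i. u i + u' i)" if "n \<in> carrier N" "n' \<in> carrier N" "rep n u" "rep n' u'" for n n' u u'
    using conjunct1[OF conjunct2[OF pr']] that by blast
  show "rep (\<pi> p \<odot>\<^bsub>N\<^esub> n) (\<lambda>i. p * u i)" if "n \<in> carrier N" "rep n u" for p n u using pr' that by blast
  show "\<exists>w. \<forall>i<\<beta>. u i - u' i - (\<Sum>j<\<gamma>. \<alpha> i j * w j) \<in> A.ker" if "n \<in> carrier N" "rep n u" "rep n u'" for n u u'
    using pr' that by blast
  show "z i \<in> carrier N" if "i < \<beta>" for i using pr' that by blast
  show "rep (z i') (\<lambda>i. if i = i' then 1 else 0)" if "i' < \<beta>" for i' using pr' that by blast
  show "lc \<pi> N z (\<lambda>i. \<alpha> i j) \<beta> = \<zero>\<^bsub>N\<^esub>" if "j < \<gamma>" for j using pr' that by blast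
  show "\<pi>' (lf (\<alpha> i j)) = \<phi> (\<pi> (\<alpha> i j))" for i j by (rule lf)
qed (use N x pd in auto)

text \<open>Otherwise \<open>lf p\<close> would be invertible modulo the kernel of the cover of
  \<open>B\<close>, and its image in \<open>A'\<close> a unit; but this image lies in the maximal
  ideal since \<open>\<phi>\<close> is local.\<close>

lemma (in ring_deform) lf_maxM:
  assumes "noetherian_local_ring A'" "noetherian_local_ring B" and lh: "local_hom A A' \<phi>" and p: "p \<in> A.maxM"
  shows "lf p \<in> B.maxM"
proof (rule ccontr)
  interpret M: maximalideal "max_ideal A'" A' by (rule local_max_ideal[OF assms(1)])
  assume "lf p \<notin> B.maxM"
  then obtain u where "lf p * u - 1 \<in> B.ker" using B.unit_ker[OF assms(2)] by blast
  then have "\<pi>' (lf p * u) = \<pi>' 1" by (simp add: psi B.ker_diff)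
  moreover have "\<phi> (\<pi> p) \<in> max_ideal A'" using lh p by (auto simp: local_hom_def A.maxM_def)
  ultimately have "\<one>\<^bsub>A'\<^esub> \<in> max_ideal A'"
    using M.I_r_closed[of "\<phi> (\<pi> p)" "\<pi>' u"] by (simp add: A'.cov_mult A'.cov_one lf)
  then show False using local_one[OF assms(1)] by blast
qed

text \<open>Flatness carries exactness of the matrices and of their transposes to \<open>A'\<close>,
  locality carries minimality, and the sizes of the matrices, which are the Betti numbers, stay the
  same.\<close>

lemma (in ring_deform) deformed_growth_symmetric:
  assumes loc: "noetherian_local_ring A'" "noetherian_local_ring B" and lh: "local_hom A A' \<phi>"
    and flat: "flat_module A AM"
    and lq: "local_quotient B.maxM B.ker x c" and J: "A'.ker = Jx B.ker x c"
    and min: "\<And>n i j. i < \<beta> (n - 1) ==> j < \<beta> n ==> a n i j \<in> A.maxM"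
    and dd: "\<And>n i k. i < \<beta> (n - 1) ==> k < \<beta> (n + 1) ==> (\<Sum>j<\<beta> n. a n i j * a (n + 1) j k) \<in> A.ker"
    and col: "\<And>n. exact_columns A.ker (\<beta> (n - 1)) (\<beta> n) (\<beta> (n + 1)) (a n) (a (n + 1))"
    and row: "\<And>n. exact_columns A.ker (\<beta> (n + 1)) (\<beta> n) (\<beta> (n - 1)) (\<lambda>i j. a (n + 1) j i) (\<lambda>i j. a n j i)"
    and N: "module A N" and pr: "presentation \<pi> N A.ker (\<beta> 0) (\<beta> 1) (a 1) rep z"
    and pr': "presentation \<pi> N A.ker (\<beta> (- 1)) (\<beta> (- 2)) (\<lambda>i j. a (- 1) j i) rep' z'"
    and pd: "projective_dimension B (restrict_scalars \<psi> (base_change A A' \<phi> N)) < \<infinity>"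
  shows "growth_le t \<beta> \<longleftrightarrow> growth_le t (\<lambda>n. \<beta> (- n))"
proof (rule local_quotient.matrix_growth_symmetric[OF lq, where a = "\<lambda>n i j. lf (a n i j)"], unfold J[symmetric])
  have x: "x j \<in> A'.ker" if "j < c" for j unfolding J using x_Jx[OF B.idl_ker that, of x 1] by simp
  show "lf (a n i j) \<in> B.maxM" if "i < \<beta> (n - 1)" "j < \<beta> n" for n i j
    using lf_maxM[OF loc lh min[OF that]] .
  show "(\<Sum>k<\<beta> n. lf (a n i k) * lf (a (n + 1) k j)) \<in> A'.ker" if "i < \<beta> (n - 1)" "j < \<beta> (n + 1)" for n i j
  proof -
    have "\<pi>' (\<Sum>k<\<beta> n. lf (a n i k) * lf (a (n + 1) k j)) = \<phi> (\<pi> (\<Sum>k<\<beta> n. a n i k * a (n + 1) k j))"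
      by (rule phi_sum) (rule lf)
    also have "\<dots> = \<phi> (\<pi> 0)" using dd[OF that] by (simp add: A.ker_def A.cov_zero)
    finally show ?thesis by (simp add: phi_simps A'.ker_def A'.cov_zero)
  qed
  show "exact_columns A'.ker (\<beta> (n - 1)) (\<beta> n) (\<beta> (n + 1)) (\<lambda>i j. lf (a n i j)) (\<lambda>i j. lf (a (n + 1) i j))" for n
    by (rule flat_exact_columns[OF flat col]) (rule lf)+
  show "exact_columns A'.ker (\<beta> (n + 1)) (\<beta> n) (\<beta> (n - 1)) (\<lambda>i j. lf (a (n + 1) j i)) (\<lambda>i j. lf (a n j i))" for n
    by (rule flat_exact_columns[OF flat row]) (rule lf)+
  show "pd_data B.ker A'.ker x c (\<beta> 0) (\<beta> 1) (\<lambda>i j. lf (a 1 i j))"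
    by (rule pd_data_presentation[OF N pr x pd])
  show "pd_data B.ker A'.ker x c (\<beta> (- 1)) (\<beta> (- 2)) (\<lambda>i j. lf (a (- 1) j i))"
    by (rule pd_data_presentation[OF N pr' x pd])
qed

text \<open>The hypothesis says that the cokernel of \<open>b\<close> vanishes, so the resolution by
  zero modules serves, and no condition involves \<open>K\<close>.\<close>

lemma pd_data_zero:
  fixes L :: "'r::comm_ring_1 set"
  assumes "\<And>i'. i' < \<beta> ==> \<exists>f. \<forall>i<\<beta>. (if i = i' then 1 else 0) - (\<Sum>j<\<gamma>. b i j * f j) \<in> L"
  shows "pd_data K L x 0 \<beta> \<gamma> b"
proof -
  have "pd_rel K L x 0 \<beta> \<gamma> b 0 (\<lambda>_. 0) (\<lambda>_ _ _. 0) (\<lambda>_ _ _. 0) (\<lambda>_ _. 0) (\<lambda>_ _. 0)"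
    unfolding pd_rel_def lessThan_0 sum.empty diff_0_right using assms by simp
  then show ?thesis unfolding pd_data_def by blast
qed

section \<open>From growth bounds to complexities, and the conclusion\<close>

lemma growth_le_eventually:
  "(\<exists>a::real. \<forall>\<^sub>F n::int in at_top. real (e n) \<le> a * real_of_int n powi (int t - 1)) \<longleftrightarrow> growth_le t e"
proof
  assume "\<exists>a::real. \<forall>\<^sub>F n::int in at_top. real (e n) \<le> a * real_of_int n powi (int t - 1)"
  then obtain a :: real and n0 where a: "\<And>n. n \<ge> n0 ==> real (e n) \<le> a * real_of_int n powi (int t - 1)"
    by (auto simp: eventually_at_top_linorder)
  show "growth_le t e"
  proof (cases t)
    case 0
    \<comment> \<open>The bound is \<open>a / n\<close>, which is below one as soon as
      \<open>n > a\<close>.\<close>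
    have "e n = 0" if n: "n \<ge> max n0 (max 1 (\<lceil>a\<rceil> + 1))" for n
    proof -
      have "real (e n) \<le> a / real_of_int n" using a[of n] n 0 by (simp add: power_int_minus divide_inverse)
      also have "\<dots> < 1"
      proof -
        have "a < real_of_int n" using n by linarith
        then show ?thesis using n by simp
      qed
      finally show ?thesis by simp
    qed
    then show ?thesis unfolding 0 growth_le_0 by blast
  next
    case (Suc s)
    have "int (e n) \<le> \<lceil>a\<rceil> * n ^ s" if n: "n \<ge> max n0 0" for n
    proof -
      have "real (e n) \<le> a * real_of_int n ^ s" using a[of n] n Suc by simp
      also have "\<dots> \<le> real_of_int \<lceil>a\<rceil> * real_of_int n ^ s" using n by (intro mult_right_mono) auto
      finally have "real_of_int (int (e n)) \<le> real_of_int (\<lceil>a\<rceil> * n ^ s)" by simp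
      then show ?thesis unfolding of_int_le_iff .
    qed
    then show ?thesis unfolding growth_le_def Suc by (intro exI[of _ "\<lceil>a\<rceil>"] exI[of _ "max n0 0"]) simp
  qed
next
  assume "growth_le t e"
  then obtain a :: int and n0 where a: "\<And>n. n \<ge> n0 ==> int (e n) \<le> (if t = 0 then 0 else a * n ^ (t - 1))"
    unfolding growth_le_def by blast
  define a' where "a' = (if t = 0 then 0 else real_of_int a)"
  have "real (e n) \<le> a' * real_of_int n powi (int t - 1)" if "n \<ge> n0" for n
  proof (cases t)
    case 0
    then show ?thesis using a[OF that] by (simp add: a'_def)
  next
    case (Suc s)
    then have "real_of_int (int (e n)) \<le> real_of_int (a * n ^ s)" using a[OF that] unfolding of_int_le_iff by simp
    then show ?thesis using Suc by (simp add: a'_def)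
  qed
  then show "\<exists>a::real. \<forall>\<^sub>F n::int in at_top. real (e n) \<le> a * real_of_int n powi (int t - 1)"
    by (intro exI[of _ a']) (auto simp: eventually_at_top_linorder)
qed

lemma eventually_at_bot_uminus: "eventually P (at_bot :: int filter) \<longleftrightarrow> (\<forall>\<^sub>F n in at_top. P (- n))"
proof
  assume "eventually P at_bot"
  then obtain n0 where "\<forall>n\<le>n0. P n" by (auto simp: eventually_at_bot_linorder)
  then show "\<forall>\<^sub>F n in at_top. P (- n)" unfolding eventually_at_top_linorder by (intro exI[of _ "- n0"]) auto
next
  assume "\<forall>\<^sub>F n in at_top. P (- n)"
  then obtain n0 where "\<And>n. n \<ge> n0 ==> P (- n)" by (auto simp: eventually_at_top_linorder)
  from this[of "- _"] show "eventually P at_bot"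
    unfolding eventually_at_bot_linorder by (intro exI[of _ "- n0"]) (metis minus_le_iff minus_minus)
qed

lemma symmetric_growthI:
  assumes "\<And>t. growth_le t (betti A C) \<longleftrightarrow> growth_le t (\<lambda>n. betti A C (- n))"
  shows "symmetric_growth A C"
proof -
  have "(\<exists>a::real. \<forall>\<^sub>F n::int in at_top. real (betti A C n) \<le> a * real_of_int n powi (int t - 1))
      \<longleftrightarrow> (\<exists>a::real. \<forall>\<^sub>F n::int in at_bot. real (betti A C n) \<le> a * real_of_int (- n) powi (int t - 1))" for t
    unfolding eventually_at_bot_uminus minus_minus growth_le_eventually using assms .
  then show ?thesis unfolding symmetric_growth_def cx_plus_def cx_minus_def by simp
qed

theorem corollary4p2:
  fixes A :: "('a, 'r) ring_scheme"
    and C :: "int \<Rightarrow> ('a, 'e) module"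
    and d :: "int \<Rightarrow> 'e \<Rightarrow> 'e"
  assumes "noetherian_local_ring A"
    and "totally_acyclic A C d"
    and "minimal_complex A C d"
    and "CI_dim_zero TYPE('b) TYPE('c) A
           (direct_sum (complex_image C d) (dual_module A (complex_image C d)))"
  shows "symmetric_growth A C"
proof (rule symmetric_growthI)
  fix t
  let ?N = "direct_sum (complex_image C d) (dual_module A (complex_image C d))"
  define \<beta> where "\<beta> = betti A C"
  have "cring A" using assms(1) by (simp add: noetherian_local_ring_def)
  then obtain \<pi> :: "(('a \<Rightarrow>\<^sub>0 nat) \<Rightarrow>\<^sub>0 int) => 'a" where cov: "ring_cover A \<pi>" using polynomial_cover by blast
  interpret A: ring_cover A \<pi> by (rule cov)
  obtain y a where b: "\<And>n. basis \<pi> (C n) (y n) (\<beta> n) A.ker"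
    and dl: "\<And>n v. d n (lc \<pi> (C n) (y n) v (\<beta> n))
        = lc \<pi> (C (n - 1)) (y (n - 1)) (\<lambda>i. \<Sum>j<\<beta> n. a n i j * v j) (\<beta> (n - 1))"
    and min: "\<And>n i j. i < \<beta> (n - 1) ==> j < \<beta> n ==> a n i j \<in> A.maxM"
    and dd: "\<And>n i k. i < \<beta> (n - 1) ==> k < \<beta> (n + 1) ==> (\<Sum>j<\<beta> n. a n i j * a (n + 1) j k) \<in> A.ker"
    and col: "\<And>n. exact_columns A.ker (\<beta> (n - 1)) (\<beta> n) (\<beta> (n + 1)) (a n) (a (n + 1))"
    and row: "\<And>n. exact_columns A.ker (\<beta> (n + 1)) (\<beta> n) (\<beta> (n - 1)) (\<lambda>i j. a (n + 1) j i) (\<lambda>i j. a n j i)"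
    using A.complex_matrices[OF assms(1-3), folded \<beta>_def] by (elim exE conjE) blast
  have m: "module A (C n)" and dh: "d n \<in> module_hom A (C n) (C (n - 1))" for n
    using assms(2) by (simp_all add: totally_acyclic_def free_complex_def fg_free_def)
  note ctx = m dh b dl dd col row
  have N: "module A ?N" by (rule module_direct_sum[OF A.module_MC[OF ctx] module_dual[OF A.module_MC[OF ctx]]])
  have "growth_le t \<beta> \<longleftrightarrow> growth_le t (\<lambda>n. \<beta> (- n))"
  proof (cases "carrier ?N = {\<zero>\<^bsub>?N\<^esub>}")
    \<comment> \<open>The zero module has CI-dimension zero by convention, without any
      quasi-deformation. Here \<open>d 0\<close> is zero and both cokernels vanish, so
      \<open>A\<close> itself with the empty sequence takes the place of the deformation.\<close>
    case True
    interpret D: module A "dual_module A (complex_image C d)" by (rule module_dual[OF A.module_MC[OF ctx]])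
    have d0: "d 0 x = \<zero>\<^bsub>C (- 1)\<^esub>" if "x \<in> carrier (C 0)" for x
    proof -
      have "(d 0 x, \<zero>\<^bsub>dual_module A (complex_image C d)\<^esub>) \<in> carrier ?N"
        using that D.zero_closed by (simp add: A.MC_sel[OF ctx] del: dual_module_sel)
      then show ?thesis unfolding True by (simp add: A.MC_sel[OF ctx] del: dual_module_sel)
    qed
    have a0: "a 0 i j \<in> A.ker" if "i < \<beta> (- 1)" "j < \<beta> 0" for i j
      using A.d0_basis[OF ctx that(2)] d0[OF A.basis_closed[OF ctx that(2)]] b[of "- 1"] that(1)
      unfolding basis_def by metis
    have unit: "(\<Sum>j<n. f j * (if j = i then 1 else 0)) = (if i < n then f i else 0)" for f :: "nat => (('a \<Rightarrow>\<^sub>0 nat) \<Rightarrow>\<^sub>0 int)" and n i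
      by (simp add: if_distrib[of "\<lambda>x. _ * x"] cong: if_cong)
    interpret lq: local_quotient A.maxM A.ker "\<lambda>_. 0" 0
    proof -
      interpret max_idl A.maxM by (rule A.max_idl_maxM[OF assms(1)])
      show "local_quotient A.maxM A.ker (\<lambda>_. 0) 0"
        by unfold_locales (use A.idl_ker A.ker_maxM[OF assms(1)] A.unit_ker[OF assms(1)] in auto)
    qed
    show ?thesis
    proof (rule lq.matrix_growth_symmetric[where a = a], unfold Jx_0)
      show "pd_data A.ker A.ker (\<lambda>_. 0) 0 (\<beta> 0) (\<beta> 1) (a 1)"
      proof (rule pd_data_zero)
        fix i' assume "i' < \<beta> 0"
        then have "\<forall>i<\<beta> (0 - 1). (\<Sum>j<\<beta> 0. a 0 i j * (if j = i' then 1 else 0)) \<in> A.ker" unfolding unit using a0 by simp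
        from mp[OF spec[OF col[of 0, unfolded exact_columns_def], of "\<lambda>j. if j = i' then 1 else 0"] this]
        show "\<exists>f. \<forall>i<\<beta> 0. (if i = i' then 1 else 0) - (\<Sum>j<\<beta> 1. a 1 i j * f j) \<in> A.ker" by simp
      qed
      show "pd_data A.ker A.ker (\<lambda>_. 0) 0 (\<beta> (- 1)) (\<beta> (- 2)) (\<lambda>i j. a (- 1) j i)"
      proof (rule pd_data_zero)
        fix i' assume "i' < \<beta> (- 1)"
        then have "\<forall>i<\<beta> (- 1 + 1). (\<Sum>j<\<beta> (- 1). a (- 1 + 1) j i * (if j = i' then 1 else 0)) \<in> A.ker"
          unfolding unit using a0 by simp
        from mp[OF spec[OF row[of "- 1", unfolded exact_columns_def], of "\<lambda>j. if j = i' then 1 else 0"] this]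
        show "\<exists>f. \<forall>i<\<beta> (- 1). (if i = i' then 1 else 0) - (\<Sum>j<\<beta> (- 2). a (- 1) j i * f j) \<in> A.ker" by simp
      qed
    qed (use min dd col row in auto)
  next
    case False
    then have "finite_CI_dim TYPE('b) TYPE('c) A ?N" using assms(4) by (simp only: CI_dim_zero_def) blast
    then obtain A' :: "'b ring" and B :: "'c ring" and \<phi> \<psi> where qd: "quasi_deformation A A' B \<phi> \<psi>"
      and pd: "projective_dimension B (restrict_scalars \<psi> (base_change A A' \<phi> ?N)) < \<infinity>"
      unfolding finite_CI_dim_def by (elim exE conjE) blast
    note qd' = qd[unfolded quasi_deformation_def]
    have loc: "noetherian_local_ring A'" "noetherian_local_ring B" and lh: "local_hom A A' \<phi>"
      and flat: "flat_module A (algebra_module \<phi> A')" and surj: "\<psi> ` carrier B = carrier A'"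
      using qd' by blast+
    obtain xs where xs: "set xs \<subseteq> max_ideal B" "regular_sequence B (self_module B) xs"
      "a_kernel B A' \<psi> = Idl\<^bsub>B\<^esub> (set xs)" using qd' by blast
    have \<phi>: "\<phi> \<in> ring_hom A A'" and \<psi>: "\<psi> \<in> ring_hom B A'" using qd' by (simp_all add: local_hom_def)
    have cr: "cring A'" "cring B" using loc by (simp_all add: noetherian_local_ring_def)
    obtain \<pi>\<^sub>B :: "(('c \<Rightarrow>\<^sub>0 nat) \<Rightarrow>\<^sub>0 int) => 'c" where covB: "ring_cover B \<pi>\<^sub>B"
      using polynomial_cover[OF cr(2)] by blast
    interpret B: ring_cover B \<pi>\<^sub>B by (rule covB)
    \<comment> \<open>Covering \<open>A'\<close> through \<open>B\<close> makes the kernel of the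
      cover equal to the ideal \<open>Jx B.ker x (length xs)\<close>.\<close>
    define \<pi>' where "\<pi>' = (\<lambda>p. \<psi> (\<pi>\<^sub>B p))"
    have "ring_cover A' \<pi>'"
    proof -
      interpret A': cring A' by (rule cr(1))
      show ?thesis
      proof
        show "\<pi>' p \<in> carrier A'" for p unfolding \<pi>'_def using ring_hom_closed[OF \<psi>] by simp
        show "\<pi>' (p + q) = \<pi>' p \<oplus>\<^bsub>A'\<^esub> \<pi>' q" for p q unfolding \<pi>'_def using ring_hom_add[OF \<psi>] by (simp add: B.cov_add)
        show "\<pi>' (p * q) = \<pi>' p \<otimes>\<^bsub>A'\<^esub> \<pi>' q" for p q unfolding \<pi>'_def using ring_hom_mult[OF \<psi>] by (simp add: B.cov_mult)
        show "\<pi>' 1 = \<one>\<^bsub>A'\<^esub>" unfolding \<pi>'_def using ring_hom_one[OF \<psi>] by (simp add: B.cov_one)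
        show "\<exists>p. \<pi>' p = s" if "s \<in> carrier A'" for s
          using that unfolding surj[symmetric] \<pi>'_def using B.cov_surj by (metis imageE)
      qed
    qed
    then interpret A': ring_cover A' \<pi>' .
    interpret D: ring_deform A \<pi> A' \<pi>' \<phi> B \<pi>\<^sub>B \<psi> by unfold_locales (use \<phi> in \<open>simp_all add: \<pi>'_def\<close>)
    define x where "x j = B.lift (xs ! j)" for j
    have lq: "local_quotient B.maxM B.ker x (length xs)"
      unfolding x_def[abs_def] by (rule B.regular_sequence_cover(1)[OF loc(2) xs(1,2)])
    have J: "A'.ker = Jx B.ker x (length xs)"
    proof (rule Set.set_eqI)
      fix p
      have "p \<in> A'.ker \<longleftrightarrow> \<pi>\<^sub>B p \<in> a_kernel B A' \<psi>" unfolding A'.ker_def a_kernel_def' by (simp add: \<pi>'_def)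
      then show "p \<in> A'.ker \<longleftrightarrow> p \<in> Jx B.ker x (length xs)"
        unfolding x_def[abs_def] B.regular_sequence_cover(2)[OF loc(2) xs(1,2)] xs(3) .
    qed
    obtain rep z where pr: "presentation \<pi> ?N A.ker (\<beta> 0) (\<beta> 1) (a 1) rep z"
      using A.presentation_image[OF ctx] by blast
    obtain rep' z' where pr': "presentation \<pi> ?N A.ker (\<beta> (- 1)) (\<beta> (- 2)) (\<lambda>i j. a (- 1) j i) rep' z'"
      using A.presentation_dual[OF ctx] by blast
    show ?thesis by (rule D.deformed_growth_symmetric[OF loc lh flat lq J min dd col row N pr pr' pd])
  qed
  then show "growth_le t (betti A C) \<longleftrightarrow> growth_le t (\<lambda>n. betti A C (- n))" by (simp add: \<beta>_def)
qed

end
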